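(* There is an absolute constant $C$ such that the following holds. For any fixed integers $\Delta\ge 1$ and $q\ge C\Delta^2$, there is an FPRAS for the number of $L$-packings of $G$, where the input consists of a graph $G$ of maximum degree $\Delta$ together with an arbitrary $q$-list assignment $L$ of $G$.
   Context: All graphs are finite and simple. A $q$-list assignment of a graph $G$ is a function $L:V(G)\to 2^{\mathbb{N}}$ with $|L(u)|=q$ for every vertex $u$. An $L$-coloring of $G$ is a proper coloring $f:V(G)\to\mathbb{N}$ (that is, $f(u)\neq f(v)$ for every edge $uv$) with $f(u)\in L(u)$ for every vertex $u$. Two colorings $f,f'$ of $G$ are disjoint if $f(u)\neq f'(u)$ for every vertex $u$. An $L$-packing of $G$ is a collection of $q$ pairwise-disjoint $L$-colorings of $G$. In counting, an $L$-packing is an indexed collection $(f_1,\dots,f_q)$; equivalently, writing $L(v)=\{c_{1,v}<\dots<c_{q,v}\}$ in ascending order, it is an element $\omega=(\omega_v)_{v\in V(G)}$ of $S_q^{V(G)}$ via $f_i(v)=c_{\omega_v(i),v}$, where $S_q$ is the symmetric group on $[q]=\{1,\dots,q\}$. (So, for example, an $n$-vertex graph with no edges has $(q!)^n$ $L$-packings.) An $\varepsilon$-approximation of a real number $x$ is a real number $y$ satisfying $e^{-\varepsilon}\le x/y\le e^{\varepsilon}$. A fully polynomial-time randomized approximation scheme (FPRAS) for a counting problem is a randomized algorithm that, given an input and $\varepsilon>0$, yields an $\varepsilon$-approximation of the true answer in time polynomial in the input size and $1/\varepsilon$; as is standard, the output is required to be an $\varepsilon$-approximation with probability at least $3/4$.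 The numbers $\Delta$ and $q$ are fixed constants: the running time may depend on them in an arbitrary way. *)

theory Defs
  imports "HOL-Probability.Probability" "HOL-Library.Log_Nat" "HOL-Library.FuncSet"
begin

section \<open>Graphs, list colorings and list packings\<close>

definition fin_graph :: "'v set \<Rightarrow> 'v set set \<Rightarrow> bool" where
  "fin_graph V E \<longleftrightarrow> finite V \<and> E \<subseteq> {e. e \<subseteq> V \<and> card e = 2}"

text \<open>The \<open>insert 0\<close> only matters for the graph without vertices, whose maximum degree is 0.\<close>

definition max_degree :: "'v set \<Rightarrow> 'v set set \<Rightarrow> nat" where
  "max_degree V E = Max (insert 0 ((\<lambda>v. card {e \<in> E. v \<in> e}) ` V))"

definition list_assignment :: "nat \<Rightarrow> 'v set \<Rightarrow> ('v \<Rightarrow> nat set) \<Rightarrow> bool" where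
  "list_assignment q V L \<longleftrightarrow> (\<forall>v\<in>V. finite (L v) \<and> card (L v) = q)"

text \<open>Functions on \<open>V\<close> are represented extensionally (value \<open>undefined\<close> outside \<open>V\<close>), so
  that cardinalities of sets of colorings are the intended ones.\<close>

definition list_colorings :: "'v set \<Rightarrow> 'v set set \<Rightarrow> ('v \<Rightarrow> nat set) \<Rightarrow> ('v \<Rightarrow> nat) set" where
  "list_colorings V E L =
     {f \<in> (\<Pi>\<^sub>E v\<in>V. L v). \<forall>u v. {u, v} \<in> E \<longrightarrow> f u \<noteq> f v}"

definition disjoint_colorings :: "'v set \<Rightarrow> ('v \<Rightarrow> nat) \<Rightarrow> ('v \<Rightarrow> nat) \<Rightarrow> bool" where
  "disjoint_colorings V f g \<longleftrightarrow> (\<forall>v\<in>V. f v \<noteq> g v)"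

text \<open>Packings are indexed families \<open>F 1, \<dots>, F q\<close>, not unordered collections.\<close>

definition list_packings ::
    "nat \<Rightarrow> 'v set \<Rightarrow> 'v set set \<Rightarrow> ('v \<Rightarrow> nat set) \<Rightarrow> (nat \<Rightarrow> 'v \<Rightarrow> nat) set" where
  "list_packings q V E L =
     {F \<in> {1..q} \<rightarrow>\<^sub>E list_colorings V E L.
        \<forall>i\<in>{1..q}. \<forall>j\<in>{1..q}. i \<noteq> j \<longrightarrow> disjoint_colorings V (F i) (F j)}"


section \<open>Randomized algorithms\<close>

text \<open>
  The machine model is a variable-free first-order functional language with unbounded loops and
  fair coin flips.  Data are binary trees with natural numbers at the leaves.  Every elementary
  operation takes one unit of time.  This is polynomially equivalent to probabilistic Turing
  machines: trees are handled as pointer structures with sharing, so that projections and pairing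
  take constant time, and the only arithmetic is addition and truncated subtraction, so that
  after \<open>t\<close> steps every number has at most \<open>t\<close> more bits than the numbers in the input and the
  program (there is deliberately no unit-cost multiplication).
\<close>

datatype val = Atom nat | Cell val val

text \<open>Size of the input in bits, up to constant factors.\<close>

primrec val_size :: "val \<Rightarrow> nat" where
  "val_size (Atom n) = 1 + floorlog 2 n"
| "val_size (Cell x y) = 1 + val_size x + val_size y"

datatype prog =
    Id
  | Const nat
  | Fst
  | Snd
  | Is_cell
  | Add
  | Sub
  | Coin
  | Fork prog prog
  | Comp prog prog
  | Cond prog prog prog
  | While prog prog

text \<open>Operations are total; ill-formed arguments yield \<open>Atom 0\<close>.\<close>

fun val_fst :: "val \<Rightarrow> val" where
  "val_fst (Cell x y) = x"
| "val_fst (Atom n) = Atom 0"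

fun val_snd :: "val \<Rightarrow> val" where
  "val_snd (Cell x y) = y"
| "val_snd (Atom n) = Atom 0"

fun val_is_cell :: "val \<Rightarrow> val" where
  "val_is_cell (Cell x y) = Atom 1"
| "val_is_cell (Atom n) = Atom 0"

fun val_add :: "val \<Rightarrow> val" where
  "val_add (Cell (Atom m) (Atom n)) = Atom (m + n)"
| "val_add _ = Atom 0"

fun val_sub :: "val \<Rightarrow> val" where
  "val_sub (Cell (Atom m) (Atom n)) = Atom (m - n)"
| "val_sub _ = Atom 0"

text \<open>
  Running a program on a value yields a subprobability distribution on pairs of a result and the
  time taken; the missing mass is the probability of divergence.  In conditions, \<open>Atom 0\<close> is
  false and everything else is true.
\<close>

partial_function (spmf) loop ::
    "(val \<Rightarrow> (val \<times> nat) spmf) \<Rightarrow> (val \<Rightarrow> (val \<times> nat) spmf) \<Rightarrow> val \<Rightarrow> (val \<times> nat) spmf" where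
  "loop b p x =
     bind_spmf (b x) (\<lambda>(c, r).
       if c = Atom 0 then return_spmf (x, r + 1)
       else bind_spmf (p x) (\<lambda>(y, s).
              bind_spmf (loop b p y) (\<lambda>(z, t). return_spmf (z, r + s + t + 1))))"

primrec run :: "prog \<Rightarrow> val \<Rightarrow> (val \<times> nat) spmf" where
  "run Id x = return_spmf (x, 1)"
| "run (Const n) x = return_spmf (Atom n, 1)"
| "run Fst x = return_spmf (val_fst x, 1)"
| "run Snd x = return_spmf (val_snd x, 1)"
| "run Is_cell x = return_spmf (val_is_cell x, 1)"
| "run Add x = return_spmf (val_add x, 1)"
| "run Sub x = return_spmf (val_sub x, 1)"
| "run Coin x = map_spmf (\<lambda>b. (Atom (of_bool b), 1)) coin_spmf"
| "run (Fork p p') x =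
     bind_spmf (run p x) (\<lambda>(y, s).
       bind_spmf (run p' x) (\<lambda>(z, t). return_spmf (Cell y z, s + t + 1)))"
| "run (Comp p p') x =
     bind_spmf (run p x) (\<lambda>(y, s).
       bind_spmf (run p' y) (\<lambda>(z, t). return_spmf (z, s + t + 1)))"
| "run (Cond b p p') x =
     bind_spmf (run b x) (\<lambda>(c, s).
       bind_spmf (if c = Atom 0 then run p' x else run p x)
         (\<lambda>(z, t). return_spmf (z, s + t + 1)))"
| "run (While b p) x = loop (run b) (run p) x"


section \<open>Encodings and approximation schemes\<close>

text \<open>Lists are nested cells ending in \<open>Atom 0\<close>.\<close>

definition encode_list :: "('a \<Rightarrow> val) \<Rightarrow> 'a list \<Rightarrow> val" where
  "encode_list enc xs = foldr (\<lambda>x r. Cell (enc x) r) xs (Atom 0)"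

text \<open>
  A graph on natural numbers with a list assignment is encoded by its adjacency lists: one entry
  \<open>(v, neighbors of v, L v)\<close> for each vertex \<open>v\<close>.
\<close>

definition encode_instance :: "nat set \<times> nat set set \<times> (nat \<Rightarrow> nat set) \<Rightarrow> val" where
  "encode_instance = (\<lambda>(V, E, L).
     encode_list
       (\<lambda>v. Cell (Atom v)
              (Cell (encode_list Atom (sorted_list_of_set {u. {u, v} \<in> E}))
                    (encode_list Atom (sorted_list_of_set (L v)))))
       (sorted_list_of_set V))"

text \<open>The accuracy is a positive rational, given to the algorithm as a reduced fraction.\<close>

definition encode_rat :: "rat \<Rightarrow> val" where
  "encode_rat r = (case quotient_of r of (a, b) \<Rightarrow> Cell (Atom (nat a)) (Atom (nat b)))"

text \<open>The output is a fraction of natural numbers, not necessarily reduced.\<close>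

fun decode_output :: "val \<Rightarrow> real" where
  "decode_output (Cell (Atom a) (Atom b)) = real a / real b"
| "decode_output _ = 0"

text \<open>For \<open>y = 0\<close> this is false, as \<open>x / 0 = 0\<close>.\<close>

definition is_approximation :: "real \<Rightarrow> real \<Rightarrow> real \<Rightarrow> bool" where
  "is_approximation \<epsilon> x y \<longleftrightarrow> exp (- \<epsilon>) \<le> x / y \<and> x / y \<le> exp \<epsilon>"

text \<open>
  \<open>P\<close> is an FPRAS for the problem of computing \<open>N x\<close> for instances \<open>x\<close> in \<open>I\<close>, encoded by
  \<open>enc\<close>.  The time bound holds for all outcomes of the coin flips.  As input sizes are positive,
  bounds of the form \<open>k * (size + 1 / \<epsilon>) ^ k\<close> dominate all polynomials in the size and
  \<open>1 / \<epsilon>\<close>.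
\<close>

definition fpras :: "prog \<Rightarrow> 'a set \<Rightarrow> ('a \<Rightarrow> val) \<Rightarrow> ('a \<Rightarrow> nat) \<Rightarrow> bool" where
  "fpras P I enc N \<longleftrightarrow>
     (\<exists>k::nat. \<forall>x\<in>I. \<forall>\<epsilon>::rat. \<epsilon> > 0 \<longrightarrow>
        (let inp = Cell (enc x) (encode_rat \<epsilon>); D = run P inp in
           lossless_spmf D \<and>
           (\<forall>(y, t) \<in> set_spmf D.
              real t \<le> real k * (real (val_size inp) + 1 / real_of_rat \<epsilon>) ^ k) \<and>
           measure (measure_spmf D)
             {(y, t). is_approximation (real_of_rat \<epsilon>) (real (N x)) (decode_output y)} \<ge> 3 / 4))"

end

theory Submission
  imports Defs
begin

text \<open>
  The algorithm is deterministic.  The state (spin) of a vertex is the list of its colors in the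
  colorings \<open>1, \<dots>, q\<close>; adjacent vertices need spins that agree in no position.  Deleting a vertex \<open>v\<close>
  with spin \<open>x\<close> pins \<open>x\<close> at its neighbors, and the weight \<open>p(x)\<close> of \<open>x\<close> is the number of configurations
  of the remaining vertices, which makes sense for every bijection \<open>x\<close>.  If \<open>x\<close> and \<open>y\<close> differ by a
  transposition, then replacing \<open>x\<close> by \<open>y\<close> at one neighbor after the other expresses \<open>p(x) / p(y)\<close> by
  marginals of the neighbors in smaller graphs.  This is a recursion of Gamarnik--Katz type.

  An error of the log-weights of a neighbor that changes by at most \<open>\<delta>\<close> under transpositions contributes
  only \<open>O(\<Delta> / q) \<delta>\<close> to \<open>ln (p(x) / p(y))\<close>: conditioning on one color in one position and excluding it
  differ, up to a factor \<open>1 + O(\<Delta> / q)\<close> in the weights, by a single transposition, and the diameter of the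
  transposition metric is at most \<open>q\<close>.  Summing over \<open>\<Delta>\<close> neighbors, the recursion contracts for
  \<open>q \<ge> C \<Delta>\<^sup>2\<close>, and logarithmic depth suffices.  Estimates of \<open>ln (p(x) / p(y))\<close> for all transpositions
  are turned into log-weights with transposition-Lipschitz error by solving a system of difference
  constraints.  All logarithms are rounded to multiples of \<open>ln (1 + 1 / M)\<close> with \<open>M\<close> polynomial in the
  input size and \<open>1 / \<epsilon>\<close>, so that only integers occur and the result is a power of \<open>(M + 1) / M\<close>.
\<close>

section \<open>Perturbing weights on bijections\<close>

text \<open>With \<open>q!\<close> spins per vertex the naive estimate does not contract: an error
  that moves by at most \<open>\<delta>\<close> under transpositions can vary by
  \<open>q * \<delta>\<close> over all bijections, the odds of one entry can be of order
  \<open>1 / q\<close>, and the product is of order \<open>\<delta>\<close>. Switching replaces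
  \<open>q * \<delta>\<close> by \<open>(1 + q * \<zeta>) * \<delta>\<close>, where
  \<open>\<zeta>\<close> of order \<open>\<Delta> / q\<close> is the share of the weight that no
  transposition matches. Each of at most \<open>\<Delta>\<close> neighbors then contributes order
  \<open>\<Delta> / q * \<delta>\<close>, in total order \<open>\<Delta> ^ 2 / q\<close>; with the
  constants of the proof the contraction asks for \<open>q \<ge> 15040 * \<Delta> ^ 2\<close>,
  rounded up to 20000.

  Accuracy is tracked by a slack \<open>D\<close>, counted in grid units, which doubles from a node
  to its children. Children of slack \<open>2 * D\<close> give back an error of at most
  \<open>0.4 * D\<close>, and rounding adds at most \<open>\<Delta> \<le> D / 16\<close>. At the
  leaves \<open>D * grid M\<close> is at least the a priori bound \<open>\<eta>\<close>, so constant
  values suffice there. The number of children depends on \<open>q\<close> and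
  \<open>\<Delta>\<close> only and \<open>2 ^ depth\<close> is polynomial, hence so is the size of
  the tree.\<close>

definition swap :: "'a list \<Rightarrow> nat \<Rightarrow> nat \<Rightarrow> 'a list" where
  "swap x i j = x[i := x ! j, j := x ! i]"

definition spins :: "nat \<Rightarrow> nat set \<Rightarrow> nat list set" where
  "spins q L = {x. length x = q \<and> distinct x \<and> set x = L}"

lemma length_swap [simp]: "length (swap x i j) = length x"
  by (simp add: swap_def)

lemma nth_swap:
  "i < length x \<Longrightarrow> j < length x \<Longrightarrow> k < length x \<Longrightarrow>
     swap x i j ! k = (if k = i then x ! j else if k = j then x ! i else x ! k)"
  by (auto simp: swap_def nth_list_update)

lemma swap_swap [simp]: "i < length x \<Longrightarrow> j < length x \<Longrightarrow> swap (swap x i j) i j = x"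
  by (rule nth_equalityI) (auto simp: nth_swap)

lemma swap_in_spins [simp]: "x \<in> spins q L \<Longrightarrow> i < q \<Longrightarrow> j < q \<Longrightarrow> swap x i j \<in> spins q L"
  unfolding spins_def swap_def by auto

lemma finite_spins: "finite L \<Longrightarrow> finite (spins q L)"
  unfolding spins_def by (rule finite_subset[OF _ finite_lists_length_eq[of L q]]) auto

lemma spins_nonempty: "finite L \<Longrightarrow> card L = q \<Longrightarrow> spins q L \<noteq> {}"
  unfolding spins_def using finite_distinct_list[of L] distinct_card by fastforce

definition lipschitz :: "nat \<Rightarrow> nat set \<Rightarrow> real \<Rightarrow> (nat list \<Rightarrow> real) \<Rightarrow> bool" where
  "lipschitz q L \<delta> g \<longleftrightarrow> (\<forall>x\<in>spins q L. \<forall>i<q. \<forall>j<q. \<bar>g (swap x i j) - g x\<bar> \<le> \<delta>)"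

lemma lipschitzD: "lipschitz q L \<delta> g \<Longrightarrow> x \<in> spins q L \<Longrightarrow> i < q \<Longrightarrow> j < q \<Longrightarrow> \<bar>g (swap x i j) - g x\<bar> \<le> \<delta>"
  by (auto simp: lipschitz_def)

lemma lipschitz_mono: "lipschitz q L \<delta> g \<Longrightarrow> \<delta> \<le> \<delta>' \<Longrightarrow> lipschitz q L \<delta>' g"
  unfolding lipschitz_def by force

text \<open>Selection sort: for \<open>k = 0, 1, ...\<close> one transposition brings
  \<open>y ! k\<close> to position \<open>k\<close> without disturbing the earlier positions, so
  \<open>q\<close> transpositions lead from \<open>x\<close> to \<open>y\<close>.\<close>

lemma lipschitz_diam:
  assumes "lipschitz q L \<delta> g" "x \<in> spins q L" "y \<in> spins q L"
  shows "\<bar>g x - g y\<bar> \<le> real q * \<delta>"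
proof -
  have "\<exists>z\<in>spins q L. (\<forall>i<k. z ! i = y ! i) \<and> \<bar>g x - g z\<bar> \<le> real k * \<delta>" if "k \<le> q" for k
    using that
  proof (induction k)
    case 0
    then show ?case using assms by auto
  next
    case (Suc k)
    then obtain z where z: "z \<in> spins q L" "\<forall>i<k. z ! i = y ! i" "\<bar>g x - g z\<bar> \<le> real k * \<delta>" by auto
    have k: "k < q" using Suc by simp
    have len: "length z = q" using z by (simp add: spins_def)
    have "y ! k \<in> L" using assms(3) k nth_mem[of k y] by (simp add: spins_def)
    then have "y ! k \<in> set z" using z(1) by (simp add: spins_def)
    then obtain j where j: "j < q" "z ! j = y ! k" using len in_set_conv_nth by metis
    have jk: "\<not> j < k"
    proof
      assume "j < k"
      then have "y ! j = y ! k" using z j by auto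
      then show False using assms(3) \<open>j < k\<close> k nth_eq_iff_index_eq[of y j k] by (simp add: spins_def)
    qed
    show ?case
    proof (intro bexI conjI allI impI)
      show "swap z k j \<in> spins q L" using z k j by simp
      show "swap z k j ! i = y ! i" if "i < Suc k" for i
        using that z j k jk len by (cases "i = k") (auto simp: nth_swap)
      have "\<bar>g (swap z k j) - g z\<bar> \<le> \<delta>" using lipschitzD[OF assms(1) z(1) k j(1)] .
      then show "\<bar>g x - g (swap z k j)\<bar> \<le> real (Suc k) * \<delta>" using z(3) by (simp add: algebra_simps)
    qed
  qed
  from this[of q] obtain z where z: "z \<in> spins q L" "\<forall>i<q. z ! i = y ! i" "\<bar>g x - g z\<bar> \<le> real q * \<delta>" by auto
  have "z = y" using z(1,2) assms(3) by (intro nth_equalityI) (auto simp: spins_def)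
  then show ?thesis using z by simp
qed

section \<open>Bijections that avoid forbidden entries\<close>

definition avoids :: "(nat \<times> nat) set \<Rightarrow> nat list \<Rightarrow> bool" where
  "avoids F x \<longleftrightarrow> (\<forall>i<length x. (i, x ! i) \<notin> F)"

definition index_of :: "'a list \<Rightarrow> 'a \<Rightarrow> nat" where
  "index_of x c = (THE i. i < length x \<and> x ! i = c)"

lemma index_of:
  assumes "distinct x" "c \<in> set x"
  shows "index_of x c < length x" "x ! index_of x c = c"
proof -
  obtain i where "i < length x" "x ! i = c" using assms by (auto simp: in_set_conv_nth)
  then have "\<exists>!i. i < length x \<and> x ! i = c" using assms by (auto simp: nth_eq_iff_index_eq)
  from theI'[OF this] show "index_of x c < length x" "x ! index_of x c = c" by (auto simp: index_of_def)
qed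

lemma index_of_nth [simp]: "distinct x \<Longrightarrow> i < length x \<Longrightarrow> index_of x (x ! i) = i"
  unfolding index_of_def by (rule the_equality) (auto simp: nth_eq_iff_index_eq)

definition degree_bounded :: "nat \<Rightarrow> nat set \<Rightarrow> nat \<Rightarrow> (nat \<times> nat) set \<Rightarrow> bool" where
  "degree_bounded q L d F \<longleftrightarrow>
     (\<forall>i<q. card {c \<in> L. (i, c) \<in> F} \<le> d) \<and> (\<forall>c\<in>L. card {i. i < q \<and> (i, c) \<in> F} \<le> d)"

text \<open>A spin is read as a placement of \<open>q\<close> non-attacking rooks on a board of
  positions and colors, and \<open>F\<close> is a set of forbidden cells with at most
  \<open>d\<close> in each row and column. The locale measures what forbidding the further cell
  \<open>(a, c)\<close> does: \<open>hit\<close> are the placements lost by it, \<open>miss\<close>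
  those that remain.\<close>

locale extra_entry =
  fixes q d a c :: nat and L :: "nat set" and F :: "(nat \<times> nat) set"
  assumes fin_L: "finite L" and card_L: "card L = q"
    and deg: "degree_bounded q L d F"
    and a: "a < q" and c: "c \<in> L" and ac: "(a, c) \<notin> F"
    and q_large: "8 * d + 4 \<le> q"
begin

definition hit where "hit = {x \<in> spins q L. avoids F x \<and> x ! a = c}"
definition miss where "miss = {x \<in> spins q L. avoids F x \<and> x ! a \<noteq> c}"
text \<open>Exchanging positions \<open>a\<close> and \<open>k\<close> in a hit \<open>x\<close>
  creates the entries \<open>(a, x ! k)\<close> and \<open>(k, c)\<close>; a target is a
  \<open>k\<close> for which both are permitted. Conversely, a miss is \<open>stuck\<close> when
  moving \<open>c\<close> back to position \<open>a\<close> would put the displaced color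
  \<open>y ! a\<close> into a forbidden cell.\<close>

definition targets where "targets x = {k. k < q \<and> k \<noteq> a \<and> (a, x ! k) \<notin> F \<and> (k, c) \<notin> F}"
definition stuck where "stuck = {y \<in> miss. (index_of y c, y ! a) \<in> F}"

lemma finite_hit: "finite hit" and finite_miss: "finite miss"
  unfolding hit_def miss_def using finite_spins[OF fin_L, of q] by auto

lemma finite_targets: "finite (targets x)"
  unfolding targets_def by auto

lemma row_count: 
  assumes "x \<in> spins q L" "i < q"
  shows "card {k. k < q \<and> (i, x ! k) \<in> F} \<le> d"
proof -
  have "card {k. k < q \<and> (i, x ! k) \<in> F} \<le> card {e \<in> L. (i, e) \<in> F}"
  proof (rule card_inj_on_le[of "\<lambda>k. x ! k"])
    show "inj_on ((!) x) {k. k < q \<and> (i, x ! k) \<in> F}"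
      using assms by (auto simp: inj_on_def spins_def nth_eq_iff_index_eq)
    show "(!) x ` {k. k < q \<and> (i, x ! k) \<in> F} \<subseteq> {e \<in> L. (i, e) \<in> F}"
      using assms by (auto simp: spins_def)
  qed (use fin_L in auto)
  also have "\<dots> \<le> d" using deg assms by (auto simp: degree_bounded_def)
  finally show ?thesis .
qed

lemma col_count: "e \<in> L \<Longrightarrow> card {k. k < q \<and> (k, e) \<in> F} \<le> d"
  using deg by (auto simp: degree_bounded_def)

text \<open>The exceptions are \<open>a\<close> itself, at most \<open>d\<close> positions whose
  color is forbidden at \<open>a\<close>, and at most \<open>d\<close> positions at which
  \<open>c\<close> is forbidden.\<close>

lemma card_targets:
  assumes "x \<in> spins q L"
  shows "q - 1 - 2 * d \<le> card (targets x)" "card (targets x) \<le> q"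
proof -
  have "card {..<q} \<le> card (targets x \<union> ({a} \<union> ({k. k < q \<and> (a, x ! k) \<in> F} \<union> {k. k < q \<and> (k, c) \<in> F})))"
    by (rule card_mono) (auto simp: targets_def)
  also have "\<dots> \<le> card (targets x) + (card {a} + (card {k. k < q \<and> (a, x ! k) \<in> F} + card {k. k < q \<and> (k, c) \<in> F}))"
    by (meson add_mono card_Un_le le_trans order_refl)
  also have "\<dots> \<le> card (targets x) + (1 + (d + d))"
    using row_count[OF assms a] col_count[OF c] by simp
  finally show "q - 1 - 2 * d \<le> card (targets x)" by simp
  show "card (targets x) \<le> q" using card_mono[of "{..<q}" "targets x"] by (auto simp: targets_def)
qed

lemma swap_hit:
  assumes "x \<in> hit" "k \<in> targets x"
  shows "swap x a k \<in> miss - stuck" "index_of (swap x a k) c = k"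
proof -
  have x: "length x = q" "distinct x" "set x = L" "avoids F x" "x ! a = c" "x \<in> spins q L" 
    using assms by (auto simp: hit_def spins_def)
  have k: "k < q" "k \<noteq> a" "(a, x ! k) \<notin> F" "(k, c) \<notin> F" using assms by (auto simp: targets_def)
  have s: "swap x a k \<in> spins q L" using x a k by simp
  have n: "swap x a k ! a = x ! k" "swap x a k ! k = c" using x a k by (auto simp: nth_swap)
  have "index_of (swap x a k) (swap x a k ! k) = k"
    using s k by (intro index_of_nth) (auto simp: spins_def)
  then show i: "index_of (swap x a k) c = k" using n by simp
  have "x ! k \<noteq> c" using x k a by (auto simp: nth_eq_iff_index_eq)
  moreover have "avoids F (swap x a k)"
    using x k a by (auto simp: avoids_def nth_swap)
  moreover have "(k, x ! k) \<notin> F" using x k by (auto simp: avoids_def)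
  ultimately show "swap x a k \<in> miss - stuck" using s n i by (auto simp: miss_def stuck_def)
qed

text \<open>Inverse of the switching in \<open>swap_hit\<close>: the position of \<open>c\<close> in
  the miss tells with which position \<open>a\<close> was exchanged. The entry \<open>(a, c)\<close>
  that it creates is permitted by \<open>ac\<close>.\<close>

lemma swap_miss:
  assumes "y \<in> miss - stuck"
  shows "swap y a (index_of y c) \<in> hit" "index_of y c \<in> targets (swap y a (index_of y c))"
    "swap (swap y a (index_of y c)) a (index_of y c) = y"
proof -
  define k where "k = index_of y c"
  have y: "length y = q" "distinct y" "set y = L" "avoids F y" "y ! a \<noteq> c" "y \<in> spins q L" "(k, y ! a) \<notin> F"
    using assms by (auto simp: miss_def spins_def stuck_def k_def)
  have k: "k < q" "y ! k = c" using index_of[of y c] y c by (auto simp: k_def)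
  have ka: "k \<noteq> a" using y k by auto
  have "avoids F (swap y a k)" using y k a ka ac by (auto simp: avoids_def nth_swap)
  then show "swap y a (index_of y c) \<in> hit"
    unfolding k_def[symmetric] hit_def using y k a by (auto simp: nth_swap)
  have "(a, y ! a) \<notin> F" "(k, c) \<notin> F" using y k a by (auto simp: avoids_def)
  then show "index_of y c \<in> targets (swap y a (index_of y c))"
    unfolding k_def[symmetric] targets_def using y k a ka by (auto simp: nth_swap)
  show "swap (swap y a (index_of y c)) a (index_of y c) = y"
    unfolding k_def[symmetric] using y k a by simp
qed

text \<open>By \<open>swap_hit\<close> and \<open>swap_miss\<close>, switching is a bijection from
  pairs of a hit and a target onto the misses that are not stuck.\<close>

lemma sum_miss_not_stuck:
  fixes w :: "nat list \<Rightarrow> real"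
  shows "(\<Sum>y\<in>miss - stuck. w y) = (\<Sum>x\<in>hit. \<Sum>k\<in>targets x. w (swap x a k))"
proof -
  have "(\<Sum>x\<in>hit. \<Sum>k\<in>targets x. w (swap x a k)) = (\<Sum>(x,k)\<in>Sigma hit targets. w (swap x a k))"
    using finite_hit finite_targets by (subst sum.Sigma) auto
  also have "\<dots> = (\<Sum>y\<in>miss - stuck. w y)"
  proof (rule sum.reindex_bij_witness[where i = "\<lambda>y. (swap y a (index_of y c), index_of y c)" 
        and j = "\<lambda>(x,k). swap x a k"])
    fix p assume p: "p \<in> Sigma hit targets"
    obtain x k where pk: "p = (x,k)" by force
    have "length x = q" "k < q" using p pk by (auto simp: hit_def spins_def targets_def)
    then show "(swap (case p of (x, k) \<Rightarrow> swap x a k) a (index_of (case p of (x, k) \<Rightarrow> swap x a k) c),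
              index_of (case p of (x, k) \<Rightarrow> swap x a k) c) = p"
      using swap_hit[of x k] p pk a by auto
    show "(case p of (x, k) \<Rightarrow> swap x a k) \<in> miss - stuck" using swap_hit[of x k] p pk by auto
  qed (use swap_miss in auto)
  finally show ?thesis by simp
qed

end

section \<open>Switching with weights that change little under transpositions\<close>

locale extra_entry_weight = extra_entry +
  fixes \<eta> :: real and w :: "nat list \<Rightarrow> real"
  assumes w_pos: "\<And>x. x \<in> spins q L \<Longrightarrow> 0 < w x"
    and w_lip: "lipschitz q L \<eta> (\<lambda>x. ln (w x))"
    and exp_\<eta>: "exp \<eta> \<le> 2" and \<eta>_nonneg: "0 \<le> \<eta>"
begin

lemma w_swap: 
  assumes "x \<in> spins q L" "i < q" "j < q"
  shows "w (swap x i j) \<le> exp \<eta> * w x" "w x \<le> exp \<eta> * w (swap x i j)"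
proof -
  have p: "0 < w x" "0 < w (swap x i j)" using w_pos assms by auto
  have l: "\<bar>ln (w (swap x i j)) - ln (w x)\<bar> \<le> \<eta>" using lipschitzD[OF w_lip assms] .
  have "exp (ln (w (swap x i j))) \<le> exp (\<eta> + ln (w x))" using l by (subst exp_le_cancel_iff) linarith
  then show "w (swap x i j) \<le> exp \<eta> * w x" using p by (simp add: exp_add)
  have "exp (ln (w x)) \<le> exp (\<eta> + ln (w (swap x i j)))" using l by (subst exp_le_cancel_iff) linarith
  then show "w x \<le> exp \<eta> * w (swap x i j)" using p by (simp add: exp_add)
qed

lemma hit_spins: "x \<in> hit \<Longrightarrow> x \<in> spins q L" and miss_spins: "x \<in> miss \<Longrightarrow> x \<in> spins q L"
  by (auto simp: hit_def miss_def)

lemma w_nonneg: "x \<in> hit \<Longrightarrow> 0 \<le> w x" "x \<in> miss \<Longrightarrow> 0 \<le> w x"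
  using w_pos hit_spins miss_spins by (auto intro!: less_imp_le)

lemma sum_hit_le:
  "(real q - 1 - 2 * real d) * (\<Sum>x\<in>hit. w x) \<le> exp \<eta> * (\<Sum>y\<in>miss. w y)"
proof -
  have "(\<Sum>x\<in>hit. (real q - 1 - 2 * real d) * w x) \<le> (\<Sum>x\<in>hit. exp \<eta> * (\<Sum>k\<in>targets x. w (swap x a k)))"
  proof (rule sum_mono)
    fix x assume x: "x \<in> hit"
    have "real (q - 1 - 2 * d) \<le> real (card (targets x))" using card_targets(1)[OF hit_spins[OF x]] by (simp only: of_nat_le_iff)
    then have "(real q - 1 - 2 * real d) * w x \<le> real (card (targets x)) * w x"
      using q_large w_nonneg x by (intro mult_right_mono) (auto simp: of_nat_diff)
    also have "\<dots> = (\<Sum>k\<in>targets x. w x)" by simp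
    also have "\<dots> \<le> (\<Sum>k\<in>targets x. exp \<eta> * w (swap x a k))"
      by (rule sum_mono, rule w_swap(2)) (use x a in \<open>auto simp: hit_def targets_def\<close>)
    finally show "(real q - 1 - 2 * real d) * w x \<le> exp \<eta> * (\<Sum>k\<in>targets x. w (swap x a k))"
      by (simp add: sum_distrib_left)
  qed
  also have "\<dots> = exp \<eta> * (\<Sum>y\<in>miss - stuck. w y)" unfolding sum_miss_not_stuck by (simp add: sum_distrib_left)
  also have "\<dots> \<le> exp \<eta> * (\<Sum>y\<in>miss. w y)"
    by (intro mult_left_mono sum_mono2 finite_miss) (auto simp: w_nonneg)
  finally show ?thesis by (simp add: sum_distrib_left)
qed

lemma sum_not_stuck_le:
  "(\<Sum>y\<in>miss - stuck. w y) \<le> exp \<eta> * real q * (\<Sum>x\<in>hit. w x)"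
proof -
  have "(\<Sum>x\<in>hit. \<Sum>k\<in>targets x. w (swap x a k)) \<le> (\<Sum>x\<in>hit. real q * (exp \<eta> * w x))"
  proof (rule sum_mono)
    fix x assume x: "x \<in> hit"
    have "(\<Sum>k\<in>targets x. w (swap x a k)) \<le> (\<Sum>k\<in>targets x. exp \<eta> * w x)"
      by (rule sum_mono, rule w_swap(1)) (use x a in \<open>auto simp: hit_def targets_def\<close>)
    also have "\<dots> \<le> real q * (exp \<eta> * w x)"
      using card_targets(2)[OF hit_spins[OF x]] w_nonneg(1)[OF x] by (auto intro!: mult_right_mono)
    finally show "(\<Sum>k\<in>targets x. w (swap x a k)) \<le> real q * (exp \<eta> * w x)" .
  qed
  then show ?thesis unfolding sum_miss_not_stuck by (simp add: sum_distrib_left mult_ac)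
qed

text \<open>A second switching. In a stuck \<open>y\<close> with \<open>c\<close> at position
  \<open>k\<close>, the color \<open>y ! a\<close> is one of at most \<open>d\<close> colors
  forbidden at \<open>k\<close>. Exchange \<open>a\<close> with one of the at least
  \<open>q - 2 - 2 * d\<close> harmless positions \<open>j\<close>: the result is a miss with
  \<open>c\<close> still at \<open>k\<close>, and together with the color \<open>y ! a\<close> it
  determines \<open>j\<close> and \<open>y\<close>. So each miss is reached at most \<open>d\<close>
  times, and the stuck misses carry only a share of order \<open>d / q\<close>.\<close>

lemma sum_stuck_le:
  "(real q - 2 - 2 * real d) * (\<Sum>y\<in>stuck. w y) \<le> real d * exp \<eta> * (\<Sum>y\<in>miss. w y)"
proof -
  define J where "J y = {j. j < q \<and> j \<noteq> a \<and> j \<noteq> index_of y c \<and> (a, y ! j) \<notin> F \<and> (j, y ! a) \<notin> F}" for y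
  define R where "R y = {e \<in> L. (index_of y c, e) \<in> F}" for y
  have finJ: "finite (J y)" and finR: "finite (R y)" for y using fin_L by (auto simp: J_def R_def)
  have fin: "finite stuck" using finite_miss by (auto simp: stuck_def)
  have facts: "length y = q" "distinct y" "set y = L" "avoids F y" "y ! a \<noteq> c" "y \<in> spins q L" 
    "index_of y c < q" "y ! index_of y c = c" "index_of y c \<noteq> a" if "y \<in> miss" for y
    using that index_of[of y c] c by (auto simp: miss_def spins_def)
  have sw: "swap y a j \<in> miss" "index_of (swap y a j) c = index_of y c" "y ! a \<in> R (swap y a j)"
    if y: "y \<in> stuck" and j: "j \<in> J y" for y j
  proof -
    have ym: "y \<in> miss" using y by (auto simp: stuck_def)
    note f = facts[OF ym]
    have j': "j < q" "j \<noteq> a" "j \<noteq> index_of y c" "(a, y ! j) \<notin> F" "(j, y ! a) \<notin> F" using j by (auto simp: J_def)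
    have s: "swap y a j \<in> spins q L" using f a j' by simp
    have "swap y a j ! (index_of y c) = c" using f a j' by (auto simp: nth_swap)
    moreover have "index_of (swap y a j) (swap y a j ! (index_of y c)) = index_of y c"
      using s f by (intro index_of_nth) (auto simp: spins_def)
    ultimately show i: "index_of (swap y a j) c = index_of y c" by simp
    have "y ! j \<noteq> c"
    proof
      assume "y ! j = c"
      then have "index_of y c = j" using f j' index_of_nth[of y j] by auto
      then show False using j' by simp
    qed
    moreover have "avoids F (swap y a j)" using f a j' by (auto simp: avoids_def nth_swap)
    ultimately show "swap y a j \<in> miss" using s f a j' by (auto simp: miss_def nth_swap)
    show "y ! a \<in> R (swap y a j)" unfolding R_def i using y f a by (auto simp: stuck_def)
  qed
  have "(\<Sum>y\<in>stuck. (real q - 2 - 2 * real d) * w y) \<le> (\<Sum>y\<in>stuck. \<Sum>j\<in>J y. exp \<eta> * w (swap y a j))"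
  proof (rule sum_mono)
    fix y assume y: "y \<in> stuck"
    then have ym: "y \<in> miss" by (auto simp: stuck_def)
    note f = facts[OF ym]
    have "card {..<q} \<le> card (J y \<union> ({a, index_of y c} \<union> ({k. k < q \<and> (a, y ! k) \<in> F} \<union> {k. k < q \<and> (k, y ! a) \<in> F})))"
      using finJ by (intro card_mono) (auto simp: J_def)
    also have "\<dots> \<le> card (J y) + (card {a, index_of y c} + (card {k. k < q \<and> (a, y ! k) \<in> F} + card {k. k < q \<and> (k, y ! a) \<in> F}))"
      by (meson add_mono card_Un_le le_trans order_refl)
    also have "\<dots> \<le> card (J y) + (2 + (d + d))"
      using row_count[OF f(6) a] col_count[of "y ! a"] f a by (intro add_mono) (auto simp: card_insert_if)
    finally have "real q - 2 - 2 * real d \<le> real (card (J y))" by simp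
    then have "(real q - 2 - 2 * real d) * w y \<le> real (card (J y)) * w y"
      using w_nonneg ym by (intro mult_right_mono) auto
    also have "\<dots> = (\<Sum>j\<in>J y. w y)" by simp
    also have "\<dots> \<le> (\<Sum>j\<in>J y. exp \<eta> * w (swap y a j))"
      by (rule sum_mono, rule w_swap(2)) (use f a in \<open>auto simp: J_def\<close>)
    finally show "(real q - 2 - 2 * real d) * w y \<le> (\<Sum>j\<in>J y. exp \<eta> * w (swap y a j))" .
  qed
  also have "\<dots> = (\<Sum>(y,j)\<in>Sigma stuck J. exp \<eta> * w (swap y a j))"
    using fin finJ by (subst sum.Sigma) auto
  also have "\<dots> \<le> (\<Sum>(y,e)\<in>Sigma miss R. exp \<eta> * w y)"
  proof -
    define f :: "nat list \<times> nat \<Rightarrow> nat list \<times> nat" where "f = (\<lambda>(y, j). (swap y a j, y ! a))"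
    have inj: "inj_on f (Sigma stuck J)"
    proof (rule inj_onI)
      fix p p' assume p: "p \<in> Sigma stuck J" "p' \<in> Sigma stuck J" "f p = f p'"
      obtain y j where yj: "p = (y, j)" by force
      obtain y' j' where yj': "p' = (y', j')" by force
      have ym: "y \<in> miss" "y' \<in> miss" using p yj yj' by (auto simp: stuck_def)
      have eq: "swap y a j = swap y' a j'" "y ! a = y' ! a" using p yj yj' by (auto simp: f_def)
      have jj: "j < q" "j' < q" using p yj yj' by (auto simp: J_def)
      have s: "length (swap y a j) = q" "distinct (swap y a j)" 
        using facts[OF ym(1)] jj a swap_in_spins[of y q L a j] by (auto simp: spins_def)
      have "swap y a j ! j = y ! a" "swap y' a j' ! j' = y' ! a"
        using facts(1)[OF ym(1)] facts(1)[OF ym(2)] jj a by (auto simp: nth_swap)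
      then have "swap y a j ! j = y ! a" "swap y a j ! j' = y ! a" using eq by auto
      then have "j = j'" using s jj by (metis index_of_nth)
      moreover have "y = swap (swap y a j) a j" "y' = swap (swap y' a j') a j'"
        using facts[OF ym(1)] facts[OF ym(2)] jj a by auto
      ultimately show "p = p'" using eq yj yj' by metis
    qed
    have "(\<Sum>(y,j)\<in>Sigma stuck J. exp \<eta> * w (swap y a j)) = (\<Sum>p\<in>Sigma stuck J. (\<lambda>(y,e). exp \<eta> * w y) (f p))"
      by (intro sum.cong) (auto simp: f_def)
    also have "\<dots> = (\<Sum>p\<in>f ` Sigma stuck J. (\<lambda>(y,e). exp \<eta> * w y) p)"
      using inj by (subst sum.reindex) auto
    also have "\<dots> \<le> (\<Sum>(y,e)\<in>Sigma miss R. exp \<eta> * w y)"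
      using sw finite_miss finR w_nonneg by (intro sum_mono2) (auto simp: f_def)
    finally show ?thesis .
  qed
  also have "\<dots> = (\<Sum>y\<in>miss. real (card (R y)) * (exp \<eta> * w y))"
    using finite_miss finR by (subst sum.Sigma[symmetric]) auto
  also have "\<dots> \<le> (\<Sum>y\<in>miss. real d * (exp \<eta> * w y))"
  proof (intro sum_mono mult_right_mono)
    fix y assume y: "y \<in> miss"
    have "card (R y) \<le> d" using deg facts[OF y] by (auto simp: R_def degree_bounded_def)
    then show "real (card (R y)) \<le> real d" by simp
    show "0 \<le> exp \<eta> * w y" using w_nonneg y by simp
  qed
  finally show ?thesis unfolding sum_distrib_left[symmetric] by (simp add: mult.assoc)
qed

lemma hit_or_miss_nonempty: "miss = {} \<Longrightarrow> hit = {}"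
proof -
  assume m: "miss = {}"
  show "hit = {}"
  proof (rule ccontr)
    assume "hit \<noteq> {}"
    then obtain x where x: "x \<in> hit" by auto
    have "0 < q - 1 - 2 * d" using q_large by simp
    then have "0 < card (targets x)" using card_targets(1)[OF hit_spins[OF x]] by (rule less_le_trans)
    then obtain k where "k \<in> targets x" by (metis card.empty ex_in_conv less_nat_zero_code)
    then show False using swap_hit(1)[OF x] m by auto
  qed
qed

lemma sum_miss_pos: "miss \<noteq> {} \<Longrightarrow> 0 < (\<Sum>y\<in>miss. w y)"
  using finite_miss w_pos miss_spins by (intro sum_pos) auto


definition odds where "odds = (\<Sum>x\<in>hit. w x) / (\<Sum>y\<in>miss. w y)"

lemma q_bounds: "real q / 2 \<le> real q - 2 - 2 * real d" "real q / 2 \<le> real q - 1 - 2 * real d" "0 < real q"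
  using q_large by (auto simp: field_simps)

text \<open>One factor 2 is the bound on \<open>exp \<eta>\<close>, the other comes from
  \<open>q / 2 \<le> q - 1 - 2 * d\<close>.\<close>

lemma odds_bounds:
  assumes "miss \<noteq> {}"
  shows "0 \<le> odds" "odds \<le> 4 / real q"
proof -
  have p: "0 < (\<Sum>y\<in>miss. w y)" using sum_miss_pos[OF assms] .
  have n: "0 \<le> (\<Sum>x\<in>hit. w x)" by (rule sum_nonneg) (rule w_nonneg)
  show "0 \<le> odds" using p n by (simp add: odds_def)
  have "real q / 2 * (\<Sum>x\<in>hit. w x) \<le> (real q - 1 - 2 * real d) * (\<Sum>x\<in>hit. w x)"
    using q_bounds n by (intro mult_right_mono) auto
  also have "\<dots> \<le> exp \<eta> * (\<Sum>y\<in>miss. w y)" by (rule sum_hit_le)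
  also have "\<dots> \<le> 2 * (\<Sum>y\<in>miss. w y)" using exp_\<eta> p by (intro mult_right_mono) auto
  finally show "odds \<le> 4 / real q" using p q_bounds(3) by (simp add: odds_def field_simps)
qed

text \<open>The switchings guaranteed for the hits account for all but a share
  \<open>\<zeta> = (6 * d + 1) / q + 2 * \<eta>\<close> of the weight of the misses. This share
  consists of the stuck misses, \<open>4 * d / q\<close>, of the gap between \<open>q\<close> and
  \<open>q - 1 - 2 * d\<close> targets, \<open>(2 * d + 1) / q\<close>, and of two comparisons of
  weights across a transposition, \<open>\<eta>\<close> each.\<close>

lemma hit_lower_bound:
  "(1 - (6 * real d + 1) / real q - 2 * \<eta>) * (\<Sum>y\<in>miss. w y)
     \<le> (real q - 1 - 2 * real d) * exp (- \<eta>) * (\<Sum>x\<in>hit. w x)"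
proof -
  define A where "A = (\<Sum>x\<in>hit. w x)"
  define B where "B = (\<Sum>y\<in>miss. w y)"
  define S where "S = (\<Sum>y\<in>stuck. w y)"
  have nn: "0 \<le> A" "0 \<le> B" "0 \<le> S" unfolding A_def B_def S_def
    by (rule sum_nonneg, use w_nonneg in \<open>force simp: stuck_def\<close>)+
  have q: "0 < real q" using q_bounds by simp
  have "real q / 2 * S \<le> (real q - 2 - 2 * real d) * S" using q_bounds nn by (intro mult_right_mono) auto
  also have "\<dots> \<le> real d * exp \<eta> * B" unfolding S_def B_def by (rule sum_stuck_le)
  also have "\<dots> \<le> real d * 2 * B" using exp_\<eta> nn by (intro mult_right_mono mult_left_mono) auto
  finally have S: "S \<le> 4 * real d / real q * B" using q by (simp add: field_simps)
  have "B - S = (\<Sum>y\<in>miss - stuck. w y)"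
    unfolding B_def S_def using finite_miss by (subst sum_diff) (auto simp: stuck_def)
  also have "\<dots> \<le> exp \<eta> * real q * A" unfolding A_def by (rule sum_not_stuck_le)
  finally have 1: "(1 - 4 * real d / real q) * B \<le> exp \<eta> * real q * A" using S by (simp add: algebra_simps)
  define x where "x = 4 * real d / real q"
  define y where "y = (1 + 2 * real d) / real q"
  have xy: "0 \<le> x" "0 \<le> y" "x + y \<le> 1" using q_large q by (auto simp: x_def y_def field_simps)
  then have y1: "y \<le> 1" by linarith
  have "(1 - x - y) * (1 - 2 * \<eta>) \<le> (1 - x - y) * exp (- (2 * \<eta>))"
    using xy exp_ge_add_one_self[of "- (2 * \<eta>)"] by (intro mult_left_mono) auto
  moreover have "1 - x - y - 2 * \<eta> \<le> (1 - x - y) * (1 - 2 * \<eta>)"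
    using mult_nonneg_nonneg[OF add_nonneg_nonneg[OF xy(1,2)] \<eta>_nonneg] by (simp add: algebra_simps)
  moreover have "(1 - x - y) \<le> (1 - x) * (1 - y)" using mult_nonneg_nonneg[OF xy(1,2)] by (simp add: algebra_simps)
  ultimately have "1 - x - y - 2 * \<eta> \<le> (1 - x) * (1 - y) * exp (- (2 * \<eta>))"
    by (smt (verit) exp_ge_zero mult_right_mono)
  then have "(1 - x - y - 2 * \<eta>) * B \<le> (1 - x) * (1 - y) * exp (- (2 * \<eta>)) * B" by (rule mult_right_mono[OF _ nn(2)])
  also have "\<dots> = (1 - y) * exp (- (2 * \<eta>)) * ((1 - x) * B)" by simp
  also have "\<dots> \<le> (1 - y) * exp (- (2 * \<eta>)) * (exp \<eta> * real q * A)"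
    using 1 y1 unfolding x_def by (intro mult_left_mono mult_nonneg_nonneg) auto
  also have "\<dots> = (real q * (1 - y)) * (exp (- (2 * \<eta>)) * exp \<eta>) * A" by simp
  also have "real q * (1 - y) = real q - 1 - 2 * real d" using q by (simp add: y_def field_simps)
  also have "exp (- (2 * \<eta>)) * exp \<eta> = exp (- \<eta>)" by (simp add: exp_add[symmetric])
  finally have "(1 - x - y - 2 * \<eta>) * B \<le> (real q - 1 - 2 * real d) * exp (- \<eta>) * A" .
  moreover have "1 - (6 * real d + 1) / real q - 2 * \<eta> = 1 - x - y - 2 * \<eta>"
    using q by (simp add: x_def y_def add_divide_distrib)
  ultimately show ?thesis unfolding A_def B_def by (simp only:)
qed

text \<open>The quotient of the two weights acts as a factor \<open>u\<close>. Whatever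
  \<open>u\<close> gains on a hit it gains, up to \<open>exp (- \<delta>)\<close>, on all misses one
  switching away, so numerator and denominator of the odds grow nearly alike. Only the unmatched
  share \<open>\<zeta>\<close> escapes this comparison, and there the diameter bound
  \<open>exp (q * \<delta>)\<close> is paid. The total loss is
  \<open>\<delta> + \<zeta> * q * \<delta>\<close>.\<close>

lemma odds_perturb:
  assumes w2: "extra_entry_weight q d a c L F \<eta> w2" and "miss \<noteq> {}"
    and lip: "lipschitz q L \<delta> (\<lambda>x. ln (w2 x) - ln (w x))" and \<delta>: "0 \<le> \<delta>"
    and \<zeta>_def: "\<zeta> = (6 * real d + 1) / real q + 2 * \<eta>" and \<zeta>: "\<zeta> \<le> 1"
  shows "extra_entry_weight.odds q a c L F w2 * (1 - (1 + real q * \<zeta>) * \<delta>) \<le> odds"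
proof -
  interpret w2: extra_entry_weight q d a c L F \<eta> w2 by (rule w2)
  define g where "g x = ln (w2 x) - ln (w x)" for x
  have fin: "finite (spins q L)" using finite_spins[OF fin_L] .
  have ne: "spins q L \<noteq> {}" using \<open>miss \<noteq> {}\<close> miss_spins by auto
  \<comment> \<open>Dividing \<open>w2 / w\<close> by its minimum leaves the odds unchanged and
    makes \<open>u \<ge> 1\<close>, so that extending a sum of \<open>w * (u - 1)\<close> to further
    misses can only increase it.\<close>
  obtain x0 where x0: "x0 \<in> spins q L" "\<And>x. x \<in> spins q L \<Longrightarrow> g x0 \<le> g x"
    using ex_min_if_finite[of "g ` spins q L"] fin ne by (metis (no_types, lifting) arg_min_if_finite(1) arg_min_least)
  define u where "u x = exp (g x - g x0)" for x
  have u: "1 \<le> u x" "u x \<le> exp (real q * \<delta>)" if "x \<in> spins q L" for x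
    using x0(2)[OF that] lipschitz_diam[OF lip that x0(1)] by (auto simp: u_def g_def)
  have w2u: "w2 x = exp (g x0) * (w x * u x)" if "x \<in> spins q L" for x
    using w_pos[OF that] w2.w_pos[OF that] by (simp add: u_def g_def exp_diff)
  have nn\<zeta>: "0 \<le> \<zeta>" using \<eta>_nonneg by (simp add: \<zeta>_def)
  define A where "A = (\<Sum>x\<in>hit. w x)"
  define B where "B = (\<Sum>y\<in>miss. w y)"
  define A' where "A' = (\<Sum>x\<in>hit. w x * u x)"
  define B' where "B' = (\<Sum>y\<in>miss. w y * u y)"
  have pB: "0 < B" using sum_miss_pos[OF \<open>miss \<noteq> {}\<close>] by (simp add: B_def)
  have odds2: "w2.odds = A' / B'"
  proof -
    have "(\<Sum>x\<in>hit. w2 x) = exp (g x0) * A'" "(\<Sum>y\<in>miss. w2 y) = exp (g x0) * B'"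
      unfolding A'_def B'_def sum_distrib_left
      by (rule sum.cong; use w2u hit_spins miss_spins in simp)+
    then show ?thesis by (simp add: w2.odds_def)
  qed
  have nn: "0 \<le> A" "A \<le> A'" "B \<le> B'" "A' \<le> exp (real q * \<delta>) * A"
  proof -
    show "0 \<le> A" unfolding A_def by (rule sum_nonneg) (rule w_nonneg)
    have 1: "w x \<le> w x * u x" if "x \<in> spins q L" for x 
      using mult_left_mono[OF u(1)[OF that] less_imp_le[OF w_pos[OF that]]] by simp
    show "A \<le> A'" unfolding A_def A'_def by (intro sum_mono 1 hit_spins)
    show "B \<le> B'" unfolding B_def B'_def by (intro sum_mono 1 miss_spins)
    have 2: "w x * u x \<le> exp (real q * \<delta>) * w x" if "x \<in> spins q L" for x 
      using mult_left_mono[OF u(2)[OF that] less_imp_le[OF w_pos[OF that]]] by (simp add: mult.commute)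
    show "A' \<le> exp (real q * \<delta>) * A"
      unfolding A_def A'_def sum_distrib_left by (auto intro!: sum_mono 2 hit_spins)
  qed
  \<comment> \<open>What a hit is guaranteed to send to its targets, per unit of its own weight: the
    least number of targets times the loss under one transposition.\<close>
  define h where "h = (real q - 1 - 2 * real d) * exp (- \<eta>)"
  have h: "0 \<le> h" using q_bounds by (simp add: h_def)
  have lower: "(1 - \<zeta>) * B \<le> h * A"
    using hit_lower_bound by (simp add: h_def A_def B_def \<zeta>_def algebra_simps)
  \<comment> \<open>The positive part is taken because \<open>card_targets\<close> bounds the number
    of targets from below, which can be multiplied only into nonnegative terms.\<close>
  define \<phi> where "\<phi> x = max 0 (exp (- \<delta>) * u x - 1)" for x
  have "h * (exp (- \<delta>) * A' - A) \<le> h * (\<Sum>x\<in>hit. w x * \<phi> x)"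
  proof (rule mult_left_mono[OF _ h])
    have "exp (- \<delta>) * A' - A = (\<Sum>x\<in>hit. w x * (exp (- \<delta>) * u x - 1))"
      unfolding A_def A'_def by (simp add: sum_distrib_left sum_subtractf algebra_simps)
    also have "\<dots> \<le> (\<Sum>x\<in>hit. w x * \<phi> x)"
      by (intro sum_mono mult_left_mono w_nonneg) (auto simp: \<phi>_def)
    finally show "exp (- \<delta>) * A' - A \<le> (\<Sum>x\<in>hit. w x * \<phi> x)" .
  qed
  moreover have "h * (\<Sum>x\<in>hit. w x * \<phi> x) \<le> B' - B"
  proof -
    have "h * (\<Sum>x\<in>hit. w x * \<phi> x) = (\<Sum>x\<in>hit. (real q - 1 - 2 * real d) * (exp (- \<eta>) * w x * \<phi> x))"
      by (simp add: h_def sum_distrib_left mult_ac)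
    also have "\<dots> \<le> (\<Sum>x\<in>hit. \<Sum>k\<in>targets x. w (swap x a k) * (u (swap x a k) - 1))"
    proof (rule sum_mono)
      fix x assume x: "x \<in> hit"
      have \<phi>0: "0 \<le> \<phi> x" by (simp add: \<phi>_def)
      have "0 \<le> exp (- \<eta>) * w x * \<phi> x" using w_nonneg x \<phi>0 by simp
      moreover have "real (q - 1 - 2 * d) \<le> real (card (targets x))"
        using card_targets(1)[OF hit_spins[OF x]] by (simp only: of_nat_le_iff)
      ultimately have "(real q - 1 - 2 * real d) * (exp (- \<eta>) * w x * \<phi> x) \<le> real (card (targets x)) * (exp (- \<eta>) * w x * \<phi> x)"
        using q_large by (intro mult_right_mono) (auto simp: of_nat_diff)
      also have "\<dots> = (\<Sum>k\<in>targets x. exp (- \<eta>) * w x * \<phi> x)" by simp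
      also have "\<dots> \<le> (\<Sum>k\<in>targets x. w (swap x a k) * (u (swap x a k) - 1))"
      proof (rule sum_mono)
        fix k assume k: "k \<in> targets x"
        then have kq: "k < q" by (simp add: targets_def)
        have xs: "x \<in> spins q L" "swap x a k \<in> spins q L" using hit_spins[OF x] a kq by auto
        have "exp (- \<eta>) * w x \<le> exp (- \<eta>) * (exp \<eta> * w (swap x a k))"
          using w_swap(2)[OF xs(1) a kq] by (intro mult_left_mono) auto
        also have "\<dots> = w (swap x a k)" by (simp add: mult.assoc[symmetric] exp_add[symmetric])
        finally have 1: "exp (- \<eta>) * w x \<le> w (swap x a k)" .
        have "exp (- \<delta>) * u x \<le> u (swap x a k)"
          using lipschitzD[OF lip xs(1) a kq] by (auto simp: u_def g_def exp_add[symmetric])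
        then have 2: "\<phi> x \<le> u (swap x a k) - 1" using u(1)[OF xs(2)] by (simp add: \<phi>_def)
        show "exp (- \<eta>) * w x * \<phi> x \<le> w (swap x a k) * (u (swap x a k) - 1)"
          using 1 2 \<phi>0 w_pos[OF xs(2)] by (intro mult_mono) auto
      qed
      finally show "(real q - 1 - 2 * real d) * (exp (- \<eta>) * w x * \<phi> x)
          \<le> (\<Sum>k\<in>targets x. w (swap x a k) * (u (swap x a k) - 1))" .
    qed
    also have "\<dots> = (\<Sum>y\<in>miss - stuck. w y * (u y - 1))"
      using sum_miss_not_stuck[of "\<lambda>y. w y * (u y - 1)"] by simp
    also have "\<dots> \<le> (\<Sum>y\<in>miss. w y * (u y - 1))"
      using finite_miss w_nonneg u miss_spins by (intro sum_mono2) auto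
    also have "\<dots> = B' - B" by (simp add: B'_def B_def sum_subtractf algebra_simps)
    finally show ?thesis .
  qed
  ultimately have key: "h * (exp (- \<delta>) * A' - A) \<le> B' - B" by linarith
  have pB': "0 < B'" using pB nn by linarith
  \<comment> \<open>\<open>A'\<close> is split in the proportion \<open>\<zeta>\<close> to
    \<open>1 - \<zeta>\<close>. The first part uses only
    \<open>A' \<le> exp (q * \<delta>) * A\<close>; the second keeps the factor
    \<open>exp (- \<delta>)\<close> that \<open>key\<close> can handle.\<close>
  have E: "A' * (1 - (1 + real q * \<zeta>) * \<delta>) \<le> \<zeta> * A + (1 - \<zeta>) * exp (- \<delta>) * A'"
  proof -
    have "A' * (1 - real q * \<delta>) \<le> A' * exp (- (real q * \<delta>))"
      using exp_ge_add_one_self[of "- (real q * \<delta>)"] nn by (intro mult_left_mono) auto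
    also have "\<dots> \<le> exp (real q * \<delta>) * A * exp (- (real q * \<delta>))" using nn by (intro mult_right_mono) auto
    also have "\<dots> = A" by (simp add: exp_minus)
    finally have "\<zeta> * (A' * (1 - real q * \<delta>)) \<le> \<zeta> * A" using nn\<zeta> by (intro mult_left_mono)
    moreover have "(1 - \<zeta>) * (1 - \<delta>) * A' \<le> (1 - \<zeta>) * exp (- \<delta>) * A'"
      using exp_ge_add_one_self[of "- \<delta>"] nn \<zeta> by (intro mult_left_mono mult_right_mono) auto
    moreover have "0 \<le> \<zeta> * \<delta> * A'" using nn\<zeta> \<delta> nn by simp
    ultimately show ?thesis by (simp add: algebra_simps)
  qed
  show ?thesis
  proof (cases "A = 0")
    case True
    then have "A' = 0" using nn by simp
    then show ?thesis by (simp add: odds2 odds_def A_def[symmetric] True)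
  next
    case False
    then have pA: "0 < A" using nn by simp
    have "B * (A' * (1 - (1 + real q * \<zeta>) * \<delta>)) \<le> B * (\<zeta> * A + (1 - \<zeta>) * exp (- \<delta>) * A')"
      using E pB by (intro mult_left_mono) auto
    also have "\<dots> \<le> A * B'"
    proof (cases "exp (- \<delta>) * A' - A \<ge> 0")
      case True
      have "(1 - \<zeta>) * B * (exp (- \<delta>) * A' - A) \<le> h * A * (exp (- \<delta>) * A' - A)"
        using lower True by (intro mult_right_mono) auto
      also have "\<dots> = A * (h * (exp (- \<delta>) * A' - A))" by simp
      also have "\<dots> \<le> A * (B' - B)" using key pA by (intro mult_left_mono) auto
      finally show ?thesis by (simp add: algebra_simps)
    next
      case False
      then have "(1 - \<zeta>) * (exp (- \<delta>) * A') \<le> (1 - \<zeta>) * A" using \<zeta> by (intro mult_left_mono) auto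
      then have "B * (\<zeta> * A + (1 - \<zeta>) * exp (- \<delta>) * A') \<le> B * A" using pB by (intro mult_left_mono) (auto simp: algebra_simps)
      also have "\<dots> \<le> B' * A" using nn by (intro mult_right_mono) auto
      finally show ?thesis by (simp add: mult.commute)
    qed
    finally show ?thesis using pB pB' by (simp add: odds2 odds_def A_def[symmetric] B_def[symmetric] field_simps)
  qed
qed

end

text \<open>Used with \<open>ln (1 + odds)\<close>, the log-ratio of the weights with and without the extra forbidden entry.\<close>

lemma ln_odds_perturb:
  assumes w1: "extra_entry_weight q d a c L F \<eta> w1" and w2: "extra_entry_weight q d a c L F \<eta> w2"
    and ne: "extra_entry.miss q a c L F \<noteq> {}"
    and lip: "lipschitz q L \<delta> (\<lambda>x. ln (w2 x) - ln (w1 x))" and \<delta>: "0 \<le> \<delta>"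
    and \<zeta>_def: "\<zeta> = (6 * real d + 1) / real q + 2 * \<eta>" and \<zeta>: "\<zeta> \<le> 1"
  shows "\<bar>ln (1 + extra_entry_weight.odds q a c L F w2) - ln (1 + extra_entry_weight.odds q a c L F w1)\<bar>
           \<le> 4 / real q * (1 + real q * \<zeta>) * \<delta>"
proof -
  have one_sided: "ln (1 + extra_entry_weight.odds q a c L F w2) - ln (1 + extra_entry_weight.odds q a c L F w1)
           \<le> 4 / real q * (1 + real q * \<zeta>) * \<delta>"
    if w1: "extra_entry_weight q d a c L F \<eta> w1" and w2: "extra_entry_weight q d a c L F \<eta> w2"
      and lip: "lipschitz q L \<delta> (\<lambda>x. ln (w2 x) - ln (w1 x))" for w1 w2
  proof -
    interpret w1: extra_entry_weight q d a c L F \<eta> w1 by (rule w1)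
    interpret w2: extra_entry_weight q d a c L F \<eta> w2 by (rule w2)
    note b1 = w1.odds_bounds[OF ne] and b2 = w2.odds_bounds[OF ne]
    have *: "0 \<le> 4 / real q * (1 + real q * \<zeta>) * \<delta>" using \<delta> w1.\<eta>_nonneg by (simp add: \<zeta>_def)
    show ?thesis
    proof (cases "w1.odds \<le> w2.odds")
      case True
      have "ln (1 + w2.odds) - ln (1 + w1.odds) \<le> ((1 + w2.odds) - (1 + w1.odds)) / (1 + w1.odds)"
        using b1 b2 by (intro ln_diff_le) auto
      also have "\<dots> \<le> (w2.odds - w1.odds) / 1" using True b1 by (intro frac_le) auto
      also have "\<dots> \<le> w2.odds * ((1 + real q * \<zeta>) * \<delta>)"
        using w1.odds_perturb[OF w2 ne lip \<delta> \<zeta>_def \<zeta>] by (simp add: algebra_simps)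
      also have "\<dots> \<le> 4 / real q * ((1 + real q * \<zeta>) * \<delta>)"
        using b2 \<delta> w1.\<eta>_nonneg by (intro mult_right_mono) (auto simp: \<zeta>_def)
      finally show ?thesis by (simp only: mult.assoc)
    next
      case False
      then have "ln (1 + w2.odds) \<le> ln (1 + w1.odds)" using b1 b2 by simp
      then show ?thesis using * by linarith
    qed
  qed
  have "lipschitz q L \<delta> (\<lambda>x. ln (w1 x) - ln (w2 x))" using lip unfolding lipschitz_def by (smt (verit))
  then show ?thesis using one_sided[OF w1 w2 lip] one_sided[OF w2 w1] by linarith
qed

lemma degree_bounded_mono: "degree_bounded q L d F \<Longrightarrow> F' \<subseteq> F \<Longrightarrow> finite L \<Longrightarrow> d \<le> d' \<Longrightarrow> degree_bounded q L d' F'"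
  unfolding degree_bounded_def
proof (intro conjI allI impI ballI)
  fix i assume *: "(\<forall>i<q. card {c \<in> L. (i, c) \<in> F} \<le> d) \<and> (\<forall>c\<in>L. card {i. i < q \<and> (i, c) \<in> F} \<le> d)"
    "F' \<subseteq> F" "finite L" "d \<le> d'" "i < q"
  have "card {c \<in> L. (i, c) \<in> F'} \<le> card {c \<in> L. (i, c) \<in> F}" using * by (intro card_mono) auto
  then show "card {c \<in> L. (i, c) \<in> F'} \<le> d'" using * by (meson le_trans)
next
  fix c assume *: "(\<forall>i<q. card {c \<in> L. (i, c) \<in> F} \<le> d) \<and> (\<forall>c\<in>L. card {i. i < q \<and> (i, c) \<in> F} \<le> d)"
    "F' \<subseteq> F" "finite L" "d \<le> d'" "c \<in> L"
  have "card {i. i < q \<and> (i, c) \<in> F'} \<le> card {i. i < q \<and> (i, c) \<in> F}" using * by (intro card_mono) auto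
  then show "card {i. i < q \<and> (i, c) \<in> F'} \<le> d'" using * by (meson le_trans)
qed

lemma degree_bounded_insert:
  assumes "degree_bounded q L d F" "finite L"
  shows "degree_bounded q L (Suc d) (insert (a, c) F)"
  unfolding degree_bounded_def
proof (intro conjI allI impI ballI)
  fix i assume i: "i < q"
  have "card {e \<in> L. (i, e) \<in> insert (a, c) F} \<le> card (insert c {e \<in> L. (i, e) \<in> F})"
    using assms by (intro card_mono) auto
  also have "\<dots> \<le> Suc (card {e \<in> L. (i, e) \<in> F})" using assms by (simp add: card_insert_if)
  also have "\<dots> \<le> Suc d" using assms(1) i by (auto simp: degree_bounded_def)
  finally show "card {e \<in> L. (i, e) \<in> insert (a, c) F} \<le> Suc d" .
next
  fix e assume e: "e \<in> L"
  have "card {i. i < q \<and> (i, e) \<in> insert (a, c) F} \<le> card (insert a {i. i < q \<and> (i, e) \<in> F})"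
    by (intro card_mono) auto
  also have "\<dots> \<le> Suc (card {i. i < q \<and> (i, e) \<in> F})" by (simp add: card_insert_if)
  also have "\<dots> \<le> Suc d" using assms(1) e by (auto simp: degree_bounded_def)
  finally show "card {i. i < q \<and> (i, e) \<in> insert (a, c) F} \<le> Suc d" .
qed

section \<open>The effect of one forbidden entry on a sum of weights\<close>

definition allowed_spins :: "nat \<Rightarrow> nat set \<Rightarrow> (nat \<times> nat) set \<Rightarrow> nat list set" where
  "allowed_spins q L F = {x \<in> spins q L. avoids F x}"

lemma finite_allowed_spins: "finite L \<Longrightarrow> finite (allowed_spins q L F)"
  unfolding allowed_spins_def using finite_spins by auto

lemma (in extra_entry) allowed_spins_insert: "allowed_spins q L (insert (a, c) F) = miss"
  using a by (auto simp: allowed_spins_def miss_def avoids_def spins_def)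

lemma (in extra_entry) allowed_spins_split: "allowed_spins q L F = hit \<union> miss" "hit \<inter> miss = {}"
  by (auto simp: allowed_spins_def miss_def hit_def)

text \<open>Every hit can be switched to a miss. That argument lives in the weighted locale, which
  the constant weight 1 with \<open>\<eta> = 0\<close> instantiates.\<close>

lemma (in extra_entry) miss_nonempty: 
  assumes "allowed_spins q L F \<noteq> {}" shows "miss \<noteq> {}"
proof
  assume m: "miss = {}"
  have "extra_entry_weight q d a c L F 0 (\<lambda>_. 1)"
    by unfold_locales (auto simp: lipschitz_def)
  from extra_entry_weight.hit_or_miss_nonempty[OF this m] show False using allowed_spins_split(1) assms m by auto
qed

text \<open>The cells of \<open>F\<close> are inserted one at a time, and by
  \<open>miss_nonempty\<close> no insertion destroys the last placement.\<close>

lemma allowed_spins_nonempty: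
  assumes L: "finite L" "card L = q" and deg: "degree_bounded q L d F" and q: "8 * d + 4 \<le> q"
  shows "allowed_spins q L F \<noteq> {}"
proof -
  \<comment> \<open>\<open>F\<close> may be infinite; only its finite part on the board matters, and
    this permits the induction over insertions.\<close>
  define R where "R = {..<q} \<times> L"
  have "allowed_spins q L F' \<noteq> {}" if "finite F'" "F' \<subseteq> F \<inter> R" for F'
    using that
  proof (induction F' rule: finite_induct)
    case empty
    then show ?case using spins_nonempty[OF L] by (auto simp: allowed_spins_def avoids_def)
  next
    case (insert p F')
    obtain a c where p: "p = (a, c)" by force
    interpret extra_entry q d a c L F'
    proof unfold_locales
      show "degree_bounded q L d F'" using degree_bounded_mono[OF deg _ L(1) le_refl, of F'] insert by auto
    qed (use insert p q L in \<open>auto simp: R_def\<close>)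
    show ?case using miss_nonempty insert by (simp add: p allowed_spins_insert)
  qed
  moreover have "finite (F \<inter> R)" using L by (auto simp: R_def)
  moreover have "allowed_spins q L (F \<inter> R) = allowed_spins q L F"
    by (auto simp: allowed_spins_def avoids_def R_def spins_def)
  ultimately show ?thesis by (metis order_refl)
qed

definition weight :: "nat \<Rightarrow> nat set \<Rightarrow> (nat \<times> nat) set \<Rightarrow> (nat list \<Rightarrow> real) \<Rightarrow> real" where
  "weight q L F w = (\<Sum>x\<in>allowed_spins q L F. w x)"

definition smooth :: "nat \<Rightarrow> nat set \<Rightarrow> real \<Rightarrow> (nat list \<Rightarrow> real) \<Rightarrow> bool" where
  "smooth q L \<eta> w \<longleftrightarrow> (\<forall>x\<in>spins q L. 0 < w x) \<and> lipschitz q L \<eta> (\<lambda>x. ln (w x))"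

context
  fixes q d :: nat and L :: "nat set" and \<eta> :: real
  assumes L: "finite L" "card L = q" and q: "8 * d + 4 \<le> q" and \<eta>: "exp \<eta> \<le> 2" "0 \<le> \<eta>"
begin

lemma extra_entry_weightI:
  assumes "degree_bounded q L d F" "a < q" "c \<in> L" "(a, c) \<notin> F" "smooth q L \<eta> w"
  shows "extra_entry_weight q d a c L F \<eta> w"
  using assms L q \<eta> by unfold_locales (auto simp: smooth_def)

lemma weight_pos:
  assumes "degree_bounded q L d F" "smooth q L \<eta> w"
  shows "0 < weight q L F w"
  unfolding weight_def using assms allowed_spins_nonempty[OF L assms(1) q] finite_allowed_spins[OF L(1)]
  by (intro sum_pos) (auto simp: allowed_spins_def smooth_def)

lemma ln_weight_insert:
  assumes "degree_bounded q L d F" "a < q" "c \<in> L" "(a, c) \<notin> F" "smooth q L \<eta> w"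
  shows "ln (weight q L F w) - ln (weight q L (insert (a, c) F) w) = ln (1 + extra_entry_weight.odds q a c L F w)"
    "extra_entry.miss q a c L F \<noteq> {}"
proof -
  interpret extra_entry_weight q d a c L F \<eta> w using assms by (rule extra_entry_weightI)
  show m: "miss \<noteq> {}" using miss_nonempty[OF allowed_spins_nonempty[OF L assms(1) q]] .
  have w: "weight q L F w = (\<Sum>x\<in>hit. w x) + (\<Sum>y\<in>miss. w y)"
    unfolding weight_def allowed_spins_split(1) using finite_hit finite_miss allowed_spins_split(2)
    by (intro sum.union_disjoint) auto
  have wi: "weight q L (insert (a, c) F) w = (\<Sum>y\<in>miss. w y)"
    unfolding weight_def allowed_spins_insert ..
  have p: "0 < (\<Sum>y\<in>miss. w y)" using sum_miss_pos[OF m] .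
  have "weight q L F w / weight q L (insert (a, c) F) w = 1 + odds"
    using p by (simp add: w wi odds_def field_simps)
  moreover have "0 < weight q L F w" using weight_pos[OF assms(1,5)] .
  ultimately show "ln (weight q L F w) - ln (weight q L (insert (a, c) F) w) = ln (1 + odds)"
    using p ln_div[of "weight q L F w" "weight q L (insert (a, c) F) w"] by (simp add: wi)
qed

lemma ln_weight_insert_bounds:
  assumes "degree_bounded q L d F" "a < q" "c \<in> L" "smooth q L \<eta> w"
  shows "0 \<le> ln (weight q L F w) - ln (weight q L (insert (a, c) F) w)"
    "ln (weight q L F w) - ln (weight q L (insert (a, c) F) w) \<le> 4 / real q"
proof -
  have "0 \<le> ln (weight q L F w) - ln (weight q L (insert (a, c) F) w) \<and>
      ln (weight q L F w) - ln (weight q L (insert (a, c) F) w) \<le> 4 / real q"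
  proof (cases "(a, c) \<in> F")
    case True
    then show ?thesis by (simp add: insert_absorb)
  next
    case False
    interpret extra_entry_weight q d a c L F \<eta> w using assms False by (intro extra_entry_weightI)
    note o = odds_bounds[OF ln_weight_insert(2)[OF assms(1-3) False assms(4)]]
    have "ln (1 + odds) \<le> odds" using o by (intro ln_add_one_self_le_self) auto
    then show ?thesis using o by (simp add: ln_weight_insert(1)[OF assms(1-3) False assms(4)])
  qed
  then show "0 \<le> ln (weight q L F w) - ln (weight q L (insert (a, c) F) w)"
    "ln (weight q L F w) - ln (weight q L (insert (a, c) F) w) \<le> 4 / real q" by auto
qed

lemma ln_weight_insert_perturb:
  assumes "degree_bounded q L d F" "a < q" "c \<in> L" "smooth q L \<eta> w1" "smooth q L \<eta> w2"
    and lip: "lipschitz q L \<delta> (\<lambda>x. ln (w2 x) - ln (w1 x))" "0 \<le> \<delta>"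
    and \<zeta>: "\<zeta> = (6 * real d + 1) / real q + 2 * \<eta>" "\<zeta> \<le> 1"
  shows "\<bar>(ln (weight q L F w2) - ln (weight q L (insert (a, c) F) w2))
         - (ln (weight q L F w1) - ln (weight q L (insert (a, c) F) w1))\<bar> \<le> 4 / real q * (1 + real q * \<zeta>) * \<delta>"
proof (cases "(a, c) \<in> F")
  case True
  then show ?thesis using lip \<zeta>(1) \<eta> by (simp add: insert_absorb)
next
  case False
  show ?thesis
    unfolding ln_weight_insert(1)[OF assms(1-3) False assms(4)] ln_weight_insert(1)[OF assms(1-3) False assms(5)]
    by (rule ln_odds_perturb[OF extra_entry_weightI[OF assms(1-3) False assms(4)]
          extra_entry_weightI[OF assms(1-3) False assms(5)] ln_weight_insert(2)[OF assms(1-3) False assms(4)] lip \<zeta>])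
qed

end

section \<open>Pinned spins as forbidden entries\<close>

definition compat :: "nat list \<Rightarrow> nat list \<Rightarrow> bool" where
  "compat x y \<longleftrightarrow> (\<forall>i<length x. x ! i \<noteq> y ! i)"

definition forbidden :: "nat \<Rightarrow> nat list list \<Rightarrow> (nat \<times> nat) set" where
  "forbidden q cs = {(i, c ! i) |i c. i < q \<and> c \<in> set cs}"

lemma avoids_forbidden: "length x = q \<Longrightarrow> avoids (forbidden q cs) x \<longleftrightarrow> (\<forall>c\<in>set cs. compat x c)"
  by (auto simp: avoids_def forbidden_def compat_def)

text \<open>A pinned spin is injective, so it forbids one color at each position and at most one
  position for each color.\<close>

lemma degree_bounded_forbidden:
  assumes "\<And>c. c \<in> set cs \<Longrightarrow> length c = q \<and> distinct c"
  shows "degree_bounded q L (length cs) (forbidden q cs)"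
  unfolding degree_bounded_def
proof (intro conjI allI impI ballI)
  fix i assume i: "i < q"
  have "card {e \<in> L. (i, e) \<in> forbidden q cs} \<le> card ((\<lambda>c. c ! i) ` set cs)"
    by (intro card_mono) (auto simp: forbidden_def)
  also have "\<dots> \<le> card (set cs)" by (intro card_image_le) auto
  also have "\<dots> \<le> length cs" by (rule card_length)
  finally show "card {e \<in> L. (i, e) \<in> forbidden q cs} \<le> length cs" .
next
  fix e assume e: "e \<in> L"
  have "card {i. i < q \<and> (i, e) \<in> forbidden q cs} \<le> card ((\<lambda>c. index_of c e) ` set cs)"
  proof (intro card_mono subsetI)
    fix i assume "i \<in> {i. i < q \<and> (i, e) \<in> forbidden q cs}"
    then obtain c where c: "i < q" "c \<in> set cs" "e = c ! i" by (auto simp: forbidden_def)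
    then have "index_of c e = i" using assms by auto
    then show "i \<in> (\<lambda>c. index_of c e) ` set cs" using c(2) by (metis image_eqI)
  qed auto
  also have "\<dots> \<le> card (set cs)" by (intro card_image_le) auto
  also have "\<dots> \<le> length cs" by (rule card_length)
  finally show "card {i. i < q \<and> (i, e) \<in> forbidden q cs} \<le> length cs" .
qed

lemma forbidden_swap:
  assumes "length s = q" "a < q" "b < q"
  shows "forbidden q (s # cs) \<union> forbidden q (swap s a b # cs) =
           insert (b, s ! a) (insert (a, s ! b) (forbidden q (s # cs)))"
proof -
  have sp: "forbidden q (x # cs) = forbidden q cs \<union> {(i, x ! i) |i. i < q}" for x
    by (auto simp: forbidden_def)
  have "{(i, s ! i) |i. i < q} \<union> {(i, swap s a b ! i) |i. i < q} =
        insert (b, s ! a) (insert (a, s ! b) {(i, s ! i) |i. i < q})"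
    using assms by (auto simp: nth_swap split: if_splits)
  then show ?thesis unfolding sp by blast
qed

text \<open>Both \<open>s\<close> and \<open>swap s a b\<close> are compared with forbidding them simultaneously, which takes two
  extra entries each.\<close>

context
  fixes q k a b :: nat and L :: "nat set" and \<eta> :: real and cs :: "nat list list" and s :: "nat list"
  assumes L: "finite L" "card L = q" and q: "8 * (k + 2) + 4 \<le> q" and \<eta>: "exp \<eta> \<le> 2" "0 \<le> \<eta>"
    and cs: "\<And>c. c \<in> set cs \<Longrightarrow> length c = q \<and> distinct c" "length cs \<le> k"
    and s: "length s = q" "distinct s" and ab: "a < q" "b < q"
begin

private lemma deg_cons: "length t = q \<Longrightarrow> distinct t \<Longrightarrow> degree_bounded q L (k + 1) (forbidden q (t # cs))"
  by (rule degree_bounded_mono[OF degree_bounded_forbidden[of "t # cs" q L] subset_refl L(1)]) (use cs in auto)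

private definition "gap w t F = (ln (weight q L (forbidden q (t # cs)) w) - ln (weight q L F w))"

text \<open>Two insertions, each costing at most \<open>4 / q\<close> in the logarithm and
  \<open>4 / q * (1 + q * \<zeta>) * \<delta>\<close> in its perturbation. The pins
  \<open>t # cs\<close> account for degree \<open>k + 1\<close> and the first inserted entry for one
  more, which is why the context works with \<open>k + 2\<close>.\<close>

private lemma one_gap:
  assumes t: "length t = q" "distinct t" and F: "F = insert p (insert p' (forbidden q (t # cs)))"
    and p: "p = (i, e)" "p' = (i', e')" "i < q" "i' < q" and w: "smooth q L \<eta> w"
  shows "0 \<le> gap w t F" "gap w t F \<le> 8 / real q"
    "smooth q L \<eta> w2 \<Longrightarrow> lipschitz q L \<delta> (\<lambda>x. ln (w2 x) - ln (w x)) \<Longrightarrow> 0 \<le> \<delta> \<Longrightarrow>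
     \<zeta> = (6 * real (k + 2) + 1) / real q + 2 * \<eta> \<Longrightarrow> \<zeta> \<le> 1 \<Longrightarrow>
     \<bar>gap w2 t F - gap w t F\<bar> \<le> 8 / real q * (1 + real q * \<zeta>) * \<delta>"
proof -
  define F0 where "F0 = forbidden q (t # cs)"
  define F1 where "F1 = insert (i', e') F0"
  have F2: "F = insert (i, e) F1" by (simp add: F F1_def F0_def p)
  have d0: "degree_bounded q L (k + 2) F0"
    unfolding F0_def by (rule degree_bounded_mono[OF deg_cons[OF t] subset_refl L(1)]) simp
  have d1: "degree_bounded q L (k + 2) F1"
    using degree_bounded_insert[OF deg_cons[OF t] L(1)] by (simp add: F1_def F0_def)
  \<comment> \<open>Pinned spins belong to other vertices with other lists, so an inserted entry may
    carry a color outside \<open>L\<close>; forbidding it changes nothing.\<close>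
  have drop: "weight q L (insert (j, f) G) w = weight q L G w" if "f \<notin> L" "j < q" for j f G w
    using that by (auto simp: weight_def allowed_spins_def avoids_def spins_def intro!: sum.cong)
  note bnd = ln_weight_insert_bounds[OF L q \<eta>]
  note prt = ln_weight_insert_perturb[OF L q \<eta>]
  have g: "gap w t F = (ln (weight q L F0 w) - ln (weight q L F1 w)) + (ln (weight q L F1 w) - ln (weight q L F w))" for w
    by (simp add: gap_def F0_def)
  have b0: "0 \<le> ln (weight q L F0 w) - ln (weight q L F1 w) \<and> ln (weight q L F0 w) - ln (weight q L F1 w) \<le> 4 / real q"
    using bnd[OF d0 p(4) _ w, of e'] by (cases "e' \<in> L") (auto simp: F1_def drop p)
  have b1: "0 \<le> ln (weight q L F1 w) - ln (weight q L F w) \<and> ln (weight q L F1 w) - ln (weight q L F w) \<le> 4 / real q"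
    using bnd[OF d1 p(3) _ w, of e] by (cases "e \<in> L") (auto simp: F2 drop p)
  show "0 \<le> gap w t F" "gap w t F \<le> 8 / real q" using b0 b1 unfolding g by auto
  assume w2: "smooth q L \<eta> w2" and lip: "lipschitz q L \<delta> (\<lambda>x. ln (w2 x) - ln (w x))" "0 \<le> \<delta>"
    and \<zeta>: "\<zeta> = (6 * real (k + 2) + 1) / real q + 2 * \<eta>" "\<zeta> \<le> 1"
  have nn: "0 \<le> 4 / real q * (1 + real q * \<zeta>) * \<delta>" using lip \<eta> by (simp add: \<zeta>)
  have p0: "\<bar>(ln (weight q L F0 w2) - ln (weight q L F1 w2)) - (ln (weight q L F0 w) - ln (weight q L F1 w))\<bar> 
     \<le> 4 / real q * (1 + real q * \<zeta>) * \<delta>"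
  proof (cases "e' \<in> L")
    case True
    show ?thesis unfolding F1_def by (rule prt[OF d0 p(4) True w w2 lip \<zeta>])
  next
    case False
    then show ?thesis unfolding F1_def using nn by (simp add: drop[OF False p(4)])
  qed
  have p1: "\<bar>(ln (weight q L F1 w2) - ln (weight q L F w2)) - (ln (weight q L F1 w) - ln (weight q L F w))\<bar> 
     \<le> 4 / real q * (1 + real q * \<zeta>) * \<delta>"
  proof (cases "e \<in> L")
    case True
    show ?thesis unfolding F2 by (rule prt[OF d1 p(3) True w w2 lip \<zeta>])
  next
    case False
    then show ?thesis unfolding F2 using nn by (simp add: drop[OF False p(3)])
  qed
  have "8 / real q * (1 + real q * \<zeta>) * \<delta> = 4 / real q * (1 + real q * \<zeta>) * \<delta> + 4 / real q * (1 + real q * \<zeta>) * \<delta>"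
    by (simp add: algebra_simps)
  then show "\<bar>gap w2 t F - gap w t F\<bar> \<le> 8 / real q * (1 + real q * \<zeta>) * \<delta>"
    using p0 p1 unfolding g by linarith
qed

private definition "both = forbidden q (s # cs) \<union> forbidden q (swap s a b # cs)"

private lemma both1: "both = insert (b, s ! a) (insert (a, s ! b) (forbidden q (s # cs)))"
  unfolding both_def by (rule forbidden_swap[OF s(1) ab])

private lemma both2: "both = insert (b, swap s a b ! a) (insert (a, swap s a b ! b) (forbidden q (swap s a b # cs)))"
  using forbidden_swap[of "swap s a b" q a b cs] s ab by (simp add: both_def Un_commute)

private lemma sw: "length (swap s a b) = q" "distinct (swap s a b)"
  using s ab by (auto simp: swap_def)

text \<open>Both gaps to the common set \<open>both\<close> lie between 0 and \<open>8 / q\<close>,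
  so their difference is at most \<open>8 / q\<close> rather than twice that.\<close>

lemma swap_ratio_bound:
  assumes "smooth q L \<eta> w"
  shows "\<bar>ln (weight q L (forbidden q (s # cs)) w) - ln (weight q L (forbidden q (swap s a b # cs)) w)\<bar> \<le> 8 / real q"
  using one_gap(1,2)[OF s both1 refl refl ab(2,1) assms] one_gap(1,2)[OF sw both2 refl refl ab(2,1) assms]
  unfolding gap_def by linarith

text \<open>Unlike the gaps themselves, their perturbations have no common sign, so here the two
  bounds \<open>8 / q\<close> add up.\<close>

lemma swap_ratio_perturb:
  assumes "smooth q L \<eta> w1" "smooth q L \<eta> w2" "lipschitz q L \<delta> (\<lambda>x. ln (w2 x) - ln (w1 x))" "0 \<le> \<delta>"
    and \<zeta>: "\<zeta> = (6 * real (k + 2) + 1) / real q + 2 * \<eta>" "\<zeta> \<le> 1"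
  shows "\<bar>(ln (weight q L (forbidden q (s # cs)) w2) - ln (weight q L (forbidden q (swap s a b # cs)) w2))
        - (ln (weight q L (forbidden q (s # cs)) w1) - ln (weight q L (forbidden q (swap s a b # cs)) w1))\<bar>
      \<le> 16 / real q * (1 + real q * \<zeta>) * \<delta>"
proof -
  have "16 / real q * (1 + real q * \<zeta>) * \<delta> = 8 / real q * (1 + real q * \<zeta>) * \<delta> + 8 / real q * (1 + real q * \<zeta>) * \<delta>"
    by (simp add: algebra_simps)
  then show ?thesis
    using one_gap(3)[OF s both1 refl refl ab(2,1) assms] one_gap(3)[OF sw both2 refl refl ab(2,1) assms]
    unfolding gap_def by linarith
qed

end

section \<open>Pinned subproblems\<close>

lemma compat_sym: "length x = length y \<Longrightarrow> compat x y \<longleftrightarrow> compat y x"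
  by (auto simp: compat_def)

text \<open>The spin of a vertex \<open>v\<close> lists the colors of \<open>v\<close> in the colorings \<open>1, \<dots>, q\<close>.  A subproblem
  consists of a set \<open>U\<close> of remaining vertices and, for each of them, a list \<open>C u\<close> of spins of
  deleted neighbors.\<close>

definition pin :: "nat set set \<Rightarrow> nat \<Rightarrow> nat list \<Rightarrow> (nat \<Rightarrow> nat list list) \<Rightarrow> nat \<Rightarrow> nat list list" where
  "pin E v x C = (\<lambda>u. if {v, u} \<in> E then x # C u else C u)"

text \<open>A hybrid between pinning \<open>s\<close> and pinning \<open>t\<close>, with no pin at the neighbor \<open>u\<close>.\<close>

definition pin_split ::
    "nat set set \<Rightarrow> nat \<Rightarrow> nat list \<Rightarrow> nat list \<Rightarrow> nat \<Rightarrow> (nat \<Rightarrow> nat list list) \<Rightarrow> nat \<Rightarrow> nat list list" where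
  "pin_split E v s t u C =
     (\<lambda>w. if {v, w} \<in> E then (if w < u then s # C w else if u < w then t # C w else C w) else C w)"

section \<open>Configurations of the remaining vertices\<close>

locale packing_graph =
  fixes q \<Delta> :: nat and V :: "nat set" and E :: "nat set set" and L :: "nat \<Rightarrow> nat set"
  assumes graph: "fin_graph V E" and lists: "list_assignment q V L" and max_deg: "max_degree V E \<le> \<Delta>"
    and \<Delta>: "1 \<le> \<Delta>" and q: "20000 * \<Delta> ^ 2 \<le> q"
begin

lemma finite_V: "finite V" using graph by (simp add: fin_graph_def)

lemma edge_V: "{u, v} \<in> E \<Longrightarrow> u \<in> V" "{u, v} \<in> E \<Longrightarrow> v \<in> V"
  using graph by (auto simp: fin_graph_def)

lemma no_loop: "{v, v} \<notin> E" "{v} \<notin> E"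
  using graph by (auto simp: fin_graph_def)

lemma L: "v \<in> V \<Longrightarrow> finite (L v)" "v \<in> V \<Longrightarrow> card (L v) = q"
  using lists by (auto simp: list_assignment_def)

definition nbrs :: "nat set \<Rightarrow> nat \<Rightarrow> nat set" where
  "nbrs U v = {u \<in> U. {v, u} \<in> E}"

lemma card_nbrs: "v \<in> V \<Longrightarrow> card (nbrs V v) \<le> \<Delta>"
proof -
  assume v: "v \<in> V"
  have "finite E" using graph finite_V by (auto simp: fin_graph_def intro: finite_subset[of E "Pow V"])
  then have "card (nbrs V v) \<le> card {e \<in> E. v \<in> e}"
    by (intro card_inj_on_le[of "\<lambda>u. {v, u}"]) (auto simp: inj_on_def nbrs_def doubleton_eq_iff)
  also have "\<dots> \<le> max_degree V E" unfolding max_degree_def using v finite_V by (intro Max_ge) auto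
  finally show ?thesis using max_deg by simp
qed

definition configs :: "nat set \<Rightarrow> (nat \<Rightarrow> nat list list) \<Rightarrow> (nat \<Rightarrow> nat list) set" where
  "configs U C = {\<omega> \<in> (\<Pi>\<^sub>E u\<in>U. spins q (L u)).
     (\<forall>u\<in>U. \<forall>c\<in>set (C u). compat (\<omega> u) c) \<and> (\<forall>u\<in>U. \<forall>w\<in>U. {u, w} \<in> E \<longrightarrow> compat (\<omega> u) (\<omega> w))}"

definition Z :: "nat set \<Rightarrow> (nat \<Rightarrow> nat list list) \<Rightarrow> real" where
  "Z U C = real (card (configs U C))"

text \<open>The pins at \<open>v\<close> itself do not enter: a conflict of \<open>x\<close> with
  \<open>C v\<close> is expressed by \<open>forbidden q (C v)\<close> instead. So the weight will be
  positive on all bijections, and transpositions can act freely.\<close>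

definition pinned_Z :: "nat set \<Rightarrow> (nat \<Rightarrow> nat list list) \<Rightarrow> nat \<Rightarrow> nat list \<Rightarrow> real" where
  "pinned_Z U C v x = Z (U - {v}) (pin E v x C)"

lemma Z_cong: "(\<And>u. u \<in> U \<Longrightarrow> C u = C' u) \<Longrightarrow> Z U C = Z U C'"
  unfolding Z_def configs_def by (intro arg_cong[where f = "\<lambda>A. real (card A)"]) auto

lemma finite_configs: "U \<subseteq> V \<Longrightarrow> finite (configs U C)"
proof -
  assume "U \<subseteq> V"
  then have "finite (\<Pi>\<^sub>E u\<in>U. spins q (L u))"
    using finite_V by (intro finite_PiE finite_spins L) (auto intro: finite_subset)
  then show ?thesis unfolding configs_def by simp
qed

lemma length_spin: "x \<in> spins q A \<Longrightarrow> length x = q" by (simp add: spins_def)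

text \<open>A configuration splits into the spin of \<open>v\<close> and the restriction to the
  other vertices, for which the edges at \<open>v\<close> become pins.\<close>

lemma Z_pick:
  assumes "U \<subseteq> V" "v \<in> U"
  shows "Z U C = weight q (L v) (forbidden q (C v)) (pinned_Z U C v)"
proof -
  have vV: "v \<in> V" using assms by auto
  define S where "S = (SIGMA x : allowed_spins q (L v) (forbidden q (C v)). configs (U - {v}) (pin E v x C))"
  have "bij_betw (\<lambda>\<omega>. (\<omega> v, restrict \<omega> (U - {v}))) (configs U C) S"
  proof (rule bij_betw_byWitness[where f' = "\<lambda>(x, \<omega>). fun_upd \<omega> v x"])
    show "\<forall>\<omega>\<in>configs U C. (case (\<omega> v, restrict \<omega> (U - {v})) of (x, \<omega>) \<Rightarrow> fun_upd \<omega> v x) = \<omega>"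
      using assms by (auto simp: configs_def fun_eq_iff PiE_def extensional_def)
    show "\<forall>p\<in>S. ((case p of (x, \<omega>) \<Rightarrow> fun_upd \<omega> v x) v, restrict (case p of (x, \<omega>) \<Rightarrow> fun_upd \<omega> v x) (U - {v})) = p"
      by (auto simp: S_def configs_def fun_eq_iff PiE_def extensional_def)
    show "(\<lambda>\<omega>. (\<omega> v, restrict \<omega> (U - {v}))) ` configs U C \<subseteq> S"
    proof clarify
      fix \<omega> assume w: "\<omega> \<in> configs U C"
      have sp: "\<omega> u \<in> spins q (L u)" if "u \<in> U" for u using w that by (auto simp: configs_def)
      have c: "compat (\<omega> u) c" if "u \<in> U" "c \<in> set (C u)" for u c using w that by (auto simp: configs_def)
      have e: "compat (\<omega> u) (\<omega> w)" if "u \<in> U" "w \<in> U" "{u, w} \<in> E" for u w using w that by (auto simp: configs_def)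
      have "\<omega> v \<in> allowed_spins q (L v) (forbidden q (C v))"
        using sp[OF assms(2)] c[OF assms(2)] length_spin by (auto simp: allowed_spins_def avoids_forbidden)
      moreover have "restrict \<omega> (U - {v}) \<in> configs (U - {v}) (pin E v (\<omega> v) C)"
        using sp c e assms(2) by (auto simp: configs_def pin_def insert_commute)
      ultimately show "(\<omega> v, restrict \<omega> (U - {v})) \<in> S" by (auto simp: S_def)
    qed
    show "(\<lambda>(x, \<omega>). fun_upd \<omega> v x) ` S \<subseteq> configs U C"
    proof clarify
      fix x \<omega> assume "(x, \<omega>) \<in> S"
      then have x: "x \<in> spins q (L v)" "avoids (forbidden q (C v)) x" and w: "\<omega> \<in> configs (U - {v}) (pin E v x C)"
        by (auto simp: S_def allowed_spins_def)
      have xc: "compat x c" if "c \<in> set (C v)" for c 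
        using x that avoids_forbidden[OF length_spin[OF x(1)]] by auto
      have sp: "\<omega> u \<in> spins q (L u)" if "u \<in> U - {v}" for u using w that by (auto simp: configs_def)
      have c: "compat (\<omega> u) c" if "u \<in> U - {v}" "c \<in> set (pin E v x C u)" for u c using w that by (auto simp: configs_def)
      have e: "compat (\<omega> u) (\<omega> w)" if "u \<in> U - {v}" "w \<in> U - {v}" "{u, w} \<in> E" for u w using w that by (auto simp: configs_def)
      have cx: "compat (\<omega> u) x" if "u \<in> U - {v}" "{v, u} \<in> E" for u using c[OF that(1), of x] that by (simp add: pin_def)
      have cx': "compat x (\<omega> u)" if "u \<in> U - {v}" "{v, u} \<in> E" for u 
        using cx[OF that] compat_sym length_spin[OF x(1)] length_spin[OF sp[OF that(1)]] by metis
      have c': "compat (\<omega> u) c" if "u \<in> U - {v}" "c \<in> set (C u)" for u c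
        using c[OF that(1)] that by (auto simp: pin_def split: if_splits)
      have ext: "\<omega> \<in> extensional (U - {v})" using w by (auto simp: configs_def PiE_def)
      have "fun_upd \<omega> v x \<in> (\<Pi>\<^sub>E u\<in>U. spins q (L u))"
        using x(1) sp ext assms(2) by (auto simp: PiE_def extensional_def)
      moreover have "compat ((fun_upd \<omega> v x) u) ((fun_upd \<omega> v x) w)" if "u \<in> U" "w \<in> U" "{u, w} \<in> E" for u w
        using that cx[of u] cx'[of w] e[of u w] no_loop by (auto simp: insert_commute)
      moreover have "compat ((fun_upd \<omega> v x) u) c" if "u \<in> U" "c \<in> set (C u)" for u c
        using that xc c' by auto
      ultimately show "fun_upd \<omega> v x \<in> configs U C" unfolding configs_def by blast
    qed
  qed
  then have "card (configs U C) = card S" by (rule bij_betw_same_card)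
  also have "\<dots> = (\<Sum>x\<in>allowed_spins q (L v) (forbidden q (C v)). card (configs (U - {v}) (pin E v x C)))"
    unfolding S_def using assms L[OF vV] by (intro card_SigmaI finite_allowed_spins ballI finite_configs) auto
  finally show ?thesis by (simp add: Z_def weight_def pinned_Z_def)
qed

text \<open>Deleting a vertex turns it from a neighbor into a pin or into nothing, so pins and
  remaining neighbors together stay within \<open>\<Delta>\<close> (\<open>valid_delete\<close>).
  This bounds the number of forbidden entries in a row or column throughout the recursion.\<close>

definition valid :: "nat set \<Rightarrow> (nat \<Rightarrow> nat list list) \<Rightarrow> bool" where
  "valid U C \<longleftrightarrow> U \<subseteq> V \<and> (\<forall>u\<in>U. length (C u) + card (nbrs U u) \<le> \<Delta> \<and> (\<forall>c\<in>set (C u). length c = q \<and> distinct c))"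

lemma valid_init: "valid V (\<lambda>_. [])"
  using card_nbrs by (simp add: valid_def)

lemma valid_delete:
  assumes "valid U C" "v \<in> U" and sub: "\<And>w. C' w = C w \<or> {v, w} \<in> E \<and> (\<exists>x. length x = q \<and> distinct x \<and> C' w = x # C w)"
  shows "valid (U - {v}) C'"
  unfolding valid_def
proof (intro conjI ballI)
  have UV: "U \<subseteq> V" using assms by (simp add: valid_def)
  then show "U - {v} \<subseteq> V" by auto
  have finU: "finite U" using UV finite_V finite_subset by blast
  fix u assume u: "u \<in> U - {v}"
  have old: "length (C u) + card (nbrs U u) \<le> \<Delta>" "\<forall>c\<in>set (C u). length c = q \<and> distinct c"
    using assms(1) u by (auto simp: valid_def)
  have neighbor_list: "nbrs (U - {v}) u = nbrs U u - {v}" by (auto simp: nbrs_def)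
  have fin: "finite (nbrs U u)" using finU by (simp add: nbrs_def)
  have le: "card (nbrs U u - {v}) \<le> card (nbrs U u)" using fin by (intro card_mono) auto
  show "length (C' u) + card (nbrs (U - {v}) u) \<le> \<Delta>"
  proof (cases "C' u = C u")
    case True
    then show ?thesis using old(1) le unfolding neighbor_list by simp
  next
    case False
    then have e: "{v, u} \<in> E" "length (C' u) = Suc (length (C u))" using sub[of u] by auto
    then have "v \<in> nbrs U u" using assms(2) by (simp add: nbrs_def insert_commute)
    then have "Suc (card (nbrs U u - {v})) = card (nbrs U u)" using fin card.remove by metis
    then show ?thesis using old(1) e(2) unfolding neighbor_list by simp
  qed
  show "length c = q" "distinct c" if "c \<in> set (C' u)" for c using sub[of u] old(2) that by auto
qed

lemma valid_pin: "valid U C \<Longrightarrow> v \<in> U \<Longrightarrow> x \<in> spins q A \<Longrightarrow> valid (U - {v}) (pin E v x C)"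
  by (rule valid_delete) (auto simp: pin_def spins_def)

lemma valid_pin_split:
  "valid U C \<Longrightarrow> v \<in> U \<Longrightarrow> s \<in> spins q A \<Longrightarrow> t \<in> spins q B \<Longrightarrow> valid (U - {v}) (pin_split E v s t u C)"
  by (rule valid_delete) (auto simp: pin_split_def spins_def)

text \<open>The vertex \<open>v\<close> still takes one of the \<open>\<Delta>\<close> places at
  \<open>u\<close>, so there is room for one more pin. The estimates for a swap are therefore
  applied with \<open>k = \<Delta> - 1\<close>.\<close>

lemma valid_nbr_length:
  assumes "valid U C" "v \<in> U" "u \<in> nbrs (U - {v}) v"
  shows "length (C u) \<le> \<Delta> - 1"
proof -
  have "finite U" using assms finite_V by (auto simp: valid_def intro: finite_subset)
  then have "0 < card (nbrs U u)" using assms by (auto simp: nbrs_def card_gt_0_iff insert_commute)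
  moreover have "length (C u) + card (nbrs U u) \<le> \<Delta>" using assms by (auto simp: valid_def nbrs_def)
  ultimately show ?thesis by linarith
qed

lemma q_pos: "0 < q" using q \<Delta> by (auto intro!: Nat.gr0I)

lemma q_ge: "20000 * \<Delta> \<le> q" "8 * (\<Delta> - 1 + 2) + 4 \<le> q" "8 * \<Delta> + 4 \<le> q"
proof -
  have "\<Delta> * 1 \<le> \<Delta> * \<Delta>" using \<Delta> by (intro mult_left_mono) auto
  then have "20000 * \<Delta> \<le> 20000 * (\<Delta> * \<Delta>)" by (intro mult_left_mono) auto
  then show "20000 * \<Delta> \<le> q" using q unfolding power2_eq_square by (rule le_trans)
  then show "8 * (\<Delta> - 1 + 2) + 4 \<le> q" "8 * \<Delta> + 4 \<le> q" using \<Delta> by auto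
qed

text \<open>At most \<open>8 / q\<close>, by \<open>swap_ratio_bound\<close>, from each of at most
  \<open>\<Delta>\<close> neighbors. The multiple \<open>5 * \<eta>\<close> below serves computed
  weights, whose error adds at most \<open>4 * \<eta>\<close>.\<close>

definition \<eta> :: real where "\<eta> = 8 * real \<Delta> / real q"

lemma \<eta>: "0 \<le> \<eta>" "5 * \<eta> \<le> 1 / 2" "exp (5 * \<eta>) \<le> 2" "exp \<eta> \<le> 2"
proof -
  have "real (20000 * \<Delta>) \<le> real q" using q_ge(1) by (simp only: of_nat_le_iff)
  then show 1: "0 \<le> \<eta>" "5 * \<eta> \<le> 1 / 2" using q_pos by (auto simp: \<eta>_def field_simps)
  then have "norm (exp (5 * \<eta>)) \<le> 2" by (intro exp_bound_half) auto
  then show "exp (5 * \<eta>) \<le> 2" by simp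
  moreover have "exp \<eta> \<le> exp (5 * \<eta>)" using 1 by simp
  ultimately show "exp \<eta> \<le> 2" by linarith
qed

text \<open>Replacing the spin \<open>s\<close> of the deleted vertex \<open>v\<close> by \<open>t\<close> one neighbor at a time.\<close>

lemma ln_pinned_Z_diff:
  assumes "valid U C" "v \<in> U"
  shows "ln (pinned_Z U C v s) - ln (pinned_Z U C v t) =
    (\<Sum>u\<in>nbrs (U - {v}) v.
       ln (weight q (L u) (forbidden q (s # C u)) (pinned_Z (U - {v}) (pin_split E v s t u C) u)) -
       ln (weight q (L u) (forbidden q (t # C u)) (pinned_Z (U - {v}) (pin_split E v s t u C) u)))"
proof -
  define W where "W = U - {v}"
  have UV: "U \<subseteq> V" and WV: "W \<subseteq> V" using assms by (auto simp: valid_def W_def)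
  have finW: "finite W" using WV finite_V finite_subset by blast
  \<comment> \<open>Hybrids indexed by all natural numbers: neighbors below \<open>k\<close> are
    pinned to \<open>s\<close>, the others to \<open>t\<close>. Passing from \<open>k = u\<close> to
    \<open>k = Suc u\<close> changes at most the pin at \<open>u\<close>, and the logarithms
    telescope.\<close>
  define D where "D k = (\<lambda>w. if {v, w} \<in> E then (if w < k then s else t) # C w else C w)" for k :: nat
  define f where "f k = ln (Z W (D k))" for k
  obtain K where K: "\<And>u. u \<in> W \<Longrightarrow> u < K" using finW by (metis finite_nat_set_iff_bounded)
  have f0: "f 0 = ln (pinned_Z U C v t)"
    unfolding f_def pinned_Z_def W_def[symmetric] by (intro arg_cong[of _ _ ln] Z_cong) (auto simp: D_def pin_def)
  have fK: "f K = ln (pinned_Z U C v s)"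
    unfolding f_def pinned_Z_def W_def[symmetric] by (intro arg_cong[of _ _ ln] Z_cong) (auto simp: D_def pin_def dest: K)
  define g where "g u = ln (weight q (L u) (forbidden q (s # C u)) (pinned_Z W (pin_split E v s t u C) u)) -
       ln (weight q (L u) (forbidden q (t # C u)) (pinned_Z W (pin_split E v s t u C) u))" for u
  have step: "f (Suc u) - f u = (if u \<in> nbrs W v then g u else 0)" for u
  proof (cases "u \<in> nbrs W v")
    case True
    then have u: "u \<in> W" "{v, u} \<in> E" by (auto simp: nbrs_def)
    \<comment> \<open>Deleting \<open>u\<close> removes the only vertex at which \<open>D u\<close>
      and \<open>D (Suc u)\<close> differ. Both give the weights of the hybrid without a pin at
      \<open>u\<close>, and only the forbidden entries at \<open>u\<close> distinguish them.\<close>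
    have pwe: "pinned_Z W (D k) u x = pinned_Z W (pin_split E v s t u C) u x" if "k = u \<or> k = Suc u" for k x
      unfolding pinned_Z_def using that by (intro Z_cong) (auto simp: D_def pin_def pin_split_def)
    have "Z W (D (Suc u)) = weight q (L u) (forbidden q (s # C u)) (pinned_Z W (pin_split E v s t u C) u)"
      using Z_pick[OF WV u(1), of "D (Suc u)"] pwe[of "Suc u"] u by (simp add: weight_def D_def)
    moreover have "Z W (D u) = weight q (L u) (forbidden q (t # C u)) (pinned_Z W (pin_split E v s t u C) u)"
      using Z_pick[OF WV u(1), of "D u"] pwe[of u] u by (simp add: weight_def D_def)
    ultimately show ?thesis using True by (simp add: f_def g_def)
  next
    case False
    have "Z W (D (Suc u)) = Z W (D u)"
      using False by (intro Z_cong) (auto simp: D_def nbrs_def less_Suc_eq)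
    then show ?thesis using False by (simp add: f_def)
  qed
  have "f K - f 0 = (\<Sum>u<K. f (Suc u) - f u)" by (simp add: sum_lessThan_telescope)
  also have "\<dots> = (\<Sum>u\<in>{..<K} \<inter> {u. u \<in> nbrs W v}. g u)" unfolding step by (simp add: sum.inter_restrict)
  also have "{..<K} \<inter> {u. u \<in> nbrs W v} = nbrs W v" using K by (auto simp: nbrs_def)
  finally show ?thesis unfolding f0 fK g_def W_def .
qed

text \<open>The two claims need each other, hence one induction on the number of vertices:
  smoothness at \<open>v\<close> follows from smoothness at its neighbors after deleting
  \<open>v\<close>, and positivity of \<open>Z U C\<close> from smoothness at some
  \<open>v \<in> U\<close>, since allowed spins exist.\<close>

lemma Z_pos_and_smooth:
  assumes "valid U C"
  shows "0 < Z U C" "v \<in> U \<Longrightarrow> smooth q (L v) \<eta> (pinned_Z U C v)"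
proof -
  have "0 < Z U C \<and> (\<forall>v\<in>U. smooth q (L v) \<eta> (pinned_Z U C v))"
    using assms
  proof (induction "card U" arbitrary: U C rule: less_induct)
    case less
    have UV: "U \<subseteq> V" using less.prems by (simp add: valid_def)
    have fin: "finite U" using UV finite_V finite_subset by blast
    have sm: "smooth q (L v) \<eta> (pinned_Z U C v)" if v: "v \<in> U" for v
    proof -
      have vV: "v \<in> V" using v UV by auto
      have card: "card (U - {v}) < card U" using fin v by (intro psubset_card_mono) auto
      have pos: "0 < pinned_Z U C v x" if x: "x \<in> spins q (L v)" for x
        unfolding pinned_Z_def using less.hyps[OF card valid_pin[OF less.prems v x]] by simp
      have "\<bar>ln (pinned_Z U C v (swap x i j)) - ln (pinned_Z U C v x)\<bar> \<le> \<eta>" 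
        if x: "x \<in> spins q (L v)" and ij: "i < q" "j < q" for x i j
      proof -
        have xs: "length x = q" "distinct x" using x by (auto simp: spins_def)
        define y where "y = swap x i j"
        have y: "y \<in> spins q (L v)" using x ij by (simp add: y_def)
        define g where "g u = ln (weight q (L u) (forbidden q (x # C u)) (pinned_Z (U - {v}) (pin_split E v x y u C) u)) -
          ln (weight q (L u) (forbidden q (y # C u)) (pinned_Z (U - {v}) (pin_split E v x y u C) u))" for u
        have g: "\<bar>g u\<bar> \<le> 8 / real q" if u: "u \<in> nbrs (U - {v}) v" for u
        proof -
          have uU: "u \<in> U - {v}" using u by (simp add: nbrs_def)
          then have uV: "u \<in> V" using UV by auto
          have sm: "smooth q (L u) \<eta> (pinned_Z (U - {v}) (pin_split E v x y u C) u)"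
            using less.hyps[OF card valid_pin_split[OF less.prems v x y]] uU by blast
          have cs: "\<And>c. c \<in> set (C u) \<Longrightarrow> length c = q \<and> distinct c" using less.prems uU by (auto simp: valid_def)
          show ?thesis unfolding g_def y_def
            by (rule swap_ratio_bound[OF L[OF uV] q_ge(2) \<eta>(4,1) cs valid_nbr_length[OF less.prems v u] xs ij])
              (use sm in \<open>auto simp: y_def\<close>)
        qed
        have "\<bar>ln (pinned_Z U C v x) - ln (pinned_Z U C v y)\<bar> = \<bar>\<Sum>u\<in>nbrs (U - {v}) v. g u\<bar>"
          unfolding ln_pinned_Z_diff[OF less.prems v] g_def ..
        also have "\<dots> \<le> (\<Sum>u\<in>nbrs (U - {v}) v. \<bar>g u\<bar>)" by (rule sum_abs)
        also have "\<dots> \<le> (\<Sum>u\<in>nbrs (U - {v}) v. 8 / real q)" using g by (rule sum_mono)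
        also have "\<dots> = real (card (nbrs (U - {v}) v)) * (8 / real q)" by simp
        also have "\<dots> \<le> real \<Delta> * (8 / real q)"
        proof (intro mult_right_mono)
          have "card (nbrs (U - {v}) v) \<le> card (nbrs V v)"
            using UV finite_V by (intro card_mono) (auto simp: nbrs_def)
          then show "real (card (nbrs (U - {v}) v)) \<le> real \<Delta>" using card_nbrs[OF vV] by simp
        qed auto
        finally show ?thesis by (simp add: \<eta>_def y_def mult.commute abs_minus_commute)
      qed
      then show ?thesis using pos by (auto simp: smooth_def lipschitz_def)
    qed
    have "0 < Z U C"
    proof (cases "U = {}")
      case True
      then show ?thesis by (simp add: Z_def configs_def)
    next
      case False
      then obtain v where v: "v \<in> U" by auto
      then have vV: "v \<in> V" using UV by auto
      have len: "length (C v) \<le> \<Delta>" and cs: "\<And>c. c \<in> set (C v) \<Longrightarrow> length c = q \<and> distinct c"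
        using less.prems v by (auto simp: valid_def)
      have "degree_bounded q (L v) \<Delta> (forbidden q (C v))"
        by (rule degree_bounded_mono[OF degree_bounded_forbidden[OF cs] subset_refl L(1)[OF vV] len])
      then show ?thesis unfolding Z_pick[OF UV v]
        by (rule weight_pos[OF L[OF vV] q_ge(3) \<eta>(4,1) _ sm[OF v]])
    qed
    then show ?case using sm by blast
  qed
  then show "0 < Z U C" "v \<in> U \<Longrightarrow> smooth q (L v) \<eta> (pinned_Z U C v)" by auto
qed

end

section \<open>The recursion\<close>

text \<open>One number, computed by a simple loop, decides the three relations in use: 0 means
  compatible, \<open>q\<close> equal, and, for spins with the same list, \<open>q - 2\<close> means
  different by one transposition.\<close>

definition agreements :: "nat list \<Rightarrow> nat list \<Rightarrow> nat" where
  "agreements x y = (\<Sum>i<length x. of_bool (x ! i = y ! i))"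

lemma agreements_card: "agreements x y = card {i. i < length x \<and> x ! i = y ! i}"
proof -
  have "{..<length x} \<inter> {i. x ! i = y ! i} = {i. i < length x \<and> x ! i = y ! i}" by auto
  then show ?thesis by (simp add: agreements_def sum_of_bool_eq)
qed

lemma agreements_0: "agreements x y = 0 \<longleftrightarrow> compat x y"
  by (auto simp: agreements_def compat_def)

lemma agreements_compl: "agreements x y + card {i. i < length x \<and> x ! i \<noteq> y ! i} = length x"
proof -
  have "card ({i. i < length x \<and> x ! i = y ! i} \<union> {i. i < length x \<and> x ! i \<noteq> y ! i}) = agreements x y + card {i. i < length x \<and> x ! i \<noteq> y ! i}"
    unfolding agreements_card by (rule card_Un_disjoint) auto
  moreover have "{i. i < length x \<and> x ! i = y ! i} \<union> {i. i < length x \<and> x ! i \<noteq> y ! i} = {..<length x}" by auto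
  ultimately show ?thesis by simp
qed

lemma agreements_full: "length x = q \<Longrightarrow> length y = q \<Longrightarrow> agreements x y = q \<longleftrightarrow> x = y"
proof -
  assume l: "length x = q" "length y = q"
  have "agreements x y = q \<longleftrightarrow> card {i. i < length x \<and> x ! i \<noteq> y ! i} = 0" using agreements_compl[of x y] l by linarith
  also have "\<dots> \<longleftrightarrow> x = y" using l by (auto simp: list_eq_iff_nth_eq)
  finally show ?thesis .
qed

lemma agreements_swap:
  assumes "x \<in> spins q L" "i < q" "j < q" "i \<noteq> j"
  shows "agreements x (swap x i j) + 2 = q"
proof -
  have l: "length x = q" "distinct x" using assms by (auto simp: spins_def)
  have "{k. k < length x \<and> x ! k \<noteq> swap x i j ! k} = {i, j}"
    using assms l by (auto simp: nth_swap nth_eq_iff_index_eq split: if_splits)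
  then show ?thesis using agreements_compl[of x "swap x i j"] l assms(4) by simp
qed

text \<open>Two bijections onto the same set that differ at exactly two positions must exchange the
  colors there.\<close>

lemma agreements_adjacent:
  assumes "x \<in> spins q L" "y \<in> spins q L" "agreements x y + 2 = q"
  shows "\<exists>i<q. \<exists>j<q. y = swap x i j"
proof -
  have l: "length x = q" "length y = q" "distinct x" "distinct y" "set x = L" "set y = L" using assms by (auto simp: spins_def)
  define A where "A = {k. k < q \<and> x ! k \<noteq> y ! k}"
  have "card A = 2" using agreements_compl[of x y] l assms(3) by (simp add: A_def)
  then obtain i j where ij: "A = {i, j}" "i \<noteq> j" by (auto simp: card_2_iff)
  have other: "y ! k = x ! k'" if k: "A = {k, k'}" for k k'
  proof -
    have kq: "k < q" "k' < q" using k by (auto simp: A_def)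
    then have "y ! k \<in> set x" using l by (metis nth_mem)
    then obtain m where m: "m < q" "x ! m = y ! k" using l by (auto simp: in_set_conv_nth)
    have "m \<noteq> k" using m k by (auto simp: A_def)
    then have "x ! m \<noteq> y ! m" using m kq l by (simp add: nth_eq_iff_index_eq)
    then have "m \<in> A" using m by (simp add: A_def)
    then show ?thesis using k m \<open>m \<noteq> k\<close> by auto
  qed
  have "y = swap x i j"
  proof (rule nth_equalityI)
    fix k assume "k < length y"
    then have k: "k < q" using l by simp
    have iq: "i < q" "j < q" using ij by (auto simp: A_def)
    have "k \<notin> A \<Longrightarrow> x ! k = y ! k" using k by (auto simp: A_def)
    then show "y ! k = swap x i j ! k" using k iq l ij other[of i j] other[of j i] by (auto simp: nth_swap insert_commute)
  qed (use l in simp)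
  moreover have "i < q" "j < q" using ij by (auto simp: A_def)
  ultimately show ?thesis by blast
qed

section \<open>Logarithms rounded to an integer grid\<close>

definition grid_weight :: "nat \<Rightarrow> nat \<Rightarrow> nat \<Rightarrow> nat" where
  "grid_weight M H k = (M + 1) ^ min k H * M ^ (H - k)"

text \<open>\<open>X / Y \<le> (1 + 1 / M) ^ j\<close> is tested without division as
  \<open>X * M ^ j \<le> Y * (M + 1) ^ j\<close>. Once the test succeeds the state stays fixed, so
  the number \<open>T\<close> of rounds only has to be large enough.\<close>

definition grid_log_step :: "nat \<Rightarrow> nat \<times> nat \<times> nat \<Rightarrow> nat \<times> nat \<times> nat" where
  "grid_log_step M = (\<lambda>(X, Y, j). if Y < X then (X * M, Y * (M + 1), j + 1) else (X, Y, j))"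

definition grid_log :: "nat \<Rightarrow> nat \<Rightarrow> nat \<Rightarrow> nat \<Rightarrow> nat" where
  "grid_log M T X Y = snd (snd ((grid_log_step M ^^ T) (X, Y, 0)))"

text \<open>The grid of the logarithm: \<open>grid_log M T X Y\<close> is the ceiling of \<open>ln (X / Y) / ln (1 + 1 / M)\<close>, or 0 if that is negative.\<close>

definition grid :: "nat \<Rightarrow> real" where "grid M = ln (1 + 1 / real M)"

lemma grid_bounds:
  assumes "0 < M"
  shows "1 / (2 * real M) \<le> grid M" "grid M \<le> 1 / real M" "0 < grid M"
proof -
  have "1 - 1 / (1 + 1 / real M) \<le> grid M"
  proof -
    have p: "0 < 1 + 1 / real M" by (simp add: add_pos_nonneg)
    have "ln (1 / (1 + 1 / real M)) = - grid M" using ln_div[of 1 "1 + 1 / real M"] p by (simp add: grid_def)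
    then show ?thesis using ln_le_minus_one[of "1 / (1 + 1 / real M)"] p by simp
  qed
  moreover have "1 / (2 * real M) \<le> 1 - 1 / (1 + 1 / real M)" using assms by (simp add: field_simps)
  ultimately show "1 / (2 * real M) \<le> grid M" by linarith
  then show "0 < grid M" using assms by (simp add: less_le_trans[of 0 "1 / (2 * real M)"])
  show "grid M \<le> 1 / real M" unfolding grid_def by (rule ln_add_one_self_le_self) auto
qed

lemma ln_Suc_M: "0 < M \<Longrightarrow> ln (real M + 1) = ln (real M) + grid M"
proof -
  assume M: "0 < M"
  have "real M + 1 = real M * (1 + 1 / real M)" using M by (simp add: field_simps)
  then have "ln (real M + 1) = ln (real M * (1 + 1 / real M))" by (simp only:)
  also have "\<dots> = ln (real M) + grid M" unfolding grid_def using M by (intro ln_mult_pos) (auto simp: add_pos_nonneg)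
  finally show ?thesis .
qed

lemma ln_mult_power: "0 < a \<Longrightarrow> 0 < b \<Longrightarrow> ln (a * b ^ n :: real) = ln a + real n * ln b"
  by (simp add: ln_mult_pos ln_realpow)

text \<open>\<open>grid_weight M H k\<close> is \<open>(1 + 1 / M) ^ k\<close> scaled by
  \<open>M ^ H\<close> to an integer. The scaling is common to all \<open>k \<le> H\<close> and
  cancels in ratios.\<close>

lemma ln_grid_weight: 
  assumes "0 < M" "k \<le> H"
  shows "ln (real (grid_weight M H k)) = real H * ln (real M) + real k * grid M"
proof -
  have "ln (real (grid_weight M H k)) = ln ((real M + 1) ^ k * real M ^ (H - k))" using assms by (simp add: grid_weight_def add.commute min_def)
  also have "\<dots> = ln ((real M + 1) ^ k) + real (H - k) * ln (real M)" using assms by (intro ln_mult_power) auto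
  also have "ln ((real M + 1) ^ k) = real k * (ln (real M) + grid M)" 
    using assms by (simp add: ln_realpow ln_Suc_M)
  also have "real (H - k) = real H - real k" using assms by (simp add: of_nat_diff)
  finally show ?thesis by (simp add: algebra_simps)
qed

lemma grid_weight_pos: "0 < M \<Longrightarrow> 0 < grid_weight M H k"
  by (simp add: grid_weight_def)

text \<open>The last two clauses make \<open>j\<close> the least successful exponent: the previous
  test failed, and the present one succeeds unless the rounds are used up.\<close>

lemma grid_log_invariant:
  assumes "0 < M" "0 < X" "0 < Y"
  shows "\<exists>j\<le>n. (grid_log_step M ^^ n) (X, Y, 0) = (X * M ^ j, Y * (M + 1) ^ j, j) \<and>
     (j = 0 \<or> Y * (M + 1) ^ (j - 1) < X * M ^ (j - 1)) \<and> (j = n \<or> X * M ^ j \<le> Y * (M + 1) ^ j)"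
proof (induction n)
  case (Suc n)
  then obtain j where j: "j \<le> n" "(grid_log_step M ^^ n) (X, Y, 0) = (X * M ^ j, Y * (M + 1) ^ j, j)"
    "j = 0 \<or> Y * (M + 1) ^ (j - 1) < X * M ^ (j - 1)" "j = n \<or> X * M ^ j \<le> Y * (M + 1) ^ j" by blast
  show ?case
  proof (cases "X * M ^ j \<le> Y * (M + 1) ^ j")
    case True
    then show ?thesis using j by (intro exI[of _ j]) (auto simp: grid_log_step_def)
  next
    case False
    then show ?thesis using j by (intro exI[of _ "Suc j"]) (auto simp: grid_log_step_def mult_ac)
  qed
qed auto

lemma grid_log_bounds:
  assumes "0 < M" "0 < X" "0 < Y" and T: "ln (real X) - ln (real Y) \<le> real T * grid M"
  defines "r \<equiv> (ln (real X) - ln (real Y)) / grid M"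
  shows "max 0 r \<le> real (grid_log M T X Y)" "real (grid_log M T X Y) \<le> max 0 (r + 1)"
proof -
  have lnX: "ln (real (X * M ^ j)) = ln (real X) + real j * ln (real M)" for j
    using ln_mult_power[of "real X" "real M" j] assms by simp
  have lnY: "ln (real (Y * (M + 1) ^ j)) = ln (real Y) + real j * (ln (real M) + grid M)" for j
    using ln_mult_power[of "real Y" "real M + 1" j] assms ln_Suc_M[OF assms(1)] by (simp add: add.commute)
  have g: "0 < grid M" using grid_bounds(3)[OF assms(1)] .
  have le: "X * M ^ j \<le> Y * (M + 1) ^ j \<longleftrightarrow> r \<le> real j" for j
  proof -
    have p: "0 < real (X * M ^ j)" "0 < real (Y * (M + 1) ^ j)" using assms by auto
    have "X * M ^ j \<le> Y * (M + 1) ^ j \<longleftrightarrow> real (X * M ^ j) \<le> real (Y * (M + 1) ^ j)" by (rule of_nat_le_iff[symmetric])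
    also have "\<dots> \<longleftrightarrow> ln (real (X * M ^ j)) \<le> ln (real (Y * (M + 1) ^ j))" using p by simp
    also have "\<dots> \<longleftrightarrow> r \<le> real j" 
      unfolding lnX lnY r_def using g by (simp add: divide_le_eq distrib_left) linarith
    finally show ?thesis .
  qed
  obtain j where j: "j \<le> T" "(grid_log_step M ^^ T) (X, Y, 0) = (X * M ^ j, Y * (M + 1) ^ j, j)"
    "j = 0 \<or> Y * (M + 1) ^ (j - 1) < X * M ^ (j - 1)" "j = T \<or> X * M ^ j \<le> Y * (M + 1) ^ j"
    using grid_log_invariant[OF assms(1-3), of T] by blast
  have u: "grid_log M T X Y = j" using j by (simp add: grid_log_def)
  have "r \<le> real T" using T g by (simp add: r_def field_simps)
  then have "r \<le> real j" using j(4) le by auto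
  then show "max 0 r \<le> real (grid_log M T X Y)" by (simp add: u)
  have "j = 0 \<or> \<not> r \<le> real (j - 1)" using j(3) le[of "j - 1"] by auto
  then show "real (grid_log M T X Y) \<le> max 0 (r + 1)" unfolding u by (cases j) auto
qed

text \<open>Natural numbers cannot hold a negative logarithm, so a signed one is kept as the
  difference of the grid logarithms of \<open>X / Y\<close> and \<open>Y / X\<close>, of which at
  most one is positive.\<close>

lemma grid_log_diff:
  assumes "0 < M" "0 < X" "0 < Y" and T: "\<bar>ln (real X) - ln (real Y)\<bar> \<le> real T * grid M"
  shows "\<bar>(real (grid_log M T X Y) - real (grid_log M T Y X)) - (ln (real X) - ln (real Y)) / grid M\<bar> \<le> 1"
proof -
  define r where "r = (ln (real X) - ln (real Y)) / grid M"
  have r': "(ln (real Y) - ln (real X)) / grid M = - r" by (simp add: r_def diff_divide_distrib)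
  note u = grid_log_bounds[OF assms(1-3), of T] grid_log_bounds[OF assms(1,3,2), of T]
  show ?thesis using u T unfolding r' r_def[symmetric] by linarith
qed

section \<open>The recursive estimator and its data\<close>

type_synonym spin_values = "(nat list \<times> nat) list"

definition wsum :: "nat \<Rightarrow> nat \<Rightarrow> nat list \<Rightarrow> spin_values \<Rightarrow> nat" where
  "wsum M H s ys = (\<Sum>(x, k)\<leftarrow>ys. if agreements x s = 0 then grid_weight M H k else 0)"

text \<open>A key \<open>(s, t, u)\<close> names one term of the sum in
  \<open>ln_pinned_Z_diff\<close>: spins \<open>s\<close> and \<open>t\<close> of the deleted vertex
  that differ by a transposition, and a neighbor \<open>u\<close>. An item stores with
  \<open>s\<close> and \<open>t\<close> the two grid logarithms whose difference estimates this
  term.\<close>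

type_synonym key = "nat list \<times> nat list \<times> nat"
type_synonym item = "nat list \<times> nat list \<times> nat \<times> nat"

definition item :: "nat \<Rightarrow> nat \<Rightarrow> nat \<Rightarrow> key \<Rightarrow> spin_values \<Rightarrow> item" where
  "item M H T = (\<lambda>(s, t, u) ys. (s, t, grid_log M T (wsum M H s ys) (wsum M H t ys), grid_log M T (wsum M H t ys) (wsum M H s ys)))"

text \<open>The remaining vertices, the pins, the vertex whose log-weights are wanted, and the slack
  in grid units.\<close>

type_synonym node = "nat list \<times> (nat \<Rightarrow> nat list list) \<times> nat \<times> nat"

definition keys :: "nat \<Rightarrow> nat set set \<Rightarrow> (nat \<Rightarrow> nat list list) \<Rightarrow> node \<Rightarrow> key list" where
  "keys q E B = (\<lambda>(vs, C, v, D). concat (map (\<lambda>s. concat (map (\<lambda>t.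
     if agreements s t + 2 = q then map (\<lambda>u. (s, t, u)) (filter (\<lambda>u. u \<noteq> v \<and> {v, u} \<in> E) vs) else []) (B v))) (B v)))"

definition child :: "nat set set \<Rightarrow> node \<Rightarrow> key \<Rightarrow> node" where
  "child E = (\<lambda>(vs, C, v, D) (s, t, u). (filter (\<lambda>u. u \<noteq> v) vs, pin_split E v s t u C, u, D + D))"

definition item_sum :: "nat \<Rightarrow> (item \<Rightarrow> nat) \<Rightarrow> item list \<Rightarrow> nat list \<Rightarrow> nat list \<Rightarrow> nat" where
  "item_sum q f its s t = (\<Sum>i\<leftarrow>its. if agreements s (fst i) = q \<and> agreements t (fst (snd i)) = q then f i else 0)"

text \<open>Items carry upper and lower parts of estimates of \<open>ln (p(s) / p(t))\<close>.  Relaxation raises the value of \<open>s\<close>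
  until it is at least that of \<open>t\<close> plus the estimate minus the slack \<open>D\<close>.\<close>

definition bump :: "nat \<Rightarrow> nat \<Rightarrow> item list \<Rightarrow> spin_values \<Rightarrow> nat list \<Rightarrow> nat \<Rightarrow> nat" where
  "bump q D its hs s k0 = fold (\<lambda>p m. if agreements s (fst p) + 2 = q then
      max m (snd p + item_sum q (\<lambda>i. fst (snd (snd i))) its s (fst p)
             - (item_sum q (\<lambda>i. snd (snd (snd i))) its s (fst p) + D)) else m) hs k0"

definition relax :: "nat \<Rightarrow> nat \<Rightarrow> item list \<Rightarrow> spin_values \<Rightarrow> spin_values" where
  "relax q D its hs = map (\<lambda>p. (fst p, bump q D its hs (fst p) (snd p))) hs"

text \<open>Spins in conflict with \<open>C v\<close> are dropped only after the relaxation: a path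
  of transpositions between two allowed spins may lead through spins that are not allowed.\<close>

definition finish :: "nat \<Rightarrow> nat \<Rightarrow> (nat \<Rightarrow> nat list list) \<Rightarrow> item list \<Rightarrow> node \<Rightarrow> spin_values" where
  "finish q R B its = (\<lambda>(vs, C, v, D).
     filter (\<lambda>p. \<forall>c\<in>set (C v). agreements (fst p) c = 0) ((relax q D its ^^ R) (map (\<lambda>x. (x, 0)) (B v))))"

text \<open>The slack \<open>D\<close> doubles from a node to its children.  At depth 0 it is so large that constant
  values, obtained from the empty list of items, are good enough.\<close>

primrec marginal :: "nat \<Rightarrow> nat \<Rightarrow> nat \<Rightarrow> nat \<Rightarrow> nat \<Rightarrow> nat set set \<Rightarrow> (nat \<Rightarrow> nat list list) \<Rightarrow> nat \<Rightarrow> node \<Rightarrow> spin_values" where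
  "marginal q M H T R E B 0 n = finish q R B [] n"
| "marginal q M H T R E B (Suc d) n =
     finish q R B (map (\<lambda>k. item M H T k (marginal q M H T R E B d (child E n k))) (keys q E B n)) n"

section \<open>Relaxation and its fixed points\<close>

lemma fold_max_ge:
  fixes c :: "'a \<Rightarrow> bool" and f :: "'a \<Rightarrow> nat"
  shows "k \<le> fold (\<lambda>p m. if c p then max m (f p) else m) ps k"
proof (induction ps arbitrary: k)
  case (Cons a ps)
  have "k \<le> (if c a then max k (f a) else k)" by simp
  also have "\<dots> \<le> fold (\<lambda>p m. if c p then max m (f p) else m) ps (if c a then max k (f a) else k)" by (rule Cons)
  finally show ?case by simp
qed simp

lemma fold_max:
  fixes c :: "'a \<Rightarrow> bool" and f :: "'a \<Rightarrow> nat"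
  shows "p \<in> set ps \<Longrightarrow> c p \<Longrightarrow> f p \<le> fold (\<lambda>p m. if c p then max m (f p) else m) ps k"
    "k \<le> G \<Longrightarrow> (\<And>p. p \<in> set ps \<Longrightarrow> c p \<Longrightarrow> f p \<le> G) \<Longrightarrow> fold (\<lambda>p m. if c p then max m (f p) else m) ps k \<le> G"
proof -
  show "p \<in> set ps \<Longrightarrow> c p \<Longrightarrow> f p \<le> fold (\<lambda>p m. if c p then max m (f p) else m) ps k"
  proof (induction ps arbitrary: k)
    case (Cons a ps)
    show ?case
    proof (cases "p = a")
      case True
      have "f p \<le> (if c a then max k (f a) else k)" using True Cons.prems by simp
      also have "\<dots> \<le> fold (\<lambda>p m. if c p then max m (f p) else m) ps (if c a then max k (f a) else k)"
        by (rule fold_max_ge)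
      finally show ?thesis by simp
    next
      case False
      then show ?thesis using Cons by simp
    qed
  qed simp
  show "k \<le> G \<Longrightarrow> (\<And>p. p \<in> set ps \<Longrightarrow> c p \<Longrightarrow> f p \<le> G) \<Longrightarrow> fold (\<lambda>p m. if c p then max m (f p) else m) ps k \<le> G"
    by (induction ps arbitrary: k) auto
qed

text \<open>As long as some value changes, the sum over \<open>A\<close> grows by at least 1, and it
  never exceeds \<open>card A * H\<close>.\<close>

lemma stationary:
  fixes h :: "nat \<Rightarrow> 'a \<Rightarrow> nat"
  assumes fin: "finite A" and mono: "\<And>i x. x \<in> A \<Longrightarrow> h i x \<le> h (Suc i) x"
    and bnd: "\<And>i x. x \<in> A \<Longrightarrow> h i x \<le> H" and n: "card A * H < n"
  obtains i where "i < n" "\<And>x. x \<in> A \<Longrightarrow> h (Suc i) x = h i x"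
proof -
  have "\<exists>i<n. \<forall>x\<in>A. h (Suc i) x = h i x"
  proof (rule ccontr)
    assume *: "\<not> ?thesis"
    have "k \<le> (\<Sum>x\<in>A. h k x)" if "k \<le> n" for k
      using that
    proof (induction k)
      case (Suc k)
      then obtain x where x: "x \<in> A" "h (Suc k) x \<noteq> h k x" using * by (meson Suc_le_lessD)
      have "(\<Sum>x\<in>A. h k x) < (\<Sum>x\<in>A. h (Suc k) x)"
      proof (rule sum_strict_mono_ex1[OF fin])
        show "\<forall>x\<in>A. h k x \<le> h (Suc k) x" using mono by blast
        show "\<exists>a\<in>A. h k a < h (Suc k) a" using x mono[of x k] by (intro bexI[of _ x]) auto
      qed
      then show ?case using Suc by linarith
    qed simp
    from this[of n] have "n \<le> (\<Sum>x\<in>A. h n x)" by simp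
    also have "\<dots> \<le> (\<Sum>x\<in>A. H)" using bnd by (intro sum_mono)
    also have "\<dots> = card A * H" by simp
    finally show False using n by simp
  qed
  then show ?thesis using that by blast
qed


lemma sum_list_single:
  assumes "distinct xs" "s \<in> set xs" "\<And>x. x \<in> set xs \<Longrightarrow> x \<noteq> s \<Longrightarrow> f x = 0"
  shows "sum_list (map f xs) = (f s :: nat)"
proof -
  have "sum_list (map f xs) = (\<Sum>x\<in>set xs. f x)" using assms(1) by (simp add: sum_list_distinct_conv_sum_set)
  also have "\<dots> = (\<Sum>x\<in>{s}. f x)" using assms by (intro sum.mono_neutral_right) auto
  finally show ?thesis by simp
qed

lemma sum_list_concat_map: "sum_list (map f (concat (map g xs))) = (\<Sum>x\<leftarrow>xs. sum_list (map f (g x)))"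
  by (induction xs) auto

text \<open>Since \<open>B v\<close> has no repetitions, exactly one pair of spins passes the two
  equality tests, and the keys of this pair run over the neighbors of \<open>v\<close>.\<close>

lemma item_sum_items:
  fixes f :: "key \<Rightarrow> spin_values"
  assumes B: "distinct (B v)" "\<And>x. x \<in> set (B v) \<Longrightarrow> length x = q" and vs: "distinct vs"
    and st: "s \<in> set (B v)" "t \<in> set (B v)" "agreements s t + 2 = q"
  shows "item_sum q g (map (\<lambda>k. item M H T k (f k)) (keys q E B (vs, C, v, D))) s t =
    (\<Sum>u\<in>{u \<in> set vs. u \<noteq> v \<and> {v, u} \<in> E}. g (item M H T (s, t, u) (f (s, t, u))))"
proof -
  define G where "G k = (if agreements s (fst k) = q \<and> agreements t (fst (snd k)) = q then g (item M H T k (f k)) else 0)" for k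
  define N where "N = filter (\<lambda>u. u \<noteq> v \<and> {v, u} \<in> E) vs"
  have "item_sum q g (map (\<lambda>k. item M H T k (f k)) (keys q E B (vs, C, v, D))) s t = sum_list (map G (keys q E B (vs, C, v, D)))"
    unfolding item_sum_def G_def map_map comp_def by (intro arg_cong[of _ _ sum_list] map_cong) (auto simp: item_def)
  also have "\<dots> = (\<Sum>a\<leftarrow>B v. \<Sum>b\<leftarrow>B v. sum_list (map G (if agreements a b + 2 = q then map (\<lambda>u. (a, b, u)) N else [])))"
    unfolding keys_def N_def by (simp add: sum_list_concat_map)
  also have "\<dots> = (\<Sum>b\<leftarrow>B v. sum_list (map G (if agreements s b + 2 = q then map (\<lambda>u. (s, b, u)) N else [])))"
  proof (rule sum_list_single[OF B(1) st(1)])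
    fix a assume "a \<in> set (B v)" "a \<noteq> s"
    then have "agreements s a \<noteq> q" using agreements_full[of s q a] B st by auto
    then have "sum_list (map G (if agreements a b + 2 = q then map (\<lambda>u. (a, b, u)) N else [])) = 0" for b
      by (auto simp: G_def)
    then show "(\<Sum>b\<leftarrow>B v. sum_list (map G (if agreements a b + 2 = q then map (\<lambda>u. (a, b, u)) N else []))) = 0" by simp
  qed
  also have "\<dots> = sum_list (map G (if agreements s t + 2 = q then map (\<lambda>u. (s, t, u)) N else []))"
  proof (rule sum_list_single[OF B(1) st(2)])
    fix b assume "b \<in> set (B v)" "b \<noteq> t"
    then have "agreements t b \<noteq> q" using agreements_full[of t q b] B st by auto
    then show "sum_list (map G (if agreements s b + 2 = q then map (\<lambda>u. (s, b, u)) N else [])) = 0"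
      by (auto simp: G_def)
  qed
  also have "\<dots> = (\<Sum>u\<leftarrow>N. G (s, t, u))" using st by (simp add: comp_def)
  also have "\<dots> = (\<Sum>u\<in>set N. G (s, t, u))" using vs by (simp add: sum_list_distinct_conv_sum_set N_def)
  also have "\<dots> = (\<Sum>u\<in>set N. g (item M H T (s, t, u) (f (s, t, u))))"
    using agreements_full[of s q s] agreements_full[of t q t] B st by (simp add: G_def)
  finally show ?thesis by (simp add: N_def conj_ac)
qed

lemma finish_funpow:
  "(relax q D its ^^ n) (map (\<lambda>x. (x, h x)) xs) =
     map (\<lambda>x. (x, ((\<lambda>h s. bump q D its (map (\<lambda>x. (x, h x)) xs) s (h s)) ^^ n) h x)) xs"
proof (induction n)
  case (Suc n)
  then show ?case by (simp add: relax_def comp_def)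
qed simp

text \<open>\<open>M\<close> makes \<open>16 * \<Delta> * 2 ^ depth * grid M\<close> comparable with
  \<open>\<eta>\<close>. \<open>H\<close> bounds the range of the log-weights in grid units: this
  range is at most \<open>q * \<eta> = 8 * \<Delta>\<close>, and a unit is at least
  \<open>1 / (2 * M)\<close>. \<open>T\<close> adds the effect of summing over at most
  \<open>q ^ q\<close> spins, using \<open>q * ln q \<le> q ^ 2\<close>. \<open>R\<close> exceeds
  the number of spins times \<open>H\<close>, as \<open>stationary\<close> requires.\<close>

locale packing_algorithm = packing_graph +
  fixes M H T R depth :: nat and B :: "nat \<Rightarrow> nat list list"
  assumes B: "\<And>v. v \<in> V \<Longrightarrow> distinct (B v)" "\<And>v. v \<in> V \<Longrightarrow> set (B v) = spins q (L v)"
    and M: "M = q * 2 ^ depth" and H: "H = 16 * \<Delta> * M" and T: "T = H + 2 * M * q ^ 2" and R: "R = q ^ q * H + 1"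
begin

lemma M_pos: "0 < M" using M q_pos by simp

lemma card_spins: "v \<in> V \<Longrightarrow> card (spins q (L v)) \<le> q ^ q"
proof -
  assume v: "v \<in> V"
  have "card (spins q (L v)) \<le> card {xs. set xs \<subseteq> L v \<and> length xs = q}"
    using L[OF v] by (intro card_mono finite_lists_length_eq) (auto simp: spins_def)
  then show ?thesis using L[OF v] by (simp add: card_lists_length_eq)
qed

text \<open>The sum lies between \<open>M ^ H\<close> and \<open>q ^ q * (M + 1) ^ H\<close>, so the
  logarithms of two such sums differ by at most \<open>T\<close> grid units. This is what
  \<open>grid_log_diff\<close> asks of \<open>T\<close>.\<close>

lemma weight_grid_weight:
  assumes v: "v \<in> V" and h: "\<And>x. x \<in> spins q (L v) \<Longrightarrow> h x \<le> H" and ne: "allowed_spins q (L v) F \<noteq> {}"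
  defines "W \<equiv> weight q (L v) F (\<lambda>x. real (grid_weight M H (h x)))"
  shows "0 < W" "real H * ln (real M) \<le> ln W" "ln W \<le> real H * ln (real M) + real T * grid M"
proof -
  have fin: "finite (allowed_spins q (L v) F)" using L[OF v] finite_allowed_spins by simp
  have wp: "0 < real (grid_weight M H k)" for k using grid_weight_pos[OF M_pos] by simp
  show p: "0 < W" unfolding W_def weight_def using fin ne wp by (intro sum_pos) auto
  obtain x where x: "x \<in> allowed_spins q (L v) F" using ne by auto
  have hx: "h x \<le> H" using x h by (simp add: allowed_spins_def)
  have "real (grid_weight M H (h x)) \<le> W" unfolding W_def weight_def using fin x by (intro member_le_sum) auto
  then have "ln (real (grid_weight M H (h x))) \<le> ln W" using wp p by simp
  then show "real H * ln (real M) \<le> ln W"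
    unfolding ln_grid_weight[OF M_pos hx] using mult_nonneg_nonneg[of "real (h x)" "grid M"] grid_bounds(3)[OF M_pos] by linarith
  have "real (grid_weight M H (h x)) \<le> real (grid_weight M H H)" if "x \<in> allowed_spins q (L v) F" for x
  proof -
    have "h x \<le> H" using that h by (simp add: allowed_spins_def)
    then have "ln (real (grid_weight M H (h x))) \<le> ln (real (grid_weight M H H))" 
      unfolding ln_grid_weight[OF M_pos \<open>h x \<le> H\<close>] ln_grid_weight[OF M_pos order_refl] using grid_bounds(3)[OF M_pos] by simp
    then show ?thesis using wp by simp
  qed
  then have "W \<le> real (card (allowed_spins q (L v) F)) * real (grid_weight M H H)"
    unfolding W_def weight_def by (rule sum_bounded_above)
  also have "\<dots> \<le> real q ^ q * real (grid_weight M H H)"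
  proof (intro mult_right_mono)
    have "card (allowed_spins q (L v) F) \<le> card (spins q (L v))"
      using L[OF v] finite_spins by (intro card_mono) (auto simp: allowed_spins_def)
    then have "card (allowed_spins q (L v) F) \<le> q ^ q" using card_spins[OF v] by simp
    then have "real (card (allowed_spins q (L v) F)) \<le> real (q ^ q)" by (simp only: of_nat_le_iff)
    then show "real (card (allowed_spins q (L v) F)) \<le> real q ^ q" by simp
  qed auto
  finally have "ln W \<le> ln (real (grid_weight M H H) * real q ^ q)" using p wp q_pos by (simp add: mult.commute)
  also have "\<dots> = real H * ln (real M) + real H * grid M + real q * ln (real q)"
    using ln_mult_power[OF wp[of H], of "real q" q] q_pos by (simp add: ln_grid_weight[OF M_pos])
  also have "real q * ln (real q) \<le> real q * real q" using ln_le_minus_one[of "real q"] q_pos by (intro mult_left_mono) auto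
  also have "real q * real q \<le> (2 * real M * real q ^ 2) * grid M"
  proof -
    have "real q ^ 2 * 1 \<le> real q ^ 2 * (2 * real M * grid M)"
      using grid_bounds(1)[OF M_pos] M_pos by (intro mult_left_mono) (auto simp: field_simps)
    then show ?thesis by (simp add: power2_eq_square mult_ac)
  qed
  finally show "ln W \<le> real H * ln (real M) + real T * grid M" by (simp add: T algebra_simps)
qed

lemma wsum_eq:
  assumes u: "u \<in> V"
  shows "real (wsum M H s (map (\<lambda>x. (x, h x)) (filter (\<lambda>x. \<forall>c\<in>set cs. agreements x c = 0) (B u)))) =
    weight q (L u) (forbidden q (s # cs)) (\<lambda>x. real (grid_weight M H (h x)))"
proof -
  have "wsum M H s (map (\<lambda>x. (x, h x)) (filter (\<lambda>x. \<forall>c\<in>set cs. agreements x c = 0) (B u))) =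
    (\<Sum>x\<in>{x \<in> spins q (L u). \<forall>c\<in>set cs. agreements x c = 0}. if agreements x s = 0 then grid_weight M H (h x) else 0)"
    using B[OF u] by (simp add: wsum_def comp_def sum_list_distinct_conv_sum_set)
  also have "\<dots> = (\<Sum>x\<in>allowed_spins q (L u) (forbidden q (s # cs)). grid_weight M H (h x))"
  proof -
    have "allowed_spins q (L u) (forbidden q (s # cs)) = {x \<in> spins q (L u). \<forall>c\<in>set cs. agreements x c = 0} \<inter> {x. agreements x s = 0}"
      by (auto simp: allowed_spins_def avoids_forbidden[OF length_spin] agreements_0)
    then show ?thesis using finite_spins[OF L(1)[OF u]] by (simp add: sum.inter_restrict)
  qed
  finally show ?thesis by (simp add: weight_def)
qed

text \<open>The factor 2 collects two errors of size \<open>D\<close>, that of the estimates and the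
  slack granted in the constraints. Heights matter only up to a common constant, so only their
  changes under transpositions are compared with the truth.\<close>

definition correct :: "nat \<Rightarrow> nat set \<Rightarrow> (nat \<Rightarrow> nat list list) \<Rightarrow> nat \<Rightarrow> (nat list \<Rightarrow> nat) \<Rightarrow> bool" where
  "correct D U C v h \<longleftrightarrow> (\<forall>x\<in>spins q (L v). h x \<le> H) \<and>
     lipschitz q (L v) (2 * real D * grid M) (\<lambda>x. real (h x) * grid M - ln (pinned_Z U C v x))"

text \<open>The true heights \<open>G\<close>, shifted to minimum 0, satisfy every constraint
  because the slack \<open>D\<close> covers the error of the estimates. Relaxation from 0 therefore
  increases without ever passing \<open>G\<close>, which is at most \<open>H\<close>, and becomes
  stationary before round \<open>R\<close>. A fixed point satisfies all constraints, and those for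
  \<open>s, t\<close> and for \<open>t, s\<close> together give the Lipschitz bound.\<close>

lemma finish_correct:
  assumes vl: "valid (set vs) C" and v: "v \<in> set vs"
    and its: "\<And>s t. s \<in> spins q (L v) \<Longrightarrow> t \<in> spins q (L v) \<Longrightarrow> agreements s t + 2 = q \<Longrightarrow>
      \<bar>(real (item_sum q (\<lambda>i. fst (snd (snd i))) its s t) - real (item_sum q (\<lambda>i. snd (snd (snd i))) its s t))
        - (ln (pinned_Z (set vs) C v s) - ln (pinned_Z (set vs) C v t)) / grid M\<bar> \<le> real D"
  shows "\<exists>h. finish q R B its (vs, C, v, D) =
      map (\<lambda>x. (x, h x)) (filter (\<lambda>x. \<forall>c\<in>set (C v). agreements x c = 0) (B v)) \<and> correct D (set vs) C v h"
proof -
  have vV: "v \<in> V" using vl v by (auto simp: valid_def)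
  define S where "S = spins q (L v)"
  have finS: "finite S" and neS: "S \<noteq> {}" and BS: "set (B v) = S" 
    using finite_spins[OF L(1)[OF vV]] spins_nonempty[OF L[OF vV]] B[OF vV] by (auto simp: S_def)
  define lp where "lp = grid M"
  have g0: "0 < lp" using grid_bounds(3)[OF M_pos] by (simp add: lp_def)
  define p where "p x = ln (pinned_Z (set vs) C v x)" for x
  have plip: "lipschitz q (L v) \<eta> p" using Z_pos_and_smooth(2)[OF vl v] by (simp add: smooth_def p_def[abs_def])
  obtain x0 where x0: "x0 \<in> S" "\<And>x. x \<in> S \<Longrightarrow> p x0 \<le> p x"
    using arg_min_if_finite(1)[OF finS neS, of p] arg_min_least[OF finS neS, of _ p] by blast
  define G where "G x = (p x - p x0) / lp" for x
  have G0: "0 \<le> G x" if "x \<in> S" for x using x0(2)[OF that] g0 by (simp add: G_def)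
  have GH: "G x \<le> real H" if x: "x \<in> S" for x
  proof -
    have "p x - p x0 \<le> real q * \<eta>" using lipschitz_diam[OF plip, of x x0] x x0(1) by (auto simp: S_def)
    also have "\<dots> = real H * (1 / (2 * real M))" using q_pos M_pos by (simp add: \<eta>_def H)
    also have "\<dots> \<le> real H * lp" unfolding lp_def using grid_bounds(1)[OF M_pos] by (intro mult_left_mono) auto
    finally show ?thesis using g0 by (simp add: G_def field_simps)
  qed
  define P where "P s t = item_sum q (\<lambda>i. fst (snd (snd i))) its s t" for s t
  define N where "N s t = item_sum q (\<lambda>i. snd (snd (snd i))) its s t" for s t
  have PN: "\<bar>(real (P s t) - real (N s t)) - (G s - G t)\<bar> \<le> real D" if "s \<in> S" "t \<in> S" "agreements s t + 2 = q" for s t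
  proof -
    have "(p s - p t) / lp = G s - G t" by (simp add: G_def diff_divide_distrib)
    then show ?thesis using its[of s t] that by (simp add: S_def P_def N_def p_def lp_def)
  qed
  define \<Phi> where "\<Phi> = (\<lambda>h s. bump q D its (map (\<lambda>x. (x, h x)) (B v)) s (h s))"
  have \<Phi>_fold: "\<Phi> h s = fold (\<lambda>p m. if agreements s (fst p) + 2 = q then max m (snd p + P s (fst p) - (N s (fst p) + D)) else m) 
      (map (\<lambda>x. (x, h x)) (B v)) (h s)" for h s
    unfolding \<Phi>_def bump_def P_def N_def ..
  have up1: "h s \<le> \<Phi> h s" for h s unfolding \<Phi>_fold by (rule fold_max_ge)
  have up2: "h t + P s t - (N s t + D) \<le> \<Phi> h s" if "t \<in> S" "agreements s t + 2 = q" for h s t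
    using fold_max(1)[of "(t, h t)" "map (\<lambda>x. (x, h x)) (B v)" "\<lambda>p. agreements s (fst p) + 2 = q"
        "\<lambda>p. snd p + P s (fst p) - (N s (fst p) + D)" "h s"] that BS unfolding \<Phi>_fold by auto
  \<comment> \<open>The bound by the real number \<open>G s\<close> is passed through its floor
    because heights are natural numbers; truncated subtraction is harmless since
    \<open>0 \<le> G s\<close>.\<close>
  have up3: "real (\<Phi> h s) \<le> G s" if h: "\<And>x. x \<in> S \<Longrightarrow> real (h x) \<le> G x" and s: "s \<in> S" for h s
  proof -
    have "\<Phi> h s \<le> nat \<lfloor>G s\<rfloor>" unfolding \<Phi>_fold
    proof (rule fold_max(2))
      show "h s \<le> nat \<lfloor>G s\<rfloor>" using h[OF s] by (simp add: le_nat_floor)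
      fix p assume "p \<in> set (map (\<lambda>x. (x, h x)) (B v))" and c: "agreements s (fst p) + 2 = q"
      then obtain t where t: "t \<in> S" "p = (t, h t)" using BS by auto
      have "real (h t + P s t - (N s t + D)) \<le> max 0 (real (h t) + real (P s t) - (real (N s t) + real D))" by simp
      also have "\<dots> \<le> G s" using PN[OF s t(1)] c t h[OF t(1)] G0[OF s] by auto
      finally show "snd p + P s (fst p) - (N s (fst p) + D) \<le> nat \<lfloor>G s\<rfloor>" using t by (simp add: le_nat_floor)
    qed
    then show ?thesis using G0[OF s] by linarith
  qed
  define hf where "hf i = (\<Phi> ^^ i) (\<lambda>_. 0)" for i
  have hS: "hf (Suc i) = \<Phi> (hf i)" for i by (simp add: hf_def)
  have hG: "real (hf i x) \<le> G x" if "x \<in> S" for i x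
    using that
  proof (induction i arbitrary: x)
    case 0
    then show ?case using G0 by (simp add: hf_def)
  next
    case (Suc i)
    then show ?case unfolding hS using up3 by blast
  qed
  have hH: "hf i x \<le> H" if "x \<in> S" for i x
    using hG[OF that, of i] GH[OF that] by linarith
  have "card S * H \<le> q ^ q * H" using card_spins[OF vV] by (simp add: S_def)
  then have "card S * H < R" unfolding R by linarith
  then obtain i where i: "i < R" "\<And>x. x \<in> S \<Longrightarrow> hf (Suc i) x = hf i x"
    using stationary[OF finS, of hf H R] up1 hH unfolding hS by metis
  have cong: "\<Phi> h s = \<Phi> h' s" if "\<And>x. x \<in> S \<Longrightarrow> h x = h' x" "s \<in> S" for h h' s
  proof -
    have m: "map (\<lambda>x. (x, h x)) (B v) = map (\<lambda>x. (x, h' x)) (B v)" using that BS by (intro map_cong) auto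
    show ?thesis unfolding \<Phi>_def m using that by simp
  qed
  \<comment> \<open>After one round without change nothing changes any more, so a fixed number of
    rounds replaces a test for convergence.\<close>
  have stable: "\<forall>x\<in>S. hf (i + n) x = hf i x" for n
  proof (induction n)
    case (Suc n)
    show ?case
    proof
      fix x assume x: "x \<in> S"
      have "hf (i + Suc n) x = \<Phi> (hf (i + n)) x" using hS[of "i + n"] by simp
      also have "\<dots> = \<Phi> (hf i) x" using Suc x by (intro cong) auto
      also have "\<dots> = hf i x" using i(2)[OF x] unfolding hS .
      finally show "hf (i + Suc n) x = hf i x" .
    qed
  qed simp
  define h where "h = hf R"
  have hfix: "\<Phi> h x = h x" if x: "x \<in> S" for x
  proof -
    have "h x = hf i x" using stable[of "R - i"] i x by (simp add: h_def)
    moreover have "\<Phi> h x = hf i x" using stable[of "Suc R - i"] i x hS[of R] by (simp add: h_def)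
    ultimately show ?thesis by simp
  qed
  have lower: "G s - real (h s) \<le> G t - real (h t) + 2 * real D" if "s \<in> S" "t \<in> S" "agreements s t + 2 = q" for s t
  proof -
    have "h t + P s t \<le> h s + (N s t + D)" using up2[OF that(2,3), of h] hfix[OF that(1)] by linarith
    then have "real (h t + P s t) \<le> real (h s + (N s t + D))" by (simp only: of_nat_le_iff)
    then show ?thesis using PN[OF that] by simp
  qed
  have "lipschitz q (L v) (2 * real D * lp) (\<lambda>x. real (h x) * lp - p x)"
    unfolding lipschitz_def
  proof (intro ballI allI impI)
    fix x i j assume x: "x \<in> spins q (L v)" and ij: "i < q" "j < q"
    show "\<bar>real (h (swap x i j)) * lp - p (swap x i j) - (real (h x) * lp - p x)\<bar> \<le> 2 * real D * lp"
    proof (cases "i = j")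
      case True
      then have "swap x i j = x" by (simp add: swap_def)
      then show ?thesis using g0 by simp
    next
      case False
      have y: "swap x i j \<in> S" "x \<in> S" using x ij by (auto simp: S_def)
      have e: "agreements x (swap x i j) + 2 = q" using agreements_swap[OF x ij False] .
      have e': "agreements (swap x i j) x + 2 = q" 
        using agreements_swap[of "swap x i j" q "L v" i j] x ij False length_spin[OF x] by simp
      have pG: "p x = G x * lp + p x0" for x using g0 by (simp add: G_def)
      have "\<bar>(real (h (swap x i j)) - G (swap x i j)) - (real (h x) - G x)\<bar> \<le> 2 * real D"
        using lower[OF y(2,1) e] lower[OF y e'] by linarith
      then have "\<bar>(real (h (swap x i j)) - G (swap x i j)) - (real (h x) - G x)\<bar> * lp \<le> 2 * real D * lp"
        using g0 by (intro mult_right_mono) auto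
      moreover have "real (h (swap x i j)) * lp - p (swap x i j) - (real (h x) * lp - p x) =
          ((real (h (swap x i j)) - G (swap x i j)) - (real (h x) - G x)) * lp"
        unfolding pG[of x] pG[of "swap x i j"] by (simp add: algebra_simps)
      ultimately show ?thesis using g0 by (simp add: abs_mult)
    qed
  qed
  then have "correct D (set vs) C v h" using hH by (simp add: correct_def S_def h_def p_def lp_def)
  moreover have "finish q R B its (vs, C, v, D) = map (\<lambda>x. (x, h x)) (filter (\<lambda>x. \<forall>c\<in>set (C v). agreements x c = 0) (B v))"
    using finish_funpow[where n = R and h = "\<lambda>_. 0" and q = q and D = D and its = its and xs = "B v"]
    by (simp add: finish_def filter_map comp_def h_def hf_def \<Phi>_def)
  ultimately show ?thesis by blast
qed

text \<open>\<open>D * 2 ^ d\<close> is the same for a node and its children, so both comparisons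
  with \<open>\<eta>\<close> persist: the lower one makes constant values good enough at depth 0,
  the upper one keeps the computed weights smooth. In the step, each neighbor contributes
  \<open>0.4 * D / \<Delta>\<close> from the error of its own values and 1 from rounding;
  \<open>16 * \<Delta> \<le> D\<close> makes the sum at most \<open>D\<close>.\<close>

lemma marginal_correct:
  assumes "valid (set vs) C" "distinct vs" "v \<in> set vs" "16 * \<Delta> \<le> D"
    "\<eta> \<le> real D * 2 ^ d * grid M" "real D * 2 ^ d * grid M \<le> 2 * \<eta>"
  shows "\<exists>h. marginal q M H T R E B d (vs, C, v, D) =
      map (\<lambda>x. (x, h x)) (filter (\<lambda>x. \<forall>c\<in>set (C v). agreements x c = 0) (B v)) \<and> correct D (set vs) C v h"
  using assms
proof (induction d arbitrary: vs C v D)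
  case 0
  have sm: "smooth q (L v) \<eta> (pinned_Z (set vs) C v)" using Z_pos_and_smooth(2)[OF 0(1,3)] .
  show ?case unfolding marginal.simps
  proof (rule finish_correct[OF 0(1,3)])
    fix s t assume st: "s \<in> spins q (L v)" "t \<in> spins q (L v)" "agreements s t + 2 = q"
    then obtain i j where ij: "i < q" "j < q" "t = swap s i j" using agreements_adjacent by blast
    have "\<bar>ln (pinned_Z (set vs) C v t) - ln (pinned_Z (set vs) C v s)\<bar> \<le> \<eta>"
      using sm lipschitzD[of q "L v" \<eta> "\<lambda>x. ln (pinned_Z (set vs) C v x)" s i j] st ij by (simp add: smooth_def)
    also have "\<dots> \<le> real D * grid M" using 0 by simp
    finally show "\<bar>(real (item_sum q (\<lambda>i. fst (snd (snd i))) [] s t) - real (item_sum q (\<lambda>i. snd (snd (snd i))) [] s t))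
        - (ln (pinned_Z (set vs) C v s) - ln (pinned_Z (set vs) C v t)) / grid M\<bar> \<le> real D"
      using grid_bounds(3)[OF M_pos] by (simp add: item_sum_def abs_minus_commute field_simps abs_le_iff)
  qed
next
  case (Suc d)
  note vl = Suc.prems(1) and dvs = Suc.prems(2) and v = Suc.prems(3)
  define U where "U = set vs"
  have UV: "U \<subseteq> V" and vV: "v \<in> V" using vl v by (auto simp: valid_def U_def)
  define lp where "lp = grid M"
  have g0: "0 < lp" using grid_bounds(3)[OF M_pos] by (simp add: lp_def)
  define f where "f k = marginal q M H T R E B d (child E (vs, C, v, D) k)" for k
  show ?case unfolding marginal.simps
  proof (rule finish_correct[OF vl v])
    fix s t assume st: "s \<in> spins q (L v)" "t \<in> spins q (L v)" "agreements s t + 2 = q"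
    then obtain i j where ij: "i < q" "j < q" "t = swap s i j" using agreements_adjacent by blast
    have ss: "length s = q" "distinct s" using st by (auto simp: spins_def)
    define its where "its = map (\<lambda>k. item M H T k (f k)) (keys q E B (vs, C, v, D))"
    define Nb where "Nb = nbrs (U - {v}) v"
    have Nb: "{u \<in> set vs. u \<noteq> v \<and> {v, u} \<in> E} = Nb" by (auto simp: Nb_def nbrs_def U_def)
    define P where "P u = fst (snd (snd (item M H T (s, t, u) (f (s, t, u)))))" for u
    define N where "N u = snd (snd (snd (item M H T (s, t, u) (f (s, t, u)))))" for u
    have sumP: "item_sum q (\<lambda>i. fst (snd (snd i))) its s t = (\<Sum>u\<in>Nb. P u)"
      and sumN: "item_sum q (\<lambda>i. snd (snd (snd i))) its s t = (\<Sum>u\<in>Nb. N u)"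
      unfolding its_def P_def N_def Nb[symmetric]
      using B[OF vV] st length_spin by (intro item_sum_items dvs; auto)+
    define X where "X u x = ln (weight q (L u) (forbidden q (x # C u)) (pinned_Z (U - {v}) (pin_split E v s t u C) u))" for u x
    have one: "\<bar>(real (P u) - real (N u)) - (X u s - X u t) / lp\<bar> \<le> 1 + 0.4 * real D / real \<Delta>" if u: "u \<in> Nb" for u
    proof -
      have uU: "u \<in> U - {v}" and e: "{v, u} \<in> E" using u by (auto simp: Nb_def nbrs_def)
      then have uV: "u \<in> V" using UV by auto
      define C' where "C' = pin_split E v s t u C"
      have C'u: "C' u = C u" by (simp add: C'_def pin_split_def)
      define vs' where "vs' = filter (\<lambda>u. u \<noteq> v) vs"
      have vs': "set vs' = U - {v}" "distinct vs'" using dvs by (auto simp: vs'_def U_def)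
      have vl': "valid (set vs') C'" unfolding vs' C'_def using valid_pin_split[OF vl[folded U_def] v[folded U_def] st(1,2)] .
      have D1: "\<eta> \<le> real (D + D) * 2 ^ d * grid M" "real (D + D) * 2 ^ d * grid M \<le> 2 * \<eta>" "16 * \<Delta> \<le> D + D"
        using Suc.prems(4-6) by (auto simp: algebra_simps)
      have "u \<in> set vs'" using uU vs' by simp
      from Suc.IH[OF vl' vs'(2) this D1(3,1,2)] obtain h where
        h: "marginal q M H T R E B d (vs', C', u, D + D) = map (\<lambda>x. (x, h x)) (filter (\<lambda>x. \<forall>c\<in>set (C' u). agreements x c = 0) (B u))"
        "correct (D + D) (set vs') C' u h" by blast
      have fk: "f (s, t, u) = map (\<lambda>x. (x, h x)) (filter (\<lambda>x. \<forall>c\<in>set (C u). agreements x c = 0) (B u))"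
        using h(1) C'u by (simp add: f_def child_def vs'_def C'_def)
      define w1 where "w1 = pinned_Z (U - {v}) C' u"
      define w2 where "w2 = (\<lambda>x. real (grid_weight M H (h x)))"
      have hH: "h x \<le> H" if "x \<in> spins q (L u)" for x using h(2) that by (simp add: correct_def)
      have lnw2: "ln (w2 x) = real H * ln (real M) + real (h x) * lp" if "x \<in> spins q (L u)" for x
        unfolding w2_def lp_def using ln_grid_weight[OF M_pos hH[OF that]] .
      \<comment> \<open>For a child of slack \<open>D + D\<close> the Lipschitz constant in
        \<open>correct\<close> is \<open>2 * (D + D) * grid M\<close>.\<close>
      define \<delta> where "\<delta> = 4 * real D * lp"
      have lip1: "lipschitz q (L u) \<delta> (\<lambda>x. real (h x) * lp - ln (w1 x))"
        using h(2) by (simp add: correct_def \<delta>_def lp_def w1_def vs' algebra_simps)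
      have lip: "lipschitz q (L u) \<delta> (\<lambda>x. ln (w2 x) - ln (w1 x))"
        unfolding lipschitz_def
      proof (intro ballI allI impI)
        fix x i j assume x: "x \<in> spins q (L u)" "i < q" "j < q"
        show "\<bar>ln (w2 (swap x i j)) - ln (w1 (swap x i j)) - (ln (w2 x) - ln (w1 x))\<bar> \<le> \<delta>"
          using lipschitzD[OF lip1 x] lnw2[OF x(1)] lnw2[OF swap_in_spins[OF x]] by simp
      qed
      have sm1: "smooth q (L u) \<eta> w1" unfolding w1_def 
        using Z_pos_and_smooth(2)[OF vl', of u] \<open>u \<in> set vs'\<close> by (simp add: vs')
      have \<delta>: "0 \<le> \<delta>" "\<delta> \<le> 4 * \<eta>"
      proof -
        have "1 * (2 * real D * lp) \<le> 2 ^ d * (2 * real D * lp)" using g0 by (intro mult_right_mono) auto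
        moreover have "2 ^ d * (2 * real D * lp) \<le> 2 * \<eta>" using D1(2) by (simp add: lp_def algebra_simps)
        ultimately show "\<delta> \<le> 4 * \<eta>" by (simp add: \<delta>_def)
        show "0 \<le> \<delta>" using g0 by (simp add: \<delta>_def)
      qed
      \<comment> \<open>\<open>swap_ratio_perturb\<close> wants one smoothness constant for the true
        and the computed weights: \<open>\<eta>\<close> for the former, and
        \<open>\<delta> \<le> 4 * \<eta>\<close> more for the latter.\<close>
      have sm1': "smooth q (L u) (5 * \<eta>) w1" using sm1 \<eta>(1) by (auto simp: smooth_def elim: lipschitz_mono)
      have sm2: "smooth q (L u) (5 * \<eta>) w2"
        unfolding smooth_def lipschitz_def
      proof (intro conjI ballI allI impI)
        show "0 < w2 x" for x using grid_weight_pos[OF M_pos] by (simp add: w2_def)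
        fix x i j assume x: "x \<in> spins q (L u)" "i < q" "j < q"
        have "\<bar>ln (w1 (swap x i j)) - ln (w1 x)\<bar> \<le> \<eta>" 
          using sm1 lipschitzD[of q "L u" \<eta> "\<lambda>x. ln (w1 x)" x i j] x by (simp add: smooth_def)
        then show "\<bar>ln (w2 (swap x i j)) - ln (w2 x)\<bar> \<le> 5 * \<eta>" using lipschitzD[OF lip x] \<delta> by linarith
      qed
      have cs: "\<And>c. c \<in> set (C u) \<Longrightarrow> length c = q \<and> distinct c" using vl uU by (auto simp: valid_def U_def)
      have len: "length (C u) \<le> \<Delta> - 1" using valid_nbr_length[OF vl v] u by (simp add: Nb_def U_def)
      define \<zeta> where "\<zeta> = (6 * real (\<Delta> - 1 + 2) + 1) / real q + 2 * (5 * \<eta>)"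
      have qr: "20000 * real \<Delta> \<le> real q" "20000 * (real \<Delta> * real \<Delta>) \<le> real q"
      proof -
        have "real (20000 * \<Delta>) \<le> real q" using q_ge(1) by (simp only: of_nat_le_iff)
        then show "20000 * real \<Delta> \<le> real q" by simp
        have "real (20000 * \<Delta> ^ 2) \<le> real q" using q by (simp only: of_nat_le_iff)
        then show "20000 * (real \<Delta> * real \<Delta>) \<le> real q" by (simp add: power2_eq_square)
      qed
      \<comment> \<open>\<open>6 * (\<Delta> + 1) + 1\<close> comes from the forbidden entries and
        \<open>10 * q * \<eta> = 80 * \<Delta>\<close> from the smoothness;
        \<open>1 \<le> \<Delta>\<close> turns the constant 7 into
        \<open>7 * \<Delta>\<close>.\<close>
      have q\<zeta>: "real q * \<zeta> \<le> 93 * real \<Delta>" 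
        using \<Delta> q_pos by (simp add: \<zeta>_def \<eta>_def of_nat_diff distrib_left field_simps)
      have \<zeta>1: "\<zeta> \<le> 1"
      proof -
        have "real q * \<zeta> \<le> real q * 1" using q\<zeta> qr by simp
        then show ?thesis using q_pos by simp
      qed
      have pert: "\<bar>(ln (weight q (L u) (forbidden q (s # C u)) w2) - ln (weight q (L u) (forbidden q (t # C u)) w2))
        - (ln (weight q (L u) (forbidden q (s # C u)) w1) - ln (weight q (L u) (forbidden q (t # C u)) w1))\<bar>
        \<le> 16 / real q * (1 + real q * \<zeta>) * \<delta>"
        unfolding ij(3)
        by (rule swap_ratio_perturb[OF L[OF uV] q_ge(2) \<eta>(3) _ cs len ss ij(1,2) sm1' sm2 lip \<delta>(1) \<zeta>_def \<zeta>1])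
          (use \<eta>(1) in auto)
      have "16 / real q * (1 + real q * \<zeta>) * \<delta> \<le> 16 / real q * (94 * real \<Delta>) * \<delta>"
        using q\<zeta> \<Delta> \<delta> q_pos by (intro mult_right_mono mult_left_mono) auto
      \<comment> \<open>\<open>6016 = 16 * 94 * 4\<close>. The bound after it is the contraction,
        and the place where \<open>q\<close> has to be quadratic in \<open>\<Delta>\<close>:
        \<open>6016 / 0.4 = 15040\<close>.\<close>
      also have "\<dots> = 6016 * real \<Delta> / real q * (real D * lp)" by (simp add: \<delta>_def)
      also have "\<dots> \<le> 0.4 / real \<Delta> * (real D * lp)"
      proof (intro mult_right_mono)
        show "6016 * real \<Delta> / real q \<le> 0.4 / real \<Delta>" using qr \<Delta> q_pos by (simp add: field_simps)
      qed (use g0 in auto)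
      finally have small: "16 / real q * (1 + real q * \<zeta>) * \<delta> \<le> 0.4 * real D / real \<Delta> * lp" by simp
      define Xs where "Xs = wsum M H s (f (s, t, u))"
      define Xt where "Xt = wsum M H t (f (s, t, u))"
      have XW: "real Xs = weight q (L u) (forbidden q (s # C u)) w2" "real Xt = weight q (L u) (forbidden q (t # C u)) w2"
        unfolding Xs_def Xt_def fk w2_def by (rule wsum_eq[OF uV])+
      have deg: "degree_bounded q (L u) \<Delta> (forbidden q (x # C u))" if "x \<in> spins q (L v)" for x
      proof (rule degree_bounded_mono[OF degree_bounded_forbidden[of "x # C u"] subset_refl L(1)[OF uV]])
        show "length c = q \<and> distinct c" if "c \<in> set (x # C u)" for c
          using that cs \<open>x \<in> spins q (L v)\<close> by (auto simp: spins_def)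
        show "length (x # C u) \<le> \<Delta>" using len \<Delta> by simp
      qed
      have ne: "allowed_spins q (L u) (forbidden q (x # C u)) \<noteq> {}" if "x \<in> spins q (L v)" for x
        by (rule allowed_spins_nonempty[OF L[OF uV] deg[OF that] q_ge(3)])
      note bs = weight_grid_weight[OF uV, of h, OF hH ne[OF st(1)], folded w2_def XW(1)]
      note bt = weight_grid_weight[OF uV, of h, OF hH ne[OF st(2)], folded w2_def XW(2)]
      have "\<bar>(real (grid_log M T Xs Xt) - real (grid_log M T Xt Xs)) - (ln (real Xs) - ln (real Xt)) / grid M\<bar> \<le> 1"
        using bs bt by (intro grid_log_diff M_pos) auto
      moreover have "P u = grid_log M T Xs Xt" "N u = grid_log M T Xt Xs" by (simp_all add: P_def N_def item_def Xs_def Xt_def)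
      moreover have "\<bar>(ln (real Xs) - ln (real Xt)) / lp - (X u s - X u t) / lp\<bar> \<le> 0.4 * real D / real \<Delta>"
      proof -
        have "\<bar>(ln (real Xs) - ln (real Xt)) - (X u s - X u t)\<bar> \<le> 0.4 * real D / real \<Delta> * lp"
          using pert small unfolding XW X_def w1_def C'_def by linarith
        then have "\<bar>((ln (real Xs) - ln (real Xt)) - (X u s - X u t)) / lp\<bar> \<le> 0.4 * real D / real \<Delta>"
          using g0 by (simp add: abs_divide pos_divide_le_eq)
        then show ?thesis by (simp add: diff_divide_distrib)
      qed
      ultimately show ?thesis unfolding lp_def by linarith
    qed
    have cardNb: "card Nb \<le> \<Delta>"
    proof -
      have "card Nb \<le> card (nbrs V v)" using UV finite_V by (intro card_mono) (auto simp: nbrs_def Nb_def)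
      then show ?thesis using card_nbrs[OF vV] by simp
    qed
    have "\<bar>((\<Sum>u\<in>Nb. real (P u)) - (\<Sum>u\<in>Nb. real (N u))) - (ln (pinned_Z U C v s) - ln (pinned_Z U C v t)) / lp\<bar> =
        \<bar>\<Sum>u\<in>Nb. (real (P u) - real (N u)) - (X u s - X u t) / lp\<bar>"
      unfolding ln_pinned_Z_diff[OF vl[folded U_def] v[folded U_def]] X_def[symmetric] Nb_def[symmetric]
      by (simp add: sum_subtractf sum_divide_distrib diff_divide_distrib)
    also have "\<dots> \<le> (\<Sum>u\<in>Nb. 1 + 0.4 * real D / real \<Delta>)"
      using one by (intro order_trans[OF sum_abs] sum_mono)
    also have "\<dots> = real (card Nb) * (1 + 0.4 * real D / real \<Delta>)" by simp
    also have "\<dots> \<le> real \<Delta> * (1 + 0.4 * real D / real \<Delta>)" using cardNb by (intro mult_right_mono) auto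
    also have "\<dots> = real \<Delta> + 0.4 * real D" using \<Delta> by (simp add: field_simps)
    also have "\<dots> \<le> real D" using Suc.prems(4) by simp
    finally show "\<bar>(real (item_sum q (\<lambda>i. fst (snd (snd i))) (map (\<lambda>k. item M H T k (marginal q M H T R E B d (child E (vs, C, v, D) k))) (keys q E B (vs, C, v, D))) s t)
        - real (item_sum q (\<lambda>i. snd (snd (snd i))) (map (\<lambda>k. item M H T k (marginal q M H T R E B d (child E (vs, C, v, D) k))) (keys q E B (vs, C, v, D))) s t))
        - (ln (pinned_Z (set vs) C v s) - ln (pinned_Z (set vs) C v t)) / grid M\<bar> \<le> real D"
      unfolding f_def[symmetric] its_def[symmetric] sumP sumN U_def lp_def by simp
  qed
qed


end

section \<open>From the weights of single vertices to the number of configurations\<close>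

primrec total :: "nat \<Rightarrow> nat \<Rightarrow> nat \<Rightarrow> nat \<Rightarrow> nat \<Rightarrow> nat set set \<Rightarrow> (nat \<Rightarrow> nat list list) \<Rightarrow> nat \<Rightarrow> nat \<Rightarrow>
    nat list \<Rightarrow> (nat \<Rightarrow> nat list list) \<Rightarrow> nat \<Rightarrow> nat" where
  "total q M H T R E B d D [] C J = J"
| "total q M H T R E B d D (v # vs) C J =
     (let ys = marginal q M H T R E B d (v # vs, C, v, D) in
      total q M H T R E B d D vs (pin E v (fst (hd ys)) C)
        (J + grid_log M T (\<Sum>p\<leftarrow>ys. grid_weight M H (snd p)) (grid_weight M H (snd (hd ys)))))"

text \<open>If every term changes by a factor between \<open>exp (c - \<delta>)\<close> and
  \<open>exp (c + \<delta>)\<close>, then so does the sum.\<close>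

lemma ln_sum_close:
  fixes f g :: "'a \<Rightarrow> real"
  assumes fin: "finite A" "A \<noteq> {}" and pos: "\<And>x. x \<in> A \<Longrightarrow> 0 < f x" "\<And>x. x \<in> A \<Longrightarrow> 0 < g x"
    and close: "\<And>x. x \<in> A \<Longrightarrow> \<bar>ln (f x) - ln (g x) - c\<bar> \<le> \<delta>"
  shows "\<bar>ln (sum f A) - ln (sum g A) - c\<bar> \<le> \<delta>"
proof -
  have p: "0 < sum f A" "0 < sum g A" using fin pos by (auto intro!: sum_pos)
  have "sum f A \<le> (\<Sum>x\<in>A. exp (c + \<delta>) * g x)"
  proof (rule sum_mono)
    fix x assume x: "x \<in> A"
    have "exp (ln (f x)) \<le> exp (c + \<delta> + ln (g x))" using close[OF x] by (subst exp_le_cancel_iff) linarith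
    then show "f x \<le> exp (c + \<delta>) * g x" using pos[OF x] by (simp add: exp_add)
  qed
  then have "ln (sum f A) \<le> ln (exp (c + \<delta>) * sum g A)" using p by (simp add: sum_distrib_left)
  also have "\<dots> = c + \<delta> + ln (sum g A)" using p by (simp add: ln_mult_pos)
  finally have 1: "ln (sum f A) - ln (sum g A) - c \<le> \<delta>" by simp
  have "(\<Sum>x\<in>A. exp (c - \<delta>) * g x) \<le> sum f A"
  proof (rule sum_mono)
    fix x assume x: "x \<in> A"
    have "exp (c - \<delta> + ln (g x)) \<le> exp (ln (f x))" using close[OF x] by (subst exp_le_cancel_iff) linarith
    then show "exp (c - \<delta>) * g x \<le> f x" using pos[OF x] by (simp add: exp_add)
  qed
  then have "exp (c - \<delta>) * sum g A \<le> sum f A" by (simp add: sum_distrib_left)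
  then have "ln (exp (c - \<delta>) * sum g A) \<le> ln (sum f A)" using p by (subst ln_le_cancel_iff) auto
  moreover have "ln (exp (c - \<delta>) * sum g A) = c - \<delta> + ln (sum g A)" using p by (simp add: ln_mult_pos)
  ultimately show ?thesis using 1 by linarith
qed

context packing_algorithm
begin

text \<open>Self-reduction: \<open>Z U C\<close> divided by \<open>pinned_Z U C v s\<close> is a sum
  of weights divided by the weight of \<open>s\<close>, which the computed heights estimate; pinning
  \<open>s\<close> leaves the same problem with one vertex less. Any allowed \<open>s\<close> will
  do, so the first one in the list is taken. Each vertex costs one unit for rounding and
  \<open>2 * D * q\<close> units because other spins are up to \<open>q\<close> transpositions away
  from \<open>s\<close>.\<close>

lemma total_correct:
  assumes "valid (set vs) C" "distinct vs" "16 * \<Delta> \<le> D"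
    "\<eta> \<le> real D * 2 ^ d * grid M" "real D * 2 ^ d * grid M \<le> 2 * \<eta>"
  shows "\<bar>real (total q M H T R E B d D vs C J) - real J - ln (Z (set vs) C) / grid M\<bar> \<le> real (length vs) * (1 + 2 * real D * real q)"
  using assms(1,2)
proof (induction vs arbitrary: C J)
  case Nil
  then show ?case by (simp add: Z_def configs_def)
next
  case (Cons v vs)
  note vl = Cons.prems(1)
  define U where "U = set (v # vs)"
  have vU: "v \<in> set (v # vs)" by simp
  have UV: "set (v # vs) \<subseteq> V" and vV: "v \<in> V" using vl by (auto simp: valid_def)
  have Uv: "set (v # vs) - {v} = set vs" using Cons.prems(2) by auto
  define lp where "lp = grid M"
  have g0: "0 < lp" using grid_bounds(3)[OF M_pos] by (simp add: lp_def)
  define ys where "ys = marginal q M H T R E B d (v # vs, C, v, D)"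
  obtain h where h: "ys = map (\<lambda>x. (x, h x)) (filter (\<lambda>x. \<forall>c\<in>set (C v). agreements x c = 0) (B v))"
    "correct D (set (v # vs)) C v h"
    using marginal_correct[OF vl Cons.prems(2) vU assms(3-5)] unfolding ys_def by blast
  define A where "A = allowed_spins q (L v) (forbidden q (C v))"
  have A: "A = set (filter (\<lambda>x. \<forall>c\<in>set (C v). agreements x c = 0) (B v))"
    using B(2)[OF vV] by (auto simp: A_def allowed_spins_def avoids_forbidden[OF length_spin] agreements_0)
  have AS: "x \<in> spins q (L v)" if "x \<in> A" for x using that by (simp add: A_def allowed_spins_def)
  have finA: "finite A" unfolding A by simp
  have len: "length (C v) \<le> \<Delta>" and cs: "\<And>c. c \<in> set (C v) \<Longrightarrow> length c = q \<and> distinct c"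
    using vl by (auto simp: valid_def)
  have "degree_bounded q (L v) \<Delta> (forbidden q (C v))"
    by (rule degree_bounded_mono[OF degree_bounded_forbidden[OF cs] subset_refl L(1)[OF vV] len])
  then have neA: "A \<noteq> {}" unfolding A_def by (rule allowed_spins_nonempty[OF L[OF vV] _ q_ge(3)])
  define s where "s = fst (hd ys)"
  have ne: "filter (\<lambda>x. \<forall>c\<in>set (C v). agreements x c = 0) (B v) \<noteq> []" using neA unfolding A by force
  have hdys: "hd ys = (s, h s)" and sA: "s \<in> A"
    using ne hd_in_set[OF ne] unfolding s_def h(1) A by (auto simp: hd_map)
  have sS: "s \<in> spins q (L v)" using AS[OF sA] .
  define p where "p = pinned_Z (set (v # vs)) C v"
  have sm: "smooth q (L v) \<eta> p" using Z_pos_and_smooth(2)[OF vl vU] by (simp add: p_def)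
  have ppos: "0 < p x" if "x \<in> spins q (L v)" for x using sm that by (simp add: smooth_def)
  have hH: "h x \<le> H" if "x \<in> spins q (L v)" for x using h(2) that by (simp add: correct_def)
  define w2 where "w2 = (\<lambda>x. real (grid_weight M H (h x)))"
  have lnw2: "ln (w2 x) = real H * ln (real M) + real (h x) * lp" if "x \<in> spins q (L v)" for x
    unfolding w2_def lp_def using ln_grid_weight[OF M_pos hH[OF that]] .
  define X where "X = (\<Sum>p\<leftarrow>ys. grid_weight M H (snd p))"
  define Y where "Y = grid_weight M H (snd (hd ys))"
  have X: "real X = sum w2 A"
  proof -
    have "X = (\<Sum>x\<in>A. grid_weight M H (h x))"
      unfolding X_def h(1) A using B(1)[OF vV] by (simp add: comp_def sum_list_distinct_conv_sum_set)
    then show ?thesis by (simp add: w2_def)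
  qed
  have Y: "real Y = w2 s" by (simp add: Y_def hdys w2_def)
  define c where "c = ln (w2 s) - ln (p s)"
  \<comment> \<open>The heights are known only up to a constant, normalized here at
    \<open>s\<close>. It cancels because the sum is compared with the weight of the same
    \<open>s\<close>.\<close>
  have close: "\<bar>ln (sum w2 A) - ln (sum p A) - c\<bar> \<le> real q * (2 * real D * lp)"
  proof (rule ln_sum_close[OF finA neA])
    show "0 < w2 x" for x using grid_weight_pos[OF M_pos] by (simp add: w2_def)
    show "0 < p x" if "x \<in> A" for x using ppos AS that by blast
    fix x assume "x \<in> A"
    then have x: "x \<in> spins q (L v)" by (rule AS)
    have "lipschitz q (L v) (2 * real D * lp) (\<lambda>x. real (h x) * lp - ln (p x))"
      using h(2) by (simp add: correct_def lp_def p_def)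
    from lipschitz_diam[OF this x sS] show "\<bar>ln (w2 x) - ln (p x) - c\<bar> \<le> real q * (2 * real D * lp)"
      unfolding c_def lnw2[OF x] lnw2[OF sS] by simp
  qed
  have wA: "weight q (L v) (forbidden q (C v)) w2 = sum w2 A" by (simp add: weight_def A_def)
  note bX = weight_grid_weight[OF vV, of h, OF hH neA[unfolded A_def], folded w2_def, unfolded wA, folded X]
  have YX: "w2 s \<le> sum w2 A" using finA sA by (intro member_le_sum) (auto simp: w2_def)
  have posY: "0 < w2 s" using grid_weight_pos[OF M_pos] by (simp add: w2_def)
  have "ln (real Y) \<le> ln (real X)" unfolding X Y using YX posY by simp
  moreover have "real H * ln (real M) \<le> ln (real Y)" unfolding Y lnw2[OF sS] using g0 by simp
  ultimately have u: "(ln (real X) - ln (real Y)) / lp \<le> real (grid_log M T X Y)" "real (grid_log M T X Y) \<le> (ln (real X) - ln (real Y)) / lp + 1"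
    using grid_log_bounds[of M X Y T] M_pos bX posY Y g0 unfolding lp_def[symmetric] by auto
  have "\<bar>(ln (real X) - ln (real Y)) - (ln (sum p A) - ln (p s))\<bar> \<le> (real q * (2 * real D)) * lp"
    using close unfolding c_def X Y by (simp add: algebra_simps)
  then have "\<bar>((ln (real X) - ln (real Y)) - (ln (sum p A) - ln (p s))) / lp\<bar> \<le> real q * (2 * real D)"
    using g0 by (simp add: abs_divide pos_divide_le_eq)
  then have r: "\<bar>(ln (real X) - ln (real Y)) / lp - (ln (sum p A) / lp - ln (p s) / lp)\<bar> \<le> 2 * real D * real q"
    by (simp add: diff_divide_distrib mult.commute)
  have ZA: "Z (set (v # vs)) C = sum p A" unfolding Z_pick[OF UV vU] by (simp add: weight_def A_def p_def)
  have ps: "p s = Z (set vs) (pin E v s C)" unfolding p_def pinned_Z_def Uv ..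
  have vl': "valid (set vs) (pin E v s C)" using valid_pin[OF vl vU sS] unfolding Uv .
  have tot: "total q M H T R E B d D (v # vs) C J = total q M H T R E B d D vs (pin E v s C) (J + grid_log M T X Y)"
    by (simp add: ys_def[symmetric] s_def[symmetric] X_def Y_def Let_def)
  have IH: "\<bar>real (total q M H T R E B d D vs (pin E v s C) (J + grid_log M T X Y)) - real (J + grid_log M T X Y) - ln (p s) / lp\<bar>
      \<le> real (length vs) * (1 + 2 * real D * real q)"
    using Cons.IH[OF vl', of "J + grid_log M T X Y"] Cons.prems(2) unfolding ps lp_def by simp
  have "real (length (v # vs)) * (1 + 2 * real D * real q) = real (length vs) * (1 + 2 * real D * real q) + 1 + 2 * real D * real q"
    by (simp add: algebra_simps)
  then show ?case unfolding tot ZA lp_def[symmetric] using IH u r by simp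
qed

end

section \<open>Polynomial time programs\<close>

text \<open>\<open>ptime D N e f\<close>: a deterministic program maps \<open>e a\<close> to \<open>f a\<close> for all indices \<open>a \<in> D\<close>, in time
  polynomial in the budget \<open>N a\<close>.  Since every operation has unit cost, only the number of loop
  iterations has to be compared with the budget; the sizes of intermediate values are irrelevant.\<close>

definition ptime :: "'a set \<Rightarrow> ('a \<Rightarrow> nat) \<Rightarrow> ('a \<Rightarrow> val) \<Rightarrow> ('a \<Rightarrow> val) \<Rightarrow> bool" where
  "ptime D N e f \<longleftrightarrow> (\<exists>p k. \<forall>a\<in>D. \<exists>t\<le>(N a + 2) ^ k. run p (e a) = return_spmf (f a, t))"

lemma ptimeI: "(\<And>a. a \<in> D \<Longrightarrow> \<exists>t\<le>(N a + 2) ^ k. run p (e a) = return_spmf (f a, t)) \<Longrightarrow> ptime D N e f"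
  unfolding ptime_def by blast

lemma ptimeE:
  assumes "ptime D N e f"
  obtains p k t where "\<And>a. a \<in> D \<Longrightarrow> t a \<le> (N a + 2) ^ k" "\<And>a. a \<in> D \<Longrightarrow> run p (e a) = return_spmf (f a, t a)"
  using assms unfolding ptime_def by metis

section \<open>Closure properties of polynomial time\<close>

lemma power_sum_bounds:
  fixes x :: nat
  assumes "2 \<le> x"
  shows "x ^ k + x ^ l + 1 \<le> x ^ (k + l + 2)" "x ^ k + (x ^ l + x ^ m) + 1 \<le> x ^ (k + l + m + 2)"
proof -
  have x: "1 \<le> x" "4 \<le> x ^ 2" using assms power_mono[OF assms, of 2] by auto
  have "x ^ k \<le> x ^ (k + l)" "x ^ l \<le> x ^ (k + l)" "1 \<le> x ^ (k + l)" using x by (auto intro: power_increasing)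
  then have "x ^ k + x ^ l + 1 \<le> x ^ (k + l) * 4" by linarith
  also have "\<dots> \<le> x ^ (k + l) * x ^ 2" using x by (intro mult_left_mono) auto
  finally show "x ^ k + x ^ l + 1 \<le> x ^ (k + l + 2)" by (simp only: power_add)
  have "x ^ k \<le> x ^ (k + l + m)" "x ^ l \<le> x ^ (k + l + m)" "x ^ m \<le> x ^ (k + l + m)" "1 \<le> x ^ (k + l + m)"
    using x by (auto intro: power_increasing)
  then have "x ^ k + (x ^ l + x ^ m) + 1 \<le> x ^ (k + l + m) * 4" by linarith
  also have "\<dots> \<le> x ^ (k + l + m) * x ^ 2" using x by (intro mult_left_mono) auto
  finally show "x ^ k + (x ^ l + x ^ m) + 1 \<le> x ^ (k + l + m + 2)" by (simp only: power_add)
qed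

lemma ptime_basic:
  assumes "\<And>x. run p x = return_spmf (g x, 1)"
  shows "ptime D N e (\<lambda>a. g (e a))"
  by (rule ptimeI[where p = p and k = 0]) (auto simp: assms)

lemma ptime_Id: "ptime D N e e"
  by (rule ptime_basic[where p = Id]) auto

lemma ptime_const: "ptime D N e (\<lambda>a. Atom n)"
  by (rule ptime_basic[where p = "Const n" and g = "\<lambda>_. Atom n"]) auto

lemma ptime_comp:
  assumes "ptime D N e f" "ptime D N f g"
  shows "ptime D N e g"
proof -
  obtain p k t where 1: "\<And>a. a \<in> D \<Longrightarrow> t a \<le> (N a + 2) ^ k" "\<And>a. a \<in> D \<Longrightarrow> run p (e a) = return_spmf (f a, t a)"
    using assms(1) by (rule ptimeE) blast
  obtain p' k' t' where 2: "\<And>a. a \<in> D \<Longrightarrow> t' a \<le> (N a + 2) ^ k'" "\<And>a. a \<in> D \<Longrightarrow> run p' (f a) = return_spmf (g a, t' a)"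
    using assms(2) by (rule ptimeE) blast
  show ?thesis
  proof (rule ptimeI[where p = "Comp p p'" and k = "k + k' + 2"], intro exI conjI)
    fix a assume a: "a \<in> D"
    show "t a + t' a + 1 \<le> (N a + 2) ^ (k + k' + 2)"
      using 1(1)[OF a] 2(1)[OF a] power_sum_bounds(1)[of "N a + 2" k k'] by simp
    show "run (Comp p p') (e a) = return_spmf (g a, t a + t' a + 1)" using 1(2)[OF a] 2(2)[OF a] by simp
  qed
qed

lemma ptime_Cell:
  assumes "ptime D N e f" "ptime D N e g"
  shows "ptime D N e (\<lambda>a. Cell (f a) (g a))"
proof -
  obtain p k t where 1: "\<And>a. a \<in> D \<Longrightarrow> t a \<le> (N a + 2) ^ k" "\<And>a. a \<in> D \<Longrightarrow> run p (e a) = return_spmf (f a, t a)"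
    using assms(1) by (rule ptimeE) blast
  obtain p' k' t' where 2: "\<And>a. a \<in> D \<Longrightarrow> t' a \<le> (N a + 2) ^ k'" "\<And>a. a \<in> D \<Longrightarrow> run p' (e a) = return_spmf (g a, t' a)"
    using assms(2) by (rule ptimeE) blast
  show ?thesis
  proof (rule ptimeI[where p = "Fork p p'" and k = "k + k' + 2"], intro exI conjI)
    fix a assume a: "a \<in> D"
    show "t a + t' a + 1 \<le> (N a + 2) ^ (k + k' + 2)"
      using 1(1)[OF a] 2(1)[OF a] power_sum_bounds(1)[of "N a + 2" k k'] by simp
    show "run (Fork p p') (e a) = return_spmf (Cell (f a) (g a), t a + t' a + 1)" using 1(2)[OF a] 2(2)[OF a] by simp
  qed
qed

lemma ptime_mono:
  assumes "ptime D N e f" "D' \<subseteq> D"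
  shows "ptime D' N e f"
  using assms unfolding ptime_def by (meson subsetD)

lemma ptime_cong:
  assumes "ptime D N e f" "\<And>a. a \<in> D \<Longrightarrow> f a = g a"
  shows "ptime D N e g"
  using assms unfolding ptime_def by metis

text \<open>Indices are only names for the inputs of a program. A typical use transfers a program
  for all states that satisfy an invariant to the states reached in the rounds of a loop.\<close>

lemma ptime_reindex:
  assumes "ptime D N e f" "\<And>b. b \<in> D' \<Longrightarrow> \<pi> b \<in> D" "\<And>b. b \<in> D' \<Longrightarrow> e' b = e (\<pi> b)" "\<And>b. b \<in> D' \<Longrightarrow> f' b = f (\<pi> b)"
    "\<And>b. b \<in> D' \<Longrightarrow> N (\<pi> b) \<le> N' b"
  shows "ptime D' N' e' f'"
proof -
  obtain p k t where 1: "\<And>a. a \<in> D \<Longrightarrow> t a \<le> (N a + 2) ^ k" "\<And>a. a \<in> D \<Longrightarrow> run p (e a) = return_spmf (f a, t a)"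
    using assms(1) by (rule ptimeE) blast
  show ?thesis
  proof (rule ptimeI[where p = p and k = k], intro exI conjI)
    fix b assume b: "b \<in> D'"
    have "t (\<pi> b) \<le> (N (\<pi> b) + 2) ^ k" using 1(1) assms(2)[OF b] .
    also have "\<dots> \<le> (N' b + 2) ^ k" using assms(5)[OF b] by (intro power_mono) auto
    finally show "t (\<pi> b) \<le> (N' b + 2) ^ k" .
    show "run p (e' b) = return_spmf (f' b, t (\<pi> b))" using 1(2)[OF assms(2)[OF b]] assms(3,4)[OF b] by simp
  qed
qed

lemma ptime_if:
  assumes "ptime D N e (\<lambda>a. Atom (of_bool (P a)))" "ptime {a \<in> D. P a} N e f" "ptime {a \<in> D. \<not> P a} N e g"
  shows "ptime D N e (\<lambda>a. if P a then f a else g a)"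
proof -
  obtain p k t where 1: "\<And>a. a \<in> D \<Longrightarrow> t a \<le> (N a + 2) ^ k" "\<And>a. a \<in> D \<Longrightarrow> run p (e a) = return_spmf (Atom (of_bool (P a)), t a)"
    using assms(1) by (rule ptimeE) blast
  obtain p' k' t' where 2: "\<And>a. a \<in> {a \<in> D. P a} \<Longrightarrow> t' a \<le> (N a + 2) ^ k'" "\<And>a. a \<in> {a \<in> D. P a} \<Longrightarrow> run p' (e a) = return_spmf (f a, t' a)"
    using assms(2) by (rule ptimeE) blast
  obtain p'' k'' t'' where 3: "\<And>a. a \<in> {a \<in> D. \<not> P a} \<Longrightarrow> t'' a \<le> (N a + 2) ^ k''" "\<And>a. a \<in> {a \<in> D. \<not> P a} \<Longrightarrow> run p'' (e a) = return_spmf (g a, t'' a)"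
    using assms(3) by (rule ptimeE) blast
  show ?thesis
  proof (rule ptimeI[where p = "Cond p p' p''" and k = "k + k' + k'' + 2"], intro exI conjI)
    fix a assume a: "a \<in> D"
    have "(if P a then t' a else t'' a) \<le> (N a + 2) ^ k' + (N a + 2) ^ k''"
      using 2(1)[of a] 3(1)[of a] a by auto
    then show "t a + (if P a then t' a else t'' a) + 1 \<le> (N a + 2) ^ (k + k' + k'' + 2)"
      using 1(1)[OF a] power_sum_bounds(2)[of "N a + 2" k k' k''] by linarith
    show "run (Cond p p' p'') (e a) = return_spmf (if P a then f a else g a, t a + (if P a then t' a else t'' a) + 1)"
      using 1(2)[OF a] 2(2)[of a] 3(2)[of a] a by simp
  qed
qed

text \<open>A deterministic run is a sequence \<open>s 0, ..., s m\<close>; the fixed point equation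
  of \<open>loop\<close> is unfolded from the last state backwards.\<close>

lemma loop_run:
  assumes "\<And>j. j \<le> m \<Longrightarrow> b (s j) = return_spmf (c j, tb j) \<and> tb j \<le> Tb"
    "\<And>j. j < m \<Longrightarrow> p (s j) = return_spmf (s (Suc j), tp j) \<and> tp j \<le> Tp"
    "\<And>j. j < m \<Longrightarrow> c j \<noteq> Atom 0" "c m = Atom 0"
  shows "\<exists>t\<le>(m + 1) * (Tb + Tp + 1). loop b p (s 0) = return_spmf (s m, t)"
proof -
  have "\<exists>t\<le>(m - i + 1) * (Tb + Tp + 1). loop b p (s i) = return_spmf (s m, t)" if "i \<le> m" for i
    using that
  proof (induction i rule: inc_induct)
    case base
    have "loop b p (s m) = return_spmf (s m, tb m + 1)"
      using assms(1)[of m] assms(4) by (subst loop.simps) simp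
    then show ?case using assms(1)[of m] by (intro exI[of _ "tb m + 1"]) auto
  next
    case (step i)
    then obtain t where t: "t \<le> (m - Suc i + 1) * (Tb + Tp + 1)" "loop b p (s (Suc i)) = return_spmf (s m, t)" by auto
    have i: "tb i \<le> Tb" "tp i \<le> Tp" using assms(1)[of i] assms(2)[of i] step by auto
    have "loop b p (s i) = return_spmf (s m, tb i + tp i + t + 1)"
      using assms(1)[of i] assms(2)[of i] assms(3)[of i] step t(2) by (subst loop.simps) simp
    moreover have "tb i + tp i + t + 1 \<le> (m - i + 1) * (Tb + Tp + 1)"
    proof -
      have "m - i + 1 = Suc (m - Suc i + 1)" using step by simp
      then have "(m - i + 1) * (Tb + Tp + 1) = (Tb + Tp + 1) + (m - Suc i + 1) * (Tb + Tp + 1)" by simp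
      then show ?thesis using i t(1) by linarith
    qed
    ultimately show ?case by blast
  qed
  from this[of 0] show ?thesis by simp
qed

text \<open>One program must serve all rounds on all inputs, so condition and body are taken over
  pairs of an input and a round number, with the budget of the input. Their uniform time bound is
  then multiplied by \<open>m a + 1\<close>.\<close>

lemma ptime_while:
  assumes cond: "ptime {z. fst z \<in> D \<and> snd z \<le> m (fst z)} (\<lambda>z. N (fst z)) (\<lambda>z. s (fst z) (snd z)) (\<lambda>z. c (fst z) (snd z))"
    and body: "ptime {z. fst z \<in> D \<and> snd z < m (fst z)} (\<lambda>z. N (fst z)) (\<lambda>z. s (fst z) (snd z)) (\<lambda>z. s (fst z) (Suc (snd z)))"
    and c: "\<And>a i. a \<in> D \<Longrightarrow> i < m a \<Longrightarrow> c a i \<noteq> Atom 0" "\<And>a. a \<in> D \<Longrightarrow> c a (m a) = Atom 0"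
    and m: "\<And>a. a \<in> D \<Longrightarrow> m a \<le> N a"
  shows "ptime D N (\<lambda>a. s a 0) (\<lambda>a. s a (m a))"
proof -
  obtain p k t where 1: "\<And>z. z \<in> {z. fst z \<in> D \<and> snd z \<le> m (fst z)} \<Longrightarrow> t z \<le> (N (fst z) + 2) ^ k"
    "\<And>z. z \<in> {z. fst z \<in> D \<and> snd z \<le> m (fst z)} \<Longrightarrow> run p (s (fst z) (snd z)) = return_spmf (c (fst z) (snd z), t z)"
    using cond by (rule ptimeE) blast
  obtain p' k' t' where 2: "\<And>z. z \<in> {z. fst z \<in> D \<and> snd z < m (fst z)} \<Longrightarrow> t' z \<le> (N (fst z) + 2) ^ k'"
    "\<And>z. z \<in> {z. fst z \<in> D \<and> snd z < m (fst z)} \<Longrightarrow> run p' (s (fst z) (snd z)) = return_spmf (s (fst z) (Suc (snd z)), t' z)"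
    using body by (rule ptimeE) blast
  show ?thesis
  proof (rule ptimeI[where p = "While p p'" and k = "Suc (k + k' + 2)"])
    fix a assume a: "a \<in> D"
    have "\<exists>r\<le>(m a + 1) * ((N a + 2) ^ k + (N a + 2) ^ k' + 1). loop (run p) (run p') (s a 0) = return_spmf (s a (m a), r)"
    proof (rule loop_run[where c = "c a" and tb = "\<lambda>j. t (a, j)" and tp = "\<lambda>j. t' (a, j)"])
      show "run p (s a j) = return_spmf (c a j, t (a, j)) \<and> t (a, j) \<le> (N a + 2) ^ k" if "j \<le> m a" for j
        using 1[of "(a, j)"] that a by simp
      show "run p' (s a j) = return_spmf (s a (Suc j), t' (a, j)) \<and> t' (a, j) \<le> (N a + 2) ^ k'" if "j < m a" for j
        using 2[of "(a, j)"] that a by simp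
    qed (use c a in auto)
    then obtain r where r: "r \<le> (m a + 1) * ((N a + 2) ^ k + (N a + 2) ^ k' + 1)" 
      "loop (run p) (run p') (s a 0) = return_spmf (s a (m a), r)" by blast
    have "(m a + 1) * ((N a + 2) ^ k + (N a + 2) ^ k' + 1) \<le> (N a + 2) * (N a + 2) ^ (k + k' + 2)"
      using m[OF a] power_sum_bounds(1)[of "N a + 2" k k'] by (intro mult_mono) auto
    then have "r \<le> (N a + 2) ^ Suc (k + k' + 2)" using r(1) by (simp only: power_Suc)
    then show "\<exists>r\<le>(N a + 2) ^ Suc (k + k' + 2). run (While p p') (s a 0) = return_spmf (s a (m a), r)" using r by auto
  qed
qed

lemma ptime_Fst: "ptime D N e (\<lambda>a. Cell (f a) (g a)) \<Longrightarrow> ptime D N e f"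
  using ptime_comp[OF _ ptime_basic[where p = Fst and g = val_fst and e = "\<lambda>a. Cell (f a) (g a)"]] by auto

lemma ptime_Snd: "ptime D N e (\<lambda>a. Cell (f a) (g a)) \<Longrightarrow> ptime D N e g"
  using ptime_comp[OF _ ptime_basic[where p = Snd and g = val_snd and e = "\<lambda>a. Cell (f a) (g a)"]] by auto

lemma ptime_val_fst: "ptime D N e f \<Longrightarrow> ptime D N e (\<lambda>a. val_fst (f a))"
  using ptime_comp[OF _ ptime_basic[where p = Fst and g = val_fst and e = f]] by auto

lemma ptime_val_snd: "ptime D N e f \<Longrightarrow> ptime D N e (\<lambda>a. val_snd (f a))"
  using ptime_comp[OF _ ptime_basic[where p = Snd and g = val_snd and e = f]] by auto

lemma ptime_is_cell: "ptime D N e f \<Longrightarrow> ptime D N e (\<lambda>a. val_is_cell (f a))"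
  using ptime_comp[OF _ ptime_basic[where p = Is_cell and g = val_is_cell and e = f]] by auto

lemma ptime_add: "ptime D N e (\<lambda>a. Atom (m a)) \<Longrightarrow> ptime D N e (\<lambda>a. Atom (n a)) \<Longrightarrow> ptime D N e (\<lambda>a. Atom (m a + n a))"
  using ptime_comp[OF ptime_Cell ptime_basic[where p = Add and g = val_add and e = "\<lambda>a. Cell (Atom (m a)) (Atom (n a))"], of D N e] by simp

lemma ptime_sub: "ptime D N e (\<lambda>a. Atom (m a)) \<Longrightarrow> ptime D N e (\<lambda>a. Atom (n a)) \<Longrightarrow> ptime D N e (\<lambda>a. Atom (m a - n a))"
  using ptime_comp[OF ptime_Cell ptime_basic[where p = Sub and g = val_sub and e = "\<lambda>a. Cell (Atom (m a)) (Atom (n a))"], of D N e] by simp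

text \<open>The machine has no variables, so an environment is a right-nested tuple: the lemmas
  \<open>ptime_v0\<close>, \<open>ptime_v1\<close>, ... read its components, and
  \<open>ptime_r1\<close>, \<open>ptime_r2\<close>, ... what remains after one, two, ...
  components.\<close>

lemma ptime_v0: "ptime D N (\<lambda>z. Cell (A z) (R z)) A" by (rule ptime_Fst[OF ptime_Id])
lemma ptime_r1: "ptime D N (\<lambda>z. Cell (A z) (R z)) R" by (rule ptime_Snd[OF ptime_Id])
lemma ptime_v1: "ptime D N (\<lambda>z. Cell (A z) (Cell (B z) (R z))) B" by (rule ptime_comp[OF ptime_r1 ptime_v0])
lemma ptime_r2: "ptime D N (\<lambda>z. Cell (A z) (Cell (B z) (R z))) R" by (rule ptime_comp[OF ptime_r1 ptime_r1])
lemma ptime_v2: "ptime D N (\<lambda>z. Cell (A z) (Cell (B z) (Cell (C z) (R z)))) C" by (rule ptime_comp[OF ptime_r2 ptime_v0])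
lemma ptime_r3: "ptime D N (\<lambda>z. Cell (A z) (Cell (B z) (Cell (C z) (R z)))) R" by (rule ptime_comp[OF ptime_r2 ptime_r1])
lemma ptime_v3: "ptime D N (\<lambda>z. Cell (A z) (Cell (B z) (Cell (C z) (Cell (F z) (R z))))) F" by (rule ptime_comp[OF ptime_r3 ptime_v0])
lemma ptime_r4: "ptime D N (\<lambda>z. Cell (A z) (Cell (B z) (Cell (C z) (Cell (F z) (R z))))) R" by (rule ptime_comp[OF ptime_r3 ptime_r1])
lemma ptime_v4: "ptime D N (\<lambda>z. Cell (A z) (Cell (B z) (Cell (C z) (Cell (F z) (Cell (G z) (R z)))))) G" by (rule ptime_comp[OF ptime_r4 ptime_v0])

lemmas ptime_vars = ptime_v0 ptime_v1 ptime_v2 ptime_v3 ptime_v4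
  ptime_r1 ptime_r2 ptime_r3 ptime_r4

lemma ptime_test:
  assumes "ptime D N e c" "\<And>a. a \<in> D \<Longrightarrow> c a = Atom 0 \<longleftrightarrow> \<not> P a"
  shows "ptime D N e (\<lambda>a. Atom (of_bool (P a)))"
proof -
  obtain p k t where 1: "\<And>a. a \<in> D \<Longrightarrow> t a \<le> (N a + 2) ^ k" "\<And>a. a \<in> D \<Longrightarrow> run p (e a) = return_spmf (c a, t a)"
    using assms(1) by (rule ptimeE) blast
  show ?thesis
  proof (rule ptimeI[where p = "Cond p (Const 1) (Const 0)" and k = "k + 0 + 2"], intro exI conjI)
    fix a assume a: "a \<in> D"
    show "t a + 1 + 1 \<le> (N a + 2) ^ (k + 0 + 2)" using 1(1)[OF a] power_sum_bounds(1)[of "N a + 2" k 0] by simp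
    show "run (Cond p (Const 1) (Const 0)) (e a) = return_spmf (Atom (of_bool (P a)), t a + 1 + 1)"
      using 1(2)[OF a] assms(2)[OF a] by simp
  qed
qed

lemma ptime_less: "ptime D N e (\<lambda>a. Atom (m a)) \<Longrightarrow> ptime D N e (\<lambda>a. Atom (n a)) \<Longrightarrow> ptime D N e (\<lambda>a. Atom (of_bool (m a < n a)))"
  by (rule ptime_test[OF ptime_sub, of D N e n m]) auto

lemma ptime_not: "ptime D N e (\<lambda>a. Atom (of_bool (P a))) \<Longrightarrow> ptime D N e (\<lambda>a. Atom (of_bool (\<not> P a)))"
  by (rule ptime_cong[OF ptime_if[OF _ ptime_const[of _ _ _ 0] ptime_const[of _ _ _ 1]]]) auto

lemma ptime_conj: 
  assumes "ptime D N e (\<lambda>a. Atom (of_bool (P a)))" "ptime D N e (\<lambda>a. Atom (of_bool (Q a)))" 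
  shows "ptime D N e (\<lambda>a. Atom (of_bool (P a \<and> Q a)))"
  by (rule ptime_cong[OF ptime_if[OF assms(1) ptime_mono[OF assms(2)] ptime_const[of _ _ _ 0]]]) auto

lemma ptime_eq: 
  assumes "ptime D N e (\<lambda>a. Atom (m a))" "ptime D N e (\<lambda>a. Atom (n a))" 
  shows "ptime D N e (\<lambda>a. Atom (of_bool (m a = n a)))"
  by (rule ptime_cong[OF ptime_conj[OF ptime_not[OF ptime_less[OF assms]] ptime_not[OF ptime_less[OF assms(2,1)]]]]) 
    (auto simp: not_less)

text \<open>The loop keeps the number of remaining rounds in front of the state and the environment
  behind it, so that the body can read the inputs.\<close>

lemma ptime_for:
  assumes n: "ptime D N e (\<lambda>a. Atom (n a))" "\<And>a. a \<in> D \<Longrightarrow> n a \<le> N a" and init: "ptime D N e (\<lambda>a. s a 0)"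
    and body: "ptime {z. fst z \<in> D \<and> snd z < n (fst z)} (\<lambda>z. N (fst z)) (\<lambda>z. Cell (s (fst z) (snd z)) (e (fst z))) (\<lambda>z. s (fst z) (Suc (snd z)))"
  shows "ptime D N e (\<lambda>a. s a (n a))"
proof -
  define S where "S a i = Cell (Atom (n a - i)) (Cell (s a i) (e a))" for a i
  have "ptime D N (\<lambda>a. S a 0) (\<lambda>a. S a (n a))"
  proof (rule ptime_while[where c = "\<lambda>a i. Atom (n a - i)"])
    show "ptime {z. fst z \<in> D \<and> snd z \<le> n (fst z)} (\<lambda>z. N (fst z)) (\<lambda>z. S (fst z) (snd z)) (\<lambda>z. Atom (n (fst z) - snd z))"
      unfolding S_def by (rule ptime_v0)
    show "ptime {z. fst z \<in> D \<and> snd z < n (fst z)} (\<lambda>z. N (fst z)) (\<lambda>z. S (fst z) (snd z)) (\<lambda>z. S (fst z) (Suc (snd z)))"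
    proof (rule ptime_cong)
      show "ptime {z. fst z \<in> D \<and> snd z < n (fst z)} (\<lambda>z. N (fst z)) (\<lambda>z. S (fst z) (snd z)) 
        (\<lambda>z. Cell (Atom (n (fst z) - snd z - 1)) (Cell (s (fst z) (Suc (snd z))) (e (fst z))))"
        unfolding S_def 
        by (intro ptime_Cell ptime_sub ptime_v0 ptime_const ptime_r2 ptime_comp[OF ptime_r1 body])
    qed (auto simp: S_def)
  qed (use n in auto)
  moreover have "ptime D N e (\<lambda>a. S a 0)" unfolding S_def
    using n(1) init by (auto intro!: ptime_Cell ptime_Id)
  ultimately have "ptime D N e (\<lambda>a. S a (n a))" by (rule ptime_comp[rotated])
  then show ?thesis unfolding S_def by (rule ptime_comp[OF _ ptime_v1])
qed

lemma ptime_funpow: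
  assumes n: "ptime D N e (\<lambda>a. Atom (n a))" "\<And>a. a \<in> D \<Longrightarrow> n a \<le> N a" and init: "ptime D N e (\<lambda>a. es a (s a))"
    and inv: "\<And>a. a \<in> D \<Longrightarrow> I a (s a)" "\<And>a x. a \<in> D \<Longrightarrow> I a x \<Longrightarrow> I a (F a x)"
    and body: "ptime {z. fst z \<in> D \<and> I (fst z) (snd z)} (\<lambda>z. N (fst z)) (\<lambda>z. Cell (es (fst z) (snd z)) (e (fst z)))
      (\<lambda>z. es (fst z) (F (fst z) (snd z)))"
  shows "ptime D N e (\<lambda>a. es a ((F a ^^ n a) (s a)))"
proof (rule ptime_for[OF n])
  show "ptime D N e (\<lambda>a. es a ((F a ^^ 0) (s a)))" using init by simp
  have inv': "I a ((F a ^^ i) (s a))" if "a \<in> D" for a i using inv that by (induction i) auto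
  show "ptime {z. fst z \<in> D \<and> snd z < n (fst z)} (\<lambda>z. N (fst z))
     (\<lambda>z. Cell (es (fst z) ((F (fst z) ^^ snd z) (s (fst z)))) (e (fst z)))
     (\<lambda>z. es (fst z) ((F (fst z) ^^ Suc (snd z)) (s (fst z))))"
    by (rule ptime_reindex[OF body, where \<pi> = "\<lambda>z. (fst z, (F (fst z) ^^ snd z) (s (fst z)))"]) (use inv' in auto)
qed

section \<open>Lists and arithmetic\<close>

lemma encode_list_Nil [simp]: "encode_list f [] = Atom 0"
  and encode_list_Cons [simp]: "encode_list f (x # xs) = Cell (f x) (encode_list f xs)"
  by (simp_all add: encode_list_def)

lemma encode_list_map [simp]: "encode_list f (map g xs) = encode_list (\<lambda>x. f (g x)) xs"
  by (induction xs) auto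

text \<open>The list is consumed cell by cell until \<open>Atom 0\<close> at its end fails the test
  \<open>val_is_cell\<close>. The invariant \<open>I\<close> restricts the states for which the body
  has to work.\<close>

lemma ptime_fold:
  assumes xs: "ptime D N e (\<lambda>a. encode_list (en a) (xs a))" "\<And>a. a \<in> D \<Longrightarrow> length (xs a) \<le> N a"
    and init: "ptime D N e (\<lambda>a. es a (s a))"
    and inv: "\<And>a. a \<in> D \<Longrightarrow> I a (s a)" "\<And>a x r. a \<in> D \<Longrightarrow> x \<in> set (xs a) \<Longrightarrow> I a r \<Longrightarrow> I a (F a x r)"
    and body: "ptime {z. fst z \<in> D \<and> fst (snd z) \<in> set (xs (fst z)) \<and> I (fst z) (snd (snd z))} (\<lambda>z. N (fst z))
      (\<lambda>z. Cell (en (fst z) (fst (snd z))) (Cell (es (fst z) (snd (snd z))) (e (fst z))))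
      (\<lambda>z. es (fst z) (F (fst z) (fst (snd z)) (snd (snd z))))"
  shows "ptime D N e (\<lambda>a. es a (fold (F a) (xs a) (s a)))"
proof -
  define st where "st a i = fold (F a) (take i (xs a)) (s a)" for a i
  have st0: "st a 0 = s a" for a by (simp add: st_def)
  have stS: "st a (Suc i) = F a (xs a ! i) (st a i)" if "i < length (xs a)" for a i
    using that by (simp add: st_def take_Suc_conv_app_nth)
  have inv': "I a (st a i)" if "a \<in> D" "i \<le> length (xs a)" for a i
    using that(2)
  proof (induction i)
    case (Suc i)
    then show ?case using inv(2)[OF that(1), of "xs a ! i" "st a i"] by (simp add: stS)
  qed (use inv that in \<open>auto simp: st0\<close>)
  define S where "S a i = Cell (encode_list (en a) (drop i (xs a))) (Cell (es a (st a i)) (e a))" for a i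
  have drp: "drop i (xs a) = xs a ! i # drop (Suc i) (xs a)" if "i < length (xs a)" for a i
    using that by (simp add: Cons_nth_drop_Suc)
  have "ptime D N (\<lambda>a. S a 0) (\<lambda>a. S a (length (xs a)))"
  proof (rule ptime_while[where c = "\<lambda>a i. val_is_cell (encode_list (en a) (drop i (xs a)))"])
    show "ptime {z. fst z \<in> D \<and> snd z \<le> length (xs (fst z))} (\<lambda>z. N (fst z)) (\<lambda>z. S (fst z) (snd z))
      (\<lambda>z. val_is_cell (encode_list (en (fst z)) (drop (snd z) (xs (fst z)))))"
      unfolding S_def by (intro ptime_is_cell ptime_v0)
    show "ptime {z. fst z \<in> D \<and> snd z < length (xs (fst z))} (\<lambda>z. N (fst z)) (\<lambda>z. S (fst z) (snd z)) (\<lambda>z. S (fst z) (Suc (snd z)))"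
    proof -
      have b: "ptime {z. fst z \<in> D \<and> snd z < length (xs (fst z))} (\<lambda>z. N (fst z)) 
        (\<lambda>z. Cell (en (fst z) (xs (fst z) ! snd z)) (Cell (es (fst z) (st (fst z) (snd z))) (e (fst z))))
        (\<lambda>z. es (fst z) (st (fst z) (Suc (snd z))))"
        by (rule ptime_reindex[OF body, where \<pi> = "\<lambda>z. (fst z, xs (fst z) ! snd z, st (fst z) (snd z))"])
          (use inv' stS in auto)
      have "ptime {z. fst z \<in> D \<and> snd z < length (xs (fst z))} (\<lambda>z. N (fst z)) 
        (\<lambda>z. Cell (Cell (en (fst z) (xs (fst z) ! snd z)) (encode_list (en (fst z)) (drop (Suc (snd z)) (xs (fst z))))) 
           (Cell (es (fst z) (st (fst z) (snd z))) (e (fst z))))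
        (\<lambda>z. S (fst z) (Suc (snd z)))"
        unfolding S_def
        by (intro ptime_Cell ptime_comp[OF ptime_v0 ptime_r1] ptime_r2
          ptime_comp[OF ptime_Cell[OF ptime_comp[OF ptime_v0 ptime_v0] ptime_r1] b])
      then show ?thesis
        by (rule ptime_reindex[where \<pi> = "\<lambda>z. z"]) (auto simp: S_def drp)
    qed
  qed (use xs drp in auto)
  moreover have "ptime D N e (\<lambda>a. S a 0)" unfolding S_def
    using xs(1) init by (auto intro!: ptime_Cell ptime_Id simp: st0)
  ultimately have "ptime D N e (\<lambda>a. S a (length (xs a)))" by (rule ptime_comp[rotated])
  then have "ptime D N e (\<lambda>a. es a (st a (length (xs a))))" unfolding S_def by (rule ptime_comp[OF _ ptime_v1])
  then show ?thesis by (simp add: st_def)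
qed

lemma ptime_rev:
  assumes xs: "ptime D N e (\<lambda>a. encode_list (en a) (xs a))" "\<And>a. a \<in> D \<Longrightarrow> length (xs a) \<le> N a"
  shows "ptime D N e (\<lambda>a. encode_list (en a) (rev (xs a)))"
proof -
  have "ptime D N e (\<lambda>a. encode_list (en a) (fold (#) (xs a) []))"
    by (rule ptime_fold[OF xs, where I = "\<lambda>_ _. True" and F = "\<lambda>_. (#)"])
      (auto intro!: ptime_const ptime_Cell ptime_vars)
  then show ?thesis by (simp add: fold_Cons_rev)
qed

text \<open>A fold that prepends builds its result backwards; a reversal, here of the result and in
  the following list lemmas of the input, restores the order.\<close>

lemma ptime_map:
  assumes xs: "ptime D N e (\<lambda>a. encode_list (en a) (xs a))" "\<And>a. a \<in> D \<Longrightarrow> length (xs a) \<le> N a"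
    and body: "ptime {z. fst z \<in> D \<and> snd z \<in> set (xs (fst z))} (\<lambda>z. N (fst z)) (\<lambda>z. Cell (en (fst z) (snd z)) (e (fst z)))
      (\<lambda>z. g (fst z) (snd z))"
  shows "ptime D N e (\<lambda>a. encode_list (g a) (xs a))"
proof -
  have "fold (\<lambda>x r. f x # r) ys zs = rev (map f ys) @ zs" for f :: "'b \<Rightarrow> val" and ys zs
    by (induction ys arbitrary: zs) auto
  then have "fold (\<lambda>x r. g a x # r) (xs a) [] = rev (map (g a) (xs a))" for a by simp
  moreover have "ptime D N e (\<lambda>a. encode_list (\<lambda>v. v) (fold (\<lambda>x r. g a x # r) (xs a) []))"
  proof (rule ptime_fold[OF xs, where I = "\<lambda>_ _. True" and es = "\<lambda>_. encode_list (\<lambda>v. v)"])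
    show "ptime D N e (\<lambda>a. encode_list (\<lambda>v. v) [])" by (simp add: ptime_const)
    have b: "ptime {z. fst z \<in> D \<and> fst (snd z) \<in> set (xs (fst z)) \<and> True} (\<lambda>z. N (fst z))
       (\<lambda>z. Cell (en (fst z) (fst (snd z))) (e (fst z))) (\<lambda>z. g (fst z) (fst (snd z)))"
      by (rule ptime_reindex[OF body, where \<pi> = "\<lambda>z. (fst z, fst (snd z))"]) auto
    show "ptime {z. fst z \<in> D \<and> fst (snd z) \<in> set (xs (fst z)) \<and> True} (\<lambda>z. N (fst z))
       (\<lambda>z. Cell (en (fst z) (fst (snd z))) (Cell (encode_list (\<lambda>v. v) (snd (snd z))) (e (fst z))))
       (\<lambda>z. encode_list (\<lambda>v. v) (g (fst z) (fst (snd z)) # snd (snd z)))"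
      unfolding encode_list_Cons
      by (intro ptime_Cell ptime_v1 ptime_comp[OF ptime_Cell[OF ptime_v0 ptime_r2] b])
  qed auto
  ultimately have "ptime D N e (\<lambda>a. encode_list (\<lambda>v. v) (rev (map (g a) (xs a))))" by simp
  then have "ptime D N e (\<lambda>a. encode_list (\<lambda>v. v) (rev (rev (map (g a) (xs a)))))" by (rule ptime_rev) (use xs in auto)
  then show ?thesis by simp
qed

lemma ptime_append:
  assumes xs: "ptime D N e (\<lambda>a. encode_list (en a) (xs a))" "\<And>a. a \<in> D \<Longrightarrow> length (xs a) \<le> N a"
    and ys: "ptime D N e (\<lambda>a. encode_list (en a) (ys a))"
  shows "ptime D N e (\<lambda>a. encode_list (en a) (xs a @ ys a))"
proof -
  have "ptime D N e (\<lambda>a. encode_list (en a) (fold (#) (rev (xs a)) (ys a)))"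
  proof (rule ptime_fold[where I = "\<lambda>_ _. True" and F = "\<lambda>_. (#)" and es = "\<lambda>a. encode_list (en a)"])
    show "ptime D N e (\<lambda>a. encode_list (en a) (rev (xs a)))" using xs by (rule ptime_rev)
  qed (use xs ys in \<open>auto intro!: ptime_Cell ptime_vars\<close>)
  then show ?thesis by (simp add: fold_Cons_rev)
qed

lemma ptime_concat_map:
  assumes xs: "ptime D N e (\<lambda>a. encode_list (en a) (xs a))" "\<And>a. a \<in> D \<Longrightarrow> length (xs a) \<le> N a"
    and len: "\<And>a x. a \<in> D \<Longrightarrow> x \<in> set (xs a) \<Longrightarrow> length (g a x) \<le> N a"
    and body: "ptime {z. fst z \<in> D \<and> snd z \<in> set (xs (fst z))} (\<lambda>z. N (fst z)) (\<lambda>z. Cell (en (fst z) (snd z)) (e (fst z)))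
      (\<lambda>z. encode_list (en' (fst z)) (g (fst z) (snd z)))"
  shows "ptime D N e (\<lambda>a. encode_list (en' a) (concat (map (g a) (xs a))))"
proof -
  have f: "fold (\<lambda>x r. f x @ r) ys zs = concat (map f (rev ys)) @ zs" for f :: "'b \<Rightarrow> 'c list" and ys zs
    by (induction ys arbitrary: zs) auto
  have "ptime D N e (\<lambda>a. encode_list (en' a) (fold (\<lambda>x r. g a x @ r) (rev (xs a)) []))"
  proof (rule ptime_fold[OF ptime_rev[OF xs], where I = "\<lambda>_ _. True"])
    show "ptime D N e (\<lambda>a. encode_list (en' a) [])" by (simp add: ptime_const)
    have b: "ptime {z. fst z \<in> D \<and> fst (snd z) \<in> set (rev (xs (fst z))) \<and> True} (\<lambda>z. N (fst z))
       (\<lambda>z. Cell (en (fst z) (fst (snd z))) (e (fst z))) (\<lambda>z. encode_list (en' (fst z)) (g (fst z) (fst (snd z))))"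
      by (rule ptime_reindex[OF body, where \<pi> = "\<lambda>z. (fst z, fst (snd z))"]) auto
    show "ptime {z. fst z \<in> D \<and> fst (snd z) \<in> set (rev (xs (fst z))) \<and> True} (\<lambda>z. N (fst z))
       (\<lambda>z. Cell (en (fst z) (fst (snd z))) (Cell (encode_list (en' (fst z)) (snd (snd z))) (e (fst z))))
       (\<lambda>z. encode_list (en' (fst z)) (g (fst z) (fst (snd z)) @ snd (snd z)))"
      by (intro ptime_append ptime_v1 ptime_comp[OF ptime_Cell[OF ptime_v0 ptime_r2] b]) (use len in auto)
  qed (use xs in auto)
  then show ?thesis by (simp add: f)
qed

lemma ptime_filter:
  assumes xs: "ptime D N e (\<lambda>a. encode_list (en a) (xs a))" "\<And>a. a \<in> D \<Longrightarrow> length (xs a) \<le> N a"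
    and body: "ptime {z. fst z \<in> D \<and> snd z \<in> set (xs (fst z))} (\<lambda>z. N (fst z)) (\<lambda>z. Cell (en (fst z) (snd z)) (e (fst z)))
      (\<lambda>z. Atom (of_bool (P (fst z) (snd z))))"
  shows "ptime D N e (\<lambda>a. encode_list (en a) (filter (P a) (xs a)))"
proof -
  have f: "fold (\<lambda>x r. if P x then x # r else r) ys zs = filter P (rev ys) @ zs" for P and ys zs :: "'b list"
    by (induction ys arbitrary: zs) auto
  have "ptime D N e (\<lambda>a. encode_list (en a) (fold (\<lambda>x r. if P a x then x # r else r) (rev (xs a)) []))"
  proof (rule ptime_fold[OF ptime_rev[OF xs], where I = "\<lambda>_ _. True"])
    show "ptime D N e (\<lambda>a. encode_list (en a) [])" by (simp add: ptime_const)
    have b: "ptime {z. fst z \<in> D \<and> fst (snd z) \<in> set (rev (xs (fst z))) \<and> True} (\<lambda>z. N (fst z))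
       (\<lambda>z. Cell (en (fst z) (fst (snd z))) (e (fst z))) (\<lambda>z. Atom (of_bool (P (fst z) (fst (snd z)))))"
      by (rule ptime_reindex[OF body, where \<pi> = "\<lambda>z. (fst z, fst (snd z))"]) auto
    have "ptime {z. fst z \<in> D \<and> fst (snd z) \<in> set (rev (xs (fst z))) \<and> True} (\<lambda>z. N (fst z))
       (\<lambda>z. Cell (en (fst z) (fst (snd z))) (Cell (encode_list (en (fst z)) (snd (snd z))) (e (fst z))))
       (\<lambda>z. if P (fst z) (fst (snd z)) then Cell (en (fst z) (fst (snd z))) (encode_list (en (fst z)) (snd (snd z)))
            else encode_list (en (fst z)) (snd (snd z)))"
      by (intro ptime_if ptime_Cell ptime_v0 ptime_v1 ptime_comp[OF ptime_Cell[OF ptime_v0 ptime_r2] b])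
    then show "ptime {z. fst z \<in> D \<and> fst (snd z) \<in> set (rev (xs (fst z))) \<and> True} (\<lambda>z. N (fst z))
       (\<lambda>z. Cell (en (fst z) (fst (snd z))) (Cell (encode_list (en (fst z)) (snd (snd z))) (e (fst z))))
       (\<lambda>z. encode_list (en (fst z)) (if P (fst z) (fst (snd z)) then fst (snd z) # snd (snd z) else snd (snd z)))"
      by (rule ptime_cong) auto
  qed (use xs in auto)
  then show ?thesis by (simp add: f)
qed

lemma ptime_sum_list:
  assumes xs: "ptime D N e (\<lambda>a. encode_list (en a) (xs a))" "\<And>a. a \<in> D \<Longrightarrow> length (xs a) \<le> N a"
    and body: "ptime {z. fst z \<in> D \<and> snd z \<in> set (xs (fst z))} (\<lambda>z. N (fst z)) (\<lambda>z. Cell (en (fst z) (snd z)) (e (fst z)))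
      (\<lambda>z. Atom (f (fst z) (snd z)))"
  shows "ptime D N e (\<lambda>a. Atom (\<Sum>x\<leftarrow>xs a. f a x))"
proof -
  have f: "fold (\<lambda>x r. f x + r) ys z = (\<Sum>y\<leftarrow>ys. f y) + z" for f and ys :: "'b list" and z :: nat
    by (induction ys arbitrary: z) auto
  have "ptime D N e (\<lambda>a. Atom (fold (\<lambda>x r. f a x + r) (xs a) 0))"
  proof (rule ptime_fold[OF xs, where I = "\<lambda>_ _. True" and es = "\<lambda>_. Atom"])
    have b: "ptime {z. fst z \<in> D \<and> fst (snd z) \<in> set (xs (fst z)) \<and> True} (\<lambda>z. N (fst z))
       (\<lambda>z. Cell (en (fst z) (fst (snd z))) (e (fst z))) (\<lambda>z. Atom (f (fst z) (fst (snd z))))"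
      by (rule ptime_reindex[OF body, where \<pi> = "\<lambda>z. (fst z, fst (snd z))"]) auto
    show "ptime {z. fst z \<in> D \<and> fst (snd z) \<in> set (xs (fst z)) \<and> True} (\<lambda>z. N (fst z))
       (\<lambda>z. Cell (en (fst z) (fst (snd z))) (Cell (Atom (snd (snd z))) (e (fst z))))
       (\<lambda>z. Atom (f (fst z) (fst (snd z)) + snd (snd z)))"
      by (intro ptime_add ptime_v1 ptime_comp[OF ptime_Cell[OF ptime_v0 ptime_r2] b])
  qed (auto intro: ptime_const)
  then show ?thesis by (simp add: f)
qed

text \<open>Repeated addition. Only the second factor is a number of rounds and has to stay within
  the budget; the first may be exponentially large. Parameters such as \<open>grid_size\<close> have
  their constant factor last for this reason.\<close>

lemma ptime_mult:
  assumes m: "ptime D N e (\<lambda>a. Atom (m a))" and n: "ptime D N e (\<lambda>a. Atom (n a))" "\<And>a. a \<in> D \<Longrightarrow> n a \<le> N a"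
  shows "ptime D N e (\<lambda>a. Atom (m a * n a))"
proof (rule ptime_comp[OF ptime_Cell[OF m n(1)]])
  have "ptime D N (\<lambda>a. Cell (Atom (m a)) (Atom (n a))) (\<lambda>a. Atom (((\<lambda>s. s + m a) ^^ n a) 0))"
    by (rule ptime_funpow[where I = "\<lambda>_ _. True" and es = "\<lambda>_. Atom"])
      (auto intro!: ptime_vars ptime_const ptime_add n(2))
  moreover have "((\<lambda>s. s + k) ^^ i) 0 = k * i" for i k :: nat by (induction i) auto
  ultimately show "ptime D N (\<lambda>a. Cell (Atom (m a)) (Atom (n a))) (\<lambda>a. Atom (m a * n a))" by simp
qed

lemma ptime_power:
  assumes m: "ptime D N e (\<lambda>a. Atom (m a))" "\<And>a. a \<in> D \<Longrightarrow> m a \<le> N a" 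
    and n: "ptime D N e (\<lambda>a. Atom (n a))" "\<And>a. a \<in> D \<Longrightarrow> n a \<le> N a"
  shows "ptime D N e (\<lambda>a. Atom (m a ^ n a))"
proof (rule ptime_comp[OF ptime_Cell[OF m(1) n(1)]])
  have "ptime D N (\<lambda>a. Cell (Atom (m a)) (Atom (n a))) (\<lambda>a. Atom (((\<lambda>s. s * m a) ^^ n a) 1))"
    by (rule ptime_funpow[where I = "\<lambda>_ _. True" and es = "\<lambda>_. Atom"])
      (auto intro!: ptime_vars ptime_const ptime_mult m(2) n(2))
  moreover have "((\<lambda>s. s * k) ^^ i) 1 = k ^ i" for i k :: nat by (induction i) auto
  ultimately show "ptime D N (\<lambda>a. Cell (Atom (m a)) (Atom (n a))) (\<lambda>a. Atom (m a ^ n a))" by simp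
qed

section \<open>Programs for the recursion\<close>

text \<open>As search rules, these two and \<open>ptime_Id\<close> find the path to a component of
  an environment of any shape.\<close>

lemma ptime_proj_fst: "ptime D N A f \<Longrightarrow> ptime D N (\<lambda>z. Cell (A z) (R z)) f"
  by (rule ptime_comp[OF ptime_v0])

lemma ptime_proj_snd: "ptime D N R f \<Longrightarrow> ptime D N (\<lambda>z. Cell (A z) (R z)) f"
  by (rule ptime_comp[OF ptime_r1])

lemmas ptime_proj = ptime_Id ptime_proj_fst ptime_proj_snd

abbreviation (input) enc_spin :: "nat list \<Rightarrow> val" where "enc_spin \<equiv> encode_list Atom"

definition neighbor_list :: "nat set set \<Rightarrow> nat \<Rightarrow> nat list" where
  "neighbor_list E u = sorted_list_of_set {w. {w, u} \<in> E}"

text \<open>A vertex carries its neighbors, its spins and its pins, so the graph and the lists need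
  no separate encoding. The neighbor list is that of the whole graph; a deleted vertex merely
  vanishes from the list of entries.\<close>

definition enc_entry :: "nat set set \<Rightarrow> (nat \<Rightarrow> nat list list) \<Rightarrow> (nat \<Rightarrow> nat list list) \<Rightarrow> nat \<Rightarrow> val" where
  "enc_entry E B C u = Cell (Atom u) (Cell (enc_spin (neighbor_list E u)) (Cell (encode_list enc_spin (B u)) (encode_list enc_spin (C u))))"

definition enc_pair :: "nat list \<times> nat \<Rightarrow> val" where
  "enc_pair p = Cell (enc_spin (fst p)) (Atom (snd p))"

definition enc_key :: "key \<Rightarrow> val" where
  "enc_key k = Cell (enc_spin (fst k)) (Cell (enc_spin (fst (snd k))) (Atom (snd (snd k))))"

definition enc_item :: "item \<Rightarrow> val" where
  "enc_item i = Cell (enc_spin (fst i)) (Cell (enc_spin (fst (snd i))) (Cell (Atom (fst (snd (snd i)))) (Atom (snd (snd (snd i))))))"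

definition enc_node :: "nat set set \<Rightarrow> (nat \<Rightarrow> nat list list) \<Rightarrow> node \<Rightarrow> val" where
  "enc_node E B n = Cell (encode_list (enc_entry E B (fst (snd n))) (fst n))
     (Cell (Atom (fst (snd (snd n)))) (Atom (snd (snd (snd n)))))"

text \<open>A power may be exponentially large, too large for the second factor in
  \<open>ptime_mult\<close>, so it is multiplied into \<open>m a\<close> one factor at a
  time.\<close>

lemma ptime_mult_power:
  assumes m: "ptime D N e (\<lambda>a. Atom (m a))" and b: "ptime D N e (\<lambda>a. Atom (b a))" "\<And>a. a \<in> D \<Longrightarrow> b a \<le> N a"
    and n: "ptime D N e (\<lambda>a. Atom (n a))" "\<And>a. a \<in> D \<Longrightarrow> n a \<le> N a"
  shows "ptime D N e (\<lambda>a. Atom (m a * b a ^ n a))"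
proof (rule ptime_comp[OF ptime_Cell[OF m ptime_Cell[OF b(1) n(1)]]])
  have "ptime D N (\<lambda>a. Cell (Atom (m a)) (Cell (Atom (b a)) (Atom (n a)))) (\<lambda>a. Atom (((\<lambda>s. s * b a) ^^ n a) (m a)))"
    by (rule ptime_funpow[where I = "\<lambda>_ _. True" and es = "\<lambda>_. Atom"])
      (auto intro!: ptime_vars ptime_const ptime_mult b(2) n(2))
  moreover have "((\<lambda>s. s * k) ^^ i) j = j * k ^ i" for i j k :: nat by (induction i) auto
  ultimately show "ptime D N (\<lambda>a. Cell (Atom (m a)) (Cell (Atom (b a)) (Atom (n a)))) (\<lambda>a. Atom (m a * b a ^ n a))" by simp
qed

text \<open>The projections return \<open>Atom 0\<close> on leaves, hence the default value 0 for the empty list.\<close>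

definition hd0 :: "nat list \<Rightarrow> nat" where "hd0 xs = (case xs of [] \<Rightarrow> 0 | x # _ \<Rightarrow> x)"

lemma val_fst_es: "val_fst (enc_spin xs) = Atom (hd0 xs)" by (cases xs) (auto simp: hd0_def)
lemma val_snd_encode_list: "val_snd (encode_list f xs) = encode_list f (tl xs)" by (cases xs) auto

lemma agreements_Cons: "agreements (c # x) (d # y) = of_bool (c = d) + agreements x y"
  unfolding agreements_def by (simp add: sum.lessThan_Suc_shift del: sum.lessThan_Suc)

text \<open>A loop over \<open>x a\<close> removes the head of \<open>y a\<close> in each round and
  counts; equal lengths keep the two lists in step.\<close>

lemma ptime_agreements:
  assumes x: "ptime D N e (\<lambda>a. enc_spin (x a))" and y: "ptime D N e (\<lambda>a. enc_spin (y a))"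
    and len: "\<And>a. a \<in> D \<Longrightarrow> length (x a) \<le> N a \<and> length (y a) = length (x a)"
  shows "ptime D N e (\<lambda>a. Atom (agreements (x a) (y a)))"
proof -
  define F where "F c p = (tl (fst p), snd p + of_bool (c = hd0 (fst p)))" for c :: nat and p :: "nat list \<times> nat"
  have F: "length ys = length xs \<Longrightarrow> snd (fold F xs (ys, n)) = n + agreements xs ys" for xs ys n
  proof (induction xs arbitrary: ys n)
    case (Cons c xs)
    then obtain d ys' where "ys = d # ys'" by (cases ys) auto
    then show ?case using Cons by (simp add: F_def hd0_def agreements_Cons)
  qed (simp add: agreements_def)
  have "ptime D N e (\<lambda>a. enc_pair (fold F (x a) (y a, 0)))"
  proof (rule ptime_fold[OF x, where I = "\<lambda>_ _. True" and es = "\<lambda>_. enc_pair"])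
    show "ptime D N e (\<lambda>a. enc_pair (y a, 0))"
      unfolding enc_pair_def by (auto intro!: ptime_Cell y ptime_const)
    show "ptime {z. fst z \<in> D \<and> fst (snd z) \<in> set (x (fst z)) \<and> True} (\<lambda>z. N (fst z))
     (\<lambda>z. Cell (Atom (fst (snd z))) (Cell (enc_pair (snd (snd z))) (e (fst z))))
     (\<lambda>z. enc_pair (F (fst (snd z)) (snd (snd z))))"
    proof (rule ptime_cong[where f = "\<lambda>z. Cell (val_snd (enc_spin (fst (snd (snd z))))) (Atom (snd (snd (snd z)) + of_bool (fst (snd z) = hd0 (fst (snd (snd z))))))"])
      have *: "ptime A N' (\<lambda>z. Cell (Atom (fst (snd z))) (Cell (enc_pair (snd (snd z))) (e (fst z))))
          (\<lambda>z. Atom (hd0 (fst (snd (snd z)))))" for A N'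
        unfolding val_fst_es[symmetric] enc_pair_def by (rule ptime_val_fst) (fast intro: ptime_proj)
      show "ptime {z. fst z \<in> D \<and> fst (snd z) \<in> set (x (fst z)) \<and> True} (\<lambda>z. N (fst z))
       (\<lambda>z. Cell (Atom (fst (snd z))) (Cell (enc_pair (snd (snd z))) (e (fst z))))
       (\<lambda>z. Cell (val_snd (enc_spin (fst (snd (snd z))))) (Atom (snd (snd (snd z)) + of_bool (fst (snd z) = hd0 (fst (snd (snd z)))))))"
        by (intro ptime_Cell ptime_val_snd ptime_add ptime_eq *; (unfold enc_pair_def)?; fast intro: ptime_proj)
    qed (simp add: F_def enc_pair_def val_snd_encode_list)
  qed (use len in auto)
  then have "ptime D N e (\<lambda>a. Atom (snd (fold F (x a) (y a, 0))))" unfolding enc_pair_def by (rule ptime_Snd)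
  then show ?thesis by (rule ptime_cong) (use F len in auto)
qed

lemma ptime_ball_agreements:
  assumes x: "ptime D N e (\<lambda>a. enc_spin (x a))" and cs: "ptime D N e (\<lambda>a. encode_list enc_spin (cs a))"
    and len: "\<And>a. a \<in> D \<Longrightarrow> length (x a) \<le> N a \<and> length (cs a) \<le> N a"
    "\<And>a c. a \<in> D \<Longrightarrow> c \<in> set (cs a) \<Longrightarrow> length c = length (x a)"
  shows "ptime D N e (\<lambda>a. Atom (of_bool (\<forall>c\<in>set (cs a). agreements (x a) c = 0)))"
proof (rule ptime_comp[OF ptime_Cell[OF x cs]])
  have "ptime D N (\<lambda>a. Cell (enc_spin (x a)) (encode_list enc_spin (cs a))) (\<lambda>a. Atom (\<Sum>c\<leftarrow>cs a. agreements (x a) c))"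
    by (rule ptime_sum_list[where en = "\<lambda>_. enc_spin"]) (auto intro!: ptime_vars ptime_agreements simp: len)
  then show "ptime D N (\<lambda>a. Cell (enc_spin (x a)) (encode_list enc_spin (cs a))) (\<lambda>a. Atom (of_bool (\<forall>c\<in>set (cs a). agreements (x a) c = 0)))"
    using ptime_not[OF ptime_test, of D N _ "\<lambda>a. Atom (\<Sum>c\<leftarrow>cs a. agreements (x a) c)" "\<lambda>a. \<not> (\<forall>c\<in>set (cs a). agreements (x a) c = 0)"]
    by auto
qed

lemma ptime_member:
  assumes x: "ptime D N e (\<lambda>a. Atom (x a))" and xs: "ptime D N e (\<lambda>a. enc_spin (xs a))"
    and len: "\<And>a. a \<in> D \<Longrightarrow> length (xs a) \<le> N a"
  shows "ptime D N e (\<lambda>a. Atom (of_bool (x a \<in> set (xs a))))"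
proof (rule ptime_comp[OF ptime_Cell[OF x xs]])
  have "ptime D N (\<lambda>a. Cell (Atom (x a)) (enc_spin (xs a))) (\<lambda>a. Atom (\<Sum>w\<leftarrow>xs a. of_bool (w = x a)))"
    by (rule ptime_sum_list[where en = "\<lambda>_. Atom"]) (auto intro!: ptime_vars ptime_eq simp: len)
  then show "ptime D N (\<lambda>a. Cell (Atom (x a)) (enc_spin (xs a))) (\<lambda>a. Atom (of_bool (x a \<in> set (xs a))))"
    by (rule ptime_test) auto
qed

definition entry_ok :: "nat \<Rightarrow> nat \<Rightarrow> nat \<Rightarrow> nat set set \<Rightarrow> (nat \<Rightarrow> nat list list) \<Rightarrow> (nat \<Rightarrow> nat list list) \<Rightarrow> nat \<Rightarrow> bool" where
  "entry_ok q n c E B C u \<longleftrightarrow> length (neighbor_list E u) \<le> n \<and> set (neighbor_list E u) = {w. {w, u} \<in> E} \<and>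
     length (B u) \<le> n \<and> (\<forall>x\<in>set (B u). length x = q) \<and> length (C u) \<le> c \<and> (\<forall>x\<in>set (C u). length x = q)"

lemma ptime_adjacent:
  assumes v: "ptime D N e (\<lambda>a. Atom (v a))" and xs: "ptime D N e (\<lambda>a. enc_spin (neighbor_list (E a) (u a)))"
    and ok: "\<And>a. a \<in> D \<Longrightarrow> entry_ok q (N a) (N a) (E a) (B a) (C a) (u a)"
  shows "ptime D N e (\<lambda>a. Atom (of_bool ({v a, u a} \<in> E a)))"
  by (rule ptime_cong[OF ptime_member[OF v xs]]) (use ok in \<open>auto simp: entry_ok_def\<close>)

lemma ptime_pin:
  assumes inst: "ptime D N e (\<lambda>a. encode_list (enc_entry (E a) (B a) (C a)) (vs a))" 
    and v: "ptime D N e (\<lambda>a. Atom (v a))" and x: "ptime D N e (\<lambda>a. enc_spin (x a))"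
    and len: "\<And>a. a \<in> D \<Longrightarrow> length (vs a) \<le> N a"
    and ok: "\<And>a u. a \<in> D \<Longrightarrow> u \<in> set (vs a) \<Longrightarrow> entry_ok q (N a) (N a) (E a) (B a) (C a) u"
  shows "ptime D N e (\<lambda>a. encode_list (enc_entry (E a) (B a) (pin (E a) (v a) (x a) (C a))) (vs a))"
proof (rule ptime_comp[OF ptime_Cell[OF inst ptime_Cell[OF v x]]], rule ptime_map[OF ptime_v0 len])
  let ?A = "{z. fst z \<in> D \<and> snd z \<in> set (vs (fst z))}"
  let ?e = "\<lambda>z. Cell (enc_entry (E (fst z)) (B (fst z)) (C (fst z)) (snd z))
             (Cell (encode_list (enc_entry (E (fst z)) (B (fst z)) (C (fst z))) (vs (fst z))) (Cell (Atom (v (fst z))) (enc_spin (x (fst z)))))"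
  have 1: "ptime ?A (\<lambda>z. N (fst z)) ?e (\<lambda>z. Atom (of_bool ({v (fst z), snd z} \<in> E (fst z))))"
    by (rule ptime_adjacent[where q = q and B = "\<lambda>z. B (fst z)" and C = "\<lambda>z. C (fst z)"]; (unfold enc_entry_def)?)
      (use ok in \<open>fast intro: ptime_proj\<close>)+
  have "ptime ?A (\<lambda>z. N (fst z)) ?e (\<lambda>z. Cell (Atom (snd z)) (Cell (enc_spin (neighbor_list (E (fst z)) (snd z)))
      (Cell (encode_list enc_spin (B (fst z) (snd z))) 
       (if {v (fst z), snd z} \<in> E (fst z) then Cell (enc_spin (x (fst z))) (encode_list enc_spin (C (fst z) (snd z))) else encode_list enc_spin (C (fst z) (snd z))))))"
    by (intro ptime_Cell ptime_if 1; (unfold enc_entry_def)?; fast intro: ptime_proj)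
  then show "ptime ?A (\<lambda>z. N (fst z)) ?e
     (\<lambda>z. enc_entry (E (fst z)) (B (fst z)) (pin (E (fst z)) (v (fst z)) (x (fst z)) (C (fst z))) (snd z))"
    by (rule ptime_cong) (auto simp: enc_entry_def pin_def)
qed

lemma ptime_pin_split:
  assumes inst: "ptime D N e (\<lambda>a. encode_list (enc_entry (E a) (B a) (C a)) (vs a))" 
    and v: "ptime D N e (\<lambda>a. Atom (v a))" and s: "ptime D N e (\<lambda>a. enc_spin (s a))" and t: "ptime D N e (\<lambda>a. enc_spin (t a))"
    and u: "ptime D N e (\<lambda>a. Atom (u a))"
    and len: "\<And>a. a \<in> D \<Longrightarrow> length (vs a) \<le> N a"
    and ok: "\<And>a u. a \<in> D \<Longrightarrow> u \<in> set (vs a) \<Longrightarrow> entry_ok q (N a) (N a) (E a) (B a) (C a) u"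
  shows "ptime D N e (\<lambda>a. encode_list (enc_entry (E a) (B a) (pin_split (E a) (v a) (s a) (t a) (u a) (C a))) (vs a))"
proof (rule ptime_comp[OF ptime_Cell[OF inst ptime_Cell[OF v ptime_Cell[OF s ptime_Cell[OF t u]]]]], rule ptime_map[OF ptime_v0 len])
  let ?A = "{z. fst z \<in> D \<and> snd z \<in> set (vs (fst z))}"
  let ?e = "\<lambda>z. Cell (enc_entry (E (fst z)) (B (fst z)) (C (fst z)) (snd z))
             (Cell (encode_list (enc_entry (E (fst z)) (B (fst z)) (C (fst z))) (vs (fst z))) (Cell (Atom (v (fst z))) 
             (Cell (enc_spin (s (fst z))) (Cell (enc_spin (t (fst z))) (Atom (u (fst z)))))))"
  have 1: "ptime ?A (\<lambda>z. N (fst z)) ?e (\<lambda>z. Atom (of_bool ({v (fst z), snd z} \<in> E (fst z))))"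
    by (rule ptime_adjacent[where q = q and B = "\<lambda>z. B (fst z)" and C = "\<lambda>z. C (fst z)"]; (unfold enc_entry_def)?)
      (use ok in \<open>fast intro: ptime_proj\<close>)+
  have "ptime ?A (\<lambda>z. N (fst z)) ?e (\<lambda>z. Cell (Atom (snd z)) (Cell (enc_spin (neighbor_list (E (fst z)) (snd z)))
      (Cell (encode_list enc_spin (B (fst z) (snd z))) 
       (if {v (fst z), snd z} \<in> E (fst z) then 
         (if snd z < u (fst z) then Cell (enc_spin (s (fst z))) (encode_list enc_spin (C (fst z) (snd z)))
          else (if u (fst z) < snd z then Cell (enc_spin (t (fst z))) (encode_list enc_spin (C (fst z) (snd z)))
          else encode_list enc_spin (C (fst z) (snd z))))
        else encode_list enc_spin (C (fst z) (snd z))))))"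
    by (intro ptime_Cell ptime_if 1 ptime_less; (unfold enc_entry_def)?; fast intro: ptime_proj)
  then show "ptime ?A (\<lambda>z. N (fst z)) ?e
     (\<lambda>z. enc_entry (E (fst z)) (B (fst z)) (pin_split (E (fst z)) (v (fst z)) (s (fst z)) (t (fst z)) (u (fst z)) (C (fst z))) (snd z))"
    by (rule ptime_cong) (auto simp: enc_entry_def pin_split_def)
qed

lemma ptime_grid_weight:
  assumes "ptime D N e (\<lambda>a. Atom (M a))" "ptime D N e (\<lambda>a. Atom (H a))" "ptime D N e (\<lambda>a. Atom (k a))"
    and b: "\<And>a. a \<in> D \<Longrightarrow> M a + 1 \<le> N a \<and> H a \<le> N a"
  shows "ptime D N e (\<lambda>a. Atom (grid_weight (M a) (H a) (k a)))"
proof -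
  have "ptime D N e (\<lambda>a. if k a < H a then Atom (k a) else Atom (H a))"
    by (rule ptime_if[OF ptime_less[OF assms(3,2)] ptime_mono[OF assms(3)] ptime_mono[OF assms(2)]]) auto
  then have m: "ptime D N e (\<lambda>a. Atom (min (k a) (H a)))" by (rule ptime_cong) auto
  have "ptime D N e (\<lambda>a. Atom (1 * (M a + 1) ^ min (k a) (H a)))"
    by (rule ptime_mult_power[OF ptime_const ptime_add[OF assms(1) ptime_const] _ m]) (use b in \<open>auto simp: min_le_iff_disj\<close>)
  then have "ptime D N e (\<lambda>a. Atom ((1 * (M a + 1) ^ min (k a) (H a)) * M a ^ (H a - k a)))"
    by (rule ptime_mult_power[OF _ assms(1) _ ptime_sub[OF assms(2,3)]]) (use b in fastforce)+
  then show ?thesis by (simp add: grid_weight_def)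
qed

lemma ptime_grid_log:
  assumes "ptime D N e (\<lambda>a. Atom (M a))" "ptime D N e (\<lambda>a. Atom (T a))" "ptime D N e (\<lambda>a. Atom (X a))" "ptime D N e (\<lambda>a. Atom (Y a))"
    and b: "\<And>a. a \<in> D \<Longrightarrow> M a + 1 \<le> N a \<and> T a \<le> N a"
  shows "ptime D N e (\<lambda>a. Atom (grid_log (M a) (T a) (X a) (Y a)))"
proof (rule ptime_comp[OF ptime_Cell[OF assms(1) ptime_Cell[OF assms(2) ptime_Cell[OF assms(3,4)]]]])
  let ?e = "\<lambda>a. Cell (Atom (M a)) (Cell (Atom (T a)) (Cell (Atom (X a)) (Atom (Y a))))"
  define et where "et p = Cell (Atom (fst p)) (Cell (Atom (fst (snd p))) (Atom (snd (snd p))))" for p :: "nat \<times> nat \<times> nat"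
  have "ptime D N ?e (\<lambda>a. et ((grid_log_step (M a) ^^ T a) (X a, Y a, 0)))"
  proof (rule ptime_funpow[where I = "\<lambda>_ _. True" and es = "\<lambda>_. et"])
    show "ptime D N ?e (\<lambda>a. et (X a, Y a, 0))" unfolding et_def fst_conv snd_conv
      by (intro ptime_Cell ptime_const; fast intro: ptime_proj)
    let ?e' = "\<lambda>z. Cell (et (snd z)) (?e (fst z))"
    have 1: "ptime (A \<inter> {z. fst z \<in> D}) (\<lambda>z. N (fst z)) ?e' (\<lambda>z. Atom (fst (snd z) * M (fst z)))" for A
      unfolding et_def by (rule ptime_mult, fast intro: ptime_proj, fast intro: ptime_proj) (use b in force)
    have 2: "ptime (A \<inter> {z. fst z \<in> D}) (\<lambda>z. N (fst z)) ?e' (\<lambda>z. Atom (fst (snd (snd z)) * (M (fst z) + 1)))" for A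
      unfolding et_def by (rule ptime_mult[OF _ ptime_add[OF _ ptime_const]], fast intro: ptime_proj, fast intro: ptime_proj) (use b in force)
    have "ptime {z. fst z \<in> D \<and> True} (\<lambda>z. N (fst z)) ?e'
     (\<lambda>z. if fst (snd (snd z)) < fst (snd z) 
       then Cell (Atom (fst (snd z) * M (fst z))) (Cell (Atom (fst (snd (snd z)) * (M (fst z) + 1))) (Atom (snd (snd (snd z)) + 1)))
       else Cell (Atom (fst (snd z))) (Cell (Atom (fst (snd (snd z)))) (Atom (snd (snd (snd z))))))"
      by (intro ptime_if ptime_less ptime_Cell ptime_add ptime_const ptime_mono[OF 1[of UNIV]] ptime_mono[OF 2[of UNIV]]; (unfold et_def)?; (fast intro: ptime_proj | auto))
    then show "ptime {z. fst z \<in> D \<and> True} (\<lambda>z. N (fst z)) ?e' (\<lambda>z. et (grid_log_step (M (fst z)) (snd z)))"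
      by (rule ptime_cong) (auto simp: et_def grid_log_step_def split: prod.split)
  qed (use b in \<open>auto intro: ptime_vars\<close>)
  then show "ptime D N ?e (\<lambda>a. Atom (grid_log (M a) (T a) (X a) (Y a)))"
    unfolding et_def grid_log_def by (rule ptime_comp[OF _ ptime_r2])
qed


lemma ptime_if_Atom:
  assumes "ptime D N e (\<lambda>a. Atom (of_bool (P a)))" "ptime {a \<in> D. P a} N e (\<lambda>a. Atom (f a))" "ptime {a \<in> D. \<not> P a} N e (\<lambda>a. Atom (g a))"
  shows "ptime D N e (\<lambda>a. Atom (if P a then f a else g a))"
  by (rule ptime_cong[OF ptime_if[OF assms]]) auto

lemma ptime_max:
  assumes "ptime D N e (\<lambda>a. Atom (m a))" "ptime D N e (\<lambda>a. Atom (n a))"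
  shows "ptime D N e (\<lambda>a. Atom (max (m a) (n a)))"
  by (rule ptime_cong[OF ptime_if[OF ptime_less[OF assms] ptime_mono[OF assms(2)] ptime_mono[OF assms(1)]]]) auto

definition values_ok :: "nat \<Rightarrow> nat \<Rightarrow> spin_values \<Rightarrow> bool" where
  "values_ok q n ys \<longleftrightarrow> length ys \<le> n \<and> (\<forall>p\<in>set ys. length (fst p) = q)"

lemma ptime_wsum:
  assumes M: "ptime D N e (\<lambda>a. Atom (M a))" and H: "ptime D N e (\<lambda>a. Atom (H a))" and s: "ptime D N e (\<lambda>a. enc_spin (s a))"
    and ys: "ptime D N e (\<lambda>a. encode_list enc_pair (ys a))"
    and b: "\<And>a. a \<in> D \<Longrightarrow> M a + 1 \<le> N a \<and> H a \<le> N a \<and> values_ok q (N a) (ys a) \<and> length (s a) = q \<and> q \<le> N a"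
  shows "ptime D N e (\<lambda>a. Atom (wsum (M a) (H a) (s a) (ys a)))"
proof (rule ptime_comp[OF ptime_Cell[OF ys ptime_Cell[OF s ptime_Cell[OF M H]]]])
  let ?e = "\<lambda>a. Cell (encode_list enc_pair (ys a)) (Cell (enc_spin (s a)) (Cell (Atom (M a)) (Atom (H a))))"
  let ?A = "{z. fst z \<in> D \<and> snd z \<in> set (ys (fst z))}"
  let ?e' = "\<lambda>z. Cell (enc_pair (snd z)) (?e (fst z))"
  have 1: "ptime ?A (\<lambda>z. N (fst z)) ?e' (\<lambda>z. Atom (agreements (fst (snd z)) (s (fst z))))"
    unfolding enc_pair_def by (rule ptime_agreements, fast intro: ptime_proj, fast intro: ptime_proj) (use b in \<open>force simp: values_ok_def\<close>)
  have 2: "ptime (?A \<inter> X) (\<lambda>z. N (fst z)) ?e' (\<lambda>z. Atom (grid_weight (M (fst z)) (H (fst z)) (snd (snd z))))" for X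
    unfolding enc_pair_def by (rule ptime_grid_weight, fast intro: ptime_proj, fast intro: ptime_proj, fast intro: ptime_proj) (use b in auto)
  have "ptime D N ?e (\<lambda>a. Atom (\<Sum>p\<leftarrow>ys a. if agreements (fst p) (s a) = 0 then grid_weight (M a) (H a) (snd p) else 0))"
    by (rule ptime_sum_list[OF ptime_v0])
      (use b in \<open>auto simp: values_ok_def intro!: ptime_if_Atom ptime_eq[OF 1 ptime_const] ptime_const ptime_mono[OF 2[of UNIV]]\<close>)
  then show "ptime D N ?e (\<lambda>a. Atom (wsum (M a) (H a) (s a) (ys a)))" unfolding wsum_def case_prod_unfold .
qed

lemma ptime_item:
  assumes M: "ptime D N e (\<lambda>a. Atom (M a))" and H: "ptime D N e (\<lambda>a. Atom (H a))" and T: "ptime D N e (\<lambda>a. Atom (T a))"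
    and k: "ptime D N e (\<lambda>a. enc_key (k a))" and ys: "ptime D N e (\<lambda>a. encode_list enc_pair (ys a))"
    and b: "\<And>a. a \<in> D \<Longrightarrow> M a + 1 \<le> N a \<and> H a \<le> N a \<and> T a \<le> N a \<and> values_ok q (N a) (ys a) \<and> length (fst (k a)) = q \<and> length (fst (snd (k a))) = q \<and> q \<le> N a"
  shows "ptime D N e (\<lambda>a. enc_item (item (M a) (H a) (T a) (k a) (ys a)))"
proof -
  have s: "ptime D N e (\<lambda>a. enc_spin (fst (k a)))" and t: "ptime D N e (\<lambda>a. enc_spin (fst (snd (k a))))"
    using k unfolding enc_key_def by (auto intro: ptime_Fst ptime_comp[OF _ ptime_v1])
  have S: "ptime D N e (\<lambda>a. Atom (wsum (M a) (H a) (fst (k a)) (ys a)))"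
    by (rule ptime_wsum[OF M H s ys, where q = q]) (use b in auto)
  have T': "ptime D N e (\<lambda>a. Atom (wsum (M a) (H a) (fst (snd (k a))) (ys a)))"
    by (rule ptime_wsum[OF M H t ys, where q = q]) (use b in auto)
  have "ptime D N e (\<lambda>a. Cell (enc_spin (fst (k a))) (Cell (enc_spin (fst (snd (k a))))
    (Cell (Atom (grid_log (M a) (T a) (wsum (M a) (H a) (fst (k a)) (ys a)) (wsum (M a) (H a) (fst (snd (k a))) (ys a))))
          (Atom (grid_log (M a) (T a) (wsum (M a) (H a) (fst (snd (k a))) (ys a)) (wsum (M a) (H a) (fst (k a)) (ys a)))))))"
    by (intro ptime_Cell s t ptime_grid_log[OF M T S T'] ptime_grid_log[OF M T T' S]) (use b in auto)
  then show ?thesis by (rule ptime_cong) (simp add: enc_item_def item_def case_prod_beta)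
qed

definition node_ok :: "nat \<Rightarrow> nat \<Rightarrow> nat \<Rightarrow> nat set set \<Rightarrow> (nat \<Rightarrow> nat list list) \<Rightarrow> node \<Rightarrow> bool" where
  "node_ok q n c E B nd \<longleftrightarrow> length (fst nd) \<le> n \<and> fst (snd (snd nd)) \<in> set (fst nd) \<and>
     (\<forall>u\<in>set (fst nd). entry_ok q n c E B (fst (snd nd)) u)"

text \<open>The record of the current vertex is the head of the list filtered for its number; it
  exists by \<open>node_ok\<close>.\<close>

lemma ptime_lookup:
  assumes nd: "ptime D N e (\<lambda>a. enc_node (E a) (B a) (n a))" and ok: "\<And>a. a \<in> D \<Longrightarrow> node_ok q (N a) (N a) (E a) (B a) (n a)"
  shows "ptime D N e (\<lambda>a. enc_entry (E a) (B a) (fst (snd (n a))) (fst (snd (snd (n a)))))"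
proof (rule ptime_comp[OF nd])
  have "ptime D N (\<lambda>a. enc_node (E a) (B a) (n a)) 
     (\<lambda>a. encode_list (enc_entry (E a) (B a) (fst (snd (n a)))) (filter (\<lambda>u. u = fst (snd (snd (n a)))) (fst (n a))))"
    unfolding enc_node_def
    by (rule ptime_filter[OF ptime_v0], use ok in \<open>force simp: node_ok_def\<close>, rule ptime_eq; (unfold enc_entry_def)?; fast intro: ptime_proj)
  then have "ptime D N (\<lambda>a. enc_node (E a) (B a) (n a)) 
     (\<lambda>a. val_fst (encode_list (enc_entry (E a) (B a) (fst (snd (n a)))) (filter (\<lambda>u. u = fst (snd (snd (n a)))) (fst (n a)))))"
    by (rule ptime_val_fst)
  then show "ptime D N (\<lambda>a. enc_node (E a) (B a) (n a)) (\<lambda>a. enc_entry (E a) (B a) (fst (snd (n a))) (fst (snd (snd (n a)))))"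
  proof (rule ptime_cong)
    fix a assume "a \<in> D"
    then have m: "fst (snd (snd (n a))) \<in> set (filter (\<lambda>u. u = fst (snd (snd (n a)))) (fst (n a)))"
      using ok by (auto simp: node_ok_def)
    define r where "r = filter (\<lambda>u. u = fst (snd (snd (n a)))) (fst (n a))"
    have ne: "r \<noteq> []" using m unfolding r_def[symmetric] by auto
    have "hd r = fst (snd (snd (n a)))" using hd_in_set[OF ne] unfolding r_def by auto
    then have "r = fst (snd (snd (n a))) # tl r" using ne by (cases r) auto
    then have "filter (\<lambda>u. u = fst (snd (snd (n a)))) (fst (n a)) = fst (snd (snd (n a))) # tl r" unfolding r_def .
    then show "val_fst (encode_list (enc_entry (E a) (B a) (fst (snd (n a)))) (filter (\<lambda>u. u = fst (snd (snd (n a)))) (fst (n a))))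
      = enc_entry (E a) (B a) (fst (snd (n a))) (fst (snd (snd (n a))))" by simp
  qed
qed

lemma length_concat_map: "x \<in> set xs \<Longrightarrow> length (g x) \<le> length (concat (map g xs))"
  by (induction xs) auto

lemma ptime_keys:
  assumes nd: "ptime D N e (\<lambda>a. enc_node (E a) (B a) (n a))" and ok: "\<And>a. a \<in> D \<Longrightarrow> node_ok q (N a) (N a) (E a) (B a) (n a)"
    and len: "\<And>a. a \<in> D \<Longrightarrow> length (keys q (E a) (B a) (n a)) \<le> N a \<and> q \<le> N a"
  shows "ptime D N e (\<lambda>a. encode_list enc_key (keys q (E a) (B a) (n a)))"
proof -
  define vs where "vs a = fst (n a)" for a
  define v where "v a = fst (snd (snd (n a)))" for a
  define C where "C a = fst (snd (n a))" for a
  define nl where "nl a = filter (\<lambda>u. u \<noteq> v a \<and> {v a, u} \<in> E a) (vs a)" for a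
  define Bv where "Bv a = B a (v a)" for a
  have vv: "v a \<in> set (vs a)" and lenvs: "length (vs a) \<le> N a"
    and eok: "\<And>u. u \<in> set (vs a) \<Longrightarrow> entry_ok q (N a) (N a) (E a) (B a) (C a) u" if "a \<in> D" for a
    using ok[OF that] by (auto simp: node_ok_def vs_def v_def C_def)
  have Bq: "length s = q" if "a \<in> D" "s \<in> set (Bv a)" for a s using eok[OF that(1) vv[OF that(1)]] that by (auto simp: entry_ok_def Bv_def)
  have lenB: "length (Bv a) \<le> N a" if "a \<in> D" for a using eok[OF that vv[OF that]] by (auto simp: entry_ok_def Bv_def)
  have 1: "ptime D N e (\<lambda>a. encode_list enc_spin (Bv a))"
    using ptime_lookup[OF nd ok] unfolding enc_entry_def Bv_def v_def by (rule ptime_comp[OF _ ptime_v2])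
  have 2: "ptime D N e (\<lambda>a. encode_list (enc_entry (E a) (B a) (C a)) (nl a))"
  proof (rule ptime_comp[OF nd], unfold enc_node_def nl_def vs_def C_def v_def, rule ptime_filter[OF ptime_v0])
    show "length (fst (n a)) \<le> N a" if "a \<in> D" for a using lenvs[OF that] by (simp add: vs_def)
    let ?A = "{z. fst z \<in> D \<and> snd z \<in> set (fst (n (fst z)))}"
    let ?e = "\<lambda>z. Cell (enc_entry (E (fst z)) (B (fst z)) (fst (snd (n (fst z)))) (snd z))
            (Cell (encode_list (enc_entry (E (fst z)) (B (fst z)) (fst (snd (n (fst z))))) (fst (n (fst z))))
              (Cell (Atom (fst (snd (snd (n (fst z)))))) (Atom (snd (snd (snd (n (fst z))))))))"
    have adj: "ptime ?A (\<lambda>z. N (fst z)) ?e (\<lambda>z. Atom (of_bool ({fst (snd (snd (n (fst z)))), snd z} \<in> E (fst z))))"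
      by (rule ptime_adjacent[where q = q and B = "\<lambda>z. B (fst z)" and C = "\<lambda>z. C (fst z)"]; (unfold enc_entry_def)?)
        (use eok in \<open>fastforce intro: ptime_proj simp: vs_def\<close>)+
    show "ptime ?A (\<lambda>z. N (fst z)) ?e (\<lambda>z. Atom (of_bool (snd z \<noteq> fst (snd (snd (n (fst z)))) \<and> {fst (snd (snd (n (fst z)))), snd z} \<in> E (fst z))))"
      by (intro ptime_conj ptime_not ptime_eq adj; (unfold enc_entry_def)?; fast intro: ptime_proj)
  qed
  have 3: "ptime D N e (\<lambda>a. enc_spin (nl a))"
    by (rule ptime_comp[OF 2], rule ptime_map[OF ptime_Id, where g = "\<lambda>_. Atom"])
      (use lenvs in \<open>auto simp: nl_def enc_entry_def intro: ptime_comp[OF ptime_v0 ptime_v0] order_trans[OF length_filter_le]\<close>)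
  define in2 where "in2 a s t = (if agreements s t + 2 = q then map (\<lambda>u. (s, t, u)) (nl a) else [])" for a s t
  define in1 where "in1 a s = concat (map (in2 a s) (Bv a))" for a s
  have kk: "keys q (E a) (B a) (n a) = concat (map (in1 a) (Bv a))" for a
    by (simp add: keys_def in1_def[abs_def] in2_def[abs_def] nl_def vs_def v_def Bv_def case_prod_beta cong: if_cong)
  have l1: "length (in1 a s) \<le> N a" if "a \<in> D" "s \<in> set (Bv a)" for a s
    using length_concat_map[OF that(2), of "in1 a"] len[OF that(1)] unfolding kk by linarith
  have l2: "length (in2 a s t) \<le> N a" if "a \<in> D" "s \<in> set (Bv a)" "t \<in> set (Bv a)" for a s t
    using length_concat_map[OF that(3), of "in2 a s"] l1[OF that(1,2)] unfolding in1_def by linarith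
  have lnl: "length (nl a) \<le> N a" if "a \<in> D" for a using lenvs[OF that] by (auto simp: nl_def intro: order_trans[OF length_filter_le])
  show ?thesis unfolding kk
  proof (rule ptime_comp[OF ptime_Cell[OF 1 3]], rule ptime_concat_map[OF ptime_v0 lenB l1])
    let ?A = "{z. fst z \<in> D \<and> snd z \<in> set (Bv (fst z))}"
    let ?e = "\<lambda>z. Cell (enc_spin (snd z)) (Cell (encode_list enc_spin (Bv (fst z))) (enc_spin (nl (fst z))))"
    show "ptime ?A (\<lambda>z. N (fst z)) ?e (\<lambda>z. encode_list enc_key (in1 (fst z) (snd z)))"
      unfolding in1_def
    proof (rule ptime_concat_map[where g = "\<lambda>z. in2 (fst z) (snd z)" and xs = "\<lambda>z. Bv (fst z)", OF ptime_v1])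
      let ?A' = "{y. fst y \<in> ?A \<and> snd y \<in> set (Bv (fst (fst y)))}"
      let ?e' = "\<lambda>y. Cell (enc_spin (snd y)) (?e (fst y))"
      have eq: "ptime ?A' (\<lambda>y. N (fst (fst y))) ?e' (\<lambda>y. Atom (of_bool (agreements (snd (fst y)) (snd y) + 2 = q)))"
        by (rule ptime_eq[OF ptime_add[OF ptime_agreements ptime_const] ptime_const], fast intro: ptime_proj, fast intro: ptime_proj)
          (use Bq len in auto)
      have mp: "ptime (X \<inter> ?A') (\<lambda>y. N (fst (fst y))) ?e' (\<lambda>y. encode_list (\<lambda>u. enc_key (snd (fst y), snd y, u)) (nl (fst (fst y))))" for X
        by (rule ptime_map[where en = "\<lambda>_. Atom"], fast intro: ptime_proj)
          (use lnl in \<open>auto simp: enc_key_def intro!: ptime_Cell ptime_vars\<close>)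
      have "ptime ?A' (\<lambda>y. N (fst (fst y))) ?e' (\<lambda>y. if agreements (snd (fst y)) (snd y) + 2 = q then 
          encode_list (\<lambda>u. enc_key (snd (fst y), snd y, u)) (nl (fst (fst y))) else Atom 0)"
        by (intro ptime_if eq ptime_const ptime_mono[OF mp[of UNIV]]) auto
      then show "ptime ?A' (\<lambda>y. N (fst (fst y))) ?e' (\<lambda>y. encode_list enc_key (in2 (fst (fst y)) (snd (fst y)) (snd y)))"
        by (rule ptime_cong) (auto simp: in2_def)
    qed (use lenB l2 in auto)
  qed
qed

lemma ptime_child:
  assumes nd: "ptime D N e (\<lambda>a. enc_node (E a) (B a) (n a))" and k: "ptime D N e (\<lambda>a. enc_key (k a))"
    and ok: "\<And>a. a \<in> D \<Longrightarrow> node_ok q (N a) (N a) (E a) (B a) (n a)"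
  shows "ptime D N e (\<lambda>a. enc_node (E a) (B a) (child (E a) (n a) (k a)))"
proof -
  define vs where "vs a = fst (n a)" for a
  define C where "C a = fst (snd (n a))" for a
  define v where "v a = fst (snd (snd (n a)))" for a
  define Dn where "Dn a = snd (snd (snd (n a)))" for a
  define s where "s a = fst (k a)" for a
  define t where "t a = fst (snd (k a))" for a
  define u where "u a = snd (snd (k a))" for a
  have lenvs: "length (vs a) \<le> N a"
    and eok: "\<And>u. u \<in> set (vs a) \<Longrightarrow> entry_ok q (N a) (N a) (E a) (B a) (C a) u" if "a \<in> D" for a
    using ok[OF that] by (auto simp: node_ok_def vs_def C_def)
  let ?e = "\<lambda>a. Cell (Cell (encode_list (enc_entry (E a) (B a) (C a)) (vs a)) (Cell (Atom (v a)) (Atom (Dn a))))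
         (Cell (enc_spin (s a)) (Cell (enc_spin (t a)) (Atom (u a))))"
  have env: "ptime D N e ?e" using ptime_Cell[OF nd k] unfolding enc_node_def enc_key_def vs_def C_def v_def Dn_def s_def t_def u_def .
  define vs' where "vs' a = filter (\<lambda>w. w \<noteq> v a) (vs a)" for a
  have 1: "ptime D N ?e (\<lambda>a. encode_list (enc_entry (E a) (B a) (C a)) (vs' a))"
    unfolding vs'_def
    by (rule ptime_filter, fast intro: ptime_proj, use lenvs in force, rule ptime_not[OF ptime_eq]; (unfold enc_entry_def)?; fast intro: ptime_proj)
  have 2: "ptime D N ?e (\<lambda>a. encode_list (enc_entry (E a) (B a) (pin_split (E a) (v a) (s a) (t a) (u a) (C a))) (vs' a))"
    by (rule ptime_pin_split[OF 1, where q = q], (fast intro: ptime_proj)+)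
      (use lenvs eok in \<open>auto simp: vs'_def intro: order_trans[OF length_filter_le]\<close>)
  have "ptime D N ?e (\<lambda>a. Cell (encode_list (enc_entry (E a) (B a) (pin_split (E a) (v a) (s a) (t a) (u a) (C a))) (vs' a))
      (Cell (Atom (u a)) (Atom (Dn a + Dn a))))"
    by (intro ptime_Cell 2 ptime_add; fast intro: ptime_proj)
  then have "ptime D N ?e (\<lambda>a. enc_node (E a) (B a) (child (E a) (n a) (k a)))"
    by (rule ptime_cong) (simp add: enc_node_def child_def case_prod_beta vs'_def vs_def C_def v_def Dn_def s_def t_def u_def)
  then show ?thesis by (rule ptime_comp[OF env])
qed

definition items_ok :: "nat \<Rightarrow> nat \<Rightarrow> item list \<Rightarrow> bool" where
  "items_ok q n its \<longleftrightarrow> length its \<le> n \<and> (\<forall>i\<in>set its. length (fst i) = q \<and> length (fst (snd i)) = q)"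

lemma ptime_item_sum:
  fixes D :: "'a set"
  assumes its: "ptime D N e (\<lambda>a. encode_list enc_item (its a))" and s: "ptime D N e (\<lambda>a. enc_spin (s a))" and t: "ptime D N e (\<lambda>a. enc_spin (t a))"
    and ok: "\<And>a. a \<in> D \<Longrightarrow> items_ok q (N a) (its a) \<and> length (s a) = q \<and> length (t a) = q \<and> q \<le> N a"
    and f: "\<And>(A :: ('a \<times> item) set) N' R. ptime A N' (\<lambda>z. Cell (enc_item (snd z)) (R z)) (\<lambda>z. Atom (f (snd z)))"
  shows "ptime D N e (\<lambda>a. Atom (item_sum q f (its a) (s a) (t a)))"
proof (rule ptime_comp[OF ptime_Cell[OF its ptime_Cell[OF s t]]], unfold item_sum_def, rule ptime_sum_list[OF ptime_v0])
  let ?A = "{z. fst z \<in> D \<and> snd z \<in> set (its (fst z))}"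
  let ?e = "\<lambda>z. Cell (enc_item (snd z)) (Cell (encode_list enc_item (its (fst z))) (Cell (enc_spin (s (fst z))) (enc_spin (t (fst z)))))"
  have 1: "ptime ?A (\<lambda>z. N (fst z)) ?e (\<lambda>z. Atom (of_bool (agreements (s (fst z)) (fst (snd z)) = q)))"
    unfolding enc_item_def
    by (rule ptime_eq[OF ptime_agreements ptime_const], fast intro: ptime_proj, fast intro: ptime_proj) (use ok in \<open>auto simp: items_ok_def\<close>)
  have 2: "ptime ?A (\<lambda>z. N (fst z)) ?e (\<lambda>z. Atom (of_bool (agreements (t (fst z)) (fst (snd (snd z))) = q)))"
    unfolding enc_item_def
    by (rule ptime_eq[OF ptime_agreements ptime_const], fast intro: ptime_proj, fast intro: ptime_proj) (use ok in \<open>auto simp: items_ok_def\<close>)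
  show "ptime ?A (\<lambda>z. N (fst z)) ?e (\<lambda>z. Atom (if agreements (s (fst z)) (fst (snd z)) = q \<and> agreements (t (fst z)) (fst (snd (snd z))) = q then f (snd z) else 0))"
    by (intro ptime_if_Atom ptime_conj 1 2 ptime_const f)
qed (use ok in \<open>auto simp: items_ok_def\<close>)

lemma ptime_bump:
  assumes d: "ptime D N e (\<lambda>a. Atom (d a))" and its: "ptime D N e (\<lambda>a. encode_list enc_item (its a))"
    and hs: "ptime D N e (\<lambda>a. encode_list enc_pair (hs a))"
    and s: "ptime D N e (\<lambda>a. enc_spin (s a))" and k: "ptime D N e (\<lambda>a. Atom (k a))"
    and ok: "\<And>a. a \<in> D \<Longrightarrow> items_ok q (N a) (its a) \<and> values_ok q (N a) (hs a) \<and> length (s a) = q \<and> q \<le> N a"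
  shows "ptime D N e (\<lambda>a. Atom (bump q (d a) (its a) (hs a) (s a) (k a)))"
proof (rule ptime_comp[OF ptime_Cell[OF hs ptime_Cell[OF k ptime_Cell[OF s ptime_Cell[OF its d]]]]])
  let ?e = "\<lambda>a. Cell (encode_list enc_pair (hs a)) (Cell (Atom (k a)) (Cell (enc_spin (s a)) (Cell (encode_list enc_item (its a)) (Atom (d a)))))"
  show "ptime D N ?e (\<lambda>a. Atom (bump q (d a) (its a) (hs a) (s a) (k a)))" unfolding bump_def
  proof (rule ptime_fold[OF ptime_v0, where I = "\<lambda>_ _. True" and es = "\<lambda>_. Atom"])
    let ?A = "{z. fst z \<in> D \<and> fst (snd z) \<in> set (hs (fst z)) \<and> True}"
    let ?e' = "\<lambda>z. Cell (enc_pair (fst (snd z))) (Cell (Atom (snd (snd z))) (?e (fst z)))"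
    have eq: "ptime ?A (\<lambda>z. N (fst z)) ?e' (\<lambda>z. Atom (of_bool (agreements (s (fst z)) (fst (fst (snd z))) + 2 = q)))"
      unfolding enc_pair_def
      by (rule ptime_eq[OF ptime_add[OF ptime_agreements ptime_const] ptime_const], fast intro: ptime_proj, fast intro: ptime_proj)
        (use ok in \<open>auto simp: values_ok_def\<close>)
    have P: "ptime ?A (\<lambda>z. N (fst z)) ?e' (\<lambda>z. Atom (item_sum q (\<lambda>i. fst (snd (snd i))) (its (fst z)) (s (fst z)) (fst (fst (snd z)))))"
      unfolding enc_pair_def
      by (rule ptime_item_sum, fast intro: ptime_proj, fast intro: ptime_proj, fast intro: ptime_proj)
        (use ok in \<open>auto simp: values_ok_def enc_item_def intro: ptime_comp[OF ptime_v0 ptime_v2]\<close>)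
    have M: "ptime ?A (\<lambda>z. N (fst z)) ?e' (\<lambda>z. Atom (item_sum q (\<lambda>i. snd (snd (snd i))) (its (fst z)) (s (fst z)) (fst (fst (snd z)))))"
      unfolding enc_pair_def
      by (rule ptime_item_sum, fast intro: ptime_proj, fast intro: ptime_proj, fast intro: ptime_proj)
        (use ok in \<open>auto simp: values_ok_def enc_item_def intro: ptime_comp[OF ptime_v0 ptime_r3]\<close>)
    have "ptime ?A (\<lambda>z. N (fst z)) ?e' (\<lambda>z. Atom (max (snd (snd z)) (snd (fst (snd z)) 
       + item_sum q (\<lambda>i. fst (snd (snd i))) (its (fst z)) (s (fst z)) (fst (fst (snd z)))
       - (item_sum q (\<lambda>i. snd (snd (snd i))) (its (fst z)) (s (fst z)) (fst (fst (snd z))) + d (fst z)))))"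
      by (intro ptime_max ptime_sub ptime_add P M; (unfold enc_pair_def)?; fast intro: ptime_proj)
    then show "ptime ?A (\<lambda>z. N (fst z)) ?e' (\<lambda>z. Atom (if agreements (s (fst z)) (fst (fst (snd z))) + 2 = q then max (snd (snd z)) (snd (fst (snd z)) 
       + item_sum q (\<lambda>i. fst (snd (snd i))) (its (fst z)) (s (fst z)) (fst (fst (snd z)))
       - (item_sum q (\<lambda>i. snd (snd (snd i))) (its (fst z)) (s (fst z)) (fst (fst (snd z))) + d (fst z))) else snd (snd z)))"
      by (intro ptime_if_Atom eq) (auto intro: ptime_mono ptime_vars)
  qed (use ok in \<open>auto simp: values_ok_def intro: ptime_vars\<close>)
qed

lemma ptime_relax:
  assumes d: "ptime D N e (\<lambda>a. Atom (d a))" and its: "ptime D N e (\<lambda>a. encode_list enc_item (its a))"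
    and hs: "ptime D N e (\<lambda>a. encode_list enc_pair (hs a))"
    and ok: "\<And>a. a \<in> D \<Longrightarrow> items_ok q (N a) (its a) \<and> values_ok q (N a) (hs a) \<and> q \<le> N a"
  shows "ptime D N e (\<lambda>a. encode_list enc_pair (relax q (d a) (its a) (hs a)))"
  unfolding relax_def encode_list_map
proof (rule ptime_comp[OF ptime_Cell[OF hs ptime_Cell[OF its d]]], rule ptime_map[OF ptime_v0])
  let ?A = "{z. fst z \<in> D \<and> snd z \<in> set (hs (fst z))}"
  let ?e = "\<lambda>z. Cell (enc_pair (snd z)) (Cell (encode_list enc_pair (hs (fst z))) (Cell (encode_list enc_item (its (fst z))) (Atom (d (fst z)))))"
  have 1: "ptime ?A (\<lambda>z. N (fst z)) ?e (\<lambda>z. Atom (bump q (d (fst z)) (its (fst z)) (hs (fst z)) (fst (snd z)) (snd (snd z))))"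
    by (rule ptime_bump, unfold enc_pair_def, fast intro: ptime_proj, fast intro: ptime_proj, fast intro: ptime_proj,
        fast intro: ptime_proj, fast intro: ptime_proj) (use ok in \<open>auto simp: values_ok_def\<close>)
  show "ptime ?A (\<lambda>z. N (fst z)) ?e (\<lambda>z. enc_pair (fst (snd z), bump q (d (fst z)) (its (fst z)) (hs (fst z)) (fst (snd z)) (snd (snd z))))"
    unfolding enc_pair_def[of "(_, _)"] fst_conv snd_conv
    by (intro ptime_Cell 1; (unfold enc_pair_def)?; fast intro: ptime_proj)
qed (use ok in \<open>auto simp: values_ok_def\<close>)

lemma ptime_finish:
  assumes R: "ptime D N e (\<lambda>a. Atom (R a))" and its: "ptime D N e (\<lambda>a. encode_list enc_item (its a))"
    and nd: "ptime D N e (\<lambda>a. enc_node (E a) (B a) (n a))" and ok: "\<And>a. a \<in> D \<Longrightarrow> node_ok q (N a) (N a) (E a) (B a) (n a)"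
    and ok': "\<And>a. a \<in> D \<Longrightarrow> items_ok q (N a) (its a) \<and> R a \<le> N a \<and> q \<le> N a"
  shows "ptime D N e (\<lambda>a. encode_list enc_pair (finish q (R a) (B a) (its a) (n a)))"
proof -
  define v where "v a = fst (snd (snd (n a)))" for a
  define d where "d a = snd (snd (snd (n a)))" for a
  define Bv where "Bv a = B a (v a)" for a
  define Cv where "Cv a = fst (snd (n a)) (v a)" for a
  have en: "entry_ok q (N a) (N a) (E a) (B a) (fst (snd (n a))) (v a)" if "a \<in> D" for a
    using ok[OF that] by (auto simp: node_ok_def v_def)
  have Bok: "length (Bv a) \<le> N a" "\<And>x. x \<in> set (Bv a) \<Longrightarrow> length x = q" 
    and Cok: "length (Cv a) \<le> N a" "\<And>x. x \<in> set (Cv a) \<Longrightarrow> length x = q" if "a \<in> D" for a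
    using en[OF that] by (auto simp: entry_ok_def Bv_def Cv_def)
  have B: "ptime D N e (\<lambda>a. encode_list enc_spin (Bv a))" and C: "ptime D N e (\<lambda>a. encode_list enc_spin (Cv a))"
    using ptime_lookup[OF nd ok] unfolding enc_entry_def Bv_def Cv_def v_def by (auto intro: ptime_comp[OF _ ptime_v2] ptime_comp[OF _ ptime_r3])
  have d: "ptime D N e (\<lambda>a. Atom (d a))" using nd unfolding enc_node_def d_def by (rule ptime_comp[OF _ ptime_r2])
  have init: "ptime D N e (\<lambda>a. encode_list enc_pair (map (\<lambda>x. (x, 0)) (Bv a)))"
    unfolding encode_list_map
    by (rule ptime_map[OF B Bok(1)]) (auto simp: enc_pair_def intro!: ptime_Cell ptime_const ptime_vars)
  let ?e = "\<lambda>a. Cell (encode_list enc_pair (map (\<lambda>x. (x, 0)) (Bv a))) (Cell (Atom (R a)) (Cell (encode_list enc_item (its a)) (Atom (d a))))"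
  have loop: "ptime D N e (\<lambda>a. encode_list enc_pair ((relax q (d a) (its a) ^^ R a) (map (\<lambda>x. (x, 0)) (Bv a))))"
  proof (rule ptime_comp[OF ptime_Cell[OF init ptime_Cell[OF R ptime_Cell[OF its d]]]])
    show "ptime D N ?e (\<lambda>a. encode_list enc_pair ((relax q (d a) (its a) ^^ R a) (map (\<lambda>x. (x, 0)) (Bv a))))"
    proof (rule ptime_funpow[where I = "\<lambda>a hs. values_ok q (N a) hs" and es = "\<lambda>_. encode_list enc_pair"])
      show "ptime {z. fst z \<in> D \<and> values_ok q (N (fst z)) (snd z)} (\<lambda>z. N (fst z)) (\<lambda>z. Cell (encode_list enc_pair (snd z)) (?e (fst z)))
        (\<lambda>z. encode_list enc_pair (relax q (d (fst z)) (its (fst z)) (snd z)))"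
        by (rule ptime_relax, fast intro: ptime_proj, fast intro: ptime_proj, fast intro: ptime_proj) (use ok' in auto)
    qed (use ok' Bok in \<open>auto simp: values_ok_def relax_def intro: ptime_vars\<close>)
  qed
  define hs where "hs a = (relax q (d a) (its a) ^^ R a) (map (\<lambda>x. (x, 0)) (Bv a))" for a
  have hs: "values_ok q (N a) (hs a)" if "a \<in> D" for a
  proof -
    have "values_ok q (N a) ((relax q (d a) (its a) ^^ i) (map (\<lambda>x. (x, 0)) (Bv a)))" for i
      by (induction i) (use Bok[OF that] in \<open>auto simp: values_ok_def relax_def\<close>)
    then show ?thesis by (simp add: hs_def)
  qed
  have "ptime D N e (\<lambda>a. encode_list enc_pair (filter (\<lambda>p. \<forall>c\<in>set (Cv a). agreements (fst p) c = 0) (hs a)))"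
  proof (rule ptime_comp[OF ptime_Cell[OF loop[folded hs_def] C]], rule ptime_filter[OF ptime_v0])
    show "ptime {z. fst z \<in> D \<and> snd z \<in> set (hs (fst z))} (\<lambda>z. N (fst z))
     (\<lambda>z. Cell (enc_pair (snd z)) (Cell (encode_list enc_pair (hs (fst z))) (encode_list enc_spin (Cv (fst z)))))
     (\<lambda>z. Atom (of_bool (\<forall>c\<in>set (Cv (fst z)). agreements (fst (snd z)) c = 0)))"
      unfolding enc_pair_def
      by (rule ptime_ball_agreements, fast intro: ptime_proj, fast intro: ptime_proj) (use hs Cok ok' in \<open>force simp: values_ok_def\<close>)+
  qed (use hs in \<open>auto simp: values_ok_def\<close>)
  then show ?thesis by (simp add: finish_def case_prod_beta hs_def Cv_def Bv_def v_def d_def)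
qed

section \<open>Evaluating the recursion tree level by level\<close>

definition expand :: "nat \<Rightarrow> nat set set \<Rightarrow> (nat \<Rightarrow> nat list list) \<Rightarrow> node list \<Rightarrow> node list" where
  "expand q E B X = concat (map (\<lambda>n. map (child E n) (keys q E B n)) X)"

text \<open>The machine language has no recursion: the tree of subproblems is expanded level by level and
  then collapsed from the leaves.\<close>

primrec level :: "nat \<Rightarrow> nat set set \<Rightarrow> (nat \<Rightarrow> nat list list) \<Rightarrow> node \<Rightarrow> nat \<Rightarrow> node list" where
  "level q E B n 0 = [n]"
| "level q E B n (Suc i) = expand q E B (level q E B n i)"

definition hdl :: "spin_values list \<Rightarrow> spin_values" where "hdl Y = (case Y of [] \<Rightarrow> [] | y # _ \<Rightarrow> y)"

definition take_items :: "nat \<Rightarrow> nat \<Rightarrow> nat \<Rightarrow> key list \<Rightarrow> spin_values list \<Rightarrow> spin_values list \<times> item list" where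
  "take_items M H T ks Y = fold (\<lambda>k p. (tl (fst p), item M H T k (hdl (fst p)) # snd p)) ks (Y, [])"

text \<open>\<open>Y\<close> is meant to hold the results of all children of the nodes in
  \<open>X\<close>, in the order of \<open>expand\<close>. No marks are needed to separate them: the
  keys of a node tell how many results belong to it, and \<open>take_items\<close> also returns the
  rest.\<close>

definition collapse :: "nat \<Rightarrow> nat \<Rightarrow> nat \<Rightarrow> nat \<Rightarrow> nat \<Rightarrow> nat set set \<Rightarrow> (nat \<Rightarrow> nat list list) \<Rightarrow> node list \<Rightarrow> spin_values list \<Rightarrow> spin_values list" where
  "collapse q M H T R E B X Y = rev (snd (fold (\<lambda>n p. (fst (take_items M H T (keys q E B n) (fst p)),
     finish q R B (rev (snd (take_items M H T (keys q E B n) (fst p)))) n # snd p)) X (Y, [])))"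

lemma take_items: "take_items M H T ks (map g ks @ Y) = (Y, rev (map (\<lambda>k. item M H T k (g k)) ks))"
proof -
  have "fold (\<lambda>k p. (tl (fst p), item M H T k (hdl (fst p)) # snd p)) ks (map g ks @ Y, its) =
    (Y, rev (map (\<lambda>k. item M H T k (g k)) ks) @ its)" for its
    by (induction ks arbitrary: its) (auto simp: hdl_def)
  then show ?thesis by (simp add: take_items_def)
qed

lemma collapse_expand:
  "collapse q M H T R E B X (map f (expand q E B X)) =
     map (\<lambda>n. finish q R B (map (\<lambda>k. item M H T k (f (child E n k))) (keys q E B n)) n) X"
proof -
  have "snd (fold (\<lambda>n p. (fst (take_items M H T (keys q E B n) (fst p)),
     finish q R B (rev (snd (take_items M H T (keys q E B n) (fst p)))) n # snd p)) X (map f (expand q E B X) @ Y, out)) =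
     rev (map (\<lambda>n. finish q R B (map (\<lambda>k. item M H T k (f (child E n k))) (keys q E B n)) n) X) @ out" for Y out
  proof (induction X arbitrary: out)
    case (Cons n X)
    have "take_items M H T (keys q E B n) (map f (expand q E B (n # X)) @ Y) =
        (map f (expand q E B X) @ Y, rev (map (\<lambda>k. item M H T k (f (child E n k))) (keys q E B n)))"
      using take_items[of M H T "keys q E B n" "\<lambda>k. f (child E n k)" "map f (expand q E B X) @ Y"]
      by (simp add: expand_def comp_def)
    then show ?case using Cons by simp
  qed simp
  from this[of "[]" "[]"] show ?thesis by (simp add: collapse_def)
qed

text \<open>The generalization to \<open>j\<close> carries the induction: one collapse turns results
  of depth \<open>j\<close> on the last level into results of depth \<open>Suc j\<close> on the
  level above it.\<close>

lemma marginal_levels: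
  "fold (collapse q M H T R E B) (map (level q E B n) (rev [0..<d])) (map (marginal q M H T R E B j) (level q E B n d)) =
     [marginal q M H T R E B (j + d) n]"
proof (induction d arbitrary: j)
  case (Suc d)
  have eq: "collapse q M H T R E B (level q E B n d) (map (marginal q M H T R E B j) (level q E B n (Suc d))) =
     map (marginal q M H T R E B (Suc j)) (level q E B n d)"
    by (simp add: collapse_expand)
  show ?case using Suc[of "Suc j"] eq by (simp del: marginal.simps level.simps)
qed simp

definition level_ok :: "nat \<Rightarrow> nat \<Rightarrow> nat set set \<Rightarrow> (nat \<Rightarrow> nat list list) \<Rightarrow> node list \<Rightarrow> bool" where
  "level_ok q m E B X \<longleftrightarrow> length X \<le> m \<and> q \<le> m \<and> (\<forall>n\<in>set X. node_ok q m m E B n \<and> length (keys q E B n) \<le> m)"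

lemma ptime_expand:
  assumes X: "ptime D N e (\<lambda>a. encode_list (enc_node (E a) (B a)) (X a))"
    and ok: "\<And>a. a \<in> D \<Longrightarrow> level_ok q (N a) (E a) (B a) (X a)"
  shows "ptime D N e (\<lambda>a. encode_list (enc_node (E a) (B a)) (expand q (E a) (B a) (X a)))"
  unfolding expand_def
proof (rule ptime_concat_map[OF X])
  let ?A = "{z. fst z \<in> D \<and> snd z \<in> set (X (fst z))}"
  let ?e = "\<lambda>z. Cell (enc_node (E (fst z)) (B (fst z)) (snd z)) (e (fst z))"
  have ok': "node_ok q (N a) (N a) (E a) (B a) n" "length (keys q (E a) (B a) n) \<le> N a \<and> q \<le> N a" 
    if "a \<in> D" "n \<in> set (X a)" for a n using ok[OF that(1)] that(2) by (auto simp: level_ok_def)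
  have 1: "ptime ?A (\<lambda>z. N (fst z)) ?e (\<lambda>z. encode_list enc_key (keys q (E (fst z)) (B (fst z)) (snd z)))"
    by (rule ptime_keys, rule ptime_v0) (use ok' in auto)
  have "ptime ?A (\<lambda>z. N (fst z)) ?e (\<lambda>z. encode_list (\<lambda>k. enc_node (E (fst z)) (B (fst z)) (child (E (fst z)) (snd z) k)) (keys q (E (fst z)) (B (fst z)) (snd z)))"
    by (rule ptime_map[OF 1], use ok' in force, rule ptime_child[where q = q], rule ptime_v1, rule ptime_v0) (use ok' in auto)
  then show "ptime ?A (\<lambda>z. N (fst z)) ?e
     (\<lambda>z. encode_list (enc_node (E (fst z)) (B (fst z))) (map (child (E (fst z)) (snd z)) (keys q (E (fst z)) (B (fst z)) (snd z))))"
    by simp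
qed (use ok in \<open>auto simp: level_ok_def\<close>)

abbreviation (input) enc_vals :: "spin_values list \<Rightarrow> val" where "enc_vals \<equiv> encode_list (encode_list enc_pair)"

lemma take_items_ok:
  assumes "\<forall>ys\<in>set Y. values_ok q m ys" "\<forall>k\<in>set ks. length (fst k) = q \<and> length (fst (snd k)) = q"
  shows "\<forall>ys\<in>set (fst (take_items M H T ks Y)). values_ok q m ys"
    "length ks \<le> m \<Longrightarrow> items_ok q m (snd (take_items M H T ks Y))"
proof -
  define F where "F = (\<lambda>k p. (tl (fst p), item M H T k (hdl (fst p)) # snd p))"
  have F: "(\<forall>ys\<in>set (fst (fold F ks (Y, its))). values_ok q m ys) \<and> length (snd (fold F ks (Y, its))) = length ks + length its \<and>
      (\<forall>i\<in>set (snd (fold F ks (Y, its))). length (fst i) = q \<and> length (fst (snd i)) = q)"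
    if "\<forall>i\<in>set its. length (fst i) = q \<and> length (fst (snd i)) = q" for its
    using assms that
  proof (induction ks arbitrary: Y its)
    case (Cons k ks)
    have "\<forall>ys\<in>set (tl Y). values_ok q m ys" using Cons.prems(1) by (cases Y) auto
    moreover have "\<forall>i\<in>set (item M H T k (hdl Y) # its). length (fst i) = q \<and> length (fst (snd i)) = q"
      using Cons.prems(2,3) by (auto simp: item_def case_prod_beta)
    moreover have "\<forall>k\<in>set ks. length (fst k) = q \<and> length (fst (snd k)) = q" using Cons.prems(2) by simp
    ultimately have IH: "(\<forall>ys\<in>set (fst (fold F ks (tl Y, item M H T k (hdl Y) # its))). values_ok q m ys) \<and>
        length (snd (fold F ks (tl Y, item M H T k (hdl Y) # its))) = length ks + length (item M H T k (hdl Y) # its) \<and>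
        (\<forall>i\<in>set (snd (fold F ks (tl Y, item M H T k (hdl Y) # its))). length (fst i) = q \<and> length (fst (snd i)) = q)"
      by (intro Cons.IH)
    have "fold F (k # ks) (Y, its) = fold F ks (tl Y, item M H T k (hdl Y) # its)" by (simp add: F_def)
    then show ?case using IH by simp
  qed simp
  show "\<forall>ys\<in>set (fst (take_items M H T ks Y)). values_ok q m ys"
    "length ks \<le> m \<Longrightarrow> items_ok q m (snd (take_items M H T ks Y))"
    using F[of "[]"] unfolding take_items_def items_ok_def F_def[symmetric] by auto
qed

lemma keys_ok: "node_ok q m m E B n \<Longrightarrow> k \<in> set (keys q E B n) \<Longrightarrow> length (fst k) = q \<and> length (fst (snd k)) = q"
  by (auto simp: keys_def node_ok_def entry_ok_def split: if_splits)

lemma ptime_take_items: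
  assumes M: "ptime D N e (\<lambda>a. Atom (M a))" and H: "ptime D N e (\<lambda>a. Atom (H a))" and T: "ptime D N e (\<lambda>a. Atom (T a))"
    and ks: "ptime D N e (\<lambda>a. encode_list enc_key (ks a))" and Y: "ptime D N e (\<lambda>a. enc_vals (Y a))"
    and ok: "\<And>a. a \<in> D \<Longrightarrow> M a + 1 \<le> N a \<and> H a \<le> N a \<and> T a \<le> N a \<and> q \<le> N a \<and> length (ks a) \<le> N a
      \<and> (\<forall>ys\<in>set (Y a). values_ok q (N a) ys) \<and> (\<forall>k\<in>set (ks a). length (fst k) = q \<and> length (fst (snd k)) = q)"
  shows "ptime D N e (\<lambda>a. Cell (enc_vals (fst (take_items (M a) (H a) (T a) (ks a) (Y a))))
    (encode_list enc_item (snd (take_items (M a) (H a) (T a) (ks a) (Y a)))))"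
proof (rule ptime_comp[OF ptime_Cell[OF ks ptime_Cell[OF Y ptime_Cell[OF M ptime_Cell[OF H T]]]]], unfold take_items_def,
    rule ptime_fold[where es = "\<lambda>_ p. Cell (enc_vals (fst p)) (encode_list enc_item (snd p))" 
      and I = "\<lambda>a p. \<forall>ys\<in>set (fst p). values_ok q (N a) ys", OF ptime_v0])
  let ?e = "\<lambda>a. Cell (encode_list enc_key (ks a)) (Cell (enc_vals (Y a)) (Cell (Atom (M a)) (Cell (Atom (H a)) (Atom (T a)))))"
  show "ptime D N ?e (\<lambda>a. Cell (enc_vals (fst (Y a, []))) (encode_list enc_item (snd (Y a, []))))"
    by (auto intro!: ptime_Cell ptime_vars ptime_const)
  let ?A = "{z. fst z \<in> D \<and> fst (snd z) \<in> set (ks (fst z)) \<and> (\<forall>ys\<in>set (fst (snd (snd z))). values_ok q (N (fst z)) ys)}"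
  let ?e' = "\<lambda>z. Cell (enc_key (fst (snd z))) (Cell (Cell (enc_vals (fst (snd (snd z)))) (encode_list enc_item (snd (snd (snd z))))) (?e (fst z)))"
  have hd: "encode_list enc_pair (hdl Y) = val_fst (enc_vals Y)" for Y by (cases Y) (auto simp: hdl_def)
  have hdok: "values_ok q m (hdl Y)" if "\<forall>ys\<in>set Y. values_ok q m ys" for m Y 
    using that by (cases Y) (auto simp: hdl_def values_ok_def)
  have 1: "ptime ?A (\<lambda>z. N (fst z)) ?e' (\<lambda>z. encode_list enc_pair (hdl (fst (snd (snd z)))))"
    unfolding hd by (rule ptime_val_fst) (fast intro: ptime_proj)
  have 2: "ptime ?A (\<lambda>z. N (fst z)) ?e' (\<lambda>z. enc_item (item (M (fst z)) (H (fst z)) (T (fst z)) (fst (snd z)) (hdl (fst (snd (snd z))))))"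
    by (rule ptime_item[OF _ _ _ _ 1, where q = q], fast intro: ptime_proj, fast intro: ptime_proj, fast intro: ptime_proj, fast intro: ptime_proj)
      (use ok hdok in auto)
  have "ptime ?A (\<lambda>z. N (fst z)) ?e' (\<lambda>z. Cell (val_snd (enc_vals (fst (snd (snd z))))) 
      (Cell (enc_item (item (M (fst z)) (H (fst z)) (T (fst z)) (fst (snd z)) (hdl (fst (snd (snd z)))))) (encode_list enc_item (snd (snd (snd z))))))"
    by (intro ptime_Cell ptime_val_snd 2; fast intro: ptime_proj)
  then show "ptime ?A (\<lambda>z. N (fst z)) ?e' (\<lambda>z. Cell (enc_vals (fst (tl (fst (snd (snd z))), item (M (fst z)) (H (fst z)) (T (fst z)) (fst (snd z)) (hdl (fst (snd (snd z)))) # snd (snd (snd z)))))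
          (encode_list enc_item (snd (tl (fst (snd (snd z))), item (M (fst z)) (H (fst z)) (T (fst z)) (fst (snd z)) (hdl (fst (snd (snd z)))) # snd (snd (snd z))))))"
    by (simp add: val_snd_encode_list)
  show "\<forall>ys\<in>set (fst (tl (fst r), item (M a) (H a) (T a) x (hdl (fst r)) # snd r)). values_ok q (N a) ys"
    if "\<forall>ys\<in>set (fst r). values_ok q (N a) ys" for a x r
    using that by (cases "fst r") auto
qed (use ok in auto)

lemma values_ok_filter: "values_ok q m ys \<Longrightarrow> values_ok q m (filter P ys)"
  by (auto simp: values_ok_def intro: order_trans[OF length_filter_le])

lemma finish_ok: 
  assumes "node_ok q m m E B n"
  shows "values_ok q m (finish q R B its n)"
proof -
  have B: "length (B (fst (snd (snd n)))) \<le> m" "\<forall>x\<in>set (B (fst (snd (snd n)))). length x = q"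
    using assms by (auto simp: node_ok_def entry_ok_def)
  have "values_ok q m ((relax q d its ^^ i) (map (\<lambda>x. (x, 0)) (B (fst (snd (snd n))))))" for d i
    by (induction i) (use B in \<open>auto simp: values_ok_def relax_def\<close>)
  then show ?thesis unfolding finish_def case_prod_beta by (rule values_ok_filter)
qed

lemma ptime_collapse:
  fixes D :: "'a set"
  assumes M: "ptime D N e (\<lambda>a. Atom (M a))" and H: "ptime D N e (\<lambda>a. Atom (H a))" and T: "ptime D N e (\<lambda>a. Atom (T a))"
    and R: "ptime D N e (\<lambda>a. Atom (R a))"
    and X: "ptime D N e (\<lambda>a. encode_list (enc_node (E a) (B a)) (X a))" and Y: "ptime D N e (\<lambda>a. enc_vals (Y a))"
    and ok: "\<And>a. a \<in> D \<Longrightarrow> M a + 1 \<le> N a \<and> H a \<le> N a \<and> T a \<le> N a \<and> R a \<le> N a \<and> level_ok q (N a) (E a) (B a) (X a)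
      \<and> (\<forall>ys\<in>set (Y a). values_ok q (N a) ys)"
  shows "ptime D N e (\<lambda>a. enc_vals (collapse q (M a) (H a) (T a) (R a) (E a) (B a) (X a) (Y a)))"
proof -
  define F where "F a n p = (fst (take_items (M a) (H a) (T a) (keys q (E a) (B a) n) (fst p)),
     finish q (R a) (B a) (rev (snd (take_items (M a) (H a) (T a) (keys q (E a) (B a) n) (fst p)))) n # snd p)" for a n p
  define et where "et p = Cell (enc_vals (fst p)) (enc_vals (snd p))" for p
  let ?e = "\<lambda>a. Cell (encode_list (enc_node (E a) (B a)) (X a)) (Cell (enc_vals (Y a)) (Cell (Atom (M a)) (Cell (Atom (H a)) (Cell (Atom (T a)) (Atom (R a))))))"
  have nok: "node_ok q (N a) (N a) (E a) (B a) n" "length (keys q (E a) (B a) n) \<le> N a" "q \<le> N a" 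
    if "a \<in> D" "n \<in> set (X a)" for a n using ok[OF that(1)] that(2) by (auto simp: level_ok_def)
  have kok: "\<forall>k\<in>set (keys q (E a) (B a) n). length (fst k) = q \<and> length (fst (snd k)) = q" 
    if "a \<in> D" "n \<in> set (X a)" for a n using keys_ok[OF nok(1)[OF that]] by blast
  have "ptime D N ?e (\<lambda>a. et (fold (F a) (X a) (Y a, [])))"
  proof (rule ptime_fold[where es = "\<lambda>_. et" and I = "\<lambda>a p. \<forall>ys\<in>set (fst p). values_ok q (N a) ys", OF ptime_v0])
    show "ptime D N ?e (\<lambda>a. et (Y a, []))" unfolding et_def by (auto intro!: ptime_Cell ptime_vars ptime_const)
    let ?A = "{z. fst z \<in> D \<and> fst (snd z) \<in> set (X (fst z)) \<and> (\<forall>ys\<in>set (fst (snd (snd z))). values_ok q (N (fst z)) ys)}"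
    let ?e' = "\<lambda>z. Cell (enc_node (E (fst z)) (B (fst z)) (fst (snd z))) (Cell (et (snd (snd z))) (?e (fst z)))"
    have 1: "ptime ?A (\<lambda>z. N (fst z)) ?e' (\<lambda>z. encode_list enc_key (keys q (E (fst z)) (B (fst z)) (fst (snd z))))"
      by (rule ptime_keys, rule ptime_v0) (use nok in auto)
    define ti where "ti z = take_items (M (fst z)) (H (fst z)) (T (fst z)) (keys q (E (fst z)) (B (fst z)) (fst (snd z))) (fst (snd (snd z)))" 
      for z :: "'a \<times> node \<times> spin_values list \<times> spin_values list"
    have tk: "M (fst z) + 1 \<le> N (fst z) \<and> H (fst z) \<le> N (fst z) \<and> T (fst z) \<le> N (fst z) \<and> q \<le> N (fst z)
        \<and> length (keys q (E (fst z)) (B (fst z)) (fst (snd z))) \<le> N (fst z) \<and> (\<forall>ys\<in>set (fst (snd (snd z))). values_ok q (N (fst z)) ys)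
        \<and> (\<forall>k\<in>set (keys q (E (fst z)) (B (fst z)) (fst (snd z))). length (fst k) = q \<and> length (fst (snd k)) = q)" if "z \<in> ?A" for z
    proof -
      have a: "fst z \<in> D" and n: "fst (snd z) \<in> set (X (fst z))" and y: "\<forall>ys\<in>set (fst (snd (snd z))). values_ok q (N (fst z)) ys"
        using that by blast+
      show ?thesis using ok[OF a] nok[OF a n] kok[OF a n] y by blast
    qed
    have 2: "ptime ?A (\<lambda>z. N (fst z)) ?e' (\<lambda>z. Cell (enc_vals (fst (ti z))) (encode_list enc_item (snd (ti z))))"
      unfolding ti_def
      by (rule ptime_take_items[OF _ _ _ 1, where q = q], fast intro: ptime_proj, fast intro: ptime_proj, fast intro: ptime_proj, 
          unfold et_def, fast intro: ptime_proj) (rule tk)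
    have tok: "items_ok q (N (fst z)) (snd (ti z))" if "z \<in> ?A" for z
      using tk[OF that] unfolding ti_def by (intro take_items_ok(2)) blast+
    have 3: "ptime ?A (\<lambda>z. N (fst z)) ?e' (\<lambda>z. encode_list enc_item (rev (snd (ti z))))"
      by (rule ptime_rev[OF ptime_Snd[OF 2]]) (use tok in \<open>auto simp: items_ok_def\<close>)
    have 4: "ptime ?A (\<lambda>z. N (fst z)) ?e' (\<lambda>z. encode_list enc_pair (finish q (R (fst z)) (B (fst z)) (rev (snd (ti z))) (fst (snd z))))"
      by (rule ptime_finish[OF _ 3, where E = "\<lambda>z. E (fst z)"], fast intro: ptime_proj, fast intro: ptime_proj) 
        (use ok nok tok in \<open>auto simp: items_ok_def\<close>)
    have "ptime ?A (\<lambda>z. N (fst z)) ?e' (\<lambda>z. Cell (enc_vals (fst (ti z))) (Cell (encode_list enc_pair (finish q (R (fst z)) (B (fst z)) (rev (snd (ti z))) (fst (snd z))))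
        (enc_vals (snd (snd (snd z))))))"
      by (intro ptime_Cell ptime_Fst[OF 2] 4, unfold et_def, fast intro: ptime_proj)
    then show "ptime ?A (\<lambda>z. N (fst z)) ?e' (\<lambda>z. et (F (fst z) (fst (snd z)) (snd (snd z))))"
      by (simp add: et_def F_def ti_def)
    show "\<forall>ys\<in>set (fst (F a n r)). values_ok q (N a) ys"
      if "a \<in> D" "n \<in> set (X a)" "\<forall>ys\<in>set (fst r). values_ok q (N a) ys" for a n r
      unfolding F_def fst_conv using that kok by (intro take_items_ok(1)) auto
  qed (use ok in \<open>auto simp: level_ok_def\<close>)
  then have "ptime D N ?e (\<lambda>a. enc_vals (snd (fold (F a) (X a) (Y a, []))))" unfolding et_def by (rule ptime_Snd)
  then have "ptime D N ?e (\<lambda>a. enc_vals (rev (snd (fold (F a) (X a) (Y a, [])))))"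
  proof (rule ptime_rev)
    fix a assume a: "a \<in> D"
    have "length (snd (fold (F a) xs p)) = length xs + length (snd p)" for xs p
      by (induction xs arbitrary: p) (auto simp: F_def)
    then show "length (snd (fold (F a) (X a) (Y a, []))) \<le> N a" using ok[OF a] by (simp add: level_ok_def)
  qed
  then have "ptime D N ?e (\<lambda>a. enc_vals (collapse q (M a) (H a) (T a) (R a) (E a) (B a) (X a) (Y a)))"
    by (simp add: collapse_def F_def[abs_def])
  then show ?thesis by (rule ptime_comp[OF ptime_Cell[OF X ptime_Cell[OF Y ptime_Cell[OF M ptime_Cell[OF H ptime_Cell[OF T R]]]]]])
qed

lemma collapse_ok:
  assumes "level_ok q m E B X"
  shows "\<forall>ys\<in>set (collapse q M H T R E B X Y). values_ok q m ys"
proof -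
  define F where "F = (\<lambda>n p. (fst (take_items M H T (keys q E B n) (fst p)),
     finish q R B (rev (snd (take_items M H T (keys q E B n) (fst p)))) n # snd p))"
  have *: "\<forall>ys\<in>set (snd (fold F X p)). values_ok q m ys"
    if "\<forall>n\<in>set X. node_ok q m m E B n" "\<forall>ys\<in>set (snd p). values_ok q m ys" for p
    using that
  proof (induction X arbitrary: p)
    case (Cons n X)
    have "\<forall>ys\<in>set (snd (F n p)). values_ok q m ys" using Cons.prems by (auto simp: F_def finish_ok)
    then show ?case using Cons.IH[of "F n p"] Cons.prems(1) by simp
  qed simp
  from *[of "(Y, [])"] assms show ?thesis unfolding collapse_def F_def[symmetric] by (simp add: level_ok_def)
qed

lemma ptime_marginal:
  assumes M: "ptime D N e (\<lambda>a. Atom (M a))" and H: "ptime D N e (\<lambda>a. Atom (H a))" and T: "ptime D N e (\<lambda>a. Atom (T a))"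
    and R: "ptime D N e (\<lambda>a. Atom (R a))" and d: "ptime D N e (\<lambda>a. Atom (d a))"
    and n: "ptime D N e (\<lambda>a. enc_node (E a) (B a) (n a))"
    and ok: "\<And>a. a \<in> D \<Longrightarrow> M a + 1 \<le> N a \<and> H a \<le> N a \<and> T a \<le> N a \<and> R a \<le> N a \<and> d a + 1 \<le> N a"
    and lok: "\<And>a i. a \<in> D \<Longrightarrow> i \<le> d a \<Longrightarrow> level_ok q (N a) (E a) (B a) (level q (E a) (B a) (n a) i)"
  shows "ptime D N e (\<lambda>a. encode_list enc_pair (marginal q (M a) (H a) (T a) (R a) (E a) (B a) (d a) (n a)))"
proof -
  let ?e = "\<lambda>a. Cell (Atom (M a)) (Cell (Atom (H a)) (Cell (Atom (T a)) (Cell (Atom (R a)) (Cell (Atom (d a)) (enc_node (E a) (B a) (n a))))))"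
  define lv where "lv a = level q (E a) (B a) (n a)" for a
  \<comment> \<open>The newest level stays in front: the next one is expanded from it, and
    collapsing needs the deepest levels first.\<close>
  define ls where "ls a i = encode_list (encode_list (enc_node (E a) (B a))) (map (lv a) (rev [0..<Suc i]))" for a i
  have ls: "ls a i = Cell (encode_list (enc_node (E a) (B a)) (lv a i)) (encode_list (encode_list (enc_node (E a) (B a))) (map (lv a) (rev [0..<i])))" for a i
    by (simp add: ls_def)
  have L: "ptime D N ?e (\<lambda>a. ls a (d a))"
  proof (rule ptime_for)
    show "ptime D N ?e (\<lambda>a. Atom (d a))" by (fast intro: ptime_proj)
    have "ptime D N ?e (\<lambda>a. Cell (Cell (enc_node (E a) (B a) (n a)) (Atom 0)) (Atom 0))"
      by (intro ptime_Cell ptime_const; fast intro: ptime_proj)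
    then show "ptime D N ?e (\<lambda>a. ls a 0)" by (simp add: ls lv_def)
    let ?A = "{z. fst z \<in> D \<and> snd z < d (fst z)}"
    have 1: "ptime ?A (\<lambda>z. N (fst z)) (\<lambda>z. Cell (ls (fst z) (snd z)) (?e (fst z))) (\<lambda>z. encode_list (enc_node (E (fst z)) (B (fst z))) (lv (fst z) (snd z)))"
      unfolding ls by (fast intro: ptime_proj)
    have "ptime ?A (\<lambda>z. N (fst z)) (\<lambda>z. Cell (ls (fst z) (snd z)) (?e (fst z))) 
      (\<lambda>z. Cell (encode_list (enc_node (E (fst z)) (B (fst z))) (expand q (E (fst z)) (B (fst z)) (lv (fst z) (snd z)))) (ls (fst z) (snd z)))"
      by (intro ptime_Cell ptime_expand[OF 1] ptime_v0) (use lok in \<open>auto simp: lv_def\<close>)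
    then show "ptime ?A (\<lambda>z. N (fst z)) (\<lambda>z. Cell (ls (fst z) (snd z)) (?e (fst z))) (\<lambda>z. ls (fst z) (Suc (snd z)))"
      by (simp add: ls_def lv_def)
  qed (use ok in \<open>auto intro: Suc_leD\<close>)
  have lsplit: "ptime D N ?e (\<lambda>a. encode_list (enc_node (E a) (B a)) (lv a (d a)))"
      "ptime D N ?e (\<lambda>a. encode_list (encode_list (enc_node (E a) (B a))) (map (lv a) (rev [0..<d a])))"
    using L unfolding ls by (auto intro: ptime_Fst ptime_Snd)
  have Y0: "ptime D N ?e (\<lambda>a. enc_vals (map (finish q (R a) (B a) []) (lv a (d a))))"
    unfolding encode_list_map
    by (rule ptime_map[OF lsplit(1)], use lok in \<open>force simp: lv_def level_ok_def\<close>,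
        rule ptime_finish[where E = "\<lambda>z. E (fst z)"], fast intro: ptime_proj, simp, rule ptime_const, fast intro: ptime_proj)
      (use lok ok in \<open>force simp: lv_def level_ok_def items_ok_def\<close>)+
  have dN: "d a \<le> N a" if "a \<in> D" for a using ok[OF that] by simp
  let ?e2 = "\<lambda>a. Cell (encode_list (encode_list (enc_node (E a) (B a))) (map (lv a) (rev [0..<d a])))
      (Cell (enc_vals (map (finish q (R a) (B a) []) (lv a (d a)))) (?e a))"
  have "ptime D N ?e2 (\<lambda>a. enc_vals (fold (collapse q (M a) (H a) (T a) (R a) (E a) (B a)) (map (lv a) (rev [0..<d a])) (map (finish q (R a) (B a) []) (lv a (d a)))))"
  proof (rule ptime_fold[where I = "\<lambda>a Y. \<forall>ys\<in>set Y. values_ok q (N a) ys" and es = "\<lambda>_. enc_vals", OF ptime_v0])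
    have lk: "level_ok q (N a) (E a) (B a) X" if "a \<in> D" "X \<in> set (map (lv a) (rev [0..<d a]))" for a X
      using that lok by (auto simp: lv_def)
    show "ptime {z. fst z \<in> D \<and> fst (snd z) \<in> set (map (lv (fst z)) (rev [0..<d (fst z)])) \<and> (\<forall>ys\<in>set (snd (snd z)). values_ok q (N (fst z)) ys)} (\<lambda>z. N (fst z))
     (\<lambda>z. Cell (encode_list (enc_node (E (fst z)) (B (fst z))) (fst (snd z))) (Cell (enc_vals (snd (snd z))) (?e2 (fst z))))
     (\<lambda>z. enc_vals (collapse q (M (fst z)) (H (fst z)) (T (fst z)) (R (fst z)) (E (fst z)) (B (fst z)) (fst (snd z)) (snd (snd z))))"
      by (rule ptime_collapse, fast intro: ptime_proj, fast intro: ptime_proj, fast intro: ptime_proj, fast intro: ptime_proj, 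
          fast intro: ptime_proj, fast intro: ptime_proj) (use ok lk in auto)
    show "\<forall>ys\<in>set (collapse q (M a) (H a) (T a) (R a) (E a) (B a) X Y). values_ok q (N a) ys"
      if "a \<in> D" "X \<in> set (map (lv a) (rev [0..<d a]))" for a X Y
      using collapse_ok[OF lk[OF that]] .
    show "\<forall>ys\<in>set (map (finish q (R a) (B a) []) (lv a (d a))). values_ok q (N a) ys" if "a \<in> D" for a
      using lok[OF that order_refl] by (auto simp: lv_def level_ok_def finish_ok)
  qed (use dN in \<open>auto intro: ptime_vars\<close>)
  then have "ptime D N ?e2 (\<lambda>a. enc_vals [marginal q (M a) (H a) (T a) (R a) (E a) (B a) (d a) (n a)])"
  proof (rule ptime_cong)
    fix a
    have "map (finish q (R a) (B a) []) (lv a (d a)) = map (marginal q (M a) (H a) (T a) (R a) (E a) (B a) 0) (lv a (d a))" by simp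
    then show "enc_vals (fold (collapse q (M a) (H a) (T a) (R a) (E a) (B a)) (map (lv a) (rev [0..<d a])) (map (finish q (R a) (B a) []) (lv a (d a)))) =
      enc_vals [marginal q (M a) (H a) (T a) (R a) (E a) (B a) (d a) (n a)]"
      unfolding lv_def by (simp only: marginal_levels add_0)
  qed
  then have "ptime D N ?e2 (\<lambda>a. encode_list enc_pair (marginal q (M a) (H a) (T a) (R a) (E a) (B a) (d a) (n a)))"
    unfolding encode_list_Cons by (rule ptime_Fst)
  then have "ptime D N ?e (\<lambda>a. encode_list enc_pair (marginal q (M a) (H a) (T a) (R a) (E a) (B a) (d a) (n a)))"
    by (rule ptime_comp[OF ptime_Cell[OF lsplit(2) ptime_Cell[OF Y0 ptime_Id]]])
  then show ?thesis
    by (rule ptime_comp[OF ptime_Cell[OF M ptime_Cell[OF H ptime_Cell[OF T ptime_Cell[OF R ptime_Cell[OF d n]]]]]])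
qed

section \<open>The loop over the vertices\<close>

primrec run_state :: "nat \<Rightarrow> nat \<Rightarrow> nat \<Rightarrow> nat \<Rightarrow> nat \<Rightarrow> nat set set \<Rightarrow> (nat \<Rightarrow> nat list list) \<Rightarrow> nat \<Rightarrow> nat \<Rightarrow>
    nat list \<Rightarrow> (nat \<Rightarrow> nat list list) \<Rightarrow> nat \<Rightarrow> (nat \<Rightarrow> nat list list) \<times> nat" where
  "run_state q M H T R E B d D vs C 0 = (C, 0)"
| "run_state q M H T R E B d D vs C (Suc i) =
     (let r = run_state q M H T R E B d D vs C i;
          ys = marginal q M H T R E B d (drop i vs, fst r, vs ! i, D) in
      (pin E (vs ! i) (fst (hd ys)) (fst r),
       snd r + grid_log M T (\<Sum>p\<leftarrow>ys. grid_weight M H (snd p)) (grid_weight M H (snd (hd ys)))))"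

lemma total_run_state_drop:
  "i \<le> length vs \<Longrightarrow> total q M H T R E B d D vs C 0 =
     total q M H T R E B d D (drop i vs) (fst (run_state q M H T R E B d D vs C i)) (snd (run_state q M H T R E B d D vs C i))"
proof (induction i)
  case (Suc i)
  then have "drop i vs = vs ! i # drop (Suc i) vs" by (simp add: Cons_nth_drop_Suc)
  then show ?case using Suc by (simp add: Let_def)
qed simp

lemma total_run_state: "total q M H T R E B d D vs C 0 = snd (run_state q M H T R E B d D vs C (length vs))"
  using total_run_state_drop[of "length vs" vs] by simp

lemma marginal_ok: "node_ok q m m E B n \<Longrightarrow> values_ok q m (marginal q M H T R E B d n)"
  by (cases d) (auto simp: finish_ok)

text \<open>\<open>run_state\<close> is the loop state after \<open>i\<close> vertices, pins and
  partial sum. The hypothesis \<open>ne\<close> guards against \<open>hd []\<close>, which is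
  unspecified, whereas the machine would produce \<open>Atom 0\<close>; \<open>lok\<close> bounds
  every tree that is evaluated.\<close>

lemma ptime_total:
  fixes A :: "'a set"
  assumes M: "ptime A N e (\<lambda>a. Atom (M a))" and H: "ptime A N e (\<lambda>a. Atom (H a))" and T: "ptime A N e (\<lambda>a. Atom (T a))"
    and R: "ptime A N e (\<lambda>a. Atom (R a))" and d: "ptime A N e (\<lambda>a. Atom (d a))" and D: "ptime A N e (\<lambda>a. Atom (D a))"
    and inst: "ptime A N e (\<lambda>a. encode_list (enc_entry (E a) (B a) (C a)) (vs a))"
    and ok: "\<And>a. a \<in> A \<Longrightarrow> M a + 1 \<le> N a \<and> H a \<le> N a \<and> T a \<le> N a \<and> R a \<le> N a \<and> d a + 1 \<le> N a \<and> length (vs a) \<le> N a"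
    and lok: "\<And>a i j. a \<in> A \<Longrightarrow> i < length (vs a) \<Longrightarrow> j \<le> d a \<Longrightarrow> level_ok q (N a) (E a) (B a)
      (level q (E a) (B a) (drop i (vs a), fst (run_state q (M a) (H a) (T a) (R a) (E a) (B a) (d a) (D a) (vs a) (C a) i), vs a ! i, D a) j)"
    and ne: "\<And>a i. a \<in> A \<Longrightarrow> i < length (vs a) \<Longrightarrow> marginal q (M a) (H a) (T a) (R a) (E a) (B a) (d a)
      (drop i (vs a), fst (run_state q (M a) (H a) (T a) (R a) (E a) (B a) (d a) (D a) (vs a) (C a) i), vs a ! i, D a) \<noteq> []"
  shows "ptime A N e (\<lambda>a. Atom (total q (M a) (H a) (T a) (R a) (E a) (B a) (d a) (D a) (vs a) (C a) 0))"
proof -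
  let ?e = "\<lambda>a. Cell (Atom (M a)) (Cell (Atom (H a)) (Cell (Atom (T a)) (Cell (Atom (R a)) (Cell (Atom (d a)) (Cell (Atom (D a)) 
      (encode_list (enc_entry (E a) (B a) (C a)) (vs a)))))))"
  define Ci where "Ci a i = fst (run_state q (M a) (H a) (T a) (R a) (E a) (B a) (d a) (D a) (vs a) (C a) i)" for a i
  define Ji where "Ji a i = snd (run_state q (M a) (H a) (T a) (R a) (E a) (B a) (d a) (D a) (vs a) (C a) i)" for a i
  define s where "s a i = Cell (encode_list (enc_entry (E a) (B a) (Ci a i)) (drop i (vs a))) (Atom (Ji a i))" for a i
  have "ptime A N ?e (\<lambda>a. s a (length (vs a)))"
  proof (rule ptime_for)
    have "ptime A N ?e (\<lambda>a. Atom (\<Sum>v\<leftarrow>vs a. 1))"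
      by (rule ptime_sum_list, fast intro: ptime_proj) (use ok in \<open>auto intro: ptime_const\<close>)
    then show "ptime A N ?e (\<lambda>a. Atom (length (vs a)))" by (simp add: sum_list_triv)
    show "ptime A N ?e (\<lambda>a. s a 0)" unfolding s_def Ci_def Ji_def run_state.simps drop_0 fst_conv snd_conv
      by (intro ptime_Cell ptime_const, fast intro: ptime_proj)
    define I where "I = {z. fst z \<in> A \<and> snd z < length (vs (fst z))}"
    define v where "v z = vs (fst z) ! snd z" for z
    define rest where "rest z = drop (Suc (snd z)) (vs (fst z))" for z
    define Cz where "Cz z = Ci (fst z) (snd z)" for z
    define nd where "nd z = (v z # rest z, Cz z, v z, D (fst z))" for z
    have drp: "drop (snd z) (vs (fst z)) = v z # rest z" if "z \<in> I" for z
      using that by (simp add: v_def rest_def I_def Cons_nth_drop_Suc)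
    have lk: "level_ok q (N (fst z)) (E (fst z)) (B (fst z)) (level q (E (fst z)) (B (fst z)) (nd z) j)" if "z \<in> I" "j \<le> d (fst z)" for z j
      using lok[of "fst z" "snd z" j] that drp[OF that(1)] by (simp add: nd_def I_def Cz_def Ci_def v_def[symmetric])
    have nok: "node_ok q (N (fst z)) (N (fst z)) (E (fst z)) (B (fst z)) (nd z)" if "z \<in> I" for z
      using lk[OF that, of 0] by (simp add: level_ok_def)
    have eok: "entry_ok q (N (fst z)) (N (fst z)) (E (fst z)) (B (fst z)) (Cz z) u" if "z \<in> I" "u \<in> set (rest z)" for z u
      using nok[OF that(1)] that(2) by (simp add: node_ok_def nd_def)
    define ys where "ys z = marginal q (M (fst z)) (H (fst z)) (T (fst z)) (R (fst z)) (E (fst z)) (B (fst z)) (d (fst z)) (nd z)" for z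
    have ysne: "ys z \<noteq> []" if "z \<in> I" for z
      using ne[of "fst z" "snd z"] that drp[OF that] by (simp add: ys_def nd_def I_def Cz_def Ci_def v_def[symmetric])
    have ysok: "values_ok q (N (fst z)) (ys z)" if "z \<in> I" for z unfolding ys_def by (rule marginal_ok[OF nok[OF that]])
    have okI: "M (fst z) + 1 \<le> N (fst z) \<and> H (fst z) \<le> N (fst z) \<and> T (fst z) \<le> N (fst z) \<and> R (fst z) \<le> N (fst z) \<and> d (fst z) + 1 \<le> N (fst z) \<and> length (vs (fst z)) \<le> N (fst z)"
      if "z \<in> I" for z using ok[of "fst z"] that by (simp add: I_def)
    let ?e' = "\<lambda>z. Cell (Cell (Cell (enc_entry (E (fst z)) (B (fst z)) (Cz z) (v z)) (encode_list (enc_entry (E (fst z)) (B (fst z)) (Cz z)) (rest z))) 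
         (Atom (Ji (fst z) (snd z)))) (?e (fst z))"
    have "ptime I (\<lambda>z. N (fst z)) ?e' (\<lambda>z. Cell (Cell (enc_entry (E (fst z)) (B (fst z)) (Cz z) (v z)) (encode_list (enc_entry (E (fst z)) (B (fst z)) (Cz z)) (rest z)))
         (Cell (Atom (v z)) (Atom (D (fst z)))))"
      by (intro ptime_Cell; (unfold enc_entry_def)?; fast intro: ptime_proj)
    then have 1: "ptime I (\<lambda>z. N (fst z)) ?e' (\<lambda>z. enc_node (E (fst z)) (B (fst z)) (nd z))" by (simp add: enc_node_def nd_def)
    have 2: "ptime I (\<lambda>z. N (fst z)) ?e' (\<lambda>z. encode_list enc_pair (ys z))"
      unfolding ys_def
      by (rule ptime_marginal[OF _ _ _ _ _ 1], fast intro: ptime_proj, fast intro: ptime_proj, fast intro: ptime_proj, fast intro: ptime_proj, fast intro: ptime_proj)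
        (use okI lk in auto)
    have 3: "ptime I (\<lambda>z. N (fst z)) ?e' (\<lambda>z. enc_pair (hd (ys z)))"
    proof (rule ptime_cong[OF ptime_val_fst[OF 2]])
      fix z assume "z \<in> I"
      from ysne[OF this] show "val_fst (encode_list enc_pair (ys z)) = enc_pair (hd (ys z))" by (cases "ys z") auto
    qed
    have hd: "ptime I (\<lambda>z. N (fst z)) ?e' (\<lambda>z. enc_spin (fst (hd (ys z))))" "ptime I (\<lambda>z. N (fst z)) ?e' (\<lambda>z. Atom (snd (hd (ys z))))"
      using 3 unfolding enc_pair_def by (auto intro: ptime_Fst ptime_Snd)
    have 4: "ptime I (\<lambda>z. N (fst z)) ?e' (\<lambda>z. Atom (\<Sum>p\<leftarrow>ys z. grid_weight (M (fst z)) (H (fst z)) (snd p)))"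
    proof (rule ptime_sum_list[OF 2])
      let ?e'' = "\<lambda>y. Cell (enc_pair (snd y)) (?e' (fst y))"
      show "ptime {y. fst y \<in> I \<and> snd y \<in> set (ys (fst y))} (\<lambda>y. N (fst (fst y))) ?e'' (\<lambda>y. Atom (grid_weight (M (fst (fst y))) (H (fst (fst y))) (snd (snd y))))"
        unfolding enc_pair_def
        by (rule ptime_grid_weight, fast intro: ptime_proj, fast intro: ptime_proj, fast intro: ptime_proj) (use okI in auto)
    qed (use ysok in \<open>simp add: values_ok_def\<close>)
    have 5: "ptime I (\<lambda>z. N (fst z)) ?e' (\<lambda>z. Atom (grid_weight (M (fst z)) (H (fst z)) (snd (hd (ys z)))))"
      by (rule ptime_grid_weight[OF _ _ hd(2)], fast intro: ptime_proj, fast intro: ptime_proj) (use okI in auto)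
    have 6: "ptime I (\<lambda>z. N (fst z)) ?e' (\<lambda>z. Atom (grid_log (M (fst z)) (T (fst z)) (\<Sum>p\<leftarrow>ys z. grid_weight (M (fst z)) (H (fst z)) (snd p)) (grid_weight (M (fst z)) (H (fst z)) (snd (hd (ys z))))))"
      by (rule ptime_grid_log[OF _ _ 4 5], fast intro: ptime_proj, fast intro: ptime_proj) (use okI in auto)
    have lr: "length (rest z) \<le> N (fst z)" if "z \<in> I" for z
      using okI[OF that] unfolding rest_def length_drop by linarith
    have 7: "ptime I (\<lambda>z. N (fst z)) ?e' (\<lambda>z. encode_list (enc_entry (E (fst z)) (B (fst z)) (pin (E (fst z)) (v z) (fst (hd (ys z))) (Cz z))) (rest z))"
      by (rule ptime_pin[OF _ _ hd(1), where q = q], fast intro: ptime_proj, unfold enc_entry_def, fast intro: ptime_proj)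
        (use okI eok lr in auto)
    have "ptime I (\<lambda>z. N (fst z)) ?e' (\<lambda>z. Cell (encode_list (enc_entry (E (fst z)) (B (fst z)) (pin (E (fst z)) (v z) (fst (hd (ys z))) (Cz z))) (rest z))
        (Atom (Ji (fst z) (snd z) + grid_log (M (fst z)) (T (fst z)) (\<Sum>p\<leftarrow>ys z. grid_weight (M (fst z)) (H (fst z)) (snd p)) (grid_weight (M (fst z)) (H (fst z)) (snd (hd (ys z)))))))"
      by (intro ptime_Cell 7 ptime_add 6, fast intro: ptime_proj)
    then have "ptime I (\<lambda>z. N (fst z)) (\<lambda>z. Cell (s (fst z) (snd z)) (?e (fst z))) (\<lambda>z. s (fst z) (Suc (snd z)))"
    proof (rule ptime_reindex[where \<pi> = "\<lambda>z. z"])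
      fix z assume z: "z \<in> I"
      show "Cell (s (fst z) (snd z)) (?e (fst z)) = ?e' z" unfolding s_def drp[OF z] by (simp add: Cz_def)
      have ysz: "ys z = marginal q (M (fst z)) (H (fst z)) (T (fst z)) (R (fst z)) (E (fst z)) (B (fst z)) (d (fst z)) (drop (snd z) (vs (fst z)), Ci (fst z) (snd z), vs (fst z) ! snd z, D (fst z))"
        unfolding ys_def nd_def drp[OF z] by (simp add: v_def Cz_def)
      show "s (fst z) (Suc (snd z)) = Cell (encode_list (enc_entry (E (fst z)) (B (fst z)) (pin (E (fst z)) (v z) (fst (hd (ys z))) (Cz z))) (rest z))
        (Atom (Ji (fst z) (snd z) + grid_log (M (fst z)) (T (fst z)) (\<Sum>p\<leftarrow>ys z. grid_weight (M (fst z)) (H (fst z)) (snd p)) (grid_weight (M (fst z)) (H (fst z)) (snd (hd (ys z))))))"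
        unfolding ysz by (simp add: s_def Ci_def Ji_def Cz_def rest_def v_def Let_def)
    qed auto
    then show "ptime {z. fst z \<in> A \<and> snd z < length (vs (fst z))} (\<lambda>z. N (fst z)) (\<lambda>z. Cell (s (fst z) (snd z)) (?e (fst z))) (\<lambda>z. s (fst z) (Suc (snd z)))"
      by (simp add: I_def)
  qed (use ok in auto)
  then have "ptime A N ?e (\<lambda>a. Atom (Ji a (length (vs a))))" unfolding s_def by (rule ptime_Snd)
  then have "ptime A N ?e (\<lambda>a. Atom (total q (M a) (H a) (T a) (R a) (E a) (B a) (d a) (D a) (vs a) (C a) 0))"
    by (simp add: Ji_def total_run_state)
  then show ?thesis
    by (rule ptime_comp[OF ptime_Cell[OF M ptime_Cell[OF H ptime_Cell[OF T ptime_Cell[OF R ptime_Cell[OF d ptime_Cell[OF D inst]]]]]]])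
qed

section \<open>Enumerating the spins of a vertex\<close>

primrec arrangements :: "nat list \<Rightarrow> nat \<Rightarrow> nat list list" where
  "arrangements xs 0 = [[]]"
| "arrangements xs (Suc i) = concat (map (\<lambda>ys. concat (map (\<lambda>y. if y \<in> set ys then [] else [y # ys]) xs)) (arrangements xs i))"

lemma set_arrangements: "set (arrangements xs i) = {ys. length ys = i \<and> distinct ys \<and> set ys \<subseteq> set xs}"
proof (induction i)
  case (Suc i)
  show ?case
  proof (intro set_eqI iffI)
    fix ys assume "ys \<in> set (arrangements xs (Suc i))"
    then show "ys \<in> {ys. length ys = Suc i \<and> distinct ys \<and> set ys \<subseteq> set xs}" using Suc by (auto split: if_splits)
  next
    fix ys assume a: "ys \<in> {ys. length ys = Suc i \<and> distinct ys \<and> set ys \<subseteq> set xs}"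
    then obtain y zs where "ys = y # zs" by (cases ys) auto
    then show "ys \<in> set (arrangements xs (Suc i))" using a Suc by auto
  qed
qed auto

lemma distinct_arrangements: "distinct xs \<Longrightarrow> distinct (arrangements xs i)"
proof (induction i)
  case (Suc i)
  have inner: "distinct (concat (map (\<lambda>y. if y \<in> set ys then [] else [y # ys]) zs))" if "distinct zs" for ys zs
    using that by (induction zs) auto
  have tl: "tl z = ys" if "z \<in> set (concat (map (\<lambda>y. if y \<in> set ys then [] else [y # ys]) zs))" for z ys and zs :: "nat list"
    using that by (auto split: if_splits)
  have "distinct (concat (map (\<lambda>ys. concat (map (\<lambda>y. if y \<in> set ys then [] else [y # ys]) xs)) as))" if "distinct as" for as
    using that
  proof (induction as)
    case (Cons a as)
    have "set (concat (map (\<lambda>y. if y \<in> set a then [] else [y # a]) xs)) \<inter> 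
        set (concat (map (\<lambda>ys. concat (map (\<lambda>y. if y \<in> set ys then [] else [y # ys]) xs)) as)) = {}"
      using Cons.prems tl by (fastforce split: if_splits)
    then show ?case using Cons inner[OF Suc.prems] by (simp only: list.map concat.simps distinct_append distinct.simps)
  qed simp
  then show ?case using Suc by simp
qed simp

lemma length_arrangements: "length (arrangements xs i) \<le> length xs ^ i"
proof (induction i)
  case (Suc i)
  have inner: "length (concat (map (\<lambda>y. if y \<in> set ys then [] else [y # ys]) zs)) \<le> length zs" for ys zs
    by (induction zs) auto
  have "length (concat (map (\<lambda>ys. concat (map (\<lambda>y. if y \<in> set ys then [] else [y # ys]) xs)) as)) \<le> length as * length xs" for as
    by (induction as) (use inner[of _ xs] in \<open>auto intro: add_mono\<close>)
  then have "length (arrangements xs (Suc i)) \<le> length (arrangements xs i) * length xs" by simp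
  also have "\<dots> \<le> length xs ^ i * length xs" using Suc by (rule mult_right_mono) simp
  finally show ?case by (simp add: mult.commute)
qed simp

lemma ptime_arrangements:
  assumes xs: "ptime D N e (\<lambda>a. enc_spin (xs a))" and len: "\<And>a. a \<in> D \<Longrightarrow> length (xs a) = q \<and> q \<le> N a \<and> q ^ q \<le> N a \<and> 1 \<le> q"
  shows "ptime D N e (\<lambda>a. encode_list enc_spin (arrangements (xs a) q))"
proof (rule ptime_comp[OF xs], rule ptime_for[where n = "\<lambda>_. q" and s = "\<lambda>a i. encode_list enc_spin (arrangements (xs a) i)", OF ptime_const])
  have "ptime D N (\<lambda>a. enc_spin (xs a)) (\<lambda>a. Cell (Atom 0) (Atom 0))" by (intro ptime_Cell ptime_const)
  then show "ptime D N (\<lambda>a. enc_spin (xs a)) (\<lambda>a. encode_list enc_spin (arrangements (xs a) 0))" by simp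
  let ?A = "{z. fst z \<in> D \<and> snd z < q}"
  have la: "length (arrangements (xs (fst z)) (snd z)) \<le> N (fst z)" if "z \<in> ?A" for z
  proof -
    have "length (arrangements (xs (fst z)) (snd z)) \<le> q ^ snd z" using length_arrangements[of "xs (fst z)" "snd z"] len that by auto
    also have "\<dots> \<le> q ^ q" using that len by (intro power_increasing) auto
    also have "\<dots> \<le> N (fst z)" using len that by auto
    finally show ?thesis .
  qed
  have l1: "length (concat (map (\<lambda>y. if y \<in> set ys then [] else [y # ys]) zs)) \<le> length zs" for ys zs
    by (induction zs) auto
  let ?e = "\<lambda>z. Cell (encode_list enc_spin (arrangements (xs (fst z)) (snd z))) (enc_spin (xs (fst z)))"
  show "ptime ?A (\<lambda>z. N (fst z)) ?e (\<lambda>z. encode_list enc_spin (arrangements (xs (fst z)) (Suc (snd z))))"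
    unfolding arrangements.simps
  proof (rule ptime_concat_map[OF ptime_v0 la])
    let ?A' = "{y. fst y \<in> ?A \<and> snd y \<in> set (arrangements (xs (fst (fst y))) (snd (fst y)))}"
    let ?e' = "\<lambda>y. Cell (enc_spin (snd y)) (?e (fst y))"
    show "ptime ?A' (\<lambda>y. N (fst (fst y))) ?e' (\<lambda>y. encode_list enc_spin (concat (map (\<lambda>x. if x \<in> set (snd y) then [] else [x # snd y]) (xs (fst (fst y))))))"
    proof (rule ptime_concat_map[where en = "\<lambda>_. Atom" and g = "\<lambda>y x. if x \<in> set (snd y) then [] else [x # snd y]"])
      show "ptime ?A' (\<lambda>y. N (fst (fst y))) ?e' (\<lambda>y. enc_spin (xs (fst (fst y))))" by (fast intro: ptime_proj)
      let ?A'' = "{w. fst w \<in> ?A' \<and> snd w \<in> set (xs (fst (fst (fst w))))}"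
      let ?e'' = "\<lambda>w. Cell (Atom (snd w)) (?e' (fst w))"
      have len': "length (snd (fst w)) \<le> N (fst (fst (fst w)))" if "w \<in> ?A''" for w
      proof -
        have "length (snd (fst w)) = snd (fst (fst w))" using that by (auto simp: set_arrangements)
        also have "\<dots> \<le> q" using that by auto
        also have "q \<le> N (fst (fst (fst w)))" using that len by auto
        finally show ?thesis .
      qed
      have mem: "ptime ?A'' (\<lambda>w. N (fst (fst (fst w)))) ?e'' (\<lambda>w. Atom (of_bool (snd w \<in> set (snd (fst w)))))"
        by (rule ptime_member, fast intro: ptime_proj, fast intro: ptime_proj, rule len')
      have "ptime ?A'' (\<lambda>w. N (fst (fst (fst w)))) ?e'' (\<lambda>w. if snd w \<in> set (snd (fst w)) then Atom 0 else Cell (Cell (Atom (snd w)) (enc_spin (snd (fst w)))) (Atom 0))"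
        by (intro ptime_if mem ptime_Cell ptime_const; fast intro: ptime_proj)
      then show "ptime ?A'' (\<lambda>w. N (fst (fst (fst w)))) ?e'' (\<lambda>w. encode_list enc_spin (if snd w \<in> set (snd (fst w)) then [] else [snd w # snd (fst w)]))"
        by (rule ptime_cong) auto
      show "length (if x \<in> set (snd y) then [] else [x # snd y]) \<le> N (fst (fst y))" if "y \<in> ?A'" for y x
      proof -
        have "1 \<le> q" "q \<le> N (fst (fst y))" using that len by auto
        then show ?thesis by simp
      qed
    qed (use len in auto)
    show "length (concat (map (\<lambda>x. if x \<in> set ys then [] else [x # ys]) (xs (fst z)))) \<le> N (fst z)" if "z \<in> ?A" for z ys
    proof -
      have "length (xs (fst z)) \<le> N (fst z)" using len that by auto
      then show ?thesis by (rule le_trans[OF l1])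
    qed
  qed
qed (use len in auto)

section \<open>The approximation scheme\<close>

context packing_graph
begin

text \<open>Transposing the indices: the color of \<open>v\<close> in coloring \<open>i\<close> is
  entry \<open>i - 1\<close> of the spin of \<open>v\<close>. Disjoint colorings make each spin
  injective, and as \<open>L v\<close> has exactly \<open>q\<close> colors it is a bijection onto
  \<open>L v\<close>; properness becomes compatibility along the edges.\<close>

lemma card_list_packings: "real (card (list_packings q V E L)) = Z V (\<lambda>_. [])"
proof -
  define f where "f F = (\<lambda>v\<in>V. map (\<lambda>i. F i v) [1..<Suc q])" for F :: "nat \<Rightarrow> nat \<Rightarrow> nat"
  define g where "g \<omega> = (\<lambda>i\<in>{1..q}. \<lambda>v\<in>V. \<omega> v ! (i - 1))" for \<omega> :: "nat \<Rightarrow> nat list"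
  have nth: "map (\<lambda>i. F i v) [1..<Suc q] ! j = F (Suc j) v" if "j < q" for F :: "nat \<Rightarrow> nat \<Rightarrow> nat" and v j
    using that by (simp add: nth_upt del: upt_Suc)
  have "bij_betw f (list_packings q V E L) (configs V (\<lambda>_. []))"
  proof (rule bij_betw_byWitness[where f' = g])
    have fF: "\<omega> \<in> extensional V" if "\<omega> \<in> configs V (\<lambda>_. [])" for \<omega> using that by (auto simp: configs_def PiE_def)
    show "\<forall>F\<in>list_packings q V E L. g (f F) = F"
    proof
      fix F assume F: "F \<in> list_packings q V E L"
      show "g (f F) = F"
      proof
        fix i
        show "g (f F) i = F i"
        proof (cases "i \<in> {1..q}")
          case True
          then have "F i \<in> extensional V" using F by (auto simp: list_packings_def list_colorings_def PiE_def)
          moreover have "g (f F) i = (\<lambda>v\<in>V. F i v)"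
            using True nth[of "i - 1"] by (auto simp: g_def f_def fun_eq_iff restrict_def simp del: upt_Suc)
          ultimately show ?thesis by (simp add: extensional_restrict)
        next
          case False
          then show ?thesis using F by (auto simp: list_packings_def g_def PiE_def extensional_def)
        qed
      qed
    qed
    show "\<forall>\<omega>\<in>configs V (\<lambda>_. []). f (g \<omega>) = \<omega>"
    proof
      fix \<omega> assume w: "\<omega> \<in> configs V (\<lambda>_. [])"
      show "f (g \<omega>) = \<omega>"
      proof
        fix v
        show "f (g \<omega>) v = \<omega> v"
        proof (cases "v \<in> V")
          case True
          then have "length (\<omega> v) = q" using w by (auto simp: configs_def spins_def)
          then show ?thesis using True by (intro nth_equalityI) (auto simp: f_def g_def nth_upt simp del: upt_Suc)
        next
          case False
          then show ?thesis using fF[OF w] by (simp add: f_def extensional_def)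
        qed
      qed
    qed
    show "f ` list_packings q V E L \<subseteq> configs V (\<lambda>_. [])"
    proof clarify
      fix F assume F: "F \<in> list_packings q V E L"
      have c: "F i v \<in> L v" if "i \<in> {1..q}" "v \<in> V" for i v
        using F that by (auto simp: list_packings_def list_colorings_def)
      have e: "F i u \<noteq> F i v" if "i \<in> {1..q}" "{u, v} \<in> E" for i u v
      proof -
        have "F i \<in> list_colorings V E L" using F that by (auto simp: list_packings_def)
        then show ?thesis using that by (auto simp: list_colorings_def)
      qed
      have dj: "F i v \<noteq> F j v" if "i \<in> {1..q}" "j \<in> {1..q}" "i \<noteq> j" "v \<in> V" for i j v
        using F that by (auto simp: list_packings_def disjoint_colorings_def)
      have sp: "f F v \<in> spins q (L v)" if v: "v \<in> V" for v
      proof -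
        have fv: "f F v = map (\<lambda>i. F i v) [1..<Suc q]" using v by (simp add: f_def)
        have "inj_on (\<lambda>i. F i v) {1..q}" using dj v unfolding inj_on_def by metis
        then have d: "distinct (f F v)" unfolding fv by (simp add: distinct_map atLeastLessThanSuc_atLeastAtMost del: upt_Suc)
        have s: "set (f F v) \<subseteq> L v" unfolding fv using c v by (auto simp del: upt_Suc)
        have l: "length (f F v) = q" unfolding fv by simp
        have "set (f F v) = L v" using card_subset_eq[OF L(1)[OF v] s] d l L(2)[OF v] by (simp add: distinct_card)
        then show ?thesis using d l by (simp add: spins_def)
      qed
      moreover have "compat (f F u) (f F w)" if "u \<in> V" "w \<in> V" "{u, w} \<in> E" for u w
        using that e nth by (auto simp: compat_def f_def simp del: upt_Suc)
      ultimately show "f F \<in> configs V (\<lambda>_. [])" by (auto simp: configs_def f_def)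
    qed
    show "g ` configs V (\<lambda>_. []) \<subseteq> list_packings q V E L"
    proof clarify
      fix \<omega> assume w: "\<omega> \<in> configs V (\<lambda>_. [])"
      have sp: "\<omega> v \<in> spins q (L v)" if "v \<in> V" for v using w that by (auto simp: configs_def)
      have cm: "compat (\<omega> u) (\<omega> w)" if "{u, w} \<in> E" for u w
        using w that edge_V[OF that] by (auto simp: configs_def)
      have "g \<omega> i \<in> list_colorings V E L" if i: "i \<in> {1..q}" for i
      proof -
        have "\<omega> v ! (i - 1) \<in> L v" if "v \<in> V" for v
        proof -
          have "set (\<omega> v) = L v" "i - 1 < length (\<omega> v)" using sp[OF that] i by (auto simp: spins_def)
          then show ?thesis using nth_mem by blast
        qed
        moreover have "\<omega> u ! (i - 1) \<noteq> \<omega> w ! (i - 1)" if "{u, w} \<in> E" for u w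
          using cm[OF that] sp[OF edge_V(1)[OF that]] i by (auto simp: compat_def spins_def)
        ultimately show ?thesis using i edge_V by (auto simp: list_colorings_def g_def)
      qed
      moreover have "disjoint_colorings V (g \<omega> i) (g \<omega> j)" if "i \<in> {1..q}" "j \<in> {1..q}" "i \<noteq> j" for i j
        using that sp by (auto simp: disjoint_colorings_def g_def spins_def nth_eq_iff_index_eq)
      ultimately show "g \<omega> \<in> list_packings q V E L" by (auto simp: list_packings_def g_def)
    qed
  qed
  then show ?thesis by (simp add: Z_def bij_betw_same_card)
qed

lemma neighbor_list: "set (neighbor_list E u) = {w. {w, u} \<in> E}" "length (neighbor_list E u) \<le> \<Delta>"
proof -
  have sub: "{w. {w, u} \<in> E} = nbrs V u" using edge_V by (auto simp: nbrs_def insert_commute)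
  have fin: "finite {w. {w, u} \<in> E}" unfolding sub nbrs_def using finite_V by simp
  then show "set (neighbor_list E u) = {w. {w, u} \<in> E}" by (simp add: neighbor_list_def)
  have "length (neighbor_list E u) = card (nbrs V u)" by (simp add: neighbor_list_def sub)
  also have "\<dots> \<le> \<Delta>"
  proof (cases "u \<in> V")
    case False
    then have "nbrs V u = {}" using edge_V by (auto simp: nbrs_def)
    then show ?thesis by simp
  qed (rule card_nbrs)
  finally show "length (neighbor_list E u) \<le> \<Delta>" .
qed

end

section \<open>The size of the recursion tree\<close>

lemma length_concat_map_le: "(\<And>x. x \<in> set xs \<Longrightarrow> length (g x) \<le> c) \<Longrightarrow> length (concat (map g xs)) \<le> length xs * c"
  by (induction xs) (auto intro: add_mono)

text \<open>Two spins out of at most \<open>q ^ q\<close> each and one out of at most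
  \<open>\<Delta>\<close> neighbors: a constant once \<open>q\<close> and \<open>\<Delta>\<close>
  are fixed.\<close>

definition branching :: "nat \<Rightarrow> nat \<Rightarrow> nat" where "branching q \<Delta> = q ^ q * (q ^ q * \<Delta>)"

context packing_algorithm
begin

definition node_inv :: "node \<Rightarrow> bool" where
  "node_inv = (\<lambda>(vs, C, v, D). valid (set vs) C \<and> distinct vs \<and> v \<in> set vs)"

lemma length_B: "v \<in> V \<Longrightarrow> length (B v) \<le> q ^ q"
  using B card_spins by (metis distinct_card)

lemma length_keys:
  assumes "node_inv n"
  shows "length (keys q E B n) \<le> branching q \<Delta>"
proof -
  obtain vs C v D where n: "n = (vs, C, v, D)" by (cases n) auto
  have inv: "valid (set vs) C" "distinct vs" "v \<in> set vs" using assms by (auto simp: n node_inv_def)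
  then have vV: "v \<in> V" by (auto simp: valid_def)
  define nl where "nl = filter (\<lambda>u. u \<noteq> v \<and> {v, u} \<in> E) vs"
  have "distinct nl" using inv by (simp add: nl_def)
  then have "length nl = card (set nl)" by (simp only: distinct_card)
  also have "\<dots> \<le> card (nbrs V v)" using inv finite_V by (intro card_mono) (auto simp: nl_def nbrs_def valid_def)
  also have "\<dots> \<le> \<Delta>" using card_nbrs[OF vV] .
  finally have nl: "length nl \<le> \<Delta>" .
  have "length (concat (map (\<lambda>t. if agreements s t + 2 = q then map (\<lambda>u. (s, t, u)) nl else []) (B v))) \<le> q ^ q * \<Delta>" for s
  proof -
    have "length (concat (map (\<lambda>t. if agreements s t + 2 = q then map (\<lambda>u. (s, t, u)) nl else []) (B v))) \<le> length (B v) * \<Delta>"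
      by (rule length_concat_map_le) (use nl in auto)
    also have "\<dots> \<le> q ^ q * \<Delta>" using length_B[OF vV] by (rule mult_right_mono) simp
    finally show ?thesis .
  qed
  then have "length (keys q E B n) \<le> length (B v) * (q ^ q * \<Delta>)"
    unfolding n keys_def prod.case nl_def by (intro length_concat_map_le)
  also have "\<dots> \<le> branching q \<Delta>" unfolding branching_def using length_B[OF vV] by (intro mult_right_mono) auto
  finally show ?thesis .
qed

lemma node_ok:
  assumes "node_inv n" "card V \<le> m" "\<Delta> \<le> m" "q ^ q \<le> m"
  shows "node_ok q m m E B n"
proof -
  obtain vs C v D where n: "n = (vs, C, v, D)" by (cases n) auto
  have inv: "valid (set vs) C" "distinct vs" "v \<in> set vs" "set vs \<subseteq> V" using assms by (auto simp: n node_inv_def valid_def)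
  have "length vs \<le> m" using inv card_mono[OF finite_V inv(4)] assms(2) by (simp add: distinct_card)
  moreover have "entry_ok q m m E B C u" if u: "u \<in> set vs" for u
  proof -
    have uV: "u \<in> V" using inv u by auto
    have "length (C u) \<le> \<Delta>" "\<forall>c\<in>set (C u). length c = q" using inv(1) u by (auto simp: valid_def)
    then show ?thesis using neighbor_list[of u] length_B[OF uV] B(2)[OF uV] length_spin assms by (auto simp: entry_ok_def)
  qed
  ultimately show ?thesis using inv by (simp add: n node_ok_def)
qed

lemma node_inv_child:
  assumes "node_inv n" "k \<in> set (keys q E B n)"
  shows "node_inv (child E n k)"
proof -
  obtain vs C v D where n: "n = (vs, C, v, D)" by (cases n) auto
  obtain s t u where k: "k = (s, t, u)" by (cases k) auto
  have inv: "valid (set vs) C" "distinct vs" "v \<in> set vs" using assms by (auto simp: n node_inv_def)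
  then have vV: "v \<in> V" by (auto simp: valid_def)
  have st: "s \<in> spins q (L v)" "t \<in> spins q (L v)" "u \<in> set vs" "u \<noteq> v"
    using assms(2) B(2)[OF vV] by (auto simp: n k keys_def split: if_splits)
  have "set (filter (\<lambda>u. u \<noteq> v) vs) = set vs - {v}" by auto
  then show ?thesis using valid_pin_split[OF inv(1,3) st(1,2), of u] inv st by (simp add: n k child_def node_inv_def)
qed

lemma level_inv:
  assumes "node_inv n"
  shows "\<forall>x\<in>set (level q E B n i). node_inv x" "length (level q E B n i) \<le> branching q \<Delta> ^ i"
proof -
  have "(\<forall>x\<in>set (level q E B n i). node_inv x) \<and> length (level q E B n i) \<le> branching q \<Delta> ^ i"
  proof (induction i)
    case (Suc i)
    then have l: "length (level q E B n (Suc i)) \<le> length (level q E B n i) * branching q \<Delta>"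
      unfolding level.simps expand_def by (intro length_concat_map_le) (auto simp: length_keys)
    also have "\<dots> \<le> branching q \<Delta> ^ i * branching q \<Delta>" using Suc by (intro mult_right_mono) auto
    finally show ?case using Suc node_inv_child by (auto simp: expand_def mult.commute)
  qed (use assms in auto)
  then show "\<forall>x\<in>set (level q E B n i). node_inv x" "length (level q E B n i) \<le> branching q \<Delta> ^ i" by auto
qed

lemma level_ok:
  assumes "node_inv n" "card V \<le> m" "\<Delta> \<le> m" "q ^ q \<le> m" "q \<le> m" "branching q \<Delta> \<le> m" "branching q \<Delta> ^ d \<le> m" "i \<le> d"
  shows "level_ok q m E B (level q E B n i)"
proof -
  have "0 < branching q \<Delta>" using q_pos \<Delta> by (simp add: branching_def)
  then have "branching q \<Delta> ^ i \<le> branching q \<Delta> ^ d" using assms(8) by (intro power_increasing) auto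
  then have "length (level q E B n i) \<le> m" using level_inv(2)[OF assms(1), of i] assms(7) by linarith
  moreover have "node_ok q m m E B x \<and> length (keys q E B x) \<le> m" if "x \<in> set (level q E B n i)" for x
    using level_inv(1)[OF assms(1), of i] that node_ok[OF _ assms(2-4)] length_keys assms(6) by (meson le_trans)
  ultimately show ?thesis using assms by (simp add: level_ok_def)
qed

context
  fixes D d :: nat
  assumes D: "16 * \<Delta> \<le> D" "\<eta> \<le> real D * 2 ^ d * grid M" "real D * 2 ^ d * grid M \<le> 2 * \<eta>"
begin

text \<open>The list returned consists of the allowed spins of \<open>v\<close>, and there is one by
  \<open>allowed_spins_nonempty\<close>; so the spin that gets pinned next keeps the subproblem
  valid.\<close>

lemma marginal_hd:
  assumes "valid (set vs) C" "distinct vs" "v \<in> set vs"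
  shows "marginal q M H T R E B d (vs, C, v, D) \<noteq> []"
    "fst (hd (marginal q M H T R E B d (vs, C, v, D))) \<in> spins q (L v)"
proof -
  have vV: "v \<in> V" using assms by (auto simp: valid_def)
  obtain h where h: "marginal q M H T R E B d (vs, C, v, D) = map (\<lambda>x. (x, h x)) (filter (\<lambda>x. \<forall>c\<in>set (C v). agreements x c = 0) (B v))"
    using marginal_correct[OF assms D] by blast
  have len: "length (C v) \<le> \<Delta>" and cs: "\<And>c. c \<in> set (C v) \<Longrightarrow> length c = q \<and> distinct c"
    using assms by (auto simp: valid_def)
  have "degree_bounded q (L v) \<Delta> (forbidden q (C v))"
    by (rule degree_bounded_mono[OF degree_bounded_forbidden[OF cs] subset_refl L(1)[OF vV] len])
  then obtain x where "x \<in> allowed_spins q (L v) (forbidden q (C v))" using allowed_spins_nonempty[OF L[OF vV] _ q_ge(3)] by blast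
  then have "x \<in> set (filter (\<lambda>x. \<forall>c\<in>set (C v). agreements x c = 0) (B v))"
    using B(2)[OF vV] by (auto simp: allowed_spins_def avoids_forbidden[OF length_spin] agreements_0)
  then have ne: "filter (\<lambda>x. \<forall>c\<in>set (C v). agreements x c = 0) (B v) \<noteq> []" by (metis empty_iff empty_set)
  then show "marginal q M H T R E B d (vs, C, v, D) \<noteq> []" by (simp add: h)
  show "fst (hd (marginal q M H T R E B d (vs, C, v, D))) \<in> spins q (L v)"
    using hd_in_set[OF ne] ne B(2)[OF vV] by (auto simp: h hd_map)
qed

lemma run_state_inv:
  assumes "distinct vs" "valid (set vs) C" "i < length vs"
  shows "node_inv (drop i vs, fst (run_state q M H T R E B d D vs C i), vs ! i, D)"
proof -
  have "valid (set (drop i vs)) (fst (run_state q M H T R E B d D vs C i))" if "i \<le> length vs" for i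
    using that
  proof (induction i)
    case (Suc i)
    define C' where "C' = fst (run_state q M H T R E B d D vs C i)"
    have dr: "drop i vs = vs ! i # drop (Suc i) vs" using Suc by (simp add: Cons_nth_drop_Suc)
    have dd: "distinct (drop i vs)" using assms(1) by simp
    have vl: "valid (set (drop i vs)) C'" using Suc by (simp add: C'_def)
    have vi: "vs ! i \<in> set (drop i vs)" unfolding dr by simp
    have st: "set (drop i vs) - {vs ! i} = set (drop (Suc i) vs)" using dd unfolding dr by auto
    show ?case using valid_pin[OF vl vi marginal_hd(2)[OF vl dd vi]] unfolding st by (simp add: Let_def C'_def)
  qed (use assms in simp)
  moreover have "vs ! i \<in> set (drop i vs)" using assms(3) by (metis Cons_nth_drop_Suc list.set_intros(1))
  ultimately show ?thesis using assms by (simp add: node_inv_def)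
qed

end

end

text \<open>The least power of two that is at least \<open>Q\<close>, with its exponent;
  \<open>Q\<close> rounds suffice since \<open>Q \<le> 2 ^ Q\<close>. Both are used: the exponent as
  recursion depth, the power as a factor of the grid size.\<close>

definition doubling :: "nat \<Rightarrow> nat \<times> nat" where
  "doubling Q = ((\<lambda>p. if fst p < Q then (fst p + fst p, snd p + 1) else p) ^^ Q) (1, 0)"

lemma doubling:
  assumes "0 < Q"
  obtains k where "doubling Q = (2 ^ k, k)" "k \<le> Q" "Q \<le> 2 ^ k" "2 ^ k \<le> 2 * Q"
proof -
  have "\<exists>k\<le>n. ((\<lambda>p. if fst p < Q then (fst p + fst p, snd p + 1) else p) ^^ n) (1, 0) = (2 ^ k, k) \<and> (Q \<le> 2 ^ k \<or> k = n) \<and> 2 ^ k \<le> 2 * Q" for n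
  proof (induction n)
    case (Suc n)
    then obtain k where k: "k \<le> n" "((\<lambda>p. if fst p < Q then (fst p + fst p, snd p + 1) else p) ^^ n) (1, 0) = (2 ^ k, k)"
      "Q \<le> 2 ^ k \<or> k = n" "2 ^ k \<le> 2 * Q" by blast
    show ?case
    proof (cases "2 ^ k < Q")
      case True
      then show ?thesis using k by (intro exI[of _ "Suc k"]) auto
    next
      case False
      then show ?thesis using k by (intro exI[of _ k]) auto
    qed
  qed (use assms in auto)
  from this[of Q] obtain k where "k \<le> Q" "doubling Q = (2 ^ k, k)" "Q \<le> 2 ^ k \<or> k = Q" "2 ^ k \<le> 2 * Q"
    unfolding doubling_def by blast
  moreover have "Q \<le> 2 ^ Q" by (simp add: less_imp_le less_exp)
  ultimately show ?thesis using that by metis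
qed

lemma ptime_doubling:
  assumes Q: "ptime D N e (\<lambda>a. Atom (Q a))" "\<And>a. a \<in> D \<Longrightarrow> Q a \<le> N a"
  shows "ptime D N e (\<lambda>a. Cell (Atom (fst (doubling (Q a)))) (Atom (snd (doubling (Q a)))))"
proof (rule ptime_comp[OF Q(1)], unfold doubling_def, 
    rule ptime_funpow[where es = "\<lambda>_ p. Cell (Atom (fst p)) (Atom (snd p))" and I = "\<lambda>_ _. True"])
  show "ptime D N (\<lambda>a. Atom (Q a)) (\<lambda>a. Cell (Atom (fst (1, 0))) (Atom (snd (1, 0))))"
    unfolding fst_conv snd_conv by (intro ptime_Cell ptime_const)
  let ?e = "\<lambda>z. Cell (Cell (Atom (fst (snd z))) (Atom (snd (snd z)))) (Atom (Q (fst z)))"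
  have "ptime {z. fst z \<in> D \<and> True} (\<lambda>z. N (fst z)) ?e
     (\<lambda>z. if fst (snd z) < Q (fst z) then Cell (Atom (fst (snd z) + fst (snd z))) (Atom (snd (snd z) + 1)) 
        else Cell (Atom (fst (snd z))) (Atom (snd (snd z))))"
    by (intro ptime_if ptime_less ptime_Cell ptime_add ptime_const; fast intro: ptime_proj)
  then show "ptime {z. fst z \<in> D \<and> True} (\<lambda>z. N (fst z)) ?e
     (\<lambda>z. Cell (Atom (fst (if fst (snd z) < Q (fst z) then (fst (snd z) + fst (snd z), snd (snd z) + 1) else snd z)))
        (Atom (snd (if fst (snd z) < Q (fst z) then (fst (snd z) + fst (snd z), snd (snd z) + 1) else snd z))))"
    by (rule ptime_cong) auto
qed (use Q in \<open>auto intro: ptime_Id\<close>)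

text \<open>Repeated subtraction takes as many rounds as the quotient says, so numerator and
  denominator of the accuracy may be exponentially large in the size of the input.\<close>

lemma ptime_div:
  assumes x: "ptime D N e (\<lambda>a. Atom (x a))" and y: "ptime D N e (\<lambda>a. Atom (y a))"
    and b: "\<And>a. a \<in> D \<Longrightarrow> 0 < y a \<and> x a div y a \<le> N a"
  shows "ptime D N e (\<lambda>a. Atom (x a div y a))"
proof -
  define s where "s a i = Cell (Atom (x a - i * y a)) (Cell (Atom i) (Atom (y a)))" for a i
  have le: "Suc i * y a \<le> x a" if "i < x a div y a" for a i
    using mult_le_mono1[of "Suc i" "x a div y a" "y a"] that div_times_less_eq_dividend[of "x a" "y a"] by linarith
  have "ptime D N (\<lambda>a. s a 0) (\<lambda>a. s a (x a div y a))"
  proof (rule ptime_while[where c = "\<lambda>a i. Atom (of_bool (\<not> x a - i * y a < y a))"])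
    show "ptime {z. fst z \<in> D \<and> snd z \<le> x (fst z) div y (fst z)} (\<lambda>z. N (fst z)) (\<lambda>z. s (fst z) (snd z))
       (\<lambda>z. Atom (of_bool (\<not> x (fst z) - snd z * y (fst z) < y (fst z))))"
      unfolding s_def by (intro ptime_not ptime_less; fast intro: ptime_proj)
    have "ptime {z. fst z \<in> D \<and> snd z < x (fst z) div y (fst z)} (\<lambda>z. N (fst z)) (\<lambda>z. s (fst z) (snd z))
       (\<lambda>z. Cell (Atom (x (fst z) - snd z * y (fst z) - y (fst z))) (Cell (Atom (snd z + 1)) (Atom (y (fst z)))))"
      unfolding s_def
      by (rule ptime_Cell, rule ptime_sub, fast intro: ptime_proj, fast intro: ptime_proj, rule ptime_Cell, rule ptime_add,
          fast intro: ptime_proj, rule ptime_const, fast intro: ptime_proj)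
    then show "ptime {z. fst z \<in> D \<and> snd z < x (fst z) div y (fst z)} (\<lambda>z. N (fst z)) (\<lambda>z. s (fst z) (snd z)) (\<lambda>z. s (fst z) (Suc (snd z)))"
      by (rule ptime_cong) (simp add: s_def)
    show "Atom (of_bool (\<not> x a - i * y a < y a)) \<noteq> Atom 0" if "i < x a div y a" for a i
      using le[OF that] by simp
    show "Atom (of_bool (\<not> x a - x a div y a * y a < y a)) = Atom 0" if "a \<in> D" for a
      using b[OF that] by (simp add: minus_div_mult_eq_mod)
  qed (use b in auto)
  moreover have "ptime D N e (\<lambda>a. s a 0)" unfolding s_def mult_0 diff_zero by (intro ptime_Cell x y ptime_const)
  ultimately have "ptime D N e (\<lambda>a. s a (x a div y a))" by (rule ptime_comp[rotated])
  then show ?thesis unfolding s_def by (rule ptime_comp[OF _ ptime_v1])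
qed

section \<open>Polynomially bounded quantities\<close>

definition poly_bounded :: "'a set \<Rightarrow> ('a \<Rightarrow> nat) \<Rightarrow> ('a \<Rightarrow> nat) \<Rightarrow> bool" where
  "poly_bounded D S f \<longleftrightarrow> (\<exists>k. \<forall>a\<in>D. f a \<le> (S a + 2) ^ k)"

lemma poly_bounded_mono: "poly_bounded D S g \<Longrightarrow> (\<And>a. a \<in> D \<Longrightarrow> f a \<le> g a) \<Longrightarrow> poly_bounded D S f"
  unfolding poly_bounded_def by (meson le_trans)

lemma poly_bounded_const: "poly_bounded D S (\<lambda>_. c)"
  unfolding poly_bounded_def
proof (intro exI ballI)
  fix a
  have "c \<le> 2 ^ c" by (simp add: less_imp_le less_exp)
  also have "\<dots> \<le> (S a + 2) ^ c" by (intro power_mono) auto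
  finally show "c \<le> (S a + 2) ^ c" .
qed

lemma poly_bounded_self: "poly_bounded D S S"
  unfolding poly_bounded_def by (intro exI[of _ 1]) auto

lemma poly_bounded_mult:
  assumes "poly_bounded D S f" "poly_bounded D S g"
  shows "poly_bounded D S (\<lambda>a. f a * g a)"
proof -
  obtain k l where "\<forall>a\<in>D. f a \<le> (S a + 2) ^ k" "\<forall>a\<in>D. g a \<le> (S a + 2) ^ l" using assms by (auto simp: poly_bounded_def)
  then have "\<forall>a\<in>D. f a * g a \<le> (S a + 2) ^ (k + l)" by (auto simp: power_add intro: mult_mono)
  then show ?thesis unfolding poly_bounded_def by blast
qed

lemma poly_bounded_add:
  assumes "poly_bounded D S f" "poly_bounded D S g"
  shows "poly_bounded D S (\<lambda>a. f a + g a)"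
proof -
  obtain k l where kl: "\<forall>a\<in>D. f a \<le> (S a + 2) ^ k" "\<forall>a\<in>D. g a \<le> (S a + 2) ^ l" using assms by (auto simp: poly_bounded_def)
  have "f a + g a \<le> (S a + 2) ^ (k + l + 2)" if "a \<in> D" for a
    using kl that power_sum_bounds(1)[of "S a + 2" k l] by (meson add_le_mono le_add1 le_add2 le_trans)
  then show ?thesis unfolding poly_bounded_def by blast
qed

lemma poly_bounded_power: "poly_bounded D S f \<Longrightarrow> poly_bounded D S (\<lambda>a. f a ^ n)"
  by (induction n) (auto intro: poly_bounded_const poly_bounded_mult)

lemmas poly_bounded_intros = poly_bounded_const poly_bounded_add poly_bounded_mult poly_bounded_power

lemma grid_log_le: "grid_log M T X Y \<le> T"
proof -
  have "snd (snd ((grid_log_step M ^^ n) p)) \<le> snd (snd p) + n" for n p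
  proof (induction n)
    case (Suc n)
    have "snd (snd (grid_log_step M r)) \<le> Suc (snd (snd r))" for r by (auto simp: grid_log_step_def split: prod.splits)
    from this[of "(grid_log_step M ^^ n) p"] show ?case using Suc by simp
  qed simp
  from this[of T "(X, Y, 0)"] show ?thesis by (simp add: grid_log_def)
qed

lemma total_le: "total q M H T R E B d D vs C J \<le> J + length vs * T"
proof (induction vs arbitrary: C J)
  case (Cons v vs)
  show ?case unfolding total.simps Let_def
    by (rule order_trans[OF Cons]) (simp add: grid_log_le)
qed simp


lemma val_size_encode_list: "length xs \<le> val_size (encode_list f xs)"
  by (induction xs) auto

section \<open>The parameters for a given input\<close>

type_synonym packing_instance = "nat set \<times> nat set set \<times> (nat \<Rightarrow> nat set)"

definition edges :: "packing_instance \<times> rat \<Rightarrow> nat set set" where "edges a = fst (snd (fst a))"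
definition vertices :: "packing_instance \<times> rat \<Rightarrow> nat list" where "vertices a = sorted_list_of_set (fst (fst a))"
definition color_list :: "packing_instance \<times> rat \<Rightarrow> nat \<Rightarrow> nat list" where
  "color_list a u = sorted_list_of_set (snd (snd (fst a)) u)"
definition spin_list :: "nat \<Rightarrow> packing_instance \<times> rat \<Rightarrow> nat \<Rightarrow> nat list list" where
  "spin_list q a u = arrangements (color_list a u) q"
definition num :: "packing_instance \<times> rat \<Rightarrow> nat" where "num a = nat (fst (quotient_of (snd a)))"
definition den :: "packing_instance \<times> rat \<Rightarrow> nat" where "den a = nat (snd (quotient_of (snd a)))"
definition recip :: "packing_instance \<times> rat \<Rightarrow> nat" where "recip a = den a div num a + 1"
text \<open>By \<open>total_correct\<close> with \<open>D = 16 * \<Delta>\<close>, the logarithm of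
  the count of a graph with \<open>n\<close> vertices is off by at most
  \<open>33 * n * \<Delta> * q\<close> grid units, each at most \<open>1 / (q * 2 ^ depth)\<close>.
  So \<open>2 ^ depth\<close> has to reach \<open>33 * n * \<Delta> / \<epsilon>\<close>, and
  \<open>recip\<close> is an integer that is at least \<open>1 / \<epsilon>\<close>.\<close>

definition resolution :: "nat \<Rightarrow> packing_instance \<times> rat \<Rightarrow> nat" where
  "resolution \<Delta> a = length (vertices a) * recip a * (33 * \<Delta>)"
definition rec_depth :: "nat \<Rightarrow> packing_instance \<times> rat \<Rightarrow> nat" where
  "rec_depth \<Delta> a = snd (doubling (resolution \<Delta> a))"
definition grid_size :: "nat \<Rightarrow> nat \<Rightarrow> packing_instance \<times> rat \<Rightarrow> nat" where
  "grid_size q \<Delta> a = fst (doubling (resolution \<Delta> a)) * q"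
definition max_height :: "nat \<Rightarrow> nat \<Rightarrow> packing_instance \<times> rat \<Rightarrow> nat" where
  "max_height q \<Delta> a = grid_size q \<Delta> a * (16 * \<Delta>)"
definition max_up :: "nat \<Rightarrow> nat \<Rightarrow> packing_instance \<times> rat \<Rightarrow> nat" where
  "max_up q \<Delta> a = max_height q \<Delta> a + grid_size q \<Delta> a * (2 * q ^ 2)"
definition rounds :: "nat \<Rightarrow> nat \<Rightarrow> packing_instance \<times> rat \<Rightarrow> nat" where
  "rounds q \<Delta> a = max_height q \<Delta> a * q ^ q + 1"
definition log_count :: "nat \<Rightarrow> nat \<Rightarrow> packing_instance \<times> rat \<Rightarrow> nat" where
  "log_count q \<Delta> a = total q (grid_size q \<Delta> a) (max_height q \<Delta> a) (max_up q \<Delta> a) (rounds q \<Delta> a) (edges a) (spin_list q a)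
     (rec_depth \<Delta> a) (16 * \<Delta>) (vertices a) (\<lambda>_. []) 0"
text \<open>A sum of everything that is compared with the budget as a number of rounds or a length.
  The power with exponent \<open>branching q \<Delta>\<close> bounds the number of nodes on a level,
  and the last summand bounds \<open>log_count\<close>.\<close>

definition budget :: "nat \<Rightarrow> nat \<Rightarrow> packing_instance \<times> rat \<Rightarrow> nat" where
  "budget q \<Delta> a = q + q ^ q + 33 * \<Delta> + 2 * q ^ 2 + branching q \<Delta> + length (vertices a) + recip a + resolution \<Delta> a + (rec_depth \<Delta> a + 1)
     + (grid_size q \<Delta> a + 1) + max_height q \<Delta> a + max_up q \<Delta> a + rounds q \<Delta> a
     + fst (doubling (resolution \<Delta> a)) ^ branching q \<Delta> + length (vertices a) * max_up q \<Delta> a"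

definition instances :: "nat \<Rightarrow> nat \<Rightarrow> packing_instance set" where
  "instances q \<Delta> = {(V, E, L). fin_graph V E \<and> max_degree V E = \<Delta> \<and> list_assignment q V L}"

definition inputs :: "nat \<Rightarrow> nat \<Rightarrow> (packing_instance \<times> rat) set" where
  "inputs q \<Delta> = {a. fst a \<in> instances q \<Delta> \<and> 0 < snd a}"

lemma num_den:
  assumes "0 < snd a"
  shows "0 < num a" "0 < den a" "real_of_rat (snd a) = real (num a) / real (den a)"
    "encode_rat (snd a) = Cell (Atom (num a)) (Atom (den a))"
proof -
  obtain x y where xy: "quotient_of (snd a) = (x, y)" by force
  have y: "0 < y" using quotient_of_denom_pos[OF xy] .
  have r: "snd a = Fract x y" using quotient_of_div[OF xy] by (simp add: Fract_of_int_quotient)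
  then have x: "0 < x" using assms y by (simp add: zero_less_Fract_iff)
  show "0 < num a" "0 < den a" using x y by (auto simp: num_def den_def xy)
  show "real_of_rat (snd a) = real (num a) / real (den a)" using x y unfolding r num_def den_def xy[unfolded r]
    by (simp add: of_rat_rat)
  show "encode_rat (snd a) = Cell (Atom (num a)) (Atom (den a))" by (simp add: encode_rat_def xy num_def den_def)
qed

lemma recip_bounds:
  assumes "0 < snd a"
  shows "1 / real_of_rat (snd a) \<le> real (recip a)" "real (recip a) \<le> 1 / real_of_rat (snd a) + 1"
proof -
  note nd = num_den[OF assms]
  have e: "1 / real_of_rat (snd a) = real (den a) / real (num a)" using nd by simp
  have "den a \<le> recip a * num a" 
    using dividend_less_div_times[OF nd(1), of "den a"] by (simp add: recip_def algebra_simps)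
  then have "real (den a) \<le> real (recip a * num a)" by (simp only: of_nat_le_iff)
  then show "1 / real_of_rat (snd a) \<le> real (recip a)" unfolding e using nd by (simp add: divide_le_eq)
  have "real (den a div num a) \<le> real (den a) / real (num a)" by (rule of_nat_div_le_of_nat)
  then show "real (recip a) \<le> 1 / real_of_rat (snd a) + 1" unfolding e by (simp add: recip_def)
qed

context
  fixes q \<Delta> :: nat
  assumes \<Delta>: "1 \<le> \<Delta>" and q: "20000 * \<Delta> ^ 2 \<le> q"
begin

private abbreviation "N \<equiv> budget q \<Delta>"

lemma q_pos': "0 < q" using q \<Delta> by (auto intro!: Nat.gr0I)

lemma input_locale:
  assumes a: "a \<in> inputs q \<Delta>"
  shows "packing_graph q \<Delta> (fst (fst a)) (edges a) (snd (snd (fst a)))"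
  using a \<Delta> q by unfold_locales (auto simp: inputs_def instances_def edges_def)

lemma vertices:
  assumes a: "a \<in> inputs q \<Delta>"
  shows "set (vertices a) = fst (fst a)" "distinct (vertices a)" "length (vertices a) = card (fst (fst a))" "0 < length (vertices a)"
proof -
  interpret packing_graph q \<Delta> "fst (fst a)" "edges a" "snd (snd (fst a))" using input_locale[OF a] .
  show s: "set (vertices a) = fst (fst a)" "distinct (vertices a)" "length (vertices a) = card (fst (fst a))"
    using finite_V by (auto simp: vertices_def)
  have "max_degree (fst (fst a)) (edges a) = \<Delta>" using a by (auto simp: inputs_def instances_def edges_def)
  then have "fst (fst a) \<noteq> {}" using \<Delta> by (auto simp: max_degree_def)
  then show "0 < length (vertices a)" using s finite_V by (simp add: card_gt_0_iff)
qed

lemma color_list: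
  assumes a: "a \<in> inputs q \<Delta>" and u: "u \<in> fst (fst a)"
  shows "set (color_list a u) = snd (snd (fst a)) u" "distinct (color_list a u)" "length (color_list a u) = q"
proof -
  interpret packing_graph q \<Delta> "fst (fst a)" "edges a" "snd (snd (fst a))" using input_locale[OF a] .
  show "set (color_list a u) = snd (snd (fst a)) u" "distinct (color_list a u)" "length (color_list a u) = q"
    using L[OF u] by (auto simp: color_list_def)
qed

lemma resolution_pos: "a \<in> inputs q \<Delta> \<Longrightarrow> 0 < resolution \<Delta> a"
  using vertices(4) \<Delta> by (simp add: resolution_def recip_def)

lemma depth_props:
  assumes a: "a \<in> inputs q \<Delta>"
  shows "fst (doubling (resolution \<Delta> a)) = 2 ^ rec_depth \<Delta> a" "rec_depth \<Delta> a \<le> resolution \<Delta> a"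
    "resolution \<Delta> a \<le> 2 ^ rec_depth \<Delta> a" "2 ^ rec_depth \<Delta> a \<le> 2 * resolution \<Delta> a"
proof -
  obtain k where "doubling (resolution \<Delta> a) = (2 ^ k, k)" "k \<le> resolution \<Delta> a" "resolution \<Delta> a \<le> 2 ^ k" "2 ^ k \<le> 2 * resolution \<Delta> a"
    using doubling[OF resolution_pos[OF a]] .
  then show "fst (doubling (resolution \<Delta> a)) = 2 ^ rec_depth \<Delta> a" "rec_depth \<Delta> a \<le> resolution \<Delta> a"
    "resolution \<Delta> a \<le> 2 ^ rec_depth \<Delta> a" "2 ^ rec_depth \<Delta> a \<le> 2 * resolution \<Delta> a"
    by (simp_all add: rec_depth_def)
qed

lemma input_algorithm:
  assumes a: "a \<in> inputs q \<Delta>"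
  shows "packing_algorithm q \<Delta> (fst (fst a)) (edges a) (snd (snd (fst a))) (grid_size q \<Delta> a) (max_height q \<Delta> a) (max_up q \<Delta> a)
     (rounds q \<Delta> a) (rec_depth \<Delta> a) (spin_list q a)"
proof -
  interpret packing_graph q \<Delta> "fst (fst a)" "edges a" "snd (snd (fst a))" using input_locale[OF a] .
  show ?thesis
  proof unfold_locales
    fix v assume v: "v \<in> fst (fst a)"
    note c = color_list[OF a v]
    show "distinct (spin_list q a v)" using c by (simp add: spin_list_def distinct_arrangements)
    have "set ys = snd (snd (fst a)) v" if "length ys = q" "distinct ys" "set ys \<subseteq> snd (snd (fst a)) v" for ys
      using card_subset_eq[OF L(1)[OF v] that(3)] that L(2)[OF v] by (simp add: distinct_card)
    then show "set (spin_list q a v) = spins q (snd (snd (fst a)) v)"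
      using c by (auto simp: spin_list_def set_arrangements spins_def)
  qed (auto simp: grid_size_def max_height_def max_up_def rounds_def depth_props[OF a])
qed

text \<open>With \<open>M = 2 ^ depth * q\<close> the middle term is
  \<open>16 * \<Delta> / q * (M * grid M)\<close>, that is \<open>2 * \<eta>\<close> times a number
  between \<open>1 / 2\<close> and 1.\<close>

lemma grid_conditions:
  assumes a: "a \<in> inputs q \<Delta>"
  shows "packing_graph.\<eta> q \<Delta> \<le> real (16 * \<Delta>) * 2 ^ rec_depth \<Delta> a * grid (grid_size q \<Delta> a)"
    "real (16 * \<Delta>) * 2 ^ rec_depth \<Delta> a * grid (grid_size q \<Delta> a) \<le> 2 * packing_graph.\<eta> q \<Delta>"
proof -
  interpret packing_graph q \<Delta> "fst (fst a)" "edges a" "snd (snd (fst a))" using input_locale[OF a] .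
  have gs: "grid_size q \<Delta> a = 2 ^ rec_depth \<Delta> a * q" by (simp add: grid_size_def depth_props[OF a])
  have p: "0 < grid_size q \<Delta> a" using q_pos' by (simp add: gs)
  have "\<eta> = real (16 * \<Delta>) * 2 ^ rec_depth \<Delta> a * (1 / (2 * real (grid_size q \<Delta> a)))" using q_pos' by (simp add: \<eta>_def gs)
  also have "\<dots> \<le> real (16 * \<Delta>) * 2 ^ rec_depth \<Delta> a * grid (grid_size q \<Delta> a)" by (intro mult_left_mono grid_bounds(1)[OF p]) auto
  finally show "\<eta> \<le> real (16 * \<Delta>) * 2 ^ rec_depth \<Delta> a * grid (grid_size q \<Delta> a)" .
  have "real (16 * \<Delta>) * 2 ^ rec_depth \<Delta> a * grid (grid_size q \<Delta> a) \<le> real (16 * \<Delta>) * 2 ^ rec_depth \<Delta> a * (1 / real (grid_size q \<Delta> a))"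
    by (intro mult_left_mono grid_bounds(2)[OF p]) auto
  also have "\<dots> = 2 * \<eta>" using q_pos' by (simp add: \<eta>_def gs)
  finally show "real (16 * \<Delta>) * 2 ^ rec_depth \<Delta> a * grid (grid_size q \<Delta> a) \<le> 2 * \<eta>" .
qed

lemma log_count_approximates:
  assumes a: "a \<in> inputs q \<Delta>"
  shows "is_approximation (real_of_rat (snd a)) (real (card (list_packings q (fst (fst a)) (edges a) (snd (snd (fst a))))))
     (real ((grid_size q \<Delta> a + 1) ^ log_count q \<Delta> a) / real (grid_size q \<Delta> a ^ log_count q \<Delta> a))"
proof -
  interpret packing_algorithm q \<Delta> "fst (fst a)" "edges a" "snd (snd (fst a))" "grid_size q \<Delta> a" "max_height q \<Delta> a" "max_up q \<Delta> a"
     "rounds q \<Delta> a" "rec_depth \<Delta> a" "spin_list q a" using input_algorithm[OF a] .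
  define M where "M = grid_size q \<Delta> a"
  define J where "J = log_count q \<Delta> a"
  define n where "n = length (vertices a)"
  have gs: "M = 2 ^ rec_depth \<Delta> a * q" by (simp add: M_def grid_size_def depth_props[OF a])
  have Mp: "0 < M" using q_pos' by (simp add: gs)
  define z where "z = Z (fst (fst a)) (\<lambda>_. [])"
  have zp: "0 < z" unfolding z_def by (rule Z_pos_and_smooth(1)[OF valid_init])
  have "\<bar>real J - ln z / grid M\<bar> \<le> real n * (1 + 2 * real (16 * \<Delta>) * real q)"
    using total_correct[of "vertices a" "\<lambda>_. []" "16 * \<Delta>" "rec_depth \<Delta> a" 0] vertices[OF a] valid_init grid_conditions[OF a]
    by (simp add: J_def log_count_def n_def z_def M_def)
  also have "\<dots> \<le> real n * (33 * real \<Delta> * real q)"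
  proof (intro mult_left_mono)
    have "1 \<le> \<Delta> * q" using \<Delta> q_pos' by simp
    then have "1 \<le> real \<Delta> * real q" by (metis of_nat_1 of_nat_le_iff of_nat_mult)
    then show "1 + 2 * real (16 * \<Delta>) * real q \<le> 33 * real \<Delta> * real q" by simp
  qed simp
  finally have "\<bar>real J - ln z / grid M\<bar> * grid M \<le> real n * (33 * real \<Delta> * real q) * (1 / real M)"
    using grid_bounds(2,3)[OF Mp] by (intro mult_mono) auto
  also have "\<dots> = real n * (33 * real \<Delta>) / 2 ^ rec_depth \<Delta> a" using q_pos' by (simp add: gs)
  also have "\<dots> \<le> real_of_rat (snd a)"
  proof -
    have ep: "0 < snd a" using a by (simp add: inputs_def)
    have "real (resolution \<Delta> a) \<le> real (2 ^ rec_depth \<Delta> a)" using depth_props(3)[OF a] by (simp only: of_nat_le_iff)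
    then have 1: "real n * real (recip a) * (33 * real \<Delta>) \<le> 2 ^ rec_depth \<Delta> a" by (simp add: resolution_def n_def)
    have r: "1 \<le> real_of_rat (snd a) * real (recip a)"
      using recip_bounds(1)[OF ep] ep by (simp add: divide_le_eq mult.commute)
    have "real n * (33 * real \<Delta>) * 1 \<le> real n * (33 * real \<Delta>) * (real_of_rat (snd a) * real (recip a))"
      by (intro mult_left_mono r) auto
    also have "\<dots> = real_of_rat (snd a) * (real n * real (recip a) * (33 * real \<Delta>))" by simp
    also have "\<dots> \<le> real_of_rat (snd a) * 2 ^ rec_depth \<Delta> a" using ep by (intro mult_left_mono 1) auto
    finally show ?thesis by (simp add: divide_le_eq)
  qed
  finally have *: "\<bar>real J - ln z / grid M\<bar> * grid M \<le> real_of_rat (snd a)" .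
  have c: "\<bar>real J * grid M - ln z\<bar> \<le> real_of_rat (snd a)"
  proof -
    have g: "0 < grid M" by (rule grid_bounds(3)[OF Mp])
    then have "real J * grid M - ln z = (real J - ln z / grid M) * grid M" by (simp add: left_diff_distrib)
    then have "\<bar>real J * grid M - ln z\<bar> = \<bar>real J - ln z / grid M\<bar> * grid M" using g by (simp only: abs_mult abs_of_pos)
    with * show ?thesis by simp
  qed
  define y where "y = real ((M + 1) ^ J) / real (M ^ J)"
  have yp: "0 < y" using Mp by (simp add: y_def)
  have "ln y = real J * grid M"
  proof -
    have "ln y = ln (real ((M + 1) ^ J)) - ln (real (M ^ J))" unfolding y_def using Mp by (simp add: ln_div)
    also have "ln (real ((M + 1) ^ J)) = real J * (ln (real M) + grid M)"
      using ln_mult_power[of 1 "real M + 1" J] ln_Suc_M[OF Mp] by (simp add: add.commute)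
    also have "ln (real (M ^ J)) = real J * ln (real M)" using ln_mult_power[of 1 "real M" J] Mp by simp
    finally show ?thesis by (simp add: algebra_simps)
  qed
  then have "\<bar>ln (z / y)\<bar> \<le> real_of_rat (snd a)" using c zp yp ln_div[of z y] by (simp add: abs_minus_commute)
  then have "exp (- real_of_rat (snd a)) \<le> exp (ln (z / y))" "exp (ln (z / y)) \<le> exp (real_of_rat (snd a))" by auto
  then have "is_approximation (real_of_rat (snd a)) z y" using zp yp by (simp add: is_approximation_def)
  then show ?thesis by (simp add: z_def card_list_packings y_def M_def J_def)
qed

text \<open>\<open>2 ^ depth\<close> is at most twice the resolution, and all exponents in the
  budget depend on \<open>q\<close> and \<open>\<Delta>\<close> only.\<close>

lemma budget_poly: "poly_bounded (inputs q \<Delta>) (\<lambda>a. length (vertices a) + recip a) N"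
proof -
  let ?D = "inputs q \<Delta>" and ?S = "\<lambda>a. length (vertices a) + recip a"
  have n: "poly_bounded ?D ?S (\<lambda>a. length (vertices a))" and r: "poly_bounded ?D ?S recip"
    by (rule poly_bounded_mono[OF poly_bounded_self], simp)+
  have Q: "poly_bounded ?D ?S (resolution \<Delta>)"
    unfolding resolution_def[abs_def] by (intro poly_bounded_intros n r)
  have P: "poly_bounded ?D ?S (\<lambda>a. fst (doubling (resolution \<Delta> a)))"
    by (rule poly_bounded_mono[OF poly_bounded_mult[OF poly_bounded_const[of _ _ 2] Q]]) (use depth_props in auto)
  have d: "poly_bounded ?D ?S (rec_depth \<Delta>)" by (rule poly_bounded_mono[OF Q]) (use depth_props in auto)
  show ?thesis
    unfolding budget_def[abs_def] rounds_def max_up_def max_height_def grid_size_def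
    by (intro poly_bounded_intros n r Q P d)
qed

lemma ptime_log_count:
  "ptime (inputs q \<Delta>) N (\<lambda>a. Cell (encode_instance (fst a)) (encode_rat (snd a)))
     (\<lambda>a. Cell (Atom ((grid_size q \<Delta> a + 1) ^ log_count q \<Delta> a)) (Atom (grid_size q \<Delta> a ^ log_count q \<Delta> a)))"
proof -
  let ?D = "inputs q \<Delta>"
  define en where "en a v = Cell (Atom v) (Cell (enc_spin (neighbor_list (edges a) v)) (enc_spin (color_list a v)))" for a v
  let ?e0 = "\<lambda>a. Cell (encode_list (en a) (vertices a)) (Cell (Atom (num a)) (Atom (den a)))"
  have inp: "Cell (encode_instance (fst a)) (encode_rat (snd a)) = ?e0 a" if "a \<in> ?D" for a
    using that num_den(4)[of a]
    by (simp add: inputs_def encode_instance_def case_prod_beta en_def[abs_def] vertices_def color_list_def neighbor_list_def edges_def)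
  have n: "ptime ?D N ?e0 (\<lambda>a. Atom (length (vertices a)))"
  proof -
    have "ptime ?D N ?e0 (\<lambda>a. Atom (\<Sum>v\<leftarrow>vertices a. 1))"
      by (rule ptime_sum_list, fast intro: ptime_proj) (auto intro: ptime_const simp: budget_def)
    then show ?thesis by (simp add: sum_list_triv)
  qed
  have r: "ptime ?D N ?e0 (\<lambda>a. Atom (recip a))"
    unfolding recip_def
    by (rule ptime_add[OF ptime_div ptime_const], fast intro: ptime_proj, fast intro: ptime_proj)
      (auto simp: inputs_def num_den(1) budget_def recip_def)
  have Q: "ptime ?D N ?e0 (\<lambda>a. Atom (resolution \<Delta> a))"
    unfolding resolution_def by (intro ptime_mult n r ptime_const) (auto simp: budget_def)
  have dbl: "ptime ?D N ?e0 (\<lambda>a. Cell (Atom (fst (doubling (resolution \<Delta> a)))) (Atom (snd (doubling (resolution \<Delta> a)))))"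
    by (rule ptime_doubling[OF Q]) (simp add: budget_def)
  have d: "ptime ?D N ?e0 (\<lambda>a. Atom (rec_depth \<Delta> a))" unfolding rec_depth_def by (rule ptime_Snd[OF dbl])
  have M: "ptime ?D N ?e0 (\<lambda>a. Atom (grid_size q \<Delta> a))"
    unfolding grid_size_def by (intro ptime_mult ptime_Fst[OF dbl] ptime_const) (simp add: budget_def)
  have H: "ptime ?D N ?e0 (\<lambda>a. Atom (max_height q \<Delta> a))"
    unfolding max_height_def by (intro ptime_mult M ptime_const) (simp add: budget_def)
  have T: "ptime ?D N ?e0 (\<lambda>a. Atom (max_up q \<Delta> a))"
    unfolding max_up_def by (intro ptime_add H ptime_mult M ptime_const) (simp add: budget_def)
  have R: "ptime ?D N ?e0 (\<lambda>a. Atom (rounds q \<Delta> a))"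
    unfolding rounds_def by (intro ptime_add ptime_mult H ptime_const) (simp add: budget_def)
  have inst: "ptime ?D N ?e0 (\<lambda>a. encode_list (enc_entry (edges a) (spin_list q a) (\<lambda>_. [])) (vertices a))"
  proof (rule ptime_map[OF ptime_v0])
    let ?A = "{z. fst z \<in> ?D \<and> snd z \<in> set (vertices (fst z))}"
    let ?e = "\<lambda>z. Cell (en (fst z) (snd z)) (?e0 (fst z))"
    have ar: "ptime ?A (\<lambda>z. N (fst z)) ?e (\<lambda>z. encode_list enc_spin (arrangements (color_list (fst z) (snd z)) q))"
      unfolding en_def
      by (rule ptime_arrangements, fast intro: ptime_proj)
        (use color_list vertices q_pos' in \<open>auto simp: budget_def\<close>)
    have "ptime ?A (\<lambda>z. N (fst z)) ?e (\<lambda>z. Cell (Atom (snd z)) (Cell (enc_spin (neighbor_list (edges (fst z)) (snd z)))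
        (Cell (encode_list enc_spin (arrangements (color_list (fst z) (snd z)) q)) (Atom 0))))"
      by (intro ptime_Cell ar ptime_const; (unfold en_def)?; fast intro: ptime_proj)
    then show "ptime ?A (\<lambda>z. N (fst z)) ?e (\<lambda>z. enc_entry (edges (fst z)) (spin_list q (fst z)) (\<lambda>_. []) (snd z))"
      by (simp add: enc_entry_def spin_list_def)
  qed (simp add: budget_def)
  have J: "ptime ?D N ?e0 (\<lambda>a. Atom (log_count q \<Delta> a))"
    unfolding log_count_def
  proof (rule ptime_total[OF M H T R d ptime_const inst])
    fix a assume a: "a \<in> ?D"
    interpret packing_algorithm q \<Delta> "fst (fst a)" "edges a" "snd (snd (fst a))" "grid_size q \<Delta> a" "max_height q \<Delta> a" "max_up q \<Delta> a"
       "rounds q \<Delta> a" "rec_depth \<Delta> a" "spin_list q a" using input_algorithm[OF a] .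
    show "grid_size q \<Delta> a + 1 \<le> N a \<and> max_height q \<Delta> a \<le> N a \<and> max_up q \<Delta> a \<le> N a \<and> rounds q \<Delta> a \<le> N a \<and>
         rec_depth \<Delta> a + 1 \<le> N a \<and> length (vertices a) \<le> N a" by (simp add: budget_def)
    have vl: "valid (set (vertices a)) (\<lambda>_. [])" using valid_init by (simp add: vertices[OF a])
    have inv: "node_inv (drop i (vertices a), fst (run_state q (grid_size q \<Delta> a) (max_height q \<Delta> a) (max_up q \<Delta> a) (rounds q \<Delta> a) (edges a)
         (spin_list q a) (rec_depth \<Delta> a) (16 * \<Delta>) (vertices a) (\<lambda>_. []) i), vertices a ! i, 16 * \<Delta>)" if "i < length (vertices a)" for i
      by (rule run_state_inv[OF order_refl grid_conditions[OF a] vertices(2)[OF a] vl that])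
    \<comment> \<open>A constant raised to a logarithmic depth:
      \<open>b ^ d \<le> (2 ^ b) ^ d = (2 ^ d) ^ b\<close>, which is polynomial because
      \<open>2 ^ d\<close> is.\<close>
    have br: "branching q \<Delta> ^ rec_depth \<Delta> a \<le> N a"
    proof -
      have "branching q \<Delta> ^ rec_depth \<Delta> a \<le> (2 ^ branching q \<Delta>) ^ rec_depth \<Delta> a"
        by (intro power_mono less_imp_le[OF less_exp]) simp
      also have "\<dots> = (2 ^ rec_depth \<Delta> a) ^ branching q \<Delta>" by (simp add: power_mult[symmetric] mult.commute)
      also have "\<dots> \<le> N a" by (simp add: budget_def depth_props(1)[OF a])
      finally show ?thesis .
    qed
    fix i assume i: "i < length (vertices a)"
    show "level_ok q (N a) (edges a) (spin_list q a) (level q (edges a) (spin_list q a)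
        (drop i (vertices a), fst (run_state q (grid_size q \<Delta> a) (max_height q \<Delta> a) (max_up q \<Delta> a) (rounds q \<Delta> a) (edges a)
         (spin_list q a) (rec_depth \<Delta> a) (16 * \<Delta>) (vertices a) (\<lambda>_. []) i), vertices a ! i, 16 * \<Delta>) j)" if "j \<le> rec_depth \<Delta> a" for j
      by (rule level_ok[OF inv[OF i] _ _ _ _ _ br that]) (auto simp: budget_def vertices(3)[OF a, symmetric])
    show "marginal q (grid_size q \<Delta> a) (max_height q \<Delta> a) (max_up q \<Delta> a) (rounds q \<Delta> a) (edges a) (spin_list q a) (rec_depth \<Delta> a)
        (drop i (vertices a), fst (run_state q (grid_size q \<Delta> a) (max_height q \<Delta> a) (max_up q \<Delta> a) (rounds q \<Delta> a) (edges a)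
         (spin_list q a) (rec_depth \<Delta> a) (16 * \<Delta>) (vertices a) (\<lambda>_. []) i), vertices a ! i, 16 * \<Delta>) \<noteq> []"
      using inv[OF i] by (intro marginal_hd(1)[OF order_refl grid_conditions[OF a]]) (auto simp: node_inv_def)
  qed
  \<comment> \<open>The powers in the output are computed by repeated multiplication, so their
    exponent must stay within the budget.\<close>
  have JN: "log_count q \<Delta> a \<le> N a" for a
    using total_le[of q "grid_size q \<Delta> a" "max_height q \<Delta> a" "max_up q \<Delta> a" "rounds q \<Delta> a" "edges a" "spin_list q a"
        "rec_depth \<Delta> a" "16 * \<Delta>" "vertices a" "\<lambda>_. []" 0]
    by (simp add: log_count_def budget_def)
  have "ptime ?D N ?e0 (\<lambda>a. Cell (Atom ((grid_size q \<Delta> a + 1) ^ log_count q \<Delta> a)) (Atom (grid_size q \<Delta> a ^ log_count q \<Delta> a)))"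
    by (rule ptime_Cell[OF ptime_power[OF ptime_add[OF M ptime_const] _ J] ptime_power[OF M _ J]]) (rule JN | simp add: budget_def)+
  then show ?thesis by (rule ptime_reindex[where \<pi> = "\<lambda>a. a"]) (auto simp: inp)
qed

lemma packing_fpras: "\<exists>P. fpras P (instances q \<Delta>) encode_instance (\<lambda>(V, E, L). card (list_packings q V E L))"
proof -
  obtain P k t where P: "\<And>a. a \<in> inputs q \<Delta> \<Longrightarrow> t a \<le> (N a + 2) ^ k"
    "\<And>a. a \<in> inputs q \<Delta> \<Longrightarrow> run P (Cell (encode_instance (fst a)) (encode_rat (snd a))) =
       return_spmf (Cell (Atom ((grid_size q \<Delta> a + 1) ^ log_count q \<Delta> a)) (Atom (grid_size q \<Delta> a ^ log_count q \<Delta> a)), t a)"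
    using ptime_log_count by (rule ptimeE) blast
  have "poly_bounded (inputs q \<Delta>) (\<lambda>a. length (vertices a) + recip a) (\<lambda>a. (N a + 2) ^ k)"
    by (intro poly_bounded_intros budget_poly)
  then obtain m where m: "\<And>a. a \<in> inputs q \<Delta> \<Longrightarrow> (N a + 2) ^ k \<le> (length (vertices a) + recip a + 2) ^ m"
    unfolding poly_bounded_def by blast
  have "fpras P (instances q \<Delta>) encode_instance (\<lambda>(V, E, L). card (list_packings q V E L))"
    unfolding fpras_def
  \<comment> \<open>\<open>fpras\<close> uses one number both as factor and as exponent. The base is
    at most \<open>4 * s\<close>, which gives \<open>4 ^ m * s ^ m\<close>, and
    \<open>1 \<le> s\<close> with \<open>m \<le> 4 ^ m\<close> raises the exponent.\<close>
  proof (intro exI[of _ "4 ^ m"] ballI allI impI)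
    fix x :: packing_instance and \<epsilon> :: rat assume x: "x \<in> instances q \<Delta>" and \<epsilon>: "0 < \<epsilon>"
    define a where "a = (x, \<epsilon>)"
    have a: "a \<in> inputs q \<Delta>" using x \<epsilon> by (simp add: a_def inputs_def)
    define inp where "inp = Cell (encode_instance x) (encode_rat \<epsilon>)"
    define y where "y = Cell (Atom ((grid_size q \<Delta> a + 1) ^ log_count q \<Delta> a)) (Atom (grid_size q \<Delta> a ^ log_count q \<Delta> a))"
    have run: "run P inp = return_spmf (y, t a)" using P(2)[OF a] by (simp add: inp_def y_def a_def)
    define s where "s = real (val_size inp) + 1 / real_of_rat \<epsilon>"
    have e0: "0 \<le> 1 / real_of_rat \<epsilon>" using \<epsilon> by simp
    have "length (vertices a) \<le> val_size (encode_instance x)"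
      unfolding encode_instance_def vertices_def a_def case_prod_beta fst_conv by (rule val_size_encode_list)
    then have "length (vertices a) + 1 \<le> val_size inp" by (simp add: inp_def)
    then have n: "real (length (vertices a)) + 1 \<le> real (val_size inp)" by (metis of_nat_1 of_nat_add of_nat_le_iff)
    have s1: "1 \<le> s" using n e0 unfolding s_def by linarith
    have "real (recip a) \<le> 1 / real_of_rat \<epsilon> + 1" using recip_bounds(2)[of a] \<epsilon> by (simp add: a_def)
    then have "real (length (vertices a) + recip a + 2) \<le> 4 * s" using n s1 by (simp add: s_def)
    then have "real (length (vertices a) + recip a + 2) ^ m \<le> (4 * s) ^ m" by (intro power_mono) auto
    moreover have "t a \<le> (length (vertices a) + recip a + 2) ^ m" using P(1)[OF a] m[OF a] by linarith
    then have "real (t a) \<le> real (length (vertices a) + recip a + 2) ^ m" by (metis of_nat_le_iff of_nat_power)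
    ultimately have "real (t a) \<le> 4 ^ m * s ^ m" by (simp add: power_mult_distrib)
    also have "\<dots> \<le> real (4 ^ m) * s ^ (4 ^ m)"
    proof -
      have "m \<le> 4 ^ m" by (rule less_imp_le, induction m) auto
      then have "s ^ m \<le> s ^ (4 ^ m)" using s1 by (intro power_increasing) auto
      then show ?thesis by simp
    qed
    finally have time: "real (t a) \<le> real (4 ^ m) * s ^ (4 ^ m)" .
    have "is_approximation (real_of_rat \<epsilon>) (real ((\<lambda>(V, E, L). card (list_packings q V E L)) x)) (decode_output y)"
      using log_count_approximates[OF a] by (simp add: y_def a_def edges_def case_prod_beta)
    then have appr: "(y, t a) \<in> {(y, t). is_approximation (real_of_rat \<epsilon>) (real ((\<lambda>(V, E, L). card (list_packings q V E L)) x)) (decode_output y)}"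
      by simp
    have "measure (measure_spmf (return_spmf (y, t a)))
        {(y, t). is_approximation (real_of_rat \<epsilon>) (real ((\<lambda>(V, E, L). card (list_packings q V E L)) x)) (decode_output y)} = 1"
      using appr by (simp add: measure_spmf_return_spmf measure_return)
    then show "let inp = Cell (encode_instance x) (encode_rat \<epsilon>); D = run P inp
         in lossless_spmf D \<and>
            (\<forall>(y, ta)\<in>set_spmf D. real ta \<le> real (4 ^ m) * (real (val_size inp) + 1 / real_of_rat \<epsilon>) ^ (4 ^ m)) \<and>
            3 / 4 \<le> measure (measure_spmf D)
              {(y, t). is_approximation (real_of_rat \<epsilon>) (real (case x of (V, E, L) \<Rightarrow> card (list_packings q V E L))) (decode_output y)}"
      unfolding Let_def inp_def[symmetric] run using time by (simp add: s_def)
  qed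
  then show ?thesis by blast
qed

end

theorem theorem2p1:
  "\<exists>C::real. \<forall>(\<Delta>::nat) (q::nat). \<Delta> \<ge> 1 \<and> real q \<ge> C * (real \<Delta>)\<^sup>2 \<longrightarrow>
     (\<exists>P. fpras P
        {(V, E, L). fin_graph V E \<and> max_degree V E = \<Delta> \<and> list_assignment q V L}
        encode_instance
        (\<lambda>(V, E, L). card (list_packings q V E L)))"
proof (intro exI[of _ 20000] allI impI, elim conjE)
  fix \<Delta> q :: nat assume \<Delta>: "1 \<le> \<Delta>" and "20000 * (real \<Delta>)\<^sup>2 \<le> real q"
  then have "real (20000 * \<Delta> ^ 2) \<le> real q" by simp
  then have "20000 * \<Delta> ^ 2 \<le> q" by (simp only: of_nat_le_iff)
  from packing_fpras[OF \<Delta> this] show "\<exists>P. fpras P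
        {(V, E, L). fin_graph V E \<and> max_degree V E = \<Delta> \<and> list_assignment q V L}
        encode_instance (\<lambda>(V, E, L). card (list_packings q V E L))"
    unfolding instances_def .
qed

end
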